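(* Let $\Omega>0$ and $\lambda>|D|^{-1}=1/\pi$. Then $\mathcal{E}$ attains its maximum over $K_\lambda(D)$, and every maximizer $w^\lambda$ satisfies $$\int_D w^\lambda(x)\,\nabla\Big(Gw^\lambda(x)+\tfrac{\Omega}{2}|x|^2\Big)\cdot\nabla^\perp\phi(x)\,dx=0\quad\text{for all }\phi\in C_c^\infty(D).$$ Moreover every maximizer has the form $w^\lambda=\lambda I_{A^\lambda}+2\Omega I_{B^\lambda}$ a.e. in $D$, where $$A^\lambda=\{x\in D: Gw^\lambda(x)+\tfrac{\Omega}{2}|x|^2>\mu^\lambda\},\qquad B^\lambda=\{x\in D: Gw^\lambda(x)+\tfrac{\Omega}{2}|x|^2=\mu^\lambda\}$$ for some real number $\mu^\lambda$ (depending on $w^\lambda$), and if $\lambda\neq 2\Omega$ then $|B^\lambda|=0$. Furthermore, for any choice of maximizers $w^\lambda$ (one for each $\lambda$), with $\varepsilon=(\pi\lambda)^{-1/2}$ and $X^\lambda=\int_D x\,w^\lambda(x)\,dx$, the following hold as $\lambda\to+\infty$: (i) there is $R_0>1$ independent of $\lambda$ such that $\operatorname{diam}(A^\lambda)\le R_0\varepsilon$ for all sufficiently large $\lambda$; (ii) every limit point $X^*$ of $X^\lambda$ as $\lambda\to+\infty$ lies in $D$ and is a global minimum point in $D$ of $x\mapsto H(x)-\frac{\Omega}{2}|x|^2$; (iii) $\lambda^{-1}w^\lambda(X^\lambda+\varepsilon y)\to I_{B_1(0)}(y)$ weakly-star in $L^\infty(B_{R_0}(0))$; (iv) $\pi\psi^\lambda(X^\lambda+\varepsilon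 y)\to V^*(y)$ in $C^1_{loc}(\mathbb{R}^2)$, where $\psi^\lambda:=Gw^\lambda+\frac{\Omega}{2}|x|^2-\mu^\lambda$ and $V^*(y)=\frac14(1-|y|^2)$ for $|y|\le1$, $V^*(y)=\frac12\ln(1/|y|)$ for $|y|>1$.
   Context: $D=\{x\in\mathbb{R}^2:|x|<1\}$ is the unit disk. $G(x,y)=-\frac{1}{2\pi}\ln|x-y|-h(x,y)$ is the Green's function of $-\Delta$ in $D$ with zero Dirichlet boundary condition, where $h(x,y)=-\frac{1}{2\pi}\ln|y|-\frac{1}{2\pi}\ln\big|x-\frac{y}{|y|^2}\big|$; $H(x)=\frac12 h(x,x)=-\frac{1}{4\pi}\ln(1-|x|^2)$ is the Robin function. For $w\in L^\infty(D)$, $Gw(x)=\int_D G(x,y)w(y)\,dy$. $I_A$ denotes the indicator function of a set $A$, $|\cdot|$ is Lebesgue measure, and $x^\perp=(x_2,-x_1)$, $\nabla^\perp=(\partial_2,-\partial_1)$. The admissible class is $K_\lambda(D)=\{w\in L^\infty(D): 0\le w\le\lambda \text{ a.e. in } D,\ \int_D w=1\}$ and the functional is $\mathcal{E}(w)=\frac12\int_D\int_D G(x,y)w(x)w(y)\,dx\,dy+\frac{\Omega}{2}\int_D|x|^2w(x)\,dx$. A maximizer means $w^\lambda\in K_\lambda(D)$ with $\mathcal{E}(w^\lambda)=\sup_{K_\lambda(D)}\mathcal{E}$. *)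

theory Defs
  imports "HOL-Analysis.Analysis"
begin

type_synonym pt = "real^2"

definition D :: "pt set" where "D = ball 0 1"

definition hfun :: "pt \<Rightarrow> pt \<Rightarrow> real" where
  "hfun x y = - (1/(2*pi)) * ln (norm y) - (1/(2*pi)) * ln (norm (x - (1 / (norm y)^2) *\<^sub>R y))"

definition Gfun :: "pt \<Rightarrow> pt \<Rightarrow> real" where
  "Gfun x y = - (1/(2*pi)) * ln (norm (x - y)) - hfun x y"

definition Robin :: "pt \<Rightarrow> real" where
  "Robin x = - (1/(4*pi)) * ln (1 - (norm x)^2)"

definition Gop :: "(pt \<Rightarrow> real) \<Rightarrow> pt \<Rightarrow> real" where
  "Gop w x = (LINT y|lebesgue_on D. Gfun x y * w y)"

definition Kset :: "real \<Rightarrow> (pt \<Rightarrow> real) set" where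
  "Kset lam = {w. w \<in> borel_measurable (lebesgue_on D)
                 \<and> (AE x in lebesgue_on D. 0 \<le> w x \<and> w x \<le> lam)
                 \<and> (LINT x|lebesgue_on D. w x) = 1}"

definition Efun :: "real \<Rightarrow> (pt \<Rightarrow> real) \<Rightarrow> real" where
  "Efun Om w = 1/2 * (LINT x|lebesgue_on D. Gop w x * w x)
              + Om/2 * (LINT x|lebesgue_on D. (norm x)^2 * w x)"

definition maximizer :: "real \<Rightarrow> real \<Rightarrow> (pt \<Rightarrow> real) \<Rightarrow> bool" where
  "maximizer Om lam w \<longleftrightarrow> w \<in> Kset lam \<and> (\<forall>v \<in> Kset lam. Efun Om v \<le> Efun Om w)"

definition grad :: "(pt \<Rightarrow> real) \<Rightarrow> pt \<Rightarrow> pt" where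
  "grad f x = (\<chi> i. frechet_derivative f (at x) (axis i 1))"

definition perp :: "pt \<Rightarrow> pt" where
  "perp v = vector [v$2, - (v$1)]"

fun iter_deriv :: "pt list \<Rightarrow> (pt \<Rightarrow> real) \<Rightarrow> pt \<Rightarrow> real" where
  "iter_deriv [] f = f"
| "iter_deriv (v # vs) f = (\<lambda>x. frechet_derivative (iter_deriv vs f) (at x) v)"

definition smooth_fun :: "(pt \<Rightarrow> real) \<Rightarrow> bool" where
  "smooth_fun f \<longleftrightarrow> (\<forall>vs x. iter_deriv vs f differentiable (at x))"

definition test_fun :: "pt set \<Rightarrow> (pt \<Rightarrow> real) \<Rightarrow> bool" where
  "test_fun U f \<longleftrightarrow> smooth_fun f \<and> compact (closure {x. f x \<noteq> 0})
                     \<and> closure {x. f x \<noteq> 0} \<subseteq> U"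

definition psi0 :: "real \<Rightarrow> (pt \<Rightarrow> real) \<Rightarrow> pt \<Rightarrow> real" where
  "psi0 Om w x = Gop w x + Om/2 * (norm x)^2"

definition weak_eq :: "real \<Rightarrow> (pt \<Rightarrow> real) \<Rightarrow> bool" where
  "weak_eq Om w \<longleftrightarrow> (\<forall>\<phi>. test_fun D \<phi> \<longrightarrow>
     (LINT x|lebesgue_on D. w x * (grad (psi0 Om w) x \<bullet> perp (grad \<phi> x))) = 0)"

definition Aset :: "real \<Rightarrow> (pt \<Rightarrow> real) \<Rightarrow> real \<Rightarrow> pt set" where
  "Aset Om w \<mu> = {x \<in> D. psi0 Om w x > \<mu>}"

definition Bset :: "real \<Rightarrow> (pt \<Rightarrow> real) \<Rightarrow> real \<Rightarrow> pt set" where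
  "Bset Om w \<mu> = {x \<in> D. psi0 Om w x = \<mu>}"

definition patch_form :: "real \<Rightarrow> real \<Rightarrow> (pt \<Rightarrow> real) \<Rightarrow> real \<Rightarrow> bool" where
  "patch_form Om lam w \<mu> \<longleftrightarrow>
     (AE x in lebesgue_on D. w x = lam * indicator (Aset Om w \<mu>) x + 2 * Om * indicator (Bset Om w \<mu>) x)
     \<and> (lam \<noteq> 2 * Om \<longrightarrow> emeasure lebesgue (Bset Om w \<mu>) = 0)"

definition epsl :: "real \<Rightarrow> real" where
  "epsl lam = 1 / sqrt (pi * lam)"

definition center :: "(pt \<Rightarrow> real) \<Rightarrow> pt" where
  "center w = (LINT x|lebesgue_on D. w x *\<^sub>R x)"

definition Vstar :: "pt \<Rightarrow> real" where
  "Vstar y = (if norm y \<le> 1 then 1/4 * (1 - (norm y)^2) else 1/2 * ln (1 / norm y))"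

definition limit_point_at_top :: "(real \<Rightarrow> pt) \<Rightarrow> pt \<Rightarrow> bool" where
  "limit_point_at_top X p \<longleftrightarrow>
     (\<exists>s :: nat \<Rightarrow> real. filterlim s at_top sequentially \<and> (\<lambda>n. X (s n)) \<longlonglongrightarrow> p)"

end

theory Submission
  imports Defs "HOL-Complex_Analysis.Complex_Analysis"
begin

text \<open>Existence follows from weak-star compactness, since the energy is weak-star continuous. A bathtub argument
shows that a maximizer equals \<open>lam\<close> above and \<open>0\<close> below some level \<open>\<mu>\<close> of \<open>psi = Gw + Om/2 |x|^2\<close>. The level set
\<open>{psi = \<mu>}\<close> is negligible for every \<open>lam\<close>, including \<open>lam = 2 * Om\<close>: otherwise one could concentrate a small mass
near one of its density points at the expense of a thin strip next to the level set, and the logarithmic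
self-energy gained would exceed the first-order loss. Hence \<open>w grad psi\<close> is \<open>lam\<close> times the gradient of the
Lipschitz function \<open>(psi - \<mu>)^+\<close>, which gives the weak equation.

For large \<open>lam\<close>, comparison with a disk of radius \<open>epsl lam\<close> at the origin forces most of the mass into a ball of
radius \<open>O(epsl lam)\<close> away from the boundary, and then \<open>\<mu>\<close> is so high that the whole patch is there. Rescaled
patches have a weak-star limit that minimizes the logarithmic energy of the plane; polarization by reflections in
the lines through the centroid shows that it is radial, and the mean value property of the logarithm
reduces the problem to a bathtub problem solved by the unit disk. Translating a patch changes only the Robin part
of its energy at leading order, which locates the limit points of the centers. The rescaled potentials converge
because the additive constant is determined by the area \<open>pi\<close> of the rescaled patch.\<close>

section \<open>Affine substitutions and singular integrals\<close>

text \<open>The term \<open>2 * Om\<close> on the level set mirrors the equation -Laplace psi = w -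
  2 Om, whose right side has to vanish almost everywhere where psi is constant. Here the level set
  is shown to be null by comparing energies, an argument that does not notice whether
  \<open>lam\<close> equals \<open>2 * Om\<close>. All regularity comes from explicit estimates on
  ln|z|: the weight |z|^(-3/2) is still integrable near 0 in the plane and exceeds the 1/|z| of the
  gradient kernel by half a power, which pays for Hoelder continuity of exponent 1/2 of the
  gradients. These bounds are uniform over densities with common bound and support, so weak-star
  convergence of rescaled patches improves to C^1 convergence of their potentials on compact sets.
  Two difficulties shape the asymptotics. The parameter \<open>lam\<close> is continuous while
  compactness is sequential, so each limit is reached through subsequences of arbitrary sequences;
  and maximizers are classes of Lebesgue measurable functions, so the analysis runs on Borel
  representatives that vanish off the disk.\<close>

lemma sets_borel_ball [measurable]: "ball (c::'a::metric_space) r \<in> sets borel" "cball c r \<in> sets borel"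
 by auto

lemma nn_integral_lborel_affine:
 fixes t :: pt
 assumes [measurable]: "f \<in> borel_measurable borel" and c: "c \<noteq> 0"
 shows "(\<integral>\<^sup>+x. f x \<partial>lborel) = ennreal (c^2) * (\<integral>\<^sup>+x. f (t + c *\<^sub>R x) \<partial>lborel)"
 by (subst lborel_affine[OF c, of t])
   (simp add: nn_integral_density nn_integral_distr nn_integral_cmult ennreal_power)

lemma integrable_lborel_affine:
 fixes f :: "pt => 'a :: {banach, second_countable_topology}"
 assumes f: "integrable lborel f" and c: "c \<noteq> 0"
 shows "integrable lborel (\<lambda>x. f (t + c *\<^sub>R x))"
 using f f[THEN borel_measurable_integrable] c unfolding integrable_iff_bounded
 by (subst (asm) nn_integral_lborel_affine[where c=c and t=t]) (auto simp: ennreal_mult_less_top)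

lemma integrable_lborel_affine_iff:
 fixes f :: "pt => 'a :: {banach, second_countable_topology}"
 assumes c: "c \<noteq> 0"
 shows "integrable lborel (\<lambda>x. f (t + c *\<^sub>R x)) \<longleftrightarrow> integrable lborel f"
 using c integrable_lborel_affine[of f c t]
  integrable_lborel_affine[of "\<lambda>x. f (t + c *\<^sub>R x)" "1/c" "-(1/c) *\<^sub>R t"]
 by (auto simp: scaleR_add_right scaleR_diff_right)

lemma integral_lborel_affine:
 fixes f :: "pt => 'a :: {banach, second_countable_topology}"
 assumes c: "c \<noteq> 0"
 shows "(LBINT x. f x) = c^2 *\<^sub>R (LBINT x. f (t + c *\<^sub>R x))"
proof (cases "integrable lborel f")
 case True
 then have [measurable]: "f \<in> borel_measurable borel" by auto
 have "(LBINT x. f x) = (\<integral>x. f x \<partial>(density (distr lborel borel (\<lambda>x. t + c *\<^sub>R x)) (\<lambda>_. ennreal (c^2))))"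
  by (subst lborel_affine[OF c, of t]) (simp add: ennreal_power)
 also have "\<dots> = c^2 *\<^sub>R (LBINT x. f (t + c *\<^sub>R x))"
  by (simp add: integral_density integral_distr)
 finally show ?thesis .
next
 case False
 then show ?thesis using integrable_lborel_affine_iff[OF c, of f t] by (simp add: not_integrable_integral_eq)
qed

lemma AE_lborel_affine:
 fixes P :: "pt => bool"
 assumes "c \<noteq> 0" and ae: "AE x in lborel. P x"
 shows "AE x in lborel. P (t + c *\<^sub>R x)"
proof -
 from ae obtain N where N: "N \<in> null_sets lborel" "{x. \<not> P x} \<subseteq> N"
  by (auto simp: eventually_ae_filter)
 have [measurable]: "N \<in> sets borel" using N by auto
 have "(\<integral>\<^sup>+x. indicator N x \<partial>lborel) = ennreal (c^2) * (\<integral>\<^sup>+x. indicator N (t + c *\<^sub>R x) \<partial>lborel)"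
  by (rule nn_integral_lborel_affine) (use assms in auto)
 then have "(\<integral>\<^sup>+x. indicator N (t + c *\<^sub>R x) \<partial>(lborel :: pt measure)) = 0"
  using N assms by (auto simp: null_sets_def)
 then have "AE x in lborel. indicator N (t + c *\<^sub>R x) = (0::ennreal)"
  by (subst (asm) nn_integral_0_iff_AE) auto
 then show ?thesis
  by eventually_elim (use N in \<open>auto simp: indicator_def split: if_splits\<close>)
qed

lemma emeasure_ball_pt: "0 \<le> r ==> emeasure lborel (ball (c::pt) r) = ennreal (pi * r^2)"
 by (simp add: emeasure_ball unit_ball_vol_2)

lemma emeasure_cball_pt: "0 \<le> r ==> emeasure lborel (cball (c::pt) r) = ennreal (pi * r^2)"
 by (simp add: emeasure_cball unit_ball_vol_2)

lemma measure_ball_pt: "0 \<le> r ==> measure lborel (ball (c::pt) r) = pi * r^2"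
 by (simp add: measure_def emeasure_ball_pt)

text \<open>\<open>lborel\<close> is characterized by its values on boxes, and the preimage of a box
  is its image under the inverse isometry, which has the same Lebesgue measure.\<close>

lemma distr_lborel_orthogonal:
 fixes f :: "pt => pt"
 assumes f: "orthogonal_transformation f"
 shows "distr lborel borel f = lborel"
proof -
 have lin: "linear f" using f by (rule orthogonal_transformation_linear)
 have [measurable]: "f \<in> borel_measurable borel"
  using lin by (intro borel_measurable_continuous_onI linear_continuous_on linear_conv_bounded_linear[THEN iffD1])
 obtain g where g: "orthogonal_transformation g" "\<And>x. g (f x) = x" "\<And>x. f (g x) = x"
  using f by (metis orthogonal_transformation_inv orthogonal_transformation_bij bij_is_inj bij_is_surj inv_f_f surj_f_inv_f)
 have pre: "f -` S = g ` S" for S using g by (auto simp: image_iff) metis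
 have "lborel = distr lborel borel f"
 proof (rule lborel_eqI)
  fix l u :: pt assume le: "\<And>b. b \<in> Basis ==> l \<bullet> b \<le> u \<bullet> b"
  have m: "g ` box l u \<in> lmeasurable" "measure lebesgue (g ` box l u) = measure lebesgue (box l u)"
   by (intro measurable_orthogonal_image measure_orthogonal_image g lmeasurable_box)+
  have b: "g ` box l u \<in> sets borel" unfolding pre[symmetric]
   using measurable_sets[of f borel borel "box l u"] by simp
  have "emeasure (distr lborel borel f) (box l u) = emeasure lborel (g ` box l u)"
   by (simp add: emeasure_distr pre)
  also have "\<dots> = emeasure lebesgue (g ` box l u)" using b by simp
  also have "\<dots> = emeasure lebesgue (box l u)"
   using m by (metis emeasure_eq_measure2 fmeasurableD2 lmeasurable_box)
  also have "\<dots> = (\<Prod>b\<in>Basis. (u - l) \<bullet> b)" using le by (simp add: inner_simps)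
  finally show "emeasure (distr lborel borel f) (box l u) = (\<Prod>b\<in>Basis. (u - l) \<bullet> b)" .
 qed simp
 then show ?thesis by simp
qed

text \<open>The disk is cut into dyadic annuli. On each the weight is at most its value at the inner
  radius, and the contributions form a geometric series of ratio 1/sqrt 2, convergent because the
  exponent 3/2 lies below the dimension 2. The constant 40 rounds up 2^(3/2) pi / (1 - 1/sqrt
  2).\<close>

lemma nn_integral_powr_ball_le:
 assumes r: "0 < r"
 shows "(\<integral>\<^sup>+z. indicator (ball (0::pt) r) z * ennreal (norm z powr (-3/2)) \<partial>lborel) \<le> ennreal (40 * sqrt r)"
proof -
 define q where "q = (1 / sqrt 2 :: real)"
 have q: "0 < q" "q < 1" by (auto simp: q_def)
 \<comment> \<open>Weight at the inner radius of the k-th annulus times the area of the full disk of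
   its outer radius.\<close>
 define a where "a k = (r / 2^(k+1)) powr (-3/2) * (pi * (r/2^k)^2)" for k :: nat
 have ak: "a k = 2 powr (3/2) * pi * sqrt r * q^k" for k
 proof -
  have "(r / 2^(k+1)) powr (-3/2) = r powr (-3/2) * (2 powr (real k + 1)) powr (3/2)"
   using r by (simp add: powr_divide powr_minus_divide powr_realpow[symmetric] powr_add powr_mult divide_simps)
  also have "\<dots> = r powr (-3/2) * (2 powr (3/2) * 2 powr (3/2*k))"
   by (simp add: powr_powr powr_add[symmetric] field_simps)
  finally have 1: "(r / 2^(k+1)) powr (-3/2) = r powr (-3/2) * (2 powr (3/2) * 2 powr (3/2*k))" .
  have 2: "(r/2^k)^2 = r powr 2 * 2 powr (- 2 * k)"
   using r by (simp add: power_divide powr_minus_divide powr_realpow[symmetric] powr_powr power2_eq_square powr_add[symmetric] flip: powr_numeral) (simp add: powr_numeral power2_eq_square)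
  have 3: "r powr (-3/2) * r powr 2 = sqrt r" 
  proof -
   have "r powr (-3/2) * r powr 2 = r powr (1/2)" by (subst powr_add[symmetric]) simp
   then show ?thesis using r by (simp only: powr_half_sqrt less_imp_le)
  qed
  have 4: "2 powr (3/2*k) * 2 powr (- 2 * k) = q^k"
  proof -
   have "q = 2 powr (-1/2)" unfolding q_def by (simp add: powr_minus_divide powr_half_sqrt)
   then have "q ^ k = 2 powr (-1/2 * k)" by (simp add: powr_powr powr_realpow[symmetric])
   moreover have "2 powr (3/2*k) * 2 powr (- 2 * k) = 2 powr (3/2*k + (- 2 * k))"
    by (rule powr_add[symmetric])
   moreover have "3/2*k + (- 2 * k) = -1/2 * real k" by simp
   ultimately show ?thesis by (simp only:)
  qed
  have "a k = (r powr (-3/2) * r powr 2) * 2 powr (3/2) * pi * (2 powr (3/2*k) * 2 powr (- 2 * k))"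
   unfolding a_def 1 2 by simp
  then show ?thesis unfolding 3 4 by simp
 qed
 have single: "f k \<le> suminf f" for f :: "nat => ennreal" and k
  using sum_le_suminf[of f "{k}"] by simp
 have pt: "indicator (ball (0::pt) r) z * ennreal (norm z powr (-3/2)) \<le>
   (\<Sum>k. ennreal ((r / 2^(k+1)) powr (-3/2)) * indicator (ball (0::pt) (r/2^k)) z)" for z
 proof (cases "z \<in> ball 0 r \<and> z \<noteq> 0")
  case True
  then have z: "0 < norm z" "norm z < r" by auto
  have "\<exists>k. r / 2^(k+1) \<le> norm z"
  proof -
   obtain n where "(1/2)^n < norm z / r" using real_arch_pow_inv[of "norm z / r" "1/2"] z r by auto
   then have "r * (1/2)^n < norm z" using r by (simp add: field_simps)
   moreover have "r / 2^(n+1) \<le> r * (1/2)^n" using r by (simp add: power_divide field_simps)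
   ultimately have "r / 2^(n+1) \<le> norm z" by linarith
   then show ?thesis by blast
  qed
  \<comment> \<open>The least such index places \<open>z\<close> between the radii r / 2^(k+1) and r
    / 2^k.\<close>
  define k where "k = (LEAST k. r / 2^(k+1) \<le> norm z)"
  have k1: "r / 2^(k+1) \<le> norm z" unfolding k_def by (rule LeastI_ex) fact
  have k2: "norm z < r / 2^k"
  proof (cases k)
   case 0 then show ?thesis using z by simp
  next
   case (Suc j)
   then have "\<not> r / 2^(j+1) \<le> norm z"
    using not_less_Least[of j "\<lambda>k. r / 2^(k+1) \<le> norm z"] unfolding k_def[symmetric] by simp
   then show ?thesis using Suc by simp
  qed
  have "norm z powr (-3/2) \<le> (r / 2^(k+1)) powr (-3/2)"
   using k1 r by (intro powr_mono2') simp_all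
  then have "indicator (ball (0::pt) r) z * ennreal (norm z powr (-3/2)) \<le> ennreal ((r / 2^(k+1)) powr (-3/2))"
   using True by (simp only: indicator_simps mult_1 ennreal_leI)
  also have "\<dots> = ennreal ((r / 2^(k+1)) powr (-3/2)) * indicator (ball (0::pt) (r/2^k)) z"
   using k2 by simp
  also have "\<dots> \<le> (\<Sum>k. ennreal ((r / 2^(k+1)) powr (-3/2)) * indicator (ball (0::pt) (r/2^k)) z)"
   by (rule single)
  finally show ?thesis .
 qed auto
 have "(\<integral>\<^sup>+z. indicator (ball (0::pt) r) z * ennreal (norm z powr (-3/2)) \<partial>lborel) \<le>
   (\<integral>\<^sup>+z. (\<Sum>k. ennreal ((r / 2^(k+1)) powr (-3/2)) * indicator (ball (0::pt) (r/2^k)) z) \<partial>lborel)"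
  by (intro nn_integral_mono) (use pt in auto)
 also have "\<dots> = (\<Sum>k. ennreal (a k))"
  by (subst nn_integral_suminf) (use r in \<open>auto simp: nn_integral_cmult emeasure_ball_pt a_def ennreal_mult'\<close>)
 also have "\<dots> = ennreal (\<Sum>k. a k)"
  by (intro suminf_ennreal2) (use r q in \<open>auto simp: ak intro!: summable_mult summable_geometric\<close>)
 also have "(\<Sum>k. a k) = 2 powr (3/2) * pi * sqrt r * (1 / (1 - q))"
  using q unfolding ak by (subst suminf_mult) (auto simp: suminf_geometric summable_geometric)
 also have "\<dots> \<le> 40 * sqrt r"
 proof -
  have s: "1.414 < sqrt 2" "sqrt 2 < (1.4143::real)" 
   by (rule real_less_rsqrt, simp add: power2_eq_square) (rule real_less_lsqrt, simp_all add: power2_eq_square)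
  have p: "2 powr (3/2) = 2 * sqrt (2::real)"

  proof -
   have "2 powr (3/2) = 2 powr (1 + 1/2::real)" by simp
   also have "\<dots> = 2 * sqrt 2" unfolding powr_add by (simp add: powr_half_sqrt)
   finally show ?thesis .
  qed
  have qq: "1 / (1-q) \<le> 3.5"
  proof -
   have "q \<le> 0.708" using s by (simp add: q_def field_simps)
   then show ?thesis using q by (simp add: field_simps)
  qed
  have "2 powr (3/2) * pi * (1/(1-q)) \<le> (2 * 1.4143) * 4 * 3.5"
   unfolding p using qq q s pi_less_4 by (intro mult_mono) auto
  also have "(2 * 1.4143) * 4 * 3.5 \<le> (40::real)" by simp
  finally have "2 powr (3/2) * pi * (1/(1-q)) \<le> 40" .
  then have "(2 powr (3/2) * pi * (1/(1-q))) * sqrt r \<le> 40 * sqrt r" using r by (intro mult_right_mono) auto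
  then show ?thesis by (simp add: mult_ac)
 qed
 finally show ?thesis by (auto intro: ennreal_leI order_trans)
qed

lemma integrable_powr_ball:
 "integrable lborel (\<lambda>z. indicator (ball (0::pt) r) z * norm z powr (-3/2))"
proof (cases "0 < r")
 case True
 have "(\<integral>\<^sup>+z. ennreal (norm (indicator (ball (0::pt) r) z * norm z powr (-3/2))) \<partial>lborel)
   = (\<integral>\<^sup>+z. indicator (ball (0::pt) r) z * ennreal (norm z powr (-3/2)) \<partial>lborel)"
  by (intro nn_integral_cong) (auto simp: indicator_def)
 moreover have "(\<lambda>z. indicator (ball (0::pt) r) z * norm z powr (-3/2)) \<in> borel_measurable lborel"
  unfolding measurable_lborel2 by measurable
 ultimately show ?thesis using nn_integral_powr_ball_le[OF True]
  unfolding integrable_iff_bounded by (auto simp: top.not_eq_extremum intro: le_less_trans)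
qed (auto simp: ball_empty)

lemma integral_powr_ball_le:
 assumes "0 < r"
 shows "(LBINT z. indicator (ball (0::pt) r) z * norm z powr (-3/2)) \<le> 40 * sqrt r"
proof -
 have "ennreal (LBINT z. indicator (ball (0::pt) r) z * norm z powr (-3/2))
  = (\<integral>\<^sup>+z. indicator (ball (0::pt) r) z * ennreal (norm z powr (-3/2)) \<partial>lborel)"
  by (subst nn_integral_eq_integral[OF integrable_powr_ball, symmetric])
    (auto simp: indicator_def intro!: nn_integral_cong)
 also have "\<dots> \<le> ennreal (40 * sqrt r)" by (rule nn_integral_powr_ball_le[OF assms])
 finally show ?thesis using assms by simp
qed

text \<open>1/|z| is |z|^(1/2) times |z|^(-3/2), so estimates for the stronger weight pass to the
  size of the gradient kernel.\<close>

lemma inverse_norm_le_powr: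
 assumes "norm z < r"
 shows "1 / norm z \<le> sqrt r * norm z powr (-3/2)"
proof (cases "norm z = 0")
 case False
 have "1 / norm z = sqrt (norm z) * norm z powr (-3/2)"
  using False powr_add[of "norm z" "1/2" "-3/2"] by (simp add: powr_half_sqrt powr_minus_divide)
 also have "\<dots> \<le> sqrt r * norm z powr (-3/2)" using assms by (intro mult_right_mono) auto
 finally show ?thesis .
qed auto

lemma integrable_inverse_ball:
 "integrable lborel (\<lambda>z. indicator (ball (0::pt) r) z * (1 / norm z))"
proof (rule Bochner_Integration.integrable_bound)
 show "integrable lborel (\<lambda>z. sqrt r * (indicator (ball (0::pt) r) z * norm z powr (-3/2)))"
  by (intro integrable_mult_right integrable_powr_ball)
 show "AE z in lborel. norm (indicator (ball (0::pt) r) z * (1 / norm z)) \<le> norm (sqrt r * (indicator (ball (0::pt) r) z * norm z powr (-3/2)))" (is "AE x in _. ?P x")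
 proof (intro AE_I2)
  fix z :: pt
  show "?P z"
  proof (cases "z \<in> ball 0 r")
   case True
   then have "norm z < r" by simp
   moreover have "0 < r" using True by (metis ball_eq_empty emptyE not_le)
   ultimately show ?thesis using inverse_norm_le_powr[of z r] True by (simp add: abs_mult)
  qed auto
 qed
 have "(\<lambda>z. indicator (ball (0::pt) r) z * (1 / norm z)) \<in> borel_measurable borel" by measurable
 then show "(\<lambda>z. indicator (ball (0::pt) r) z * (1 / norm z)) \<in> borel_measurable lborel"
  unfolding measurable_lborel2 .
qed

lemma integral_inverse_ball_le:
 assumes r: "0 < r"
 shows "(LBINT z. indicator (ball (0::pt) r) z * (1 / norm z)) \<le> 40 * r"
proof -
 have "(LBINT z. indicator (ball (0::pt) r) z * (1 / norm z)) \<le> (LBINT z. sqrt r * (indicator (ball (0::pt) r) z * norm z powr (-3/2)))"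
  by (intro integral_mono integrable_inverse_ball integrable_mult_right integrable_powr_ball)
    (auto simp: indicator_def dest: inverse_norm_le_powr)
 also have "\<dots> \<le> sqrt r * (40 * sqrt r)"
  using integral_powr_ball_le[OF r] r by (simp add: mult_left_mono)
 also have "\<dots> = 40 * r" using r by simp
 finally show ?thesis .
qed

section \<open>Weak-star compactness of bounded densities\<close>

lemma convergent_approx:
 fixes f :: "nat => real"
 assumes "\<And>e. 0 < e ==> \<exists>g. convergent g \<and> (\<forall>n. \<bar>f n - g n\<bar> \<le> e)"
 shows "convergent f"
proof -
 have "Cauchy f"
 proof (rule CauchyI)
  fix e :: real assume "0 < e"
  then obtain g where g: "convergent g" "\<And>n. \<bar>f n - g n\<bar> \<le> e/4" using assms[of "e/4"] by auto
  then have "Cauchy g" by (simp add: Cauchy_convergent_iff)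
  then obtain M where M: "\<And>m n. m \<ge> M ==> n \<ge> M ==> norm (g m - g n) < e/4"
   using CauchyD[of g "e/4"] \<open>0 < e\<close> by auto
  have "norm (f m - f n) < e" if "m \<ge> M" "n \<ge> M" for m n
   using g(2)[of m] g(2)[of n] M[OF that] \<open>0 < e\<close> unfolding real_norm_def abs_le_iff abs_less_iff by linarith
  then show "\<exists>M. \<forall>m\<ge>M. \<forall>n\<ge>M. norm (f m - f n) < e" by blast
 qed
 then show ?thesis by (simp add: Cauchy_convergent_iff)
qed

lemma tendsto_approx:
 fixes f :: "nat => real"
 assumes "\<And>e. 0 < e ==> \<exists>g b. g \<longlonglongrightarrow> b \<and> (\<forall>n. \<bar>f n - g n\<bar> \<le> e) \<and> \<bar>b - a\<bar> \<le> e"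
 shows "f \<longlonglongrightarrow> a"
proof (rule LIMSEQ_I)
 fix e :: real assume "0 < e"
 then obtain g b where g: "g \<longlonglongrightarrow> b" "\<And>n. \<bar>f n - g n\<bar> \<le> e/4" "\<bar>b - a\<bar> \<le> e/4"
  using assms[of "e/4"] by auto
 obtain M where M: "\<And>n. n \<ge> M ==> norm (g n - b) < e/4"
  using LIMSEQ_D[OF g(1), of "e/4"] \<open>0 < e\<close> by auto
 have "norm (f n - a) < e" if "n \<ge> M" for n
  using g(2)[of n] g(3) M[OF that] \<open>0 < e\<close> unfolding real_norm_def abs_le_iff abs_less_iff by linarith
 then show "\<exists>no. \<forall>n\<ge>no. norm (f n - a) < e" by blast
qed

text \<open>Diagonal extraction needs countably many sets, and Dynkin induction up to all Borel sets
  needs stability under intersections; the finite intersections of a countable basis offer both. The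
  empty intersection supplies \<open>UNIV\<close>.\<close>

lemma countable_Int_stable_generator:
 obtains G :: "'a::second_countable_topology set set"
 where "countable G" "Int_stable G" "UNIV \<in> G" "sets borel = sigma_sets UNIV G"
proof -
 obtain B :: "'a set set" where B: "countable B" "topological_basis B"
  using ex_countable_basis by auto
 define G where "G = Inter ` {F. finite F \<and> F \<subseteq> B}"
 have "countable G" unfolding G_def using countable_Collect_finite_subset[OF B(1)]
  by (intro countable_image) (simp add: conj_commute)
 moreover have "Int_stable G"
 proof (rule Int_stableI)
  fix a b assume "a \<in> G" "b \<in> G"
  then obtain F F' where "finite F" "F \<subseteq> B" "a = \<Inter>F" "finite F'" "F' \<subseteq> B" "b = \<Inter>F'"
   by (auto simp: G_def)
  then show "a \<inter> b \<in> G" unfolding G_def by (intro image_eqI[of _ _ "F \<union> F'"]) auto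
 qed
 moreover have "UNIV \<in> G" unfolding G_def by (intro image_eqI[of _ _ "{}"]) auto
 moreover have "sets borel = sigma_sets UNIV G"
 proof -
  have "borel = sigma UNIV G"
  proof (subst borel_eq_countable_basis[OF B], rule sigma_eqI)
   have 1: "B \<subseteq> G" unfolding G_def by (auto intro!: image_eqI[of _ _ "{_}"])
   have "G \<subseteq> sigma_sets UNIV B"
   proof
    fix a assume "a \<in> G"
    then obtain F where F: "finite F" "F \<subseteq> B" "a = \<Inter>F" by (auto simp: G_def)
    have "open a" unfolding F(3) using F B by (intro open_Inter) (auto dest: topological_basis_open)
    then have "a \<in> sets borel" by simp
    then show "a \<in> sigma_sets UNIV B" unfolding borel_eq_countable_basis[OF B] by simp
   qed
   then show "sigma_sets UNIV B = sigma_sets UNIV G"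
    using 1 by (intro sigma_sets_eqI) auto
  qed auto
  then show ?thesis by (metis sets_measure_of top_greatest Pow_UNIV)
 qed
 ultimately show thesis by (rule that)
qed

lemma bounded_density_integrable_mult:
 fixes f w :: "'a => real"
 assumes "integrable M f" "w \<in> borel_measurable M" "\<And>x. \<bar>w x\<bar> \<le> L"
 shows "integrable M (\<lambda>x. f x * w x)"
proof (rule Bochner_Integration.integrable_bound)
 show "integrable M (\<lambda>x. L * f x)" using assms by auto
 show "(\<lambda>x. f x * w x) \<in> borel_measurable M" using assms by measurable
 show "AE x in M. norm (f x * w x) \<le> norm (L * f x)"
  by (intro AE_I2) (use assms(3) in \<open>auto simp: abs_mult mult.commute[of L] intro!: mult_left_mono intro: order_trans[OF _ abs_ge_self]\<close>)
qed

text \<open>Densities are treated as set functions. A diagonal subsequence makes the masses of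
  countably many generating sets converge, domination by \<open>L\<close> times Lebesgue measure on
  \<open>S\<close> carries this to all Borel sets, and the limit is a measure whose Radon-Nikodym
  density lies between 0 and \<open>L\<close>. Testing extends from indicators to integrable
  functions because the densities are uniformly bounded.\<close>

lemma weak_star_compactness:
 fixes w :: "nat => 'a::euclidean_space => real"
 assumes w [measurable]: "\<And>n. w n \<in> borel_measurable borel"
  and b: "\<And>n x. 0 \<le> w n x" "\<And>n x. w n x \<le> L"
  and S [measurable]: "S \<in> sets borel" and fin: "emeasure lborel S < \<infinity>"
  and z: "\<And>n x. x \<notin> S ==> w n x = 0"
 obtains k v where "strict_mono (k::nat=>nat)" "v \<in> borel_measurable borel"
  "\<And>x. 0 \<le> v x" "\<And>x. v x \<le> L" "\<And>x. x \<notin> S ==> v x = 0"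
  "\<And>f. integrable lborel f ==> (\<lambda>n. LBINT x. f x * w (k n) x) \<longlonglongrightarrow> (LBINT x. f x * v x)"
proof -
 have L0: "0 \<le> L" using b[of 0 undefined] by linarith
 have iS: "integrable lborel (indicator (A \<inter> S) :: 'a => real)" if "A \<in> sets borel" for A
 proof (rule integrable_real_indicator)
  show "A \<inter> S \<in> sets lborel" using that by simp
  have "emeasure lborel (A \<inter> S) \<le> emeasure lborel S" by (rule emeasure_mono) auto
  then show "emeasure lborel (A \<inter> S) < \<infinity>" using fin by (rule le_less_trans)
 qed
 have absw: "\<bar>w n x\<bar> \<le> L" for n x using b by simp
 have fS: "emeasure lborel (A \<inter> S) < \<infinity>" for A
 proof -
  have "emeasure lborel (A \<inter> S) \<le> emeasure lborel S" by (rule emeasure_mono) auto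
  then show ?thesis using fin by (rule le_less_trans)
 qed
 have iw: "integrable lborel (\<lambda>x. indicator A x * w n x)" if "A \<in> sets borel" for A n
 proof -
  have "(\<lambda>x. indicator A x * w n x) = (\<lambda>x. indicator (A \<inter> S) x * w n x)"
   using z[of _ n] by (auto simp: indicator_def fun_eq_iff)
  then show ?thesis using bounded_density_integrable_mult[OF iS[OF that], of "w n" L] absw by simp
 qed
 define a where "a n A = (LBINT x. indicator A x * w n x)" for n A
 have a0: "0 \<le> a n A" for n A unfolding a_def by (intro Bochner_Integration.integral_nonneg) (use b in auto)
 have aL: "a n A \<le> L * measure lborel (A \<inter> S)" if "A \<in> sets borel" for n A
 proof -
  have "a n A \<le> (LBINT x. L * indicator (A \<inter> S) x)"
   unfolding a_def
  proof (rule integral_mono)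
   show "integrable lborel (\<lambda>x. L * indicator (A \<inter> S) x)" using iS[OF that] by (rule integrable_mult_right)
   show "indicator A x * w n x \<le> L * indicator (A \<inter> S) x" for x
    using b(2)[of n x] z[of x n] by (auto simp: indicator_def)
  qed (rule iw[OF that])
  then show ?thesis using that by simp
 qed
 have mono: "measure lborel (A \<inter> S) \<le> measure lborel S" if "A \<in> sets borel" for A
  using that fin by (intro measure_mono_fmeasurable) (auto simp: fmeasurable_def)
 obtain G :: "'a set set" where G: "countable G" "Int_stable G" "UNIV \<in> G" "sets borel = sigma_sets UNIV G"
  by (rule countable_Int_stable_generator)
 have GB: "A \<in> sets borel" if "A \<in> G" for A unfolding G(4) using that by auto
 obtain k where k: "strict_mono (k::nat=>nat)" "\<And>A. A \<in> G ==> \<exists>l. (\<lambda>n. a (k n) A) \<longlonglongrightarrow> l"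
 proof (rule function_convergent_subsequence[OF G(1), of a "L * measure lborel S"])
  fix n A assume "A \<in> G"
  then show "norm (a n A) \<le> L * measure lborel S"
   using a0[of n A] aL[of A n] mono[of A] GB mult_left_mono[OF mono[of A] L0] by auto
 qed auto
 have a_UN: "a n (\<Union>i\<in>I. A i) = (\<Sum>i\<in>I. a n (A i))" if "finite I" "disjoint_family_on A I" "\<And>i. i \<in> I ==> A i \<in> sets borel" for n I and A :: "nat => 'a set"
 proof -
  have "indicator (\<Union>i\<in>I. A i) x = (\<Sum>i\<in>I. indicator (A i) x :: real)" for x
   using that by (subst indicator_UN_disjoint) auto
  then have *: "(\<lambda>x. indicator (\<Union>i\<in>I. A i) x * w n x) = (\<lambda>x. \<Sum>i\<in>I. indicator (A i) x * w n x)"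
   by (simp only: sum_distrib_right)
  show ?thesis unfolding a_def *
   by (rule Bochner_Integration.integral_sum) (rule iw, rule that)
 qed
 have split: "a n (A \<union> B) = a n A + a n B" if "A \<inter> B = {}" "A \<in> sets borel" "B \<in> sets borel" for n A B
 proof -
  have *: "(\<lambda>x. indicator (A \<union> B) x * w n x) = (\<lambda>x. indicator A x * w n x + indicator B x * w n x)"
   using that by (subst indicator_disj_union[symmetric] | auto simp: fun_eq_iff indicator_def split: split_of_bool)+
  show ?thesis unfolding a_def * using iw that by simp
 qed
 have vanish: "(\<lambda>i. measure lborel (A i \<inter> S)) \<longlonglongrightarrow> 0"
  if "range A \<subseteq> sets borel" "decseq A" "(\<Inter>i. A i) = {}" for A :: "nat => 'a set"
 proof -
  have "(\<lambda>i. measure lborel (A i \<inter> S)) \<longlonglongrightarrow> measure lborel (\<Inter>i. A i \<inter> S)"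
   using that fS by (intro Lim_measure_decseq) (auto simp: decseq_def less_top[symmetric])
  moreover have "(\<Inter>i. A i \<inter> S) = {}" using that by auto
  ultimately show ?thesis by simp
 qed
 \<comment> \<open>Dynkin induction over the generator. Countable disjoint unions are the delicate
   case: the tail has to be small uniformly along the sequence.\<close>
 have conv: "convergent (\<lambda>n. a (k n) A)" if "A \<in> sets borel" for A
 proof -
  have GP: "G \<subseteq> Pow UNIV" by simp
  have A: "A \<in> sigma_sets UNIV G" using that G(4) by simp
  show ?thesis using G(2) GP A
  proof (induction rule: sigma_sets_induct_disjoint)
   case (basic A) then show ?case using k(2) by (auto simp: convergent_def)
  next
   case empty show ?case by (simp add: a_def convergent_const)
  next
   case (compl A)
   then have A: "A \<in> sets borel" using G(4) by simp
   have "a n (UNIV - A) = a n UNIV - a n A" for n using split[of A "UNIV - A" n] A by auto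
   moreover have "convergent (\<lambda>n. a (k n) UNIV)" using k(2)[OF G(3)] by (auto simp: convergent_def)
   ultimately show ?case using compl by (auto intro: convergent_diff)
  next
   case (union A)
   then have A: "A i \<in> sets borel" for i using G(4) by auto
   \<comment> \<open>The tail of the union. Its mass is at most \<open>L\<close> times its Lebesgue
     measure inside \<open>S\<close>, whatever the index of the sequence.\<close>
   define R where "R N = (\<Union>i. A i) - (\<Union>i<N. A i)" for N
   have RB: "R N \<in> sets borel" for N using A by (auto simp: R_def)
   have lim: "(\<lambda>N. measure lborel (R N \<inter> S)) \<longlonglongrightarrow> 0"
   proof (rule vanish)
    show "range R \<subseteq> sets borel" using RB by auto
    show "decseq R" unfolding decseq_def R_def by fastforce
    show "(\<Inter>N. R N) = {}" unfolding R_def by auto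
   qed
   show ?case
   proof (rule convergent_approx)
    fix e :: real assume e: "0 < e"
    have "(\<lambda>N. L * measure lborel (R N \<inter> S)) \<longlonglongrightarrow> L * 0" by (intro tendsto_mult lim tendsto_const)
    then obtain N where N: "L * measure lborel (R N \<inter> S) < e"
     using e by (metis (no_types, lifting) LIMSEQ_D diff_zero dual_order.refl mult_zero_right real_norm_def abs_less_iff)
    have "a n (\<Union>i. A i) = (\<Sum>i<N. a n (A i)) + a n (R N)" for n
    proof -
     have *: "(\<Union>i. A i) = (\<Union>i<N. A i) \<union> R N" unfolding R_def by auto
     have "a n (\<Union>i. A i) = a n (\<Union>i<N. A i) + a n (R N)" unfolding *
     proof (rule split)
      show "(\<Union>i<N. A i) \<inter> R N = {}" unfolding R_def by blast
      show "(\<Union>i<N. A i) \<in> sets borel" using A by (intro sets.countable_UN') auto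
     qed (rule RB)
     also have "a n (\<Union>i<N. A i) = (\<Sum>i<N. a n (A i))"
      using union A by (intro a_UN) (auto intro: disjoint_family_on_mono)
     finally show ?thesis .
    qed
    then have "\<bar>a (k n) (\<Union>i. A i) - (\<Sum>i<N. a (k n) (A i))\<bar> \<le> e" for n
     using a0[of "k n" "R N"] aL[OF RB, of "k n" N] N by simp
    moreover have "convergent (\<lambda>n. \<Sum>i<N. a (k n) (A i))" using union by (intro convergent_sum) auto
    ultimately show "\<exists>g. convergent g \<and> (\<forall>n. \<bar>a (k n) (\<Union>i. A i) - g n\<bar> \<le> e)" by blast
   qed
  qed
 qed
 define \<nu> where "\<nu> A = lim (\<lambda>n. a (k n) A)" for A
 have \<nu>: "(\<lambda>n. a (k n) A) \<longlonglongrightarrow> \<nu> A" if "A \<in> sets borel" for A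
  using conv[OF that] unfolding \<nu>_def by (simp add: convergent_LIMSEQ_iff)
 have \<nu>0: "0 \<le> \<nu> A" if "A \<in> sets borel" for A
  using \<nu>[OF that] a0 by (intro LIMSEQ_le_const) auto
 have \<nu>L: "\<nu> A \<le> L * measure lborel (A \<inter> S)" if "A \<in> sets borel" for A
  using \<nu>[OF that] aL[OF that] by (intro LIMSEQ_le_const2) auto
 define N where "N = measure_of UNIV (sets borel) (\<lambda>A. ennreal (\<nu> A))"
 have alg: "sigma_algebra (UNIV::'a set) (sets borel)" by (metis sets.sigma_algebra_axioms space_borel)
 \<comment> \<open>For a finite additive set function, countable additivity amounts to continuity at
   the empty set, and \<open>\<nu>L\<close> provides that.\<close>
 have ca: "countably_additive (sets borel) (\<lambda>A. ennreal (\<nu> A))"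
 proof (rule ring_of_sets.empty_continuous_imp_countably_additive)
  show "ring_of_sets UNIV (sets (borel::'a measure))" by (metis sets.ring_of_sets_axioms space_borel)
  show "positive (sets borel) (\<lambda>A. ennreal (\<nu> A))"
   using \<nu>[of "{}"] by (auto simp: positive_def a_def LIMSEQ_const_iff)
  show "additive (sets borel) (\<lambda>A. ennreal (\<nu> A))"
   unfolding additive_def
  proof (intro ballI impI)
   fix A B :: "'a set" assume AB: "A \<in> sets borel" "B \<in> sets borel" "A \<inter> B = {}"
   have "(\<lambda>n. a (k n) (A \<union> B)) \<longlonglongrightarrow> \<nu> A + \<nu> B"
    unfolding split[OF AB(3,1,2)] by (intro tendsto_add \<nu> AB)
   then have "\<nu> (A \<union> B) = \<nu> A + \<nu> B" using \<nu>[of "A \<union> B"] AB LIMSEQ_unique by blast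
   then show "ennreal (\<nu> (A \<union> B)) = ennreal (\<nu> A) + ennreal (\<nu> B)" using \<nu>0 AB by simp
  qed
  show "\<forall>A\<in>sets borel. ennreal (\<nu> A) \<noteq> \<infinity>" by simp
  fix A :: "nat => 'a set" assume A: "range A \<subseteq> sets borel" "decseq A" "(\<Inter>i. A i) = {}"
  have "(\<lambda>i. \<nu> (A i)) \<longlonglongrightarrow> 0"
  proof (rule tendsto_sandwich[OF _ _ tendsto_const])
   show "(\<lambda>i. L * measure lborel (A i \<inter> S)) \<longlonglongrightarrow> 0" using tendsto_mult[OF tendsto_const vanish[OF A], of L] by simp
  qed (use \<nu>0 \<nu>L A in auto)
  then show "(\<lambda>i. ennreal (\<nu> (A i))) \<longlonglongrightarrow> 0" using tendsto_ennrealI by fastforce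
 qed
 have eN: "emeasure N A = ennreal (\<nu> A)" if "A \<in> sets borel" for A
  unfolding N_def using that ca alg \<nu>[of "{}"]
  by (intro emeasure_measure_of_sigma) (auto simp: positive_def a_def LIMSEQ_const_iff)
 have sN [simp]: "sets N = sets borel" unfolding N_def using alg
  by (metis sigma_algebra.sets_measure_of_eq)
 have ac: "absolutely_continuous lborel N"
 proof -
  have "A \<in> null_sets N" if A: "A \<in> null_sets lborel" for A
  proof -
   have "A \<in> sets borel" "measure lborel (A \<inter> S) = 0" using A null_set_Int2[of A lborel S]
    by (auto simp: null_sets_def measure_def Int_commute)
   then have "\<nu> A = 0" using \<nu>0 \<nu>L by fastforce
   then show ?thesis using \<open>A \<in> sets borel\<close> eN by (auto simp: null_sets_def)
  qed
  then show ?thesis unfolding absolutely_continuous_def by auto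
 qed
 obtain f where f [measurable]: "f \<in> borel_measurable lborel" and fN: "density lborel f = N"
  using sigma_finite_measure.Radon_Nikodym[OF sigma_finite_lborel ac] by auto
 have fA: "(\<integral>\<^sup>+x. f x * indicator A x \<partial>lborel) = ennreal (\<nu> A)" if "A \<in> sets borel" for A
  using eN[OF that] that unfolding fN[symmetric] by (simp add: emeasure_density)
 \<comment> \<open>The set where the density exceeds its bound. Comparing the two integrals over it
   shows that the excess integrates to 0.\<close>
 define A where "A = {x. ennreal L * indicator S x < f x}"
 have A [measurable]: "A \<in> sets borel" unfolding A_def using f by measurable
 have LA: "(\<integral>\<^sup>+x. ennreal L * indicator S x * indicator A x \<partial>lborel) = ennreal (L * measure lborel (A \<inter> S))"
 proof -
  have "(\<integral>\<^sup>+x. ennreal L * indicator S x * indicator A x \<partial>lborel) = (\<integral>\<^sup>+x. ennreal L * indicator (A \<inter> S) x \<partial>lborel)"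
   by (intro nn_integral_cong) (auto simp: indicator_def)
  also have "\<dots> = ennreal L * emeasure lborel (A \<inter> S)" by (simp add: nn_integral_cmult)
  also have "emeasure lborel (A \<inter> S) = ennreal (measure lborel (A \<inter> S))"
   using fS[of A] by (intro emeasure_eq_ennreal_measure) auto
  finally show ?thesis using L0 by (simp add: ennreal_mult')
 qed
 have "(\<integral>\<^sup>+x. (f x * indicator A x - ennreal L * indicator S x * indicator A x) \<partial>lborel)
   = (\<integral>\<^sup>+x. f x * indicator A x \<partial>lborel) - (\<integral>\<^sup>+x. ennreal L * indicator S x * indicator A x \<partial>lborel)"
 proof (rule nn_integral_diff)
  show "(\<integral>\<^sup>+x. ennreal L * indicator S x * indicator A x \<partial>lborel) \<noteq> \<infinity>" unfolding LA by simp
  show "AE x in lborel. ennreal L * indicator S x * indicator A x \<le> f x * indicator A x"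
   by (intro AE_I2) (auto simp: A_def split: split_indicator)
 qed measurable
 also have "\<dots> = 0" unfolding fA[OF A] LA using \<nu>L[OF A] \<nu>0[OF A] L0
  by (simp add: ennreal_minus ennreal_eq_0_iff)
 finally have "AE x in lborel. f x * indicator A x - ennreal L * indicator S x * indicator A x = 0"
  by (subst (asm) nn_integral_0_iff_AE) auto
 then have AEf: "AE x in lborel. f x \<le> ennreal L * indicator S x"
 proof eventually_elim
  case (elim x)
  show ?case
  proof (rule ccontr)
   assume "\<not> ?case"
   then have *: "x \<in> A" "ennreal L * indicator S x < f x" by (auto simp: A_def)
   with elim have "f x - ennreal L * indicator S x = 0" by simp
   with *(2) show False by (auto simp: diff_eq_0_iff_ennreal)
  qed
 qed
 \<comment> \<open>Modifying the density on a null set turns almost everywhere bounds into pointwise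
   ones.\<close>
 define v where "v x = min L (enn2real (f x)) * indicator S x" for x
 have vb [measurable]: "v \<in> borel_measurable borel" unfolding v_def using f by measurable
 have v0: "0 \<le> v x" and vL: "v x \<le> L" and vS: "x \<notin> S ==> v x = 0" for x
  using L0 by (auto simp: v_def indicator_def)
 have AEv: "AE x in lborel. ennreal (v x) = f x" using AEf
 proof eventually_elim
  case (elim x)
  show ?case
  proof (cases "x \<in> S")
   case True
   then have le: "f x \<le> ennreal L" using elim by simp
   then have fin: "f x < top" using ennreal_less_top le_less_trans by blast
   then have "enn2real (f x) \<le> L" using le L0 by (metis enn2real_leI)
   then show ?thesis using True fin by (simp add: v_def min_def)
  qed (use elim in \<open>auto simp: v_def\<close>)
 qed
 have vA: "(LBINT x. indicator A x * v x) = \<nu> A" if [measurable]: "A \<in> sets borel" for A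
 proof -
  have i: "integrable lborel (\<lambda>x. indicator A x * v x)"
  proof -
   have "(\<lambda>x. indicator A x * v x) = (\<lambda>x. indicator (A \<inter> S) x * v x)"
    using vS by (auto simp: indicator_def fun_eq_iff)
   then show ?thesis using bounded_density_integrable_mult[OF iS[OF that], of v L] v0 vL by simp
  qed
  have "ennreal (LBINT x. indicator A x * v x) = (\<integral>\<^sup>+x. ennreal (indicator A x * v x) \<partial>lborel)"
   using i v0 by (subst nn_integral_eq_integral) auto
  also have "\<dots> = (\<integral>\<^sup>+x. f x * indicator A x \<partial>lborel)"
   using AEv by (intro nn_integral_cong_AE) (auto simp: indicator_def)
  also have "\<dots> = ennreal (\<nu> A)" by (rule fA[OF that])
  finally have *: "ennreal (LBINT x. indicator A x * v x) = ennreal (\<nu> A)" .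
  have "0 \<le> (LBINT x. indicator A x * v x)"
   by (intro Bochner_Integration.integral_nonneg) (simp add: v0)
  with * \<nu>0[OF that] show ?thesis by (simp add: ennreal_inj)
 qed
 have absv: "\<bar>v x\<bar> \<le> L" for x using v0 vL by simp
 have "(\<lambda>n. LBINT x. f x * w (k n) x) \<longlonglongrightarrow> (LBINT x. f x * v x)" if "integrable lborel f" for f :: "'a => real"
  using that
 proof (induction rule: integrable_induct)
  case (base A c)
  then have A: "A \<in> sets borel" by simp
  have "(\<lambda>n. c * a (k n) A) \<longlonglongrightarrow> c * \<nu> A" by (intro tendsto_mult tendsto_const \<nu> A)
  then show ?case unfolding vA[OF A, symmetric] a_def
   by (simp add: mult_ac flip: integral_mult_right_zero)
 next
  case (add f g)
  then show ?case
   using bounded_density_integrable_mult[of lborel f v L] bounded_density_integrable_mult[of lborel g v L]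
    bounded_density_integrable_mult[of lborel f "w (k n)" L for n] bounded_density_integrable_mult[of lborel g "w (k n)" L for n] absv absw
   by (simp add: distrib_right tendsto_add)
 next
  case (lim f s)
  have d: "(\<lambda>i. LBINT x. \<bar>s i x - f x\<bar>) \<longlonglongrightarrow> (\<integral>x. 0 \<partial>(lborel::'a measure))"
  proof (rule integral_dominated_convergence)
   \<comment> \<open>The approximating functions of \<open>integrable_induct\<close> are bounded by
     2 |f|, hence the factor 3 for the difference.\<close>
   show "integrable lborel (\<lambda>x. 3 * \<bar>f x\<bar>)" using lim by simp
   show "AE x in lborel. (\<lambda>i. \<bar>s i x - f x\<bar>) \<longlonglongrightarrow> 0"
    using lim by (intro AE_I2) (auto simp: LIM_zero_iff tendsto_rabs_zero_iff)
   show "AE x in lborel. norm \<bar>s i x - f x\<bar> \<le> 3 * \<bar>f x\<bar>" for i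
   proof (intro AE_I2)
    fix x show "norm \<bar>s i x - f x\<bar> \<le> 3 * \<bar>f x\<bar>" using lim.hyps(3)[of x i] by simp
   qed
  qed (use lim in auto)
  show ?case
  proof (rule tendsto_approx)
   fix e :: real assume e: "0 < e"
   have "(\<lambda>i. L * (LBINT x. \<bar>s i x - f x\<bar>)) \<longlonglongrightarrow> 0" using tendsto_mult[OF tendsto_const d, of L] by simp
   then obtain i where i: "L * (LBINT x. \<bar>s i x - f x\<bar>) < e"
    using e by (metis (no_types, lifting) LIMSEQ_D diff_zero dual_order.refl real_norm_def abs_less_iff)
   have est: "\<bar>(LBINT x. f x * u x) - (LBINT x. s i x * u x)\<bar> \<le> e"
    if u: "u \<in> borel_measurable borel" "\<And>x. \<bar>u x\<bar> \<le> L" for u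
   proof -
    have ii: "integrable lborel (\<lambda>x. f x * u x)" "integrable lborel (\<lambda>x. s i x * u x)"
     using u lim bounded_density_integrable_mult[of lborel _ u L] by auto
    have "\<bar>(LBINT x. f x * u x) - (LBINT x. s i x * u x)\<bar> = \<bar>LBINT x. f x * u x - s i x * u x\<bar>"
     using ii by simp
    also have "\<dots> \<le> (LBINT x. \<bar>f x * u x - s i x * u x\<bar>)" by (rule integral_abs_bound)
    also have "\<dots> \<le> (LBINT x. L * \<bar>s i x - f x\<bar>)"
    proof (rule integral_mono)
     show "integrable lborel (\<lambda>x. \<bar>f x * u x - s i x * u x\<bar>)" using ii by simp
     show "integrable lborel (\<lambda>x. L * \<bar>s i x - f x\<bar>)" using lim by auto
     fix x
     have "\<bar>f x * u x - s i x * u x\<bar> = \<bar>u x\<bar> * \<bar>s i x - f x\<bar>" by (simp add: abs_mult[symmetric] algebra_simps)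
     then show "\<bar>f x * u x - s i x * u x\<bar> \<le> L * \<bar>s i x - f x\<bar>" using u(2)[of x] by (simp add: mult_right_mono)
    qed
    finally show ?thesis using i by simp
   qed
   show "\<exists>g b. g \<longlonglongrightarrow> b \<and> (\<forall>n. \<bar>(LBINT x. f x * w (k n) x) - g n\<bar> \<le> e) \<and> \<bar>b - (LBINT x. f x * v x)\<bar> \<le> e"
    using lim.IH[of i] est[of "w (k _)"] est[of v] w absw absv vb
    by (intro exI[of _ "\<lambda>n. LBINT x. s i x * w (k n) x"] exI[of _ "LBINT x. s i x * v x"])
      (auto simp: abs_minus_commute)
  qed
 qed
 then show thesis using that[OF k(1) vb v0 vL vS] by blast
qed

text \<open>Weak-star convergence makes the potentials converge pointwise, and dominated convergence then
 handles the remaining factor.\<close>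

lemma weak_star_double_integral:
 fixes w :: "nat => 'a::euclidean_space => real" and K :: "'a \<times> 'a => real"
 assumes w [measurable]: "\<And>n. w n \<in> borel_measurable borel" "v \<in> borel_measurable borel"
  and b: "\<And>n x. \<bar>w n x\<bar> \<le> L" "\<And>x. \<bar>v x\<bar> \<le> L"
  and S [measurable]: "S \<in> sets borel"
  and z: "\<And>n x. x \<notin> S ==> w n x = 0" "\<And>x. x \<notin> S ==> v x = 0"
  and conv: "\<And>f. integrable lborel f ==> (\<lambda>n. LBINT x. f x * w n x) \<longlonglongrightarrow> (LBINT x. f x * v x)"
  and K: "integrable (lborel \<Otimes>\<^sub>M lborel) (\<lambda>(x,y). indicator S x * indicator S y * K (x,y))"
  and Km [measurable]: "K \<in> borel_measurable (lborel \<Otimes>\<^sub>M lborel)"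
 shows "(\<lambda>n. LBINT x. (LBINT y. K (x,y) * w n y) * w n x) \<longlonglongrightarrow> (LBINT x. (LBINT y. K (x,y) * v y) * v x)"
proof -
 have L0: "0 \<le> L" using b(2)[of undefined] by linarith
 \<comment> \<open>The kernel is assumed integrable only on S x S; as the densities vanish off
   \<open>S\<close>, the cut kernel gives the same energies.\<close>
 define Q where "Q x y = indicator S x * indicator S y * K (x,y)" for x y
 have Qm [measurable]: "(\<lambda>(x,y). Q x y) \<in> borel_measurable (lborel \<Otimes>\<^sub>M lborel)"
  unfolding Q_def by measurable
 have Qi: "integrable (lborel \<Otimes>\<^sub>M lborel) (\<lambda>(x,y). Q x y)" using K unfolding Q_def .
 have Q1: "AE x in lborel. integrable lborel (Q x)" using lborel_pair.AE_integrable_fst'[OF Qi] by simp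
 define q where "q x = (LBINT y. \<bar>Q x y\<bar>)" for x
 have qi: "integrable lborel q"
  using lborel_pair.integrable_fst'[OF integrable_abs[OF Qi]] unfolding q_def by (simp add: case_prod_beta)
 define P where "P u x = (LBINT y. Q x y * u y)" for u x
 have Pm [measurable]: "P u \<in> borel_measurable borel" if [measurable]: "u \<in> borel_measurable borel" for u
 proof -
  have "(\<lambda>x. LBINT y. Q x y * u y) \<in> borel_measurable lborel"
   by (rule lborel.borel_measurable_lebesgue_integral) measurable
  then show ?thesis unfolding P_def by simp
 qed
 have Pb: "AE x in lborel. \<bar>P u x\<bar> \<le> L * q x" if u [measurable]: "u \<in> borel_measurable borel" and ub: "\<And>x. \<bar>u x\<bar> \<le> L" for u
  using Q1
 proof eventually_elim
  case (elim x)
  have "\<bar>P u x\<bar> \<le> (LBINT y. \<bar>Q x y * u y\<bar>)" unfolding P_def by (rule integral_abs_bound)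
  also have "\<dots> \<le> (LBINT y. L * \<bar>Q x y\<bar>)"
  proof (rule integral_mono)
   show "integrable lborel (\<lambda>y. \<bar>Q x y * u y\<bar>)"
    using bounded_density_integrable_mult[OF elim, of u L] u ub by simp
   show "integrable lborel (\<lambda>y. L * \<bar>Q x y\<bar>)" using elim by simp
   show "\<bar>Q x y * u y\<bar> \<le> L * \<bar>Q x y\<bar>" for y using ub[of y] by (simp add: abs_mult mult.commute mult_right_mono)
  qed
  finally show ?case by (simp add: q_def)
 qed
 have eq: "(LBINT x. (LBINT y. K (x,y) * u y) * u x) = (LBINT x. P u x * u x)"
  if "\<And>x. x \<notin> S ==> u x = 0" for u
 proof (intro Bochner_Integration.integral_cong refl)
  fix x
  show "(LBINT y. K (x,y) * u y) * u x = P u x * u x"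
  proof (cases "x \<in> S")
   case True
   have "(LBINT y. K (x,y) * u y) = P u x" unfolding P_def Q_def
    using that True by (intro Bochner_Integration.integral_cong) (auto simp: indicator_def)
   then show ?thesis by simp
  qed (use that in auto)
 qed
 have Pc: "AE x in lborel. (\<lambda>n. P (w n) x) \<longlonglongrightarrow> P v x" using Q1
  by eventually_elim (simp add: P_def conv)
 have 1: "(\<lambda>n. LBINT x. (P (w n) x - P v x) * w n x) \<longlonglongrightarrow> (\<integral>x. 0 \<partial>(lborel::'a measure))"
 proof (rule integral_dominated_convergence[where w="\<lambda>x. 2 * L * L * q x"])
  show "integrable lborel (\<lambda>x. 2 * L * L * q x)" using qi by simp
  show "AE x in lborel. (\<lambda>n. (P (w n) x - P v x) * w n x) \<longlonglongrightarrow> 0" using Pc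
  proof eventually_elim
   case (elim x)
   show ?case
   proof (rule tendsto_0_le[where K=L])
    show "(\<lambda>n. P (w n) x - P v x) \<longlonglongrightarrow> 0" using elim by (simp add: LIM_zero_iff)
    show "\<forall>\<^sub>F n in sequentially. norm ((P (w n) x - P v x) * w n x) \<le> norm (P (w n) x - P v x) * L"
     using b by (intro always_eventually allI) (auto simp: abs_mult intro!: mult_left_mono)
   qed
  qed
  show "AE x in lborel. norm ((P (w n) x - P v x) * w n x) \<le> 2 * L * L * q x" for n
   using Pb[of "w n", OF _ b(1)] Pb[of v, OF _ b(2)] w
  proof -
   have "AE x in lborel. \<bar>P (w n) x\<bar> \<le> L * q x" "AE x in lborel. \<bar>P v x\<bar> \<le> L * q x"
    using Pb[of "w n", OF _ b(1)] Pb[of v, OF _ b(2)] w by auto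
   then show ?thesis
   proof eventually_elim
    case (elim x)
    have "\<bar>P (w n) x - P v x\<bar> * \<bar>w n x\<bar> \<le> (2 * L * q x) * L"
     using elim b(1)[of n x] L0 by (intro mult_mono) linarith+
    then show ?case by (simp add: abs_mult mult_ac)
   qed
  qed
 qed auto
 have Pvi: "integrable lborel (P v)"
 proof (rule Bochner_Integration.integrable_bound)
  show "integrable lborel (\<lambda>x. L * q x)" using qi by simp
  show "AE x in lborel. norm (P v x) \<le> norm (L * q x)" using Pb[of v, OF _ b(2)] w(2)
   by auto
 qed auto
 have 2: "(\<lambda>n. LBINT x. P v x * w n x) \<longlonglongrightarrow> (LBINT x. P v x * v x)" by (rule conv[OF Pvi])
 have Pni: "integrable lborel (P (w n))" for n
 proof (rule Bochner_Integration.integrable_bound)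
  show "integrable lborel (\<lambda>x. L * q x)" using qi by simp
  show "AE x in lborel. norm (P (w n) x) \<le> norm (L * q x)" using Pb[of "w n", OF _ b(1)] w(1)
   by auto
 qed auto
 have "(LBINT x. P (w n) x * w n x) = (LBINT x. (P (w n) x - P v x) * w n x) + (LBINT x. P v x * w n x)" for n
  using bounded_density_integrable_mult[OF Pni, of "w n" L n] bounded_density_integrable_mult[OF Pvi, of "w n" L] b w
  by (simp add: left_diff_distrib)
 then have "(\<lambda>n. LBINT x. P (w n) x * w n x) \<longlonglongrightarrow> (LBINT x. P v x * v x)"
  using tendsto_add[OF 1 2] by simp
 moreover have "(LBINT x. (LBINT y. K (x,y) * w n y) * w n x) = (LBINT x. P (w n) x * w n x)" for n
  by (rule eq) (rule z)
 moreover have "(LBINT x. (LBINT y. K (x,y) * v y) * v x) = (LBINT x. P v x * v x)"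
  by (rule eq) (rule z)
 ultimately show ?thesis by simp
qed

section \<open>Logarithmic potentials\<close>

definition lpot :: "(pt => real) => pt => real" where
 "lpot f x = (LBINT y. ln (norm (x - y)) * f y)"

text \<open>The kernel (x - y)/|x - y|^2 is the gradient of ln|x - y| in \<open>x\<close>; at y = x
  division by zero makes it 0.\<close>

definition lgrad :: "(pt => real) => pt => pt" where
 "lgrad f x = (LBINT y. f y *\<^sub>R ((1 / (norm (x - y))^2) *\<^sub>R (x - y)))"

text \<open>Signed functions are allowed so that differences of admissible densities, the
  variations, belong to the class as well.\<close>

definition bdens :: "real => real => (pt => real) => bool" where
 "bdens L R f \<longleftrightarrow> f \<in> borel_measurable borel \<and> (\<forall>x. \<bar>f x\<bar> \<le> L) \<and> (\<forall>x. x \<notin> ball 0 R --> f x = 0)"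

lemma integrable_indicator_ball: "integrable lborel (indicator (ball (c::pt) R) :: pt => real)"
 by (intro integrable_real_indicator emeasure_bounded_finite bounded_ball) auto

lemma bdens_measurable: "bdens L R f ==> f \<in> borel_measurable borel"
 by (simp add: bdens_def)

lemma bdens_nonneg: "bdens L R f ==> 0 \<le> L"
 unfolding bdens_def by (meson abs_ge_zero order_trans)

lemma integrable_bdens: assumes "bdens L R f" shows "integrable lborel f"
proof -
 have "integrable lborel (indicator (ball (0::pt) R) :: pt => real)"
  by (rule integrable_indicator_ball)
 then have "integrable lborel (\<lambda>x. indicator (ball 0 R) x * f x)"
  using assms by (intro bounded_density_integrable_mult[where L=L]) (auto simp: bdens_def)
 also have "(\<lambda>x. indicator (ball 0 R) x * f x) = f"
  using assms by (auto simp: bdens_def fun_eq_iff split: split_indicator)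
 finally show ?thesis .
qed

text \<open>The substitution z = x - y moves the support of \<open>f\<close> into the disk of radius
  R + |x|, where the kernel is integrable.\<close>

lemma kernel_conv:
 fixes k :: "pt => real"
 assumes k: "integrable lborel (\<lambda>z. indicator (ball 0 \<rho>) z * k z)" and km [measurable]: "k \<in> borel_measurable borel"
  and f: "bdens L R f" and r: "R + norm x \<le> \<rho>"
 shows integrable_kernel_conv: "integrable lborel (\<lambda>y. k (x - y) * f y)"
  and kernel_conv_bound: "(LBINT y. \<bar>k (x - y) * f y\<bar>) \<le> L * (LBINT z. indicator (ball 0 \<rho>) z * \<bar>k z\<bar>)"
proof -
 have fm [measurable]: "f \<in> borel_measurable borel" and fb: "\<And>x. \<bar>f x\<bar> \<le> L" and f0: "\<And>x. x \<notin> ball 0 R ==> f x = 0"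
  using f by (auto simp: bdens_def)
 have L0: "0 \<le> L" using bdens_nonneg[OF f] .
 have k': "integrable lborel (\<lambda>y. indicator (ball 0 \<rho>) (x - y) * k (x - y))"
  using integrable_lborel_affine[OF k, of "-1" x] by simp
 have in_ball: "x - y \<in> ball 0 \<rho>" if "y \<in> ball 0 R" for y
  using that r norm_triangle_ineq4[of x y] by auto
 have le: "\<bar>k (x - y) * f y\<bar> \<le> L * (indicator (ball 0 \<rho>) (x - y) * \<bar>k (x - y)\<bar>)" for y
 proof (cases "y \<in> ball 0 R")
  case True
  then show ?thesis using in_ball[OF True] fb[of y] by (simp add: abs_mult mult.commute mult_right_mono)
 qed (use f0 L0 in auto)
 have "(\<lambda>y. \<bar>indicator (ball 0 \<rho>) (x - y) * k (x - y)\<bar>) = (\<lambda>y. indicator (ball 0 \<rho>) (x - y) * \<bar>k (x - y)\<bar>)"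
  by (simp add: abs_mult)
 then have k'': "integrable lborel (\<lambda>y. indicator (ball 0 \<rho>) (x - y) * \<bar>k (x - y)\<bar>)"
  using integrable_abs[OF k'] by simp
 show 1: "integrable lborel (\<lambda>y. k (x - y) * f y)"
 proof (rule Bochner_Integration.integrable_bound)
  show "integrable lborel (\<lambda>y. L * (indicator (ball 0 \<rho>) (x - y) * \<bar>k (x - y)\<bar>))" using k'' by simp
  show "AE y in lborel. norm (k (x - y) * f y) \<le> norm (L * (indicator (ball 0 \<rho>) (x - y) * \<bar>k (x - y)\<bar>))"
   using order_trans[OF le abs_ge_self] by simp
 qed measurable
 have "(LBINT y. \<bar>k (x - y) * f y\<bar>) \<le> (LBINT y. L * (indicator (ball 0 \<rho>) (x - y) * \<bar>k (x - y)\<bar>))"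
  by (intro integral_mono integrable_abs 1 integrable_mult_right k'' le)
 also have "\<dots> = L * (LBINT y. indicator (ball 0 \<rho>) (x - y) * \<bar>k (x - y)\<bar>)" by simp
 also have "(LBINT y. indicator (ball 0 \<rho>) (x - y) * \<bar>k (x - y)\<bar>) = (LBINT z. indicator (ball 0 \<rho>) z * \<bar>k z\<bar>)"
  using integral_lborel_affine[of "-1" "\<lambda>z. indicator (ball 0 \<rho>) z * \<bar>k z\<bar>" x] by simp
 finally show "(LBINT y. \<bar>k (x - y) * f y\<bar>) \<le> L * (LBINT z. indicator (ball 0 \<rho>) z * \<bar>k z\<bar>)" .
qed

lemma abs_ln_le: assumes "0 < t" shows "\<bar>ln t\<bar> \<le> 1 / t + (t::real)"
proof -
 have "ln t \<le> t - 1" "- ln t \<le> 1 / t - 1" "0 < 1 / t"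
  using assms ln_le_minus_one[of t] ln_le_minus_one[of "1/t"] by (auto simp: ln_div)
 then show ?thesis using assms by linarith
qed

lemma integrable_ln_ball:
 "integrable lborel (\<lambda>z. indicator (ball (0::pt) \<rho>) z * ln (norm z))"
proof (rule Bochner_Integration.integrable_bound)
 have "integrable lborel (indicator (ball (0::pt) \<rho>) :: pt => real)"
  by (rule integrable_indicator_ball)
 then show "integrable lborel (\<lambda>z. indicator (ball (0::pt) \<rho>) z * (1 / norm z) + \<rho> * indicator (ball (0::pt) \<rho>) z)"
  by (intro Bochner_Integration.integrable_add integrable_inverse_ball) simp
 show "AE z in lborel. norm (indicator (ball (0::pt) \<rho>) z * ln (norm z)) \<le> norm (indicator (ball (0::pt) \<rho>) z * (1 / norm z) + \<rho> * indicator (ball (0::pt) \<rho>) z)" (is "AE x in _. ?P x")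
 proof (intro AE_I2)
  fix z :: pt
  show "?P z"
  proof (cases "z \<in> ball 0 \<rho> \<and> z \<noteq> 0")
   case True
   then have "\<bar>ln (norm z)\<bar> \<le> 1 / norm z + norm z" by (intro abs_ln_le) auto
   also have "\<dots> \<le> 1 / norm z + \<rho>" using True by simp
   finally show ?thesis using True by simp
  qed auto
 qed
qed measurable

lemma integrable_lpot:
 assumes "bdens L R f"
 shows "integrable lborel (\<lambda>y. ln (norm (x - y)) * f y)"
 using integrable_kernel_conv[OF integrable_ln_ball _ assms order_refl] by simp

lemma measurable_lgrad_kernel [measurable]:
 assumes [measurable]: "f \<in> borel_measurable borel"
 shows "(\<lambda>y::pt. f y *\<^sub>R ((1 / (norm (x - y))^2) *\<^sub>R (x - y))) \<in> borel_measurable borel"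
 by measurable

lemma integrable_lgrad:
 assumes f: "bdens L R f"
 shows "integrable lborel (\<lambda>y. f y *\<^sub>R ((1 / (norm (x - y))^2) *\<^sub>R (x - y)))"
proof (rule Bochner_Integration.integrable_bound)
 have [measurable]: "f \<in> borel_measurable borel" using f by (rule bdens_measurable)
 show "integrable lborel (\<lambda>y. (1 / norm (x - y)) * f y)"
  using integrable_kernel_conv[OF integrable_inverse_ball _ f order_refl] by simp
 show "AE y in lborel. norm (f y *\<^sub>R ((1 / (norm (x - y))^2) *\<^sub>R (x - y))) \<le> norm ((1 / norm (x - y)) * f y)"
  by (intro AE_I2) (simp add: power2_eq_square)
 show "(\<lambda>y. f y *\<^sub>R ((1 / (norm (x - y))^2) *\<^sub>R (x - y))) \<in> borel_measurable lborel"
  by simp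
qed

lemma AE_lborel_neq: "AE y in lborel. y \<noteq> (x::pt)"
 by (rule AE_lborel_singleton)

lemma abs_ln_diff_le:
 assumes "0 < a" "0 < b" shows "\<bar>ln a - ln b\<bar> \<le> \<bar>a - b\<bar> * (1 / a + 1 / b :: real)"
proof -
 have "ln a - ln b \<le> (a - b) / b" using ln_diff_le[of a b] assms by simp
 moreover have "ln b - ln a \<le> (b - a) / a" using ln_diff_le[of b a] assms by simp
 moreover have "(a - b) / b \<le> \<bar>a - b\<bar> * (1/a + 1/b)"
 proof -
  have "(a - b) / b \<le> \<bar>a - b\<bar> / b" using assms by (intro divide_right_mono) auto
  also have "\<dots> \<le> \<bar>a - b\<bar> * (1/a + 1/b)" using assms by (simp add: distrib_left)
  finally show ?thesis .
 qed
 moreover have "(b - a) / a \<le> \<bar>a - b\<bar> * (1/a + 1/b)"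
 proof -
  have "(b - a) / a \<le> \<bar>a - b\<bar> / a" using assms by (intro divide_right_mono) auto
  also have "\<dots> \<le> \<bar>a - b\<bar> * (1/a + 1/b)" using assms by (simp add: distrib_left)
  finally show ?thesis .
 qed
 ultimately show ?thesis by linarith
qed

lemma inverse_conv_bound:
 assumes f: "bdens L R f" and \<rho>: "0 < \<rho>" "R + norm x \<le> \<rho>"
 shows "integrable lborel (\<lambda>y. 1 / norm (x - y) * \<bar>f y\<bar>)"
  and "(LBINT y. 1 / norm (x - y) * \<bar>f y\<bar>) \<le> 40 * L * \<rho>"
proof -
 have km: "(\<lambda>z::pt. 1 / norm z) \<in> borel_measurable borel" by measurable
 note * = kernel_conv[OF integrable_inverse_ball km f \<rho>(2)]
 show "integrable lborel (\<lambda>y. 1 / norm (x - y) * \<bar>f y\<bar>)"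
  using integrable_abs[OF *(1)] by (simp add: abs_mult)
 have "(LBINT y. 1 / norm (x - y) * \<bar>f y\<bar>) \<le> L * (LBINT z. indicator (ball (0::pt) \<rho>) z * (1 / norm z))"
  using *(2) by (simp add: abs_mult)
 also have "\<dots> \<le> L * (40 * \<rho>)" using integral_inverse_ball_le[OF \<rho>(1)] bdens_nonneg[OF f] by (rule mult_left_mono)
 finally show "(LBINT y. 1 / norm (x - y) * \<bar>f y\<bar>) \<le> 40 * L * \<rho>" by (simp add: mult_ac)
qed

lemma powr_conv_bound:
 assumes f: "bdens L R f" and \<rho>: "0 < \<rho>" "R + norm x \<le> \<rho>"
 shows "integrable lborel (\<lambda>y. norm (x - y) powr (-3/2) * \<bar>f y\<bar>)"
  and "(LBINT y. norm (x - y) powr (-3/2) * \<bar>f y\<bar>) \<le> 40 * L * sqrt \<rho>"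
proof -
 have km: "(\<lambda>z::pt. norm z powr (-3/2)) \<in> borel_measurable borel" by measurable
 note * = kernel_conv[OF integrable_powr_ball km f \<rho>(2)]
 show "integrable lborel (\<lambda>y. norm (x - y) powr (-3/2) * \<bar>f y\<bar>)"
  using integrable_abs[OF *(1)] by (simp add: abs_mult)
 have "(LBINT y. norm (x - y) powr (-3/2) * \<bar>f y\<bar>) \<le> L * (LBINT z. indicator (ball (0::pt) \<rho>) z * norm z powr (-3/2))"
  using *(2) by (simp add: abs_mult)
 also have "\<dots> \<le> L * (40 * sqrt \<rho>)" using integral_powr_ball_le[OF \<rho>(1)] bdens_nonneg[OF f] by (rule mult_left_mono)
 finally show "(LBINT y. norm (x - y) powr (-3/2) * \<bar>f y\<bar>) \<le> 40 * L * sqrt \<rho>" by (simp add: mult_ac)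
qed

text \<open>Integrate |ln a - ln b| <= |a - b| (1/a + 1/b); each of the two reciprocal kernels
  contributes 40.\<close>

lemma lpot_lipschitz:
 assumes f: "bdens L R f" and \<rho>: "0 < \<rho>" "R + norm x \<le> \<rho>" "R + norm x' \<le> \<rho>"
 shows "\<bar>lpot f x - lpot f x'\<bar> \<le> 80 * L * \<rho> * norm (x - x')"
proof -
 have eq: "lpot f x - lpot f x' = (LBINT y. ln (norm (x - y)) * f y - ln (norm (x' - y)) * f y)"
  unfolding lpot_def using integrable_lpot[OF f] by simp
 have "\<bar>lpot f x - lpot f x'\<bar> \<le> (LBINT y. \<bar>ln (norm (x - y)) * f y - ln (norm (x' - y)) * f y\<bar>)"
  unfolding eq by (rule integral_abs_bound)
 also have "\<dots> \<le> (LBINT y. norm (x - x') * (1 / norm (x - y) * \<bar>f y\<bar> + 1 / norm (x' - y) * \<bar>f y\<bar>))"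
 proof (rule integral_mono_AE)
  show "integrable lborel (\<lambda>y. \<bar>ln (norm (x - y)) * f y - ln (norm (x' - y)) * f y\<bar>)"
   using integrable_lpot[OF f] by simp
  show "integrable lborel (\<lambda>y. norm (x - x') * (1 / norm (x - y) * \<bar>f y\<bar> + 1 / norm (x' - y) * \<bar>f y\<bar>))"
   by (intro integrable_mult_right Bochner_Integration.integrable_add inverse_conv_bound(1)[OF f \<rho>(1)] \<rho>)
  show "AE y in lborel. \<bar>ln (norm (x - y)) * f y - ln (norm (x' - y)) * f y\<bar> \<le> norm (x - x') * (1 / norm (x - y) * \<bar>f y\<bar> + 1 / norm (x' - y) * \<bar>f y\<bar>)"
   using AE_lborel_neq[of x] AE_lborel_neq[of x']
  proof eventually_elim
   case (elim y)
   have "\<bar>ln (norm (x - y)) - ln (norm (x' - y))\<bar> \<le> \<bar>norm (x - y) - norm (x' - y)\<bar> * (1 / norm (x - y) + 1 / norm (x' - y))"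
    using elim by (intro abs_ln_diff_le) auto
   also have "\<dots> \<le> norm (x - x') * (1 / norm (x - y) + 1 / norm (x' - y))"
    using norm_triangle_ineq3[of "x - y" "x' - y"] by (intro mult_right_mono) auto
   finally have "\<bar>ln (norm (x - y)) - ln (norm (x' - y))\<bar> * \<bar>f y\<bar> \<le> norm (x - x') * (1 / norm (x - y) + 1 / norm (x' - y)) * \<bar>f y\<bar>"
    by (intro mult_right_mono) auto
   then show ?case by (simp add: abs_mult[symmetric] left_diff_distrib algebra_simps)
  qed
 qed
 also have "\<dots> = norm (x - x') * ((LBINT y. 1 / norm (x - y) * \<bar>f y\<bar>) + (LBINT y. 1 / norm (x' - y) * \<bar>f y\<bar>))"
  using inverse_conv_bound(1)[OF f \<rho>(1,2)] inverse_conv_bound(1)[OF f \<rho>(1,3)] by simp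
 also have "\<dots> \<le> norm (x - x') * (40 * L * \<rho> + 40 * L * \<rho>)"
  by (intro mult_left_mono add_mono inverse_conv_bound(2)[OF f \<rho>(1)] \<rho>) auto
 finally show ?thesis by (simp add: algebra_simps)
qed

text \<open>The exponent 3/2 is a compromise: Taylor expansion would give |t|^2 with a singularity
  |a|^(-2), which is not integrable in the plane, whereas |a|^(-3/2) is. Steps that are small
  against \<open>a\<close> are treated by Taylor's formula; for the others each term on the left
  already has the size of the right side.\<close>

lemma ln_norm_remainder:
 fixes a t :: "'a::real_inner"
 assumes a: "a \<noteq> 0" "a + t \<noteq> 0"
 shows "\<bar>ln (norm (a + t)) - ln (norm a) - (a \<bullet> t) / (norm a)^2\<bar>
  \<le> 6 * norm t powr (3/2) * (norm a powr (-3/2) + norm (a + t) powr (-3/2))"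
proof (cases "norm t \<le> norm a / 5")
 case True
 \<comment> \<open>\<open>s\<close> is the relative step, \<open>u\<close> the linear term, and
   \<open>p\<close> is determined by |a + t|^2 = |a|^2 (1 + p).\<close>
 define s where "s = norm t / norm a"
 define u where "u = (a \<bullet> t) / (norm a)^2"
 define p where "p = 2 * u + s^2"
 have na: "0 < norm a" using a by simp
 have s: "0 \<le> s" "s \<le> 1/5" using True na by (auto simp: s_def field_simps)
 have us: "\<bar>u\<bar> \<le> s"
 proof -
  have "\<bar>a \<bullet> t\<bar> \<le> norm a * norm t" by (rule Cauchy_Schwarz_ineq2)
  then show ?thesis using na unfolding u_def s_def
   by (simp add: abs_divide divide_le_eq power2_eq_square field_simps)
 qed
 have s2: "s^2 \<le> s / 5" using mult_left_mono[OF s(2) s(1)] by (simp add: power2_eq_square)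
 have pb: "\<bar>p\<bar> \<le> (11/5) * s" unfolding p_def using us s2 s zero_le_power2[of s] by linarith
 have p12: "\<bar>p\<bar> \<le> 1/2" using pb s by linarith
 have "(norm (a + t))^2 = (norm a)^2 * (1 + p)"
 proof -
  have "(norm (a + t))^2 = (norm a)^2 + 2 * (a \<bullet> t) + (norm t)^2"
   by (simp add: power2_norm_eq_inner inner_add inner_commute)
  also have "\<dots> = (norm a)^2 * (1 + p)"
   using na unfolding p_def u_def s_def by (simp add: power_divide distrib_left)
  finally show ?thesis .
 qed
 then have "ln ((norm (a + t))^2) = ln ((norm a)^2) + ln (1 + p)"
  using na p12 by (simp add: ln_mult)
 then have l: "ln (norm (a + t)) - ln (norm a) = ln (1 + p) / 2"
  using na a by (simp add: ln_realpow)
 have "\<bar>ln (1 + p) - p\<bar> \<le> 2 * p^2" using abs_ln_one_plus_x_minus_x_bound[of p] p12 by simp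
 then have "\<bar>ln (1 + p) / 2 - u\<bar> \<le> s^2 / 2 + p^2" unfolding p_def using zero_le_power2[of s] by linarith
 also have "p^2 \<le> ((11/5) * s)^2" using pb s by (intro abs_le_square_iff[THEN iffD1]) auto
 then have "s^2 / 2 + p^2 \<le> 6 * s^2" unfolding power_mult_distrib using zero_le_power2[of s] by (simp add: power_divide) (use zero_le_power2[of s] in linarith)
 also have "s^2 \<le> s powr (3/2)"
 proof (cases "s = 0")
  case False
  then have "s^2 = s powr 2" using s by (simp add: powr_numeral)
  also have "\<dots> \<le> s powr (3/2)" using False s by (intro powr_mono') auto
  finally show ?thesis .
 qed auto
 finally have "\<bar>ln (1 + p) / 2 - u\<bar> \<le> 6 * s powr (3/2)" by simp
 also have "s powr (3/2) = norm t powr (3/2) * norm a powr (-3/2)"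
  using na unfolding s_def by (simp add: powr_divide powr_minus_divide)
 also have "6 * (norm t powr (3/2) * norm a powr (-3/2)) \<le> 6 * norm t powr (3/2) * (norm a powr (-3/2) + norm (a + t) powr (-3/2))"
  by (simp add: distrib_left)
 finally show ?thesis unfolding l u_def .
next
 case False
 have na: "0 < norm a" "0 < norm (a + t)" using a by auto
 have nt: "0 < norm t" using False na by (smt (verit) divide_nonneg_nonneg norm_ge_zero)
 \<comment> \<open>Large steps satisfy |a| < 5 |t| and |a + t| < 6 |t|. The common bound 9 |t| is
   convenient because its square root gives the factor 3; the term with |a| occurs twice, whence
   6.\<close>
 have key: "norm t / b \<le> 3 * (norm t powr (3/2) * b powr (-3/2))" if "0 < b" "b \<le> 9 * norm t" for b
 proof -
  have "norm t / b = (norm t powr (3/2) * norm t powr (-1/2)) * (b powr (-3/2) * b powr (1/2))"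
   using that nt unfolding powr_add[symmetric] by (simp add: powr_minus_divide)
  also have "\<dots> = (norm t powr (3/2) * b powr (-3/2)) * (b powr (1/2) * norm t powr (-1/2))" by simp
  finally have eq: "norm t / b = (norm t powr (3/2) * b powr (-3/2)) * (b powr (1/2) * norm t powr (-1/2))" .
  have "b powr (1/2) * norm t powr (-1/2) \<le> 3"
  proof -
   have "b powr (1/2) \<le> (9 * norm t) powr (1/2)" using that by (intro powr_mono2) auto
   also have "\<dots> = 3 * norm t powr (1/2)" using nt by (simp add: powr_mult powr_half_sqrt)
   finally have "b powr (1/2) * norm t powr (-1/2) \<le> 3 * norm t powr (1/2) * norm t powr (-1/2)"
    by (intro mult_right_mono) auto
   also have "\<dots> = 3" using nt by (simp add: powr_minus_divide)
   finally show ?thesis .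
  qed
  then have "(norm t powr (3/2) * b powr (-3/2)) * (b powr (1/2) * norm t powr (-1/2)) \<le> (norm t powr (3/2) * b powr (-3/2)) * 3"
   by (intro mult_left_mono) auto
  then show ?thesis unfolding eq by (simp only: mult.commute)
 qed
 have "\<bar>ln (norm (a + t)) - ln (norm a)\<bar> \<le> \<bar>norm (a + t) - norm a\<bar> * (1 / norm (a + t) + 1 / norm a)"
  by (intro abs_ln_diff_le na)
 also have "\<dots> \<le> norm t * (1 / norm (a + t) + 1 / norm a)"
  using norm_triangle_ineq3[of "a + t" a] by (intro mult_right_mono) auto
 finally have 1: "\<bar>ln (norm (a + t)) - ln (norm a)\<bar> \<le> norm t / norm (a + t) + norm t / norm a" by (simp add: distrib_left)
 have 2: "\<bar>(a \<bullet> t) / (norm a)^2\<bar> \<le> norm t / norm a"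
  using Cauchy_Schwarz_ineq2[of a t] na by (simp add: abs_divide divide_le_eq power2_eq_square field_simps)
 have 3: "norm t / norm (a + t) \<le> 3 * (norm t powr (3/2) * norm (a + t) powr (-3/2))"
  by (rule key[OF na(2)]) (use False nt norm_triangle_ineq[of a t] in linarith)
 have 4: "norm t / norm a \<le> 3 * (norm t powr (3/2) * norm a powr (-3/2))"
  by (rule key[OF na(1)]) (use False nt in linarith)
 have 5: "0 \<le> norm t powr (3/2) * norm (a + t) powr (-3/2)" by simp
 from 1 2 3 4 5 show ?thesis by (simp only: distrib_left mult.assoc)
qed

text \<open>Integrate \<open>ln_norm_remainder\<close> against \<open>f\<close>; the singular
  weights at \<open>x\<close> and at \<open>x + t\<close> give 6 * (40 + 40) = 480.\<close>

lemma lpot_remainder: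
 assumes f: "bdens L R f" and \<rho>: "0 < \<rho>" "R + norm x \<le> \<rho>" "R + norm (x + t) \<le> \<rho>"
 shows "\<bar>lpot f (x + t) - lpot f x - lgrad f x \<bullet> t\<bar> \<le> 480 * L * sqrt \<rho> * norm t powr (3/2)"
proof -
 have ig: "integrable lborel (\<lambda>y. (f y *\<^sub>R ((1 / (norm (x - y))^2) *\<^sub>R (x - y))) \<bullet> t)"
  by (intro integrable_inner_left integrable_lgrad[OF f])
 have "lgrad f x \<bullet> t = (LBINT y. (f y *\<^sub>R ((1 / (norm (x - y))^2) *\<^sub>R (x - y))) \<bullet> t)"
  unfolding lgrad_def by (rule integral_inner_left[symmetric]) (rule integrable_lgrad[OF f])
 then have eq: "lpot f (x + t) - lpot f x - lgrad f x \<bullet> t = (LBINT y. ln (norm (x + t - y)) * f y - ln (norm (x - y)) * f y - (f y *\<^sub>R ((1 / (norm (x - y))^2) *\<^sub>R (x - y))) \<bullet> t)"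
  unfolding lpot_def using integrable_lpot[OF f] ig by simp
 have "\<bar>lpot f (x + t) - lpot f x - lgrad f x \<bullet> t\<bar> \<le> (LBINT y. \<bar>ln (norm (x + t - y)) * f y - ln (norm (x - y)) * f y - (f y *\<^sub>R ((1 / (norm (x - y))^2) *\<^sub>R (x - y))) \<bullet> t\<bar>)"
  unfolding eq by (rule integral_abs_bound)
 also have "\<dots> \<le> (LBINT y. 6 * norm t powr (3/2) * (norm (x - y) powr (-3/2) * \<bar>f y\<bar> + norm (x + t - y) powr (-3/2) * \<bar>f y\<bar>))"
 proof (rule integral_mono_AE)
  show "integrable lborel (\<lambda>y. \<bar>ln (norm (x + t - y)) * f y - ln (norm (x - y)) * f y - (f y *\<^sub>R ((1 / (norm (x - y))^2) *\<^sub>R (x - y))) \<bullet> t\<bar>)"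
   by (intro integrable_abs Bochner_Integration.integrable_diff integrable_lpot[OF f] ig)
  show "integrable lborel (\<lambda>y. 6 * norm t powr (3/2) * (norm (x - y) powr (-3/2) * \<bar>f y\<bar> + norm (x + t - y) powr (-3/2) * \<bar>f y\<bar>))"
   by (intro integrable_mult_right Bochner_Integration.integrable_add powr_conv_bound(1)[OF f \<rho>(1)] \<rho>)
  show "AE y in lborel. \<bar>ln (norm (x + t - y)) * f y - ln (norm (x - y)) * f y - (f y *\<^sub>R ((1 / (norm (x - y))^2) *\<^sub>R (x - y))) \<bullet> t\<bar>
   \<le> 6 * norm t powr (3/2) * (norm (x - y) powr (-3/2) * \<bar>f y\<bar> + norm (x + t - y) powr (-3/2) * \<bar>f y\<bar>)"
   using AE_lborel_neq[of x] AE_lborel_neq[of "x + t"]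
  proof eventually_elim
   case (elim y)
   have e: "x - y + t = x + t - y" by simp
   have "\<bar>ln (norm (x + t - y)) - ln (norm (x - y)) - ((x - y) \<bullet> t) / (norm (x - y))^2\<bar>
    \<le> 6 * norm t powr (3/2) * (norm (x - y) powr (-3/2) + norm (x + t - y) powr (-3/2))"
    using ln_norm_remainder[of "x - y" t] elim unfolding e by auto
   then have "\<bar>ln (norm (x + t - y)) - ln (norm (x - y)) - ((x - y) \<bullet> t) / (norm (x - y))^2\<bar> * \<bar>f y\<bar>
    \<le> 6 * norm t powr (3/2) * (norm (x - y) powr (-3/2) + norm (x + t - y) powr (-3/2)) * \<bar>f y\<bar>"
    by (intro mult_right_mono) auto
   moreover have "ln (norm (x + t - y)) * f y - ln (norm (x - y)) * f y - (f y *\<^sub>R ((1 / (norm (x - y))^2) *\<^sub>R (x - y))) \<bullet> t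
    = (ln (norm (x + t - y)) - ln (norm (x - y)) - ((x - y) \<bullet> t) / (norm (x - y))^2) * f y"
    by (simp add: left_diff_distrib right_diff_distrib mult.commute)
   ultimately show ?case by (simp only: abs_mult) (simp add: algebra_simps)
  qed
 qed
 also have "\<dots> = 6 * norm t powr (3/2) * ((LBINT y. norm (x - y) powr (-3/2) * \<bar>f y\<bar>) + (LBINT y. norm (x + t - y) powr (-3/2) * \<bar>f y\<bar>))"
  using powr_conv_bound(1)[OF f \<rho>(1,2)] powr_conv_bound(1)[OF f \<rho>(1,3)] by simp
 also have "\<dots> \<le> 6 * norm t powr (3/2) * (40 * L * sqrt \<rho> + 40 * L * sqrt \<rho>)"
  by (intro mult_left_mono add_mono powr_conv_bound(2)[OF f \<rho>(1)] \<rho>) auto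
 finally show ?thesis by (simp add: algebra_simps)
qed

lemma has_derivative_of_remainder:
 fixes f :: "pt => real"
 assumes d: "0 < d" and b: "\<And>t. norm t < d ==> \<bar>f (x + t) - f x - g \<bullet> t\<bar> \<le> C * norm t powr (3/2)"
 shows "(f has_derivative (\<lambda>t. g \<bullet> t)) (at x)"
 unfolding has_derivative_at
proof
 show "bounded_linear (\<lambda>t. g \<bullet> t)" by (rule bounded_linear_inner_right)
 show "(\<lambda>t. norm (f (x + t) - f x - g \<bullet> t) / norm t) \<midarrow>0\<rightarrow> 0"
 proof (rule tendsto_sandwich[OF _ _ tendsto_const])
  show "\<forall>\<^sub>F t in at 0. norm (f (x + t) - f x - g \<bullet> t) / norm t \<le> C * sqrt (norm t)"
   unfolding eventually_at
  proof (intro exI conjI ballI impI)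
   show "0 < d" by fact
   fix t :: pt assume "t \<noteq> 0 \<and> dist t 0 < d"
   then have t: "0 < norm t" "norm t < d" by auto
   have "norm t powr (3/2) = norm t powr (1 + 1/2)" by simp
   also have "\<dots> = norm t * sqrt (norm t)" using t unfolding powr_add by (simp add: powr_half_sqrt)
   finally show "norm (f (x + t) - f x - g \<bullet> t) / norm t \<le> C * sqrt (norm t)"
    using b[OF t(2)] t by (simp add: divide_le_eq mult_ac)
  qed
  have "((\<lambda>t::pt. norm t) \<longlongrightarrow> 0) (at 0)" by (rule tendsto_norm_zero) (rule tendsto_ident_at)
  from tendsto_mult[OF tendsto_const tendsto_real_sqrt[OF this], of C] show "((\<lambda>t::pt. C * sqrt (norm t)) \<longlongrightarrow> 0) (at 0)" by simp
 qed simp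
qed

lemma lpot_has_derivative:
 assumes f: "bdens L R f"
 shows "(lpot f has_derivative (\<lambda>t. lgrad f x \<bullet> t)) (at x)"
proof (rule has_derivative_of_remainder[of 1 _ _ _ "480 * L * sqrt (\<bar>R\<bar> + norm x + 1)"])
 fix t :: pt assume "norm t < 1"
 then show "\<bar>lpot f (x + t) - lpot f x - lgrad f x \<bullet> t\<bar> \<le> 480 * L * sqrt (\<bar>R\<bar> + norm x + 1) * norm t powr (3/2)"
  using norm_triangle_ineq[of x t] norm_ge_zero[of x] abs_ge_self[of R] abs_ge_zero[of R]
  by (intro lpot_remainder[OF f]) linarith+
qed simp

text \<open>The map a -> a/|a|^2 is the inversion, and this is its classical distance formula. It
  measures exactly how the gradient kernel varies.\<close>

lemma norm_diff_inversion:
 fixes a b :: "'a::real_inner"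
 assumes "a \<noteq> 0" "b \<noteq> 0"
 shows "norm ((1 / (norm a)^2) *\<^sub>R a - (1 / (norm b)^2) *\<^sub>R b) = norm (a - b) / (norm a * norm b)"
proof -
 have "(norm ((1 / (norm a)^2) *\<^sub>R a - (1 / (norm b)^2) *\<^sub>R b))^2 = (norm (a - b) / (norm a * norm b))^2"
 proof -
  have e: "(norm (u - v))^2 = (norm u)^2 - 2 * (u \<bullet> v) + (norm v)^2" for u v :: 'a
   by (simp add: power2_norm_eq_inner inner_diff inner_commute)
  have na: "norm a \<noteq> 0" "norm b \<noteq> 0" using assms by auto
  have i: "(norm ((1 / (norm a)^2) *\<^sub>R a))^2 = 1 / (norm a)^2" if "norm a \<noteq> 0" for a :: 'a
   using that by (simp add: power_divide power_mult_distrib divide_simps)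
  have "(norm ((1 / (norm a)^2) *\<^sub>R a - (1 / (norm b)^2) *\<^sub>R b))^2
   = 1 / (norm a)^2 - 2 * ((a \<bullet> b) / ((norm a)^2 * (norm b)^2)) + 1 / (norm b)^2"
   unfolding e i[OF na(1)] i[OF na(2)] by simp
  also have "\<dots> = ((norm a)^2 - 2 * (a \<bullet> b) + (norm b)^2) / ((norm a)^2 * (norm b)^2)"
   using na by (simp add: field_simps)
  finally show ?thesis unfolding power_divide e power_mult_distrib .
 qed
 then show ?thesis by (rule power2_eq_imp_eq) auto
qed

text \<open>Half a power of |a - b| is kept and the other half is bounded by the larger norm, which
  lowers the singularity from 1/(|a| |b|) to the power -3/2 of the smaller norm.\<close>

lemma inversion_holder:
 fixes a b :: "'a::real_inner"
 assumes "a \<noteq> 0" "b \<noteq> 0"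
 shows "norm ((1 / (norm a)^2) *\<^sub>R a - (1 / (norm b)^2) *\<^sub>R b) \<le> 2 * sqrt (norm (a - b)) * (norm a powr (-3/2) + norm b powr (-3/2))"
proof -
 have *: "norm (a - b) / (norm a * norm b) \<le> 2 * sqrt (norm (a - b)) * norm a powr (-3/2)"
  if "norm a \<le> norm b" "a \<noteq> 0" "b \<noteq> 0" for a b :: 'a
 proof -
  have p: "0 < norm a" "0 < norm b" using that by auto
  have "norm (a - b) \<le> norm a + norm b" by (rule norm_triangle_ineq4)
  also have "\<dots> \<le> 4 * norm b" using that norm_ge_zero[of b] by linarith
  finally have "sqrt (norm (a - b)) \<le> sqrt (4 * norm b)" by simp
  also have "\<dots> = 2 * sqrt (norm b)" by (simp add: real_sqrt_mult)
  finally have 1: "sqrt (norm (a - b)) \<le> 2 * sqrt (norm b)" .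
  have "norm (a - b) / (norm a * norm b) = sqrt (norm (a - b)) * (sqrt (norm (a - b)) / (norm a * norm b))" by simp
  also have "\<dots> \<le> sqrt (norm (a - b)) * (2 * sqrt (norm b) / (norm a * norm b))"
   using 1 p by (intro mult_left_mono divide_right_mono) auto
  also have "2 * sqrt (norm b) / (norm a * norm b) = 2 / (norm a * sqrt (norm b))"
   using p by (simp add: field_simps)
  also have "\<dots> \<le> 2 / (norm a * sqrt (norm a))"
   using p that by (intro divide_left_mono mult_left_mono) auto
  also have "2 / (norm a * sqrt (norm a)) = 2 * norm a powr (-3/2)"
  proof -
   have "norm a powr (3/2) = norm a powr (1 + 1/2)" by simp
   also have "\<dots> = norm a * sqrt (norm a)" using p unfolding powr_add by (simp add: powr_half_sqrt)
   finally show ?thesis by (simp add: powr_minus_divide)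
  qed
  finally show ?thesis by (simp add: mult_left_mono)
 qed
 show ?thesis
 proof (cases "norm a \<le> norm b")
  case True
  have "2 * sqrt (norm (a - b)) * norm a powr (-3/2) \<le> 2 * sqrt (norm (a - b)) * (norm a powr (-3/2) + norm b powr (-3/2))"
   by (intro mult_left_mono) auto
  then show ?thesis unfolding norm_diff_inversion[OF assms] using *[OF True assms] by linarith
 next
  case False
  have "2 * sqrt (norm (a - b)) * norm b powr (-3/2) \<le> 2 * sqrt (norm (a - b)) * (norm a powr (-3/2) + norm b powr (-3/2))"
   by (intro mult_left_mono) auto
  then show ?thesis unfolding norm_diff_inversion[OF assms] using *[of b a] False assms
   by (simp add: norm_minus_commute mult.commute[of "norm a" "norm b"])
 qed
qed

text \<open>The modulus of continuity depends on the density only through its bound and the radius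
  of its support. This makes the gradients of a weak-star convergent sequence
  equicontinuous.\<close>

lemma lgrad_holder:
 assumes f: "bdens L R f" and \<rho>: "0 < \<rho>" "R + norm x \<le> \<rho>" "R + norm x' \<le> \<rho>"
 shows "norm (lgrad f x - lgrad f x') \<le> 160 * L * sqrt \<rho> * sqrt (norm (x - x'))"
proof -
 let ?k = "\<lambda>x y. (1 / (norm (x - y))^2) *\<^sub>R (x - y) :: pt"
 have eq: "lgrad f x - lgrad f x' = (LBINT y. f y *\<^sub>R ?k x y - f y *\<^sub>R ?k x' y)"
  unfolding lgrad_def using integrable_lgrad[OF f] by simp
 have "norm (lgrad f x - lgrad f x') \<le> (LBINT y. norm (f y *\<^sub>R ?k x y - f y *\<^sub>R ?k x' y))"
  unfolding eq by (rule integral_norm_bound)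
 also have "\<dots> \<le> (LBINT y. 2 * sqrt (norm (x - x')) * (norm (x - y) powr (-3/2) * \<bar>f y\<bar> + norm (x' - y) powr (-3/2) * \<bar>f y\<bar>))"
 proof (rule integral_mono_AE)
  show "integrable lborel (\<lambda>y. norm (f y *\<^sub>R ?k x y - f y *\<^sub>R ?k x' y))"
   by (intro integrable_norm Bochner_Integration.integrable_diff integrable_lgrad[OF f])
  show "integrable lborel (\<lambda>y. 2 * sqrt (norm (x - x')) * (norm (x - y) powr (-3/2) * \<bar>f y\<bar> + norm (x' - y) powr (-3/2) * \<bar>f y\<bar>))"
   by (intro integrable_mult_right Bochner_Integration.integrable_add powr_conv_bound(1)[OF f \<rho>(1)] \<rho>)
  show "AE y in lborel. norm (f y *\<^sub>R ?k x y - f y *\<^sub>R ?k x' y) \<le> 2 * sqrt (norm (x - x')) * (norm (x - y) powr (-3/2) * \<bar>f y\<bar> + norm (x' - y) powr (-3/2) * \<bar>f y\<bar>)"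
   using AE_lborel_neq[of x] AE_lborel_neq[of x']
  proof eventually_elim
   case (elim y)
   have "norm (?k x y - ?k x' y) \<le> 2 * sqrt (norm (x - x')) * (norm (x - y) powr (-3/2) + norm (x' - y) powr (-3/2))"
    using inversion_holder[of "x - y" "x' - y"] elim by auto
   then have "norm (?k x y - ?k x' y) * \<bar>f y\<bar> \<le> 2 * sqrt (norm (x - x')) * (norm (x - y) powr (-3/2) + norm (x' - y) powr (-3/2)) * \<bar>f y\<bar>"
    by (intro mult_right_mono) auto
   moreover have "f y *\<^sub>R ?k x y - f y *\<^sub>R ?k x' y = f y *\<^sub>R (?k x y - ?k x' y)" by (simp only: scaleR_diff_right)
   then have "norm (f y *\<^sub>R ?k x y - f y *\<^sub>R ?k x' y) = norm (?k x y - ?k x' y) * \<bar>f y\<bar>"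
    by (simp only: norm_scaleR mult.commute)
   ultimately show ?case by (simp only:) (simp add: algebra_simps)
  qed
 qed
 also have "\<dots> = 2 * sqrt (norm (x - x')) * ((LBINT y. norm (x - y) powr (-3/2) * \<bar>f y\<bar>) + (LBINT y. norm (x' - y) powr (-3/2) * \<bar>f y\<bar>))"
  using powr_conv_bound(1)[OF f \<rho>(1,2)] powr_conv_bound(1)[OF f \<rho>(1,3)] by simp
 also have "\<dots> \<le> 2 * sqrt (norm (x - x')) * (40 * L * sqrt \<rho> + 40 * L * sqrt \<rho>)"
  by (intro mult_left_mono add_mono powr_conv_bound(2)[OF f \<rho>(1)] \<rho>) auto
 finally show ?thesis by (simp add: algebra_simps)
qed

section \<open>Uniform convergence of potentials from weak-star convergence of densities\<close>

lemma uniform_limit_equicontinuous: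
 fixes f :: "nat => 'a::metric_space => 'b::metric_space"
 assumes K: "compact K" and p: "\<And>x. x \<in> K ==> (\<lambda>n. f n x) \<longlonglongrightarrow> g x"
  and eq: "\<And>e. 0 < e ==> \<exists>d>0. \<forall>n. \<forall>x\<in>K. \<forall>x'\<in>K. dist x x' < d --> dist (f n x) (f n x') \<le> e"
 shows "uniform_limit K f g sequentially"
proof (rule uniform_limitI)
 fix e :: real assume e: "0 < e"
 then obtain d where d: "0 < d" "\<And>n x x'. x \<in> K ==> x' \<in> K ==> dist x x' < d ==> dist (f n x) (f n x') \<le> e/4"
  using eq[of "e/4"] by auto
 have dg: "dist (g x) (g x') \<le> e/4" if "x \<in> K" "x' \<in> K" "dist x x' < d" for x x'
  using tendsto_dist[OF p[OF that(1)] p[OF that(2)]] d(2)[OF that] by (intro LIMSEQ_le_const2) auto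
 obtain k where k: "finite k" "k \<subseteq> K" "K \<subseteq> (\<Union>x\<in>k. ball x d)"
  by (rule compactE_image[OF K, of K "\<lambda>x. ball x d"]) (use d(1) in \<open>auto intro!: exI[of _ d]\<close>)
 have "\<forall>\<^sub>F n in sequentially. \<forall>x\<in>k. dist (f n x) (g x) < e/4"
 proof (rule eventually_ball_finite[OF k(1)], intro ballI)
  fix x assume "x \<in> k"
  then have "(\<lambda>n. f n x) \<longlonglongrightarrow> g x" using k(2) p by blast
  then show "\<forall>\<^sub>F n in sequentially. dist (f n x) (g x) < e/4" by (rule tendstoD) (use e in simp)
 qed
 then show "\<forall>\<^sub>F n in sequentially. \<forall>x\<in>K. dist (f n x) (g x) < e"
 proof eventually_elim
  case (elim n)
  show ?case
  proof
   fix x assume x: "x \<in> K"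
   then have "x \<in> (\<Union>x\<in>k. ball x d)" using k(3) by blast
   then obtain x' where x': "x' \<in> k" "dist x' x < d" by (auto simp: mem_ball)
   then have "x' \<in> K" using k(2) by blast
   note x' = x'(1) this x'(2)
   have "dist (f n x) (g x) \<le> dist (f n x) (f n x') + dist (f n x') (g x') + dist (g x') (g x)"
    using dist_triangle[of "f n x" "g x" "f n x'"] dist_triangle[of "f n x'" "g x" "g x'"] by linarith
   moreover have "dist (f n x) (f n x') \<le> e/4" "dist (g x') (g x) \<le> e/4"
    using d(2)[of x x' n] dg[of x' x] x x' by (auto simp: dist_commute)
   ultimately show "dist (f n x) (g x) < e" using elim[rule_format, OF x'(1)] e by linarith
  qed
 qed
qed

text \<open>For fixed \<open>x\<close> the kernels, cut to the common support, are integrable test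
  functions, so weak-star convergence gives pointwise limits. The Lipschitz and Hoelder bounds hold
  uniformly in \<open>n\<close> and upgrade them on compact sets.\<close>

lemma weak_star_lpot_uniform:
 assumes f: "\<And>n. bdens L R (f n)" and g: "bdens L R g" and K: "compact K"
  and conv: "\<And>h. integrable lborel h ==> (\<lambda>n. LBINT x. h x * f n x) \<longlonglongrightarrow> (LBINT x. h x * g x)"
 shows "uniform_limit K (\<lambda>n. lpot (f n)) (lpot g) sequentially"
  and "uniform_limit K (\<lambda>n. lgrad (f n)) (lgrad g) sequentially"
proof -
 obtain B where B: "0 < B" "\<And>x. x \<in> K ==> norm x \<le> B"
  using compact_imp_bounded[OF K] by (auto simp: bounded_pos)
 define \<rho> where "\<rho> = \<bar>R\<bar> + B"
 have \<rho>: "0 < \<rho>" "\<And>x. x \<in> K ==> R + norm x \<le> \<rho>" using B by (auto simp: \<rho>_def) (use B(2) in fastforce)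
 have L0: "0 \<le> L" using bdens_nonneg[OF g] .
 have i1: "integrable lborel (\<lambda>y. indicator (ball (0::pt) R) y :: real)"
  by (rule integrable_indicator_ball)
 have ball: "indicator (ball 0 R) y * h y = h y" if "bdens L R h" for h y
  using that by (auto simp: bdens_def split: split_indicator)
 have bi: "bdens 1 R (indicator (ball 0 R))" by (auto simp: bdens_def split: split_indicator)
 have lp: "(\<lambda>n. lpot (f n) x) \<longlonglongrightarrow> lpot g x" for x
 proof -
  have "(\<lambda>n. LBINT y. (ln (norm (x - y)) * indicator (ball 0 R) y) * f n y) \<longlonglongrightarrow> (LBINT y. (ln (norm (x - y)) * indicator (ball 0 R) y) * g y)"
   by (rule conv) (rule integrable_lpot[OF bi])
  then show ?thesis unfolding lpot_def mult.assoc ball[OF f] ball[OF g] .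
 qed
 have lg: "(\<lambda>n. lgrad (f n) x) \<longlonglongrightarrow> lgrad g x" for x
 proof (rule vec_tendstoI)
  fix i :: 2
  define k where "k y = ((1 / (norm (x - y))^2) *\<^sub>R (x - y)) $ i" for y
  have ki: "integrable lborel (\<lambda>y. k y * indicator (ball 0 R) y)"
  proof -
   have "integrable lborel (\<lambda>y. (indicator (ball 0 R) y *\<^sub>R ((1 / (norm (x - y))^2) *\<^sub>R (x - y))) \<bullet> axis i 1)"
    by (intro integrable_inner_left integrable_lgrad[OF bi])
   then show ?thesis by (simp add: k_def inner_axis mult_ac)
  qed
  have c: "lgrad h x $ i = (LBINT y. (k y * indicator (ball 0 R) y) * h y)" if h: "bdens L R h" for h
  proof -
   have "lgrad h x $ i = lgrad h x \<bullet> axis i 1" by (simp add: inner_axis)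
   also have "\<dots> = (LBINT y. (h y *\<^sub>R ((1 / (norm (x - y))^2) *\<^sub>R (x - y))) \<bullet> axis i 1)"
    unfolding lgrad_def by (rule integral_inner_left[symmetric]) (rule integrable_lgrad[OF h])
   also have "\<dots> = (LBINT y. (k y * indicator (ball 0 R) y) * h y)"
    unfolding mult.assoc ball[OF h] by (simp add: k_def inner_axis mult_ac)
   finally show ?thesis .
  qed
  show "(\<lambda>n. lgrad (f n) x $ i) \<longlonglongrightarrow> lgrad g x $ i"
   unfolding c[OF f] c[OF g] by (rule conv[OF ki])
 qed
 show "uniform_limit K (\<lambda>n. lpot (f n)) (lpot g) sequentially"
 proof (rule uniform_limit_equicontinuous[OF K lp])
  fix e :: real assume e: "0 < e"
  define d where "d = e / (80 * L * \<rho> + 1)"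
  have pos: "0 < 80 * L * \<rho> + 1" using L0 \<rho>(1) by (simp add: add_nonneg_pos)
  have d: "0 < d" using e pos by (simp add: d_def)
  have "dist (lpot (f n) x) (lpot (f n) x') \<le> e" if "x \<in> K" "x' \<in> K" "dist x x' < d" for n x x'
  proof -
   have "dist (lpot (f n) x) (lpot (f n) x') \<le> 80 * L * \<rho> * norm (x - x')"
    using lpot_lipschitz[OF f \<rho>(1) \<rho>(2)[OF that(1)] \<rho>(2)[OF that(2)]] by (simp add: dist_real_def)
   also have "\<dots> \<le> (80 * L * \<rho> + 1) * d" using that L0 \<rho>(1) by (intro mult_mono) (auto simp: dist_norm)
   also have "\<dots> = e" using pos by (simp add: d_def)
   finally show ?thesis .
  qed
  then show "\<exists>d>0. \<forall>n. \<forall>x\<in>K. \<forall>x'\<in>K. dist x x' < d --> dist (lpot (f n) x) (lpot (f n) x') \<le> e" using d by blast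
 qed
 show "uniform_limit K (\<lambda>n. lgrad (f n)) (lgrad g) sequentially"
 proof (rule uniform_limit_equicontinuous[OF K lg])
  fix e :: real assume e: "0 < e"
  define d where "d = (e / (160 * L * sqrt \<rho> + 1))^2"
  have pos: "0 < 160 * L * sqrt \<rho> + 1" using L0 \<rho>(1) by (simp add: add_nonneg_pos)
  have d: "0 < d" using e pos by (simp add: d_def)
  have "dist (lgrad (f n) x) (lgrad (f n) x') \<le> e" if "x \<in> K" "x' \<in> K" "dist x x' < d" for n x x'
  proof -
   have "dist (lgrad (f n) x) (lgrad (f n) x') \<le> 160 * L * sqrt \<rho> * sqrt (norm (x - x'))"
    using lgrad_holder[OF f \<rho>(1) \<rho>(2)[OF that(1)] \<rho>(2)[OF that(2)]] by (simp add: dist_norm)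
   also have "\<dots> \<le> (160 * L * sqrt \<rho> + 1) * sqrt d" using that L0 \<rho>(1) by (intro mult_mono) (auto simp: dist_norm)
   also have "\<dots> = e" using pos e by (simp add: d_def)
   finally show ?thesis .
  qed
  then show "\<exists>d>0. \<forall>n. \<forall>x\<in>K. \<forall>x'\<in>K. dist x x' < d --> dist (lgrad (f n) x) (lgrad (f n) x') \<le> e" using d by blast
 qed
qed

section \<open>The Green function of the disk\<close>

text \<open>For nonzero \<open>y\<close> this is |y|^2 |x - y/|y|^2|^2, the square of the quantity
  whose logarithm enters \<open>hfun\<close>. Expanded it is a symmetric polynomial, regular also at
  y = 0.\<close>

definition Nker :: "pt => pt => real" where
 "Nker x y = (norm x)^2 * (norm y)^2 - 2 * (x \<bullet> y) + 1"

definition hreg :: "pt => pt => real" where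
 "hreg x y = - (1/(4*pi)) * ln (Nker x y)"

definition hgk :: "pt => pt => pt" where
 "hgk x y = (- (1/(2*pi)) / Nker x y) *\<^sub>R ((norm y)^2 *\<^sub>R x - y)"

definition hpot :: "(pt => real) => pt => real" where
 "hpot f x = (LBINT y. hreg x y * f y)"

definition hgrad :: "(pt => real) => pt => pt" where
 "hgrad f x = (LBINT y. f y *\<^sub>R hgk x y)"

lemma Nker_commute: "Nker x y = Nker y x"
 by (simp add: Nker_def inner_commute mult.commute)

text \<open>The product on the right is nonnegative in the disk, which yields positivity of the
  Green function; on the diagonal it alone survives and produces the Robin function.\<close>

lemma Nker_eq: "Nker x y = (norm (x - y))^2 + (1 - (norm x)^2) * (1 - (norm y)^2)"
 by (simp add: Nker_def power2_norm_eq_inner inner_diff inner_commute algebra_simps)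

lemma Nker_ge: "(1 - norm x * norm y)^2 \<le> Nker x y"
 using norm_cauchy_schwarz[of x y] by (simp add: Nker_def power2_eq_square algebra_simps)

lemma D_iff: "x \<in> D \<longleftrightarrow> norm x < 1" by (simp add: D_def)

lemma sets_D [measurable]: "D \<in> sets borel" by (simp add: D_def)

lemma Nker_ge_dist: assumes "x \<in> D" "y \<in> D" shows "(norm (x - y))^2 \<le> Nker x y"
 using assms unfolding Nker_eq D_iff by (simp add: abs_square_less_1 mult_nonneg_nonneg less_imp_le)

lemma Nker_pos: assumes "x \<in> D" "y \<in> D" shows "0 < Nker x y"
proof -
 have "norm x * norm y < 1" using assms mult_strict_mono[of "norm x" 1 "norm y" 1] by (simp add: D_iff)
 then have "0 < (1 - norm x * norm y)^2" by simp
 then show ?thesis using Nker_ge[of x y] by linarith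
qed

lemma Nker_le_4: assumes "x \<in> D" "y \<in> D" shows "Nker x y \<le> 4"
proof -
 have n: "norm x \<le> 1" "norm y \<le> 1" using assms by (auto simp: D_iff)
 have "norm x * norm y \<le> 1" using n by (simp add: mult_le_one)
 then have a: "\<bar>x \<bullet> y\<bar> \<le> 1" using Cauchy_Schwarz_ineq2[of x y] by linarith
 have "(norm x)^2 * (norm y)^2 \<le> 1" using n by (simp add: mult_le_one power_le_one)
 with a show ?thesis unfolding Nker_def by linarith
qed

lemma Nker_ge_sq:
 assumes "norm x \<le> 1 - d" "0 \<le> d" "norm y \<le> 1"
 shows "d^2 \<le> Nker x y"
proof -
 have "norm x * norm y \<le> norm x * 1" using assms by (intro mult_left_mono) auto
 then have "d \<le> 1 - norm x * norm y" using assms by linarith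
 then have "d^2 \<le> (1 - norm x * norm y)^2" using assms by (intro power_mono) auto
 then show ?thesis using Nker_ge[of x y] by linarith
qed

text \<open>At y = 0 the expression in \<open>hfun\<close> divides by zero and misses the correct
  limit value, so this point is left out; for integrals in \<open>y\<close> it is a null
  set.\<close>

lemma Gfun_eq:
 assumes "x \<in> D" "y \<in> D" "y \<noteq> 0"
 shows "Gfun x y = - (1/(2*pi)) * ln (norm (x - y)) - hreg x y"
proof -
 have ny: "0 < norm y" using assms by simp
 have e: "(norm y * norm (x - (1 / (norm y)^2) *\<^sub>R y))^2 = Nker x y"
 proof -
  have "(norm (x - u))^2 = (norm x)^2 - 2 * (x \<bullet> u) + (norm u)^2" for u
   by (simp add: power2_norm_eq_inner inner_diff inner_commute)
  then have "(norm (x - (1 / (norm y)^2) *\<^sub>R y))^2 = (norm x)^2 - 2 * ((x \<bullet> y) / (norm y)^2) + (norm ((1 / (norm y)^2) *\<^sub>R y))^2"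
   by simp
  also have "(norm ((1 / (norm y)^2) *\<^sub>R y))^2 = 1 / (norm y)^2" using ny by (simp add: power_divide power_mult_distrib divide_simps)
  finally show ?thesis using ny unfolding power_mult_distrib Nker_def by (simp add: field_simps)
 qed
 then have pos: "0 < norm (x - (1 / (norm y)^2) *\<^sub>R y)" using Nker_pos[OF assms(1,2)]
  by (metis less_irrefl mult_zero_right norm_ge_zero order_le_less power_zero_numeral)
 have "ln (Nker x y) = 2 * ln (norm y * norm (x - (1 / (norm y)^2) *\<^sub>R y))"
  unfolding e[symmetric] using pos ny by (simp add: ln_realpow)
 also have "\<dots> = 2 * (ln (norm y) + ln (norm (x - (1 / (norm y)^2) *\<^sub>R y)))"
  using pos ny by (simp only: ln_mult_pos)
 finally show ?thesis unfolding Gfun_def hfun_def hreg_def by (simp add: field_simps)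
qed

lemma hreg_bounds:
 assumes "x \<in> D" "y \<in> D"
 shows "- (1/(4*pi)) * ln 4 \<le> hreg x y"
 using Nker_le_4[OF assms] Nker_pos[OF assms] unfolding hreg_def by (simp add: divide_right_mono)

lemma hreg_le:
 assumes "norm x \<le> 1 - d" "0 < d" "norm y \<le> 1"
 shows "hreg x y \<le> - (1/(2*pi)) * ln d"
proof -
 have "ln (d^2) \<le> ln (Nker x y)" using Nker_ge_sq[of x d y] assms by (intro ln_mono) auto
 then have "2 * ln d \<le> ln (Nker x y)" using assms by (simp add: ln_realpow)
 then show ?thesis unfolding hreg_def by (simp add: field_simps)
qed

text \<open>Positivity is |x - y|^2 <= \<open>Nker x y\<close>. The upper bound is deliberately
  crude: it reduces integrals of the Green function to those of 1/|z|.\<close>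

lemma Gfun_nonneg_le:
 assumes "x \<in> D" "y \<in> D" "y \<noteq> 0" "x \<noteq> y"
 shows "0 \<le> Gfun x y" "Gfun x y \<le> 1 / norm (x - y)"
proof -
 have p: "0 < norm (x - y)" using assms by simp
 have "ln ((norm (x - y))^2) \<le> ln (Nker x y)" using Nker_ge_dist[OF assms(1,2)] p by (intro ln_mono) auto
 then have "2 * ln (norm (x - y)) \<le> ln (Nker x y)" using p by (simp add: ln_realpow)
 then show "0 \<le> Gfun x y" unfolding Gfun_eq[OF assms(1-3)] hreg_def by (simp add: field_simps)
 have "ln (4::real) = 2 * ln 2" using ln_realpow[of 2 2] by simp
 then have "hreg x y \<ge> - (1/(2*pi)) * ln 2" using hreg_bounds[OF assms(1,2)] by simp
 then have "Gfun x y \<le> (1/(2*pi)) * (ln 2 - ln (norm (x - y)))" unfolding Gfun_eq[OF assms(1-3)] by (simp add: right_diff_distrib)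
 also have "ln 2 - ln (norm (x - y)) = ln (2 / norm (x - y))" using p by (simp add: ln_div)
 also have "(1/(2*pi)) * ln (2 / norm (x - y)) \<le> (1/(2*pi)) * (2 / norm (x - y))"
  using p ln_le_minus_one[of "2 / norm (x - y)"] by (intro mult_left_mono) auto
 also have "\<dots> \<le> 1 / norm (x - y)" using p pi_ge_two by (simp add: field_simps)
 finally show "Gfun x y \<le> 1 / norm (x - y)" .
qed

lemma Gfun_commute: "x \<in> D ==> y \<in> D ==> x \<noteq> 0 ==> y \<noteq> 0 ==> Gfun x y = Gfun y x"
 by (simp add: Gfun_eq hreg_def Nker_commute[of x y] norm_minus_commute)

lemma measurable_Gfun [measurable]:
 "(\<lambda>(x,y). Gfun x y) \<in> borel_measurable (lborel \<Otimes>\<^sub>M lborel)"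
 unfolding Gfun_def hfun_def by measurable

lemma measurable_Gfun_fst [measurable]: "Gfun x \<in> borel_measurable borel"
 unfolding Gfun_def hfun_def by measurable

lemma measurable_hreg [measurable]: "hreg x \<in> borel_measurable borel"
 unfolding hreg_def Nker_def by measurable

lemma measurable_hreg_pair [measurable]: "(\<lambda>(x,y). hreg x y) \<in> borel_measurable (lborel \<Otimes>\<^sub>M lborel)"
 unfolding hreg_def Nker_def by measurable

lemma measurable_hgk [measurable]: "hgk x \<in> borel_measurable borel"
 unfolding hgk_def Nker_def by measurable

section \<open>From Lebesgue integrals over the disk to Borel densities on the plane\<close>

lemma LINT_lebesgue_on_D:
 fixes f :: "pt => 'b::{banach, second_countable_topology}"
 assumes [measurable]: "f \<in> borel_measurable borel" and "\<And>x. x \<notin> D ==> f x = 0"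
 shows "(LINT x|lebesgue_on D. f x) = (LBINT x. f x)"
proof -
 have "(LINT x|lebesgue_on D. f x) = (\<integral>x. indicator D x *\<^sub>R f x \<partial>lebesgue)"
  by (rule integral_restrict_space) auto
 also have "(\<lambda>x. indicator D x *\<^sub>R f x) = f" using assms(2) by (auto simp: fun_eq_iff split: split_indicator)
 finally show ?thesis by (simp add: integral_completion)
qed

lemma bdens_D: "bdens L 1 f ==> x \<notin> D ==> f x = 0"
 by (simp add: bdens_def D_def)

lemma Gop_eq_lborel:
 assumes f: "bdens L 1 f"
 shows "Gop f x = (LBINT y. Gfun x y * f y)"
 unfolding Gop_def
 by (rule LINT_lebesgue_on_D) (use bdens_measurable[OF f] bdens_D[OF f] in \<open>auto intro!: borel_measurable_times\<close>)

lemma integrable_hpot: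
 assumes f: "bdens L 1 f" and x: "x \<in> D"
 shows "integrable lborel (\<lambda>y. hreg x y * f y)"
proof -
 have [measurable]: "f \<in> borel_measurable borel" using f by (rule bdens_measurable)
 define d where "d = 1 - norm x"
 have d: "0 < d" "norm x \<le> 1 - d" using x by (auto simp: d_def D_iff)
 define C where "C = (1/(4*pi)) * ln 4 + \<bar>(1/(2*pi)) * ln d\<bar>"
 have le: "\<bar>hreg x y\<bar> \<le> C" if "y \<in> D" for y
 proof -
  have "0 \<le> (1/(4*pi)) * ln 4" by simp
  then show ?thesis using hreg_bounds[OF x that] hreg_le[OF d(2,1), of y] that
   unfolding C_def D_iff by linarith
 qed
 show ?thesis
 proof (rule Bochner_Integration.integrable_bound)
  show "integrable lborel (\<lambda>y. C * f y)" using integrable_bdens[OF f] by simp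
  show "AE y in lborel. norm (hreg x y * f y) \<le> norm (C * f y)" (is "AE x in _. ?P x")
  proof (intro AE_I2)
   fix y show "?P y"
   proof (cases "y \<in> D")
    case True
    have "\<bar>hreg x y\<bar> * \<bar>f y\<bar> \<le> \<bar>C\<bar> * \<bar>f y\<bar>" using le[OF True] by (intro mult_right_mono) auto
    then show ?thesis by (simp add: abs_mult)
   qed (simp add: bdens_D[OF f])
  qed
 qed measurable
qed

lemma integrable_Gop:
 assumes f: "bdens L 1 f" and x: "x \<in> D"
 shows "integrable lborel (\<lambda>y. Gfun x y * f y)"
  and Gop_eq: "Gop f x = - (1/(2*pi)) * lpot f x - hpot f x"
proof -
 have [measurable]: "f \<in> borel_measurable borel" using f by (rule bdens_measurable)
 have i: "integrable lborel (\<lambda>y. - (1/(2*pi)) * (ln (norm (x - y)) * f y) - hreg x y * f y)"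
  by (intro Bochner_Integration.integrable_diff integrable_mult_right integrable_lpot[OF f] integrable_hpot[OF f x])
 have ae: "AE y in lborel. Gfun x y * f y = - (1/(2*pi)) * (ln (norm (x - y)) * f y) - hreg x y * f y"
  using AE_lborel_neq[of 0]
 proof eventually_elim
  case (elim y)
  show ?case
  proof (cases "y \<in> D")
   case True
   show ?thesis unfolding Gfun_eq[OF x True elim] by (simp add: algebra_simps)
  qed (simp add: bdens_D[OF f])
 qed
 show "integrable lborel (\<lambda>y. Gfun x y * f y)"
  by (rule integrable_cong_AE_imp[OF i]) (use ae in \<open>auto elim: eventually_mono\<close>)
 have "Gop f x = (LBINT y. - (1/(2*pi)) * (ln (norm (x - y)) * f y) - hreg x y * f y)"
  unfolding Gop_eq_lborel[OF f] by (rule integral_cong_AE) (use ae in auto)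
 also have "\<dots> = (LBINT y. - (1/(2*pi)) * (ln (norm (x - y)) * f y)) - (LBINT y. hreg x y * f y)"
  by (intro Bochner_Integration.integral_diff integrable_mult_right integrable_lpot[OF f] integrable_hpot[OF f x])
 finally show "Gop f x = - (1/(2*pi)) * lpot f x - hpot f x"
  unfolding lpot_def hpot_def by simp
qed

lemma Gop_nonneg:
 assumes f: "bdens L 1 f" "\<And>y. 0 \<le> f y" and x: "x \<in> D"
 shows "0 \<le> Gop f x"
proof -
 have "0 \<le> (LBINT y. Gfun x y * f y)"
 proof (rule integral_nonneg_AE)
  show "AE y in lborel. 0 \<le> Gfun x y * f y" using AE_lborel_neq[of 0] AE_lborel_neq[of x]
  proof eventually_elim
   case (elim y) then show ?case
    by (cases "y \<in> D") (use Gfun_nonneg_le(1)[OF x, of y] f bdens_D[OF f(1)] in auto)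
  qed
 qed
 then show ?thesis by (simp add: Gop_eq_lborel[OF f(1)])
qed

text \<open>For two points of the disk x - y stays in the disk of radius 2, so the bound 40 r for
  the integral of 1/|z| gives 80.\<close>

lemma Gop_bound:
 assumes f: "bdens L 1 f" and x: "x \<in> D"
 shows "(LBINT y. \<bar>Gfun x y * f y\<bar>) \<le> 80 * L" and "\<bar>Gop f x\<bar> \<le> 80 * L"
proof -
 have r: "1 + norm x \<le> 2" using x by (simp add: D_iff)
 have "(LBINT y. \<bar>Gfun x y * f y\<bar>) \<le> (LBINT y. 1 / norm (x - y) * \<bar>f y\<bar>)"
 proof (rule integral_mono_AE)
  show "integrable lborel (\<lambda>y. \<bar>Gfun x y * f y\<bar>)" using integrable_Gop(1)[OF f x] by simp
  show "integrable lborel (\<lambda>y. 1 / norm (x - y) * \<bar>f y\<bar>)" by (rule inverse_conv_bound(1)[OF f _ r]) simp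
  show "AE y in lborel. \<bar>Gfun x y * f y\<bar> \<le> 1 / norm (x - y) * \<bar>f y\<bar>" using AE_lborel_neq[of 0] AE_lborel_neq[of x]
  proof eventually_elim
   case (elim y)
   show ?case
   proof (cases "y \<in> D")
    case True
    then have "\<bar>Gfun x y\<bar> \<le> 1 / norm (x - y)" using Gfun_nonneg_le[OF x, of y] elim by auto
    then show ?thesis unfolding abs_mult by (intro mult_right_mono) auto
   qed (simp add: bdens_D[OF f])
  qed
 qed
 also have "\<dots> \<le> 40 * L * 2" by (rule inverse_conv_bound(2)[OF f _ r]) simp
 finally show 1: "(LBINT y. \<bar>Gfun x y * f y\<bar>) \<le> 80 * L" by simp
 have "\<bar>Gop f x\<bar> \<le> (LBINT y. \<bar>Gfun x y * f y\<bar>)" unfolding Gop_eq_lborel[OF f] by (rule integral_abs_bound)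
 with 1 show "\<bar>Gop f x\<bar> \<le> 80 * L" by simp
qed

lemma measurable_Gop:
 assumes f: "bdens L 1 f" shows "Gop f \<in> borel_measurable borel"
proof -
 have [measurable]: "f \<in> borel_measurable borel" using f by (rule bdens_measurable)
 have "(\<lambda>x. LBINT y. Gfun x y * f y) \<in> borel_measurable lborel"
  by (rule lborel.borel_measurable_lebesgue_integral) measurable
 then show ?thesis by (simp add: Gop_eq_lborel[OF f, abs_def])
qed

lemma integrable_Gop_mult:
 assumes f: "bdens L 1 f" and g: "bdens M 1 g"
 shows "integrable lborel (\<lambda>x. Gop f x * g x)"
proof (rule Bochner_Integration.integrable_bound)
 have [measurable]: "g \<in> borel_measurable borel" "Gop f \<in> borel_measurable borel"
  using bdens_measurable[OF g] measurable_Gop[OF f] by auto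
 show "integrable lborel (\<lambda>x. 80 * L * g x)" using integrable_bdens[OF g] by simp
 show "AE x in lborel. norm (Gop f x * g x) \<le> norm (80 * L * g x)" (is "AE x in _. ?P x")
 proof (intro AE_I2)
  fix x show "?P x"
  proof (cases "x \<in> D")
   case True
   have "\<bar>Gop f x\<bar> * \<bar>g x\<bar> \<le> \<bar>80 * L\<bar> * \<bar>g x\<bar>" using Gop_bound(2)[OF f True] by (intro mult_right_mono) auto
   then show ?thesis by (simp add: abs_mult)
  qed (simp add: bdens_D[OF g])
 qed
 show "(\<lambda>x. Gop f x * g x) \<in> borel_measurable lborel" by simp
qed

lemma integrable_Gfun_pair:
 assumes f: "bdens L 1 f" and g: "bdens M 1 g"
 shows "integrable (lborel \<Otimes>\<^sub>M lborel) (\<lambda>(x,y). Gfun x y * f y * g x)"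
proof (rule lborel_pair.Fubini_integrable)
 have [measurable]: "f \<in> borel_measurable borel" "g \<in> borel_measurable borel"
  using bdens_measurable f g by auto
 show "(\<lambda>(x,y). Gfun x y * f y * g x) \<in> borel_measurable (lborel \<Otimes>\<^sub>M lborel)" by measurable
 show "AE x in lborel. integrable lborel (\<lambda>y. case (x, y) of (x, y) => Gfun x y * f y * g x)" (is "AE x in _. ?P x")
 proof (intro AE_I2)
  fix x show "?P x"
   by (cases "x \<in> D") (use integrable_Gop(1)[OF f] bdens_D[OF g] in auto)
 qed
 have [measurable]: "(\<lambda>x. LBINT y. norm (Gfun x y * f y * g x)) \<in> borel_measurable lborel"
  by (rule lborel.borel_measurable_lebesgue_integral) measurable
 have "integrable lborel (\<lambda>x. LBINT y. norm (Gfun x y * f y * g x))"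
 proof (rule Bochner_Integration.integrable_bound)
  show "integrable lborel (\<lambda>x. 80 * L * g x)" using integrable_bdens[OF g] by simp
  show "AE x in lborel. norm (LBINT y. norm (Gfun x y * f y * g x)) \<le> norm (80 * L * g x)" (is "AE x in _. ?P x")
  proof (intro AE_I2)
   fix x
   have e: "(LBINT y. norm (Gfun x y * f y * g x)) = (LBINT y. \<bar>Gfun x y * f y\<bar>) * \<bar>g x\<bar>"
    by (simp add: abs_mult)
   have n: "0 \<le> (LBINT y. \<bar>Gfun x y * f y\<bar>)" by simp
   show "?P x"
   proof (cases "x \<in> D")
    case True
    have "(LBINT y. \<bar>Gfun x y * f y\<bar>) * \<bar>g x\<bar> \<le> \<bar>80 * L\<bar> * \<bar>g x\<bar>"
     using Gop_bound(1)[OF f True] by (intro mult_right_mono) auto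
    then show ?thesis unfolding e using n by (simp add: abs_mult)
   qed (simp add: bdens_D[OF g])
  qed
 qed measurable
 then show "integrable lborel (\<lambda>x. LBINT y. norm (case (x, y) of (x, y) => Gfun x y * f y * g x))" by simp
qed

section \<open>The Green energy as a symmetric bilinear form\<close>

definition Gq :: "(pt => real) => (pt => real) => real" where
 "Gq f g = (LBINT x. Gop f x * g x)"

lemma Gq_commute:
 assumes f: "bdens L 1 f" and g: "bdens M 1 g"
 shows "Gq f g = Gq g f"
proof -
 have "Gq f g = (LBINT x. (LBINT y. Gfun x y * f y * g x))"
  unfolding Gq_def Gop_eq_lborel[OF f] by simp
 also have "\<dots> = (LBINT y. (LBINT x. Gfun x y * f y * g x))"
  using lborel_pair.Fubini_integral[of "\<lambda>x y. Gfun x y * f y * g x"] integrable_Gfun_pair[OF f g] by simp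
 also have "\<dots> = (LBINT y. (LBINT x. Gfun y x * g x * f y))"
 proof (rule integral_cong_AE)
  have [measurable]: "f \<in> borel_measurable borel" "g \<in> borel_measurable borel"
   using bdens_measurable f g by auto
  have "(\<lambda>y. LBINT x. Gfun x y * f y * g x) \<in> borel_measurable lborel"
   by (rule lborel.borel_measurable_lebesgue_integral) measurable
  then show "(\<lambda>y. LBINT x. Gfun x y * f y * g x) \<in> borel_measurable lborel" .
  have "(\<lambda>y. LBINT x. Gfun y x * g x * f y) \<in> borel_measurable lborel"
   by (rule lborel.borel_measurable_lebesgue_integral) measurable
  then show "(\<lambda>y. LBINT x. Gfun y x * g x * f y) \<in> borel_measurable lborel" .
  show "AE y in lborel. (LBINT x. Gfun x y * f y * g x) = (LBINT x. Gfun y x * g x * f y)"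
   using AE_lborel_neq[of 0]
  proof eventually_elim
   case (elim y)
   show ?case
   proof (rule integral_cong_AE)
    have "(\<lambda>x. Gfun x y) \<in> borel_measurable borel" unfolding Gfun_def hfun_def by measurable
    then show "(\<lambda>x. Gfun x y * f y * g x) \<in> borel_measurable lborel" by simp
    show "(\<lambda>x. Gfun y x * g x * f y) \<in> borel_measurable lborel" by simp
    show "AE x in lborel. Gfun x y * f y * g x = Gfun y x * g x * f y"
     using AE_lborel_neq[of 0]
    proof eventually_elim
     case (elim x)
     then show ?case
      by (cases "x \<in> D \<and> y \<in> D")
        (use \<open>y \<noteq> 0\<close> Gfun_commute[of x y] bdens_D[OF f] bdens_D[OF g] in auto)
    qed
   qed
  qed
 qed
 also have "\<dots> = Gq g f" unfolding Gq_def Gop_eq_lborel[OF g] by simp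
 finally show ?thesis .
qed

lemma bdens_add_scale:
 assumes f: "bdens L R f" and g: "bdens M R g"
 shows "bdens (L + \<bar>c\<bar> * M) R (\<lambda>x. f x + c * g x)"
proof -
 have "\<bar>f x + c * g x\<bar> \<le> L + \<bar>c\<bar> * M" for x
 proof -
  have "\<bar>f x + c * g x\<bar> \<le> \<bar>f x\<bar> + \<bar>c\<bar> * \<bar>g x\<bar>" using abs_triangle_ineq[of "f x" "c * g x"] by (simp add: abs_mult)
  also have "\<dots> \<le> L + \<bar>c\<bar> * M" using f g by (intro add_mono mult_left_mono) (auto simp: bdens_def)
  finally show ?thesis .
 qed
 moreover have "(\<lambda>x. f x + c * g x) \<in> borel_measurable borel"
  using bdens_measurable[OF f] bdens_measurable[OF g] by measurable
 ultimately show ?thesis using f g by (auto simp: bdens_def)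
qed

lemma Gop_add_scale:
 assumes f: "bdens L 1 f" and g: "bdens M 1 g" and x: "x \<in> D"
 shows "Gop (\<lambda>x. f x + c * g x) x = Gop f x + c * Gop g x"
proof -
 have "Gop (\<lambda>x. f x + c * g x) x = (LBINT y. Gfun x y * f y + c * (Gfun x y * g y))"
  unfolding Gop_eq_lborel[OF bdens_add_scale[OF f g]] by (simp add: algebra_simps)
 then show ?thesis using integrable_Gop(1)[OF f x] integrable_Gop(1)[OF g x]
  by (simp add: Gop_eq_lborel[OF f] Gop_eq_lborel[OF g])
qed

lemma Gq_add_scale_right:
 assumes f: "bdens L 1 f" and g: "bdens M 1 g" and h: "bdens P 1 h"
 shows "Gq h (\<lambda>x. f x + c * g x) = Gq h f + c * Gq h g"
proof -
 have "Gq h (\<lambda>x. f x + c * g x) = (LBINT x. Gop h x * f x + c * (Gop h x * g x))"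
  unfolding Gq_def by (simp add: algebra_simps)
 then show ?thesis using integrable_Gop_mult[OF h f] integrable_Gop_mult[OF h g] by (simp add: Gq_def)
qed

lemma Efun_eq:
 assumes f: "bdens L 1 f"
 shows "Efun Om f = 1/2 * Gq f f + Om/2 * (LBINT x. (norm x)^2 * f x)"
proof -
 have [measurable]: "f \<in> borel_measurable borel" "Gop f \<in> borel_measurable borel"
  using bdens_measurable[OF f] measurable_Gop[OF f] by auto
 have "(LINT x|lebesgue_on D. Gop f x * f x) = Gq f f" unfolding Gq_def
  by (rule LINT_lebesgue_on_D) (use bdens_D[OF f] in auto)
 moreover have "(LINT x|lebesgue_on D. (norm x)^2 * f x) = (LBINT x. (norm x)^2 * f x)"
  by (rule LINT_lebesgue_on_D) (use bdens_D[OF f] in auto)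
 ultimately show ?thesis by (simp add: Efun_def)
qed

lemma integrable_norm2_mult:
 assumes f: "bdens L 1 f" shows "integrable lborel (\<lambda>x. (norm x)^2 * f x)"
proof (rule Bochner_Integration.integrable_bound)
 have [measurable]: "f \<in> borel_measurable borel" using bdens_measurable[OF f] .
 show "integrable lborel f" using f by (rule integrable_bdens)
 show "AE x in lborel. norm ((norm x)^2 * f x) \<le> norm (f x)" (is "AE x in _. ?P x")
 proof (intro AE_I2)
  fix x show "?P x"
  proof (cases "x \<in> D")
   case True
   then have "(norm x)^2 \<le> 1" by (simp add: D_iff abs_square_le_1)
   then show ?thesis by (simp add: abs_mult mult_left_le_one_le)
  qed (simp add: bdens_D[OF f])
 qed
 show "(\<lambda>x. (norm x)^2 * f x) \<in> borel_measurable lborel" by simp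
qed

lemma integrable_psi0_mult:
 assumes f: "bdens L 1 f" and g: "bdens M 1 g"
 shows "integrable lborel (\<lambda>x. psi0 Om f x * g x)"
 unfolding psi0_def distrib_right mult.assoc
 by (intro Bochner_Integration.integrable_add integrable_mult_right integrable_Gop_mult[OF f g] integrable_norm2_mult[OF g])

text \<open>The energy is exactly quadratic, with \<open>psi0\<close> as first variation and the
  Green energy as second. The exchange arguments for maximizers evaluate this expansion.\<close>

lemma Efun_add_scale:
 assumes f: "bdens L 1 f" and g: "bdens M 1 g"
 shows "Efun Om (\<lambda>x. f x + c * g x) = Efun Om f + c * (LBINT x. psi0 Om f x * g x) + c^2 / 2 * Gq g g"
proof -
 note fg = bdens_add_scale[OF f g, of c]
 have "Gq (\<lambda>x. f x + c * g x) (\<lambda>x. f x + c * g x) = Gq f f + 2 * c * Gq f g + c^2 * Gq g g"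
 proof -
  have "Gq (\<lambda>x. f x + c * g x) (\<lambda>x. f x + c * g x) = Gq (\<lambda>x. f x + c * g x) f + c * Gq (\<lambda>x. f x + c * g x) g"
   by (rule Gq_add_scale_right[OF f g fg])
  also have "Gq (\<lambda>x. f x + c * g x) f = Gq f (\<lambda>x. f x + c * g x)" by (rule Gq_commute[OF fg f])
  also have "\<dots> = Gq f f + c * Gq f g" by (rule Gq_add_scale_right[OF f g f])
  also have "Gq (\<lambda>x. f x + c * g x) g = Gq g (\<lambda>x. f x + c * g x)" by (rule Gq_commute[OF fg g])
  also have "\<dots> = Gq g f + c * Gq g g" by (rule Gq_add_scale_right[OF f g g])
  also have "Gq g f = Gq f g" by (rule Gq_commute[OF g f])
  finally show ?thesis by (simp add: algebra_simps power2_eq_square)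
 qed
 moreover have "(LBINT x. (norm x)^2 * (f x + c * g x)) = (LBINT x. (norm x)^2 * f x) + c * (LBINT x. (norm x)^2 * g x)"
 proof -
  have "(LBINT x. (norm x)^2 * (f x + c * g x)) = (LBINT x. (norm x)^2 * f x + c * ((norm x)^2 * g x))"
   by (simp add: algebra_simps)
  then show ?thesis using integrable_norm2_mult[OF f] integrable_norm2_mult[OF g] by simp
 qed
 moreover have "(LBINT x. psi0 Om f x * g x) = Gq f g + Om/2 * (LBINT x. (norm x)^2 * g x)"
 proof -
  have "(LBINT x. psi0 Om f x * g x) = (LBINT x. Gop f x * g x + Om/2 * ((norm x)^2 * g x))"
   by (simp add: psi0_def algebra_simps)
  then show ?thesis using integrable_Gop_mult[OF f g] integrable_norm2_mult[OF g] by (simp add: Gq_def)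
 qed
 ultimately show ?thesis unfolding Efun_eq[OF fg] Efun_eq[OF f] by (simp add: algebra_simps)
qed

text \<open>For |x| <= 1 - d the polynomial \<open>Nker\<close> is at least d^2, so its logarithm
  can be expanded with constants depending on \<open>d\<close> alone. The natural remainder |t|^2 is
  weakened to |t|^(3/2) to fit \<open>has_derivative_of_remainder\<close>. From |q| <= 5 |t|/d^2 the
  quadratic term costs 50, and the part \<open>r\<close> of \<open>q\<close> one more.\<close>

lemma hreg_remainder:
 assumes d: "0 < d" "d \<le> 1" and x: "norm x \<le> 1 - d" and y: "norm y \<le> 1" and t: "norm t \<le> d^2 / 10"
 shows "\<bar>hreg (x + t) y - hreg x y - hgk x y \<bullet> t\<bar> \<le> 51 / d^4 * norm t powr (3/2)"
proof -
 define N where "N = Nker x y"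
 have N: "d^2 \<le> N" unfolding N_def using Nker_ge_sq[of x d y] d x y by simp
 have d2: "0 < d^2" "d^2 \<le> 1" using d by (auto simp: power_le_one)
 have N0: "0 < N" using N d2 by linarith
 have t1: "norm t \<le> 1/10" using t d2 by linarith
 define l where "l = (2 * ((norm y)^2 * (x \<bullet> t)) - 2 * (y \<bullet> t)) / N"
 define r where "r = (norm y)^2 * (norm t)^2 / N"
 define q where "q = l + r"
 have eq: "Nker (x + t) y = N * (1 + q)"
 proof -
  have "N * (1 + q) = N + N * l + N * r" by (simp add: q_def algebra_simps)
  also have "N * l = 2 * ((norm y)^2 * (x \<bullet> t)) - 2 * (y \<bullet> t)" using N0 by (simp add: l_def)
  also have "N * r = (norm y)^2 * (norm t)^2" using N0 by (simp add: r_def)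
  finally show ?thesis unfolding N_def Nker_def
   by (simp add: power2_norm_eq_inner inner_add inner_commute algebra_simps)
 qed
 have y2: "(norm y)^2 \<le> 1" using y by (simp add: power_le_one)
 have xt: "\<bar>x \<bullet> t\<bar> \<le> norm t" using Cauchy_Schwarz_ineq2[of x t] mult_right_mono[of "norm x" 1 "norm t"] x d by simp
 have yt: "\<bar>y \<bullet> t\<bar> \<le> norm t" using Cauchy_Schwarz_ineq2[of y t] mult_right_mono[of "norm y" 1 "norm t"] y by simp
 have "(norm y)^2 * \<bar>x \<bullet> t\<bar> \<le> 1 * norm t" using xt y2 by (intro mult_mono) auto
 then have num: "\<bar>2 * ((norm y)^2 * (x \<bullet> t)) - 2 * (y \<bullet> t)\<bar> \<le> 4 * norm t"
  using yt abs_triangle_ineq4[of "2 * ((norm y)^2 * (x \<bullet> t))" "2 * (y \<bullet> t)"] by (simp add: abs_mult)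
 have l: "\<bar>l\<bar> \<le> 4 * norm t / d^2"
 proof -
  have "\<bar>l\<bar> \<le> 4 * norm t / N" unfolding l_def using num N0 by (simp add: abs_divide divide_right_mono)
  also have "\<dots> \<le> 4 * norm t / d^2" using N d2 N0 by (intro divide_left_mono) auto
  finally show ?thesis .
 qed
 have r: "0 \<le> r" "r \<le> (norm t)^2 / d^2"
 proof -
  show "0 \<le> r" using N0 by (simp add: r_def)
  have "(norm y)^2 * (norm t)^2 / N \<le> 1 * (norm t)^2 / N" using y2 N0 by (intro divide_right_mono mult_right_mono) auto
  also have "\<dots> \<le> (norm t)^2 / d^2" using N d2 N0 by (simp add: divide_left_mono)
  finally show "r \<le> (norm t)^2 / d^2" by (simp add: r_def)
 qed
 have t2: "(norm t)^2 \<le> norm t" using t1 by (simp add: power2_eq_square mult_left_le)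
 have "(norm t)^2 / d^2 \<le> norm t / d^2" using t2 d2 by (intro divide_right_mono) auto
 then have q: "\<bar>q\<bar> \<le> 5 * norm t / d^2" using l r unfolding q_def by (simp add: abs_le_iff)
 have "5 * norm t / d^2 \<le> 1/2" using t d2 by (simp add: field_simps)
 then have q2: "\<bar>q\<bar> \<le> 1/2" using q by linarith
 have lnq: "\<bar>ln (1 + q) - q\<bar> \<le> 2 * q^2" using abs_ln_one_plus_x_minus_x_bound[of q] q2 by simp
 have "q^2 \<le> (5 * norm t / d^2)^2" using q by (intro abs_le_square_iff[THEN iffD1]) auto
 then have qq: "2 * q^2 \<le> 50 * (norm t)^2 / d^4" by (simp add: power_divide power_mult_distrib flip: power_mult)
 have "(norm t)^2 / d^2 \<le> (norm t)^2 / d^4"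
  using d by (intro divide_left_mono power_decreasing) auto
 then have tot: "\<bar>ln (1 + q) - l\<bar> \<le> 51 * (norm t)^2 / d^4" using lnq qq r unfolding q_def by (simp add: abs_le_iff)
 have lnN: "ln (Nker (x + t) y) - ln (Nker x y) = ln (1 + q)" unfolding eq N_def[symmetric] using N0 q2 by (simp add: ln_mult)
 have hg: "hgk x y \<bullet> t = - (1/(4*pi)) * l"
  unfolding hgk_def l_def N_def using N0 by (simp add: inner_diff N_def[symmetric] field_simps)
 have "hreg (x + t) y - hreg x y - hgk x y \<bullet> t = - (1/(4*pi)) * (ln (1 + q) - l)"
  unfolding hg lnN[symmetric] hreg_def by (simp add: algebra_simps add_divide_distrib)
 then have "\<bar>hreg (x + t) y - hreg x y - hgk x y \<bullet> t\<bar> = (1/(4*pi)) * \<bar>ln (1 + q) - l\<bar>" by (simp add: abs_mult)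
 also have "\<dots> \<le> 1 * \<bar>ln (1 + q) - l\<bar>" using pi_ge_two by (intro mult_right_mono) (auto simp: field_simps)
 also have "\<dots> \<le> 51 * (norm t)^2 / d^4" using tot by simp
 also have "\<dots> \<le> 51 / d^4 * norm t powr (3/2)"
 proof -
  have "(norm t)^2 \<le> norm t powr (3/2)"
  proof (cases "t = 0")
   case False
   then have "(norm t)^2 = norm t powr 2" by (simp add: powr_numeral)
   also have "\<dots> \<le> norm t powr (3/2)" using False t1 by (intro powr_mono') auto
   finally show ?thesis .
  qed auto
  then have "51 / d^4 * (norm t)^2 \<le> 51 / d^4 * norm t powr (3/2)" using d by (intro mult_left_mono) auto
  then show ?thesis by simp
 qed
 finally show ?thesis .
qed

lemma norm_hgk_le:
 assumes d: "0 < d" "d \<le> 1" and x: "norm x \<le> 1 - d" and y: "norm y \<le> 1"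
 shows "norm (hgk x y) \<le> 1 / d^2"
proof -
 have N: "d^2 \<le> Nker x y" using Nker_ge_sq[of x d y] d x y by simp
 have d2: "0 < d^2" using d by simp
 have N0: "0 < Nker x y" using N d2 by linarith
 have "norm ((norm y)^2 *\<^sub>R x - y) \<le> (norm y)^2 * norm x + norm y" using norm_triangle_ineq4[of "(norm y)^2 *\<^sub>R x" y] by simp
 also have "(norm y)^2 * norm x \<le> 1 * 1" using x y d by (intro mult_mono) (auto simp: power_le_one)
 finally have n: "norm ((norm y)^2 *\<^sub>R x - y) \<le> 2" using y by simp
 have "norm (hgk x y) = (1/(2*pi)) / Nker x y * norm ((norm y)^2 *\<^sub>R x - y)"
  unfolding hgk_def using N0 by (simp add: abs_mult)
 also have "\<dots> \<le> (1/(2*pi)) / Nker x y * 2" using n N0 by (intro mult_left_mono) auto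
 also have "\<dots> \<le> 1 / Nker x y" using N0 pi_ge_two by (simp add: field_simps)
 also have "\<dots> \<le> 1 / d^2" using N mult_pos_pos[OF N0 d2] by (intro divide_left_mono) auto
 finally show ?thesis .
qed

lemma integrable_hgrad:
 assumes f: "bdens L 1 f" and x: "x \<in> D"
 shows "integrable lborel (\<lambda>y. f y *\<^sub>R hgk x y)"
proof (rule Bochner_Integration.integrable_bound)
 have [measurable]: "f \<in> borel_measurable borel" using f by (rule bdens_measurable)
 show "integrable lborel (\<lambda>y. 1 / (1 - norm x)^2 * \<bar>f y\<bar>)" using integrable_bdens[OF f] by simp
 show "(\<lambda>y. f y *\<^sub>R hgk x y) \<in> borel_measurable lborel" by simp
 show "AE y in lborel. norm (f y *\<^sub>R hgk x y) \<le> norm (1 / (1 - norm x)^2 * \<bar>f y\<bar>)" (is "AE x in _. ?P x")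
 proof (intro AE_I2)
  fix y show "?P y"
  proof (cases "y \<in> D")
   case True
   have "\<bar>f y\<bar> * norm (hgk x y) \<le> \<bar>f y\<bar> * (1 / (1 - norm x)^2)"
    using x True norm_hgk_le[of "1 - norm x" x y] by (intro mult_left_mono) (auto simp: D_iff)
   then show ?thesis by simp
  qed (simp add: bdens_D[OF f])
 qed
qed

lemma norm_hgrad_le:
 assumes f: "bdens L 1 f" and d: "0 < d" "d \<le> 1" and x: "norm x \<le> 1 - d"
 shows "norm (hgrad f x) \<le> 1 / d^2 * (LBINT y. \<bar>f y\<bar>)"
proof -
 have xD: "x \<in> D" using x d by (simp add: D_iff)
 have "norm (hgrad f x) \<le> (LBINT y. norm (f y *\<^sub>R hgk x y))" unfolding hgrad_def by (rule integral_norm_bound)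
 also have "\<dots> \<le> (LBINT y. 1 / d^2 * \<bar>f y\<bar>)"
 proof (rule integral_mono)
  show "integrable lborel (\<lambda>y. norm (f y *\<^sub>R hgk x y))" using integrable_hgrad[OF f xD] by (rule integrable_norm)
  show "integrable lborel (\<lambda>y. 1 / d^2 * \<bar>f y\<bar>)" using integrable_bdens[OF f] by simp
  fix y show "norm (f y *\<^sub>R hgk x y) \<le> 1 / d^2 * \<bar>f y\<bar>"
  proof (cases "y \<in> D")
   case True
   have "\<bar>f y\<bar> * norm (hgk x y) \<le> \<bar>f y\<bar> * (1 / d^2)"
    using True norm_hgk_le[OF d x, of y] by (intro mult_left_mono) (auto simp: D_iff)
   then show ?thesis by simp
  qed (simp add: bdens_D[OF f])
 qed
 finally show ?thesis by simp
qed

lemma hpot_has_derivative: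
 assumes f: "bdens L 1 f" and x: "x \<in> D"
 shows "(hpot f has_derivative (\<lambda>t. hgrad f x \<bullet> t)) (at x)"
proof -
 define d where "d = 1 - norm x"
 have d: "0 < d" "d \<le> 1" "norm x \<le> 1 - d" using x by (auto simp: d_def D_iff)
 have dd: "0 < d^2 / 10" "d^2 / 10 < d"
  using d by (auto simp: power2_eq_square)
 show ?thesis
 proof (rule has_derivative_of_remainder[OF dd(1)])
  fix t :: pt assume t: "norm t < d^2 / 10"
  have xt: "x + t \<in> D" using t dd norm_triangle_ineq[of x t] by (simp add: D_iff d_def)
  have ig: "integrable lborel (\<lambda>y. (f y *\<^sub>R hgk x y) \<bullet> t)"
   by (intro integrable_inner_left integrable_hgrad[OF f x])
  have "hgrad f x \<bullet> t = (LBINT y. (f y *\<^sub>R hgk x y) \<bullet> t)"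
   unfolding hgrad_def by (rule integral_inner_left[symmetric]) (rule integrable_hgrad[OF f x])
  then have eq: "hpot f (x + t) - hpot f x - hgrad f x \<bullet> t = (LBINT y. hreg (x + t) y * f y - hreg x y * f y - (f y *\<^sub>R hgk x y) \<bullet> t)"
   unfolding hpot_def using integrable_hpot[OF f x] integrable_hpot[OF f xt] ig by simp
  have "\<bar>hpot f (x + t) - hpot f x - hgrad f x \<bullet> t\<bar> \<le> (LBINT y. \<bar>hreg (x + t) y * f y - hreg x y * f y - (f y *\<^sub>R hgk x y) \<bullet> t\<bar>)"
   unfolding eq by (rule integral_abs_bound)
  also have "\<dots> \<le> (LBINT y. 51 / d^4 * norm t powr (3/2) * \<bar>f y\<bar>)"
  proof (rule integral_mono)
   show "integrable lborel (\<lambda>y. \<bar>hreg (x + t) y * f y - hreg x y * f y - (f y *\<^sub>R hgk x y) \<bullet> t\<bar>)"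
    by (intro integrable_abs Bochner_Integration.integrable_diff integrable_hpot[OF f] x xt ig)
   show "integrable lborel (\<lambda>y. 51 / d^4 * norm t powr (3/2) * \<bar>f y\<bar>)" using integrable_bdens[OF f] by simp
   fix y
   show "\<bar>hreg (x + t) y * f y - hreg x y * f y - (f y *\<^sub>R hgk x y) \<bullet> t\<bar> \<le> 51 / d^4 * norm t powr (3/2) * \<bar>f y\<bar>"
   proof (cases "y \<in> D")
    case True
    have "hreg (x + t) y * f y - hreg x y * f y - (f y *\<^sub>R hgk x y) \<bullet> t = (hreg (x + t) y - hreg x y - hgk x y \<bullet> t) * f y"
     by (simp add: algebra_simps)
    moreover have "\<bar>hreg (x + t) y - hreg x y - hgk x y \<bullet> t\<bar> * \<bar>f y\<bar> \<le> (51 / d^4 * norm t powr (3/2)) * \<bar>f y\<bar>"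
     using True t d by (intro mult_right_mono hreg_remainder) (auto simp: D_iff)
    ultimately show ?thesis by (simp only: abs_mult)
   qed (simp add: bdens_D[OF f])
  qed
  also have "\<dots> = (51 / d^4 * (LBINT y. \<bar>f y\<bar>)) * norm t powr (3/2)" by simp
  finally show "\<bar>hpot f (x + t) - hpot f x - hgrad f x \<bullet> t\<bar> \<le> (51 / d^4 * (LBINT y. \<bar>f y\<bar>)) * norm t powr (3/2)" .
 qed
qed

lemma hpot_lipschitz:
 assumes f: "bdens L 1 f" and d: "0 < d" "d \<le> 1" and x: "norm x \<le> 1 - d" "norm x' \<le> 1 - d"
 shows "\<bar>hpot f x - hpot f x'\<bar> \<le> 1 / d^2 * (LBINT y. \<bar>f y\<bar>) * norm (x - x')"
proof -
 have "norm (hpot f x - hpot f x') \<le> (1 / d^2 * (LBINT y. \<bar>f y\<bar>)) * norm (x - x')"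
 proof (rule differentiable_bound)
  show "convex (cball (0::pt) (1 - d))" by simp
  show "(hpot f has_derivative (\<lambda>t. hgrad f u \<bullet> t)) (at u within cball 0 (1 - d))" if "u \<in> cball 0 (1 - d)" for u
  proof -
   have "u \<in> D" using that d by (simp add: D_iff)
   from has_derivative_at_withinI[OF hpot_has_derivative[OF f this]] show ?thesis .
  qed
  show "onorm (\<lambda>t. hgrad f u \<bullet> t) \<le> 1 / d^2 * (LBINT y. \<bar>f y\<bar>)" if "u \<in> cball 0 (1 - d)" for u
  proof (rule onorm_le)
   fix t
   have "norm (hgrad f u \<bullet> t) \<le> norm (hgrad f u) * norm t" using Cauchy_Schwarz_ineq2 by (simp add: real_norm_def)
   also have "\<dots> \<le> 1 / d^2 * (LBINT y. \<bar>f y\<bar>) * norm t"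
    using that by (intro mult_right_mono norm_hgrad_le[OF f d]) auto
   finally show "norm (hgrad f u \<bullet> t) \<le> 1 / d^2 * (LBINT y. \<bar>f y\<bar>) * norm t" .
  qed
 qed (use x in auto)
 then show ?thesis by simp
qed

definition pgrad :: "real => (pt => real) => pt => pt" where
 "pgrad Om f x = - (1/(2*pi)) *\<^sub>R lgrad f x - hgrad f x + Om *\<^sub>R x"

lemma psi0_eq:
 assumes f: "bdens L 1 f" and x: "x \<in> D"
 shows "psi0 Om f x = - (1/(2*pi)) * lpot f x - hpot f x + Om/2 * (norm x)^2"
 unfolding psi0_def Gop_eq[OF f x] by simp

lemma psi0_has_derivative:
 assumes f: "bdens L 1 f" and x: "x \<in> D"
 shows "(psi0 Om f has_derivative (\<lambda>t. pgrad Om f x \<bullet> t)) (at x)"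
proof -
 have n: "((\<lambda>x::pt. Om/2 * (norm x)^2) has_derivative (\<lambda>t. Om * (x \<bullet> t))) (at x)"
  unfolding power2_norm_eq_inner by (auto intro!: derivative_eq_intros simp: inner_commute)
 have "((\<lambda>x. - (1/(2*pi)) * lpot f x - hpot f x + Om/2 * (norm x)^2) has_derivative
   (\<lambda>t. - (1/(2*pi)) * (lgrad f x \<bullet> t) - hgrad f x \<bullet> t + Om * (x \<bullet> t))) (at x)"
  by (intro has_derivative_add has_derivative_diff n has_derivative_mult_right lpot_has_derivative[OF f] hpot_has_derivative[OF f x])
 then have "((\<lambda>x. - (1/(2*pi)) * lpot f x - hpot f x + Om/2 * (norm x)^2) has_derivative (\<lambda>t. pgrad Om f x \<bullet> t)) (at x)"
  unfolding pgrad_def inner_add_left inner_diff_left inner_scaleR_left .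
 then show ?thesis
 proof (rule has_derivative_transform_within_open)
  show "open D" by (simp add: D_def)
  show "x \<in> D" by fact
 qed (simp add: psi0_eq[OF f])
qed

lemma grad_eq:
 assumes "(f has_derivative (\<lambda>t. g \<bullet> t)) (at x)" shows "grad f x = g"
proof -
 have "frechet_derivative f (at x) = (\<lambda>t. g \<bullet> t)" using frechet_derivative_at[OF assms] by simp
 then show ?thesis unfolding grad_def by (simp add: vec_eq_iff inner_axis)
qed

lemma psi0_lipschitz:
 assumes f: "bdens L 1 f" and d: "0 < d" "d \<le> 1"
 obtains C where "0 < C" "\<And>x x'. norm x \<le> 1 - d ==> norm x' \<le> 1 - d ==> \<bar>psi0 Om f x - psi0 Om f x'\<bar> \<le> C * norm (x - x')"
proof -
 define C where "C = (1/(2*pi)) * (80 * L * 2) + 1 / d^2 * (LBINT y. \<bar>f y\<bar>) + \<bar>Om\<bar>"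
 have L0: "0 \<le> L" using bdens_nonneg[OF f] .
 have C0: "0 \<le> C" unfolding C_def using L0 by (intro add_nonneg_nonneg mult_nonneg_nonneg) auto
 have "\<bar>psi0 Om f x - psi0 Om f x'\<bar> \<le> (C + 1) * norm (x - x')" if x: "norm x \<le> 1 - d" "norm x' \<le> 1 - d" for x x'
 proof -
  have xD: "x \<in> D" "x' \<in> D" using x d by (auto simp: D_iff)
  have 1: "\<bar>lpot f x - lpot f x'\<bar> \<le> 80 * L * 2 * norm (x - x')" by (rule lpot_lipschitz[OF f]) (use x d in auto)
  have 2: "\<bar>hpot f x - hpot f x'\<bar> \<le> 1 / d^2 * (LBINT y. \<bar>f y\<bar>) * norm (x - x')" by (rule hpot_lipschitz[OF f d x])
  have 3: "\<bar>(norm x)^2 - (norm x')^2\<bar> \<le> 2 * norm (x - x')"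
  proof -
   have "(norm x)^2 - (norm x')^2 = (norm x + norm x') * (norm x - norm x')" by (simp add: power2_eq_square algebra_simps)
   then have "\<bar>(norm x)^2 - (norm x')^2\<bar> = (norm x + norm x') * \<bar>norm x - norm x'\<bar>" by (simp add: abs_mult)
   also have "\<dots> \<le> 2 * norm (x - x')" using x d norm_triangle_ineq3[of x x'] by (intro mult_mono) auto
   finally show ?thesis .
  qed
  have "\<bar>psi0 Om f x - psi0 Om f x'\<bar> = \<bar>- (1/(2*pi)) * (lpot f x - lpot f x') - (hpot f x - hpot f x') + Om/2 * ((norm x)^2 - (norm x')^2)\<bar>"
   unfolding psi0_eq[OF f xD(1)] psi0_eq[OF f xD(2)] right_diff_distrib
   by (rule arg_cong[where f=abs]) (simp add: algebra_simps)
  also have "\<dots> \<le> (1/(2*pi)) * \<bar>lpot f x - lpot f x'\<bar> + \<bar>hpot f x - hpot f x'\<bar> + \<bar>Om\<bar>/2 * \<bar>(norm x)^2 - (norm x')^2\<bar>"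
  proof -
   have "\<bar>- (1/(2*pi)) * (lpot f x - lpot f x')\<bar> = (1/(2*pi)) * \<bar>lpot f x - lpot f x'\<bar>" by (simp add: abs_mult)
   moreover have "\<bar>Om/2 * ((norm x)^2 - (norm x')^2)\<bar> = \<bar>Om\<bar>/2 * \<bar>(norm x)^2 - (norm x')^2\<bar>" by (simp add: abs_mult)
   ultimately show ?thesis by linarith
  qed
  also have "\<dots> \<le> (1/(2*pi)) * (80 * L * 2 * norm (x - x')) + 1 / d^2 * (LBINT y. \<bar>f y\<bar>) * norm (x - x') + \<bar>Om\<bar>/2 * (2 * norm (x - x'))"
   by (intro add_mono mult_left_mono 1 2 3) auto
  also have "\<dots> = C * norm (x - x')" unfolding C_def by (simp add: algebra_simps)
  also have "\<dots> \<le> (C + 1) * norm (x - x')" by (simp add: algebra_simps)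
  finally show ?thesis .
 qed
 then show thesis using that[of "C + 1"] C0 by simp
qed

section \<open>Existence of maximizers\<close>

text \<open>Pointwise Borel version of the admissible class, extended by 0 off the disk. Each member
  of \<open>Kset\<close> agrees almost everywhere on the disk with such a function, see
  \<open>Kset_representative\<close>.\<close>

definition adm :: "real => (pt => real) => bool" where
 "adm lam v \<longleftrightarrow> v \<in> borel_measurable borel \<and> (\<forall>x. 0 \<le> v x \<and> v x \<le> lam) \<and> (\<forall>x. x \<notin> D --> v x = 0)
   \<and> (LBINT x. v x) = 1"

definition amax :: "real => real => (pt => real) => bool" where
 "amax Om lam v \<longleftrightarrow> adm lam v \<and> (\<forall>u. adm lam u --> Efun Om u \<le> Efun Om v)"

lemma adm_bdens: "adm lam v ==> bdens lam 1 v"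
 by (auto simp: adm_def bdens_def D_def)

section \<open>Borel representatives of admissible classes\<close>

lemma AE_lebesgue_on_D: "(AE x in lebesgue_on D. P x) \<longleftrightarrow> (AE x in lborel. x \<in> D --> P x)"
 by (subst AE_restrict_space_iff) (auto simp: AE_completion_iff)

lemma measurable_lebesgue_on_D: "f \<in> borel_measurable borel ==> f \<in> borel_measurable (lebesgue_on D)"
 by (intro measurable_restrict_space1 measurable_completion) simp

lemma adm_Kset:
 assumes "adm lam v" shows "v \<in> Kset lam"
proof -
 have "(LINT x|lebesgue_on D. v x) = (LBINT x. v x)"
  by (rule LINT_lebesgue_on_D) (use assms in \<open>auto simp: adm_def\<close>)
 moreover have "v \<in> borel_measurable (lebesgue_on D)" using assms by (intro measurable_lebesgue_on_D) (simp add: adm_def)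
 ultimately show ?thesis using assms unfolding Kset_def adm_def by simp
qed

lemma LINT_lebesgue_on_cong_AE:
 fixes f g :: "pt => 'b::{banach, second_countable_topology}"
 assumes "AE x in lebesgue_on D. w x = v x" "w \<in> borel_measurable (lebesgue_on D)" "v \<in> borel_measurable (lebesgue_on D)"
  "f \<in> borel_measurable (lebesgue_on D)"
 shows "(LINT x|lebesgue_on D. w x *\<^sub>R f x) = (LINT x|lebesgue_on D. v x *\<^sub>R f x)"
 by (rule integral_cong_AE) (use assms in \<open>auto elim!: eventually_mono\<close>)

lemma Kset_representative:
 assumes w: "w \<in> Kset lam" and lam: "0 \<le> lam"
 obtains v where "adm lam v" "AE x in lebesgue_on D. w x = v x"
proof -
 have wm: "w \<in> borel_measurable (lebesgue_on D)" and wb: "AE x in lebesgue_on D. 0 \<le> w x \<and> w x \<le> lam"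
  and w1: "(LINT x|lebesgue_on D. w x) = 1" using w by (auto simp: Kset_def)
 have "(\<lambda>x. if x \<in> D then w x else 0) \<in> borel_measurable lebesgue"
  using wm by (subst borel_measurable_if) auto
 then obtain u where u [measurable]: "u \<in> borel_measurable lborel" "AE x in lborel. (if x \<in> D then w x else 0) = u x"
  using completion_ex_borel_measurable_real by blast
 define v where "v x = indicator D x * max 0 (min lam (u x))" for x
 have vm [measurable]: "v \<in> borel_measurable borel" unfolding v_def using u(1) by measurable
 have ae: "AE x in lebesgue_on D. w x = v x"
  using wb u(2) unfolding AE_lebesgue_on_D
  by eventually_elim (auto simp: v_def)
 have "(LINT x|lebesgue_on D. v x) = (LINT x|lebesgue_on D. w x)"
  by (rule integral_cong_AE) (use ae wm measurable_lebesgue_on_D[OF vm] in \<open>auto elim!: eventually_mono\<close>)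
 moreover have "(LINT x|lebesgue_on D. v x) = (LBINT x. v x)"
  by (rule LINT_lebesgue_on_D) (auto simp: v_def)
 ultimately have "adm lam v" using w1 lam by (auto simp: adm_def v_def split: split_indicator)
 then show thesis using ae by (rule that)
qed

context
 fixes w v :: "pt => real" and lam :: real
 assumes w: "w \<in> Kset lam" and v: "adm lam v" and wv: "AE x in lebesgue_on D. w x = v x"
begin

lemma representative_measurable:
 "w \<in> borel_measurable (lebesgue_on D)" "v \<in> borel_measurable (lebesgue_on D)"
 using w v by (auto simp: Kset_def adm_def intro!: measurable_lebesgue_on_D)

lemma representative_Gop: "Gop w = Gop v"
proof
 fix x
 have "(LINT y|lebesgue_on D. w y *\<^sub>R Gfun x y) = (LINT y|lebesgue_on D. v y *\<^sub>R Gfun x y)"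
  by (rule LINT_lebesgue_on_cong_AE[OF wv representative_measurable]) (auto intro!: measurable_lebesgue_on_D)
 then show "Gop w x = Gop v x" by (simp add: Gop_def mult.commute)
qed

lemma representative_psi0: "psi0 Om w = psi0 Om v"
 by (simp add: fun_eq_iff psi0_def representative_Gop)

lemma representative_Efun: "Efun Om w = Efun Om v"
proof -
 have "(LINT x|lebesgue_on D. w x *\<^sub>R Gop v x) = (LINT x|lebesgue_on D. v x *\<^sub>R Gop v x)"
  by (rule LINT_lebesgue_on_cong_AE[OF wv representative_measurable])
    (auto intro!: measurable_lebesgue_on_D measurable_Gop[OF adm_bdens[OF v]])
 moreover have "(LINT x|lebesgue_on D. w x *\<^sub>R (norm x)^2) = (LINT x|lebesgue_on D. v x *\<^sub>R (norm x)^2)"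
  by (rule LINT_lebesgue_on_cong_AE[OF wv representative_measurable]) (auto intro!: measurable_lebesgue_on_D)
 ultimately show ?thesis by (simp add: Efun_def representative_Gop mult.commute)
qed

lemma representative_center: "center w = (LBINT x. v x *\<^sub>R x)"
proof -
 have "center w = (LINT x|lebesgue_on D. v x *\<^sub>R x)" unfolding center_def
  by (rule LINT_lebesgue_on_cong_AE[OF wv representative_measurable]) (auto intro!: measurable_lebesgue_on_D)
 also have "\<dots> = (LBINT x. v x *\<^sub>R x)"
  by (rule LINT_lebesgue_on_D) (use v in \<open>auto simp: adm_def\<close>)
 finally show ?thesis .
qed

lemma representative_maximizer:
 assumes "maximizer Om lam w" shows "amax Om lam v"
 unfolding amax_def
proof (intro conjI allI impI v)
 fix u assume "adm lam u"
 then have "Efun Om u \<le> Efun Om w" using assms adm_Kset by (auto simp: maximizer_def)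
 then show "Efun Om u \<le> Efun Om v" by (simp add: representative_Efun)
qed

end

lemma amax_maximizer:
 assumes v: "amax Om lam v" and lam: "0 \<le> lam" shows "maximizer Om lam v"
 unfolding maximizer_def
proof (intro conjI ballI)
 show "v \<in> Kset lam" using v by (auto simp: amax_def intro: adm_Kset)
 fix w assume w: "w \<in> Kset lam"
 obtain u where u: "adm lam u" "AE x in lebesgue_on D. w x = u x" using Kset_representative[OF w lam] .
 show "Efun Om w \<le> Efun Om v" using representative_Efun[OF w u] u v by (simp add: amax_def)
qed

section \<open>The direct method and variations of a maximizer\<close>

lemma bdens_indicator_D: "bdens 1 1 (indicator D)"
 by (auto simp: bdens_def D_def split: split_indicator)

lemma adm_integral_norm2_le:
 assumes v: "adm lam v" shows "0 \<le> (LBINT x. (norm x)^2 * v x)" "(LBINT x. (norm x)^2 * v x) \<le> 1"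
proof -
 show "0 \<le> (LBINT x. (norm x)^2 * v x)" using v by (intro Bochner_Integration.integral_nonneg) (auto simp: adm_def)
 have "(LBINT x. (norm x)^2 * v x) \<le> (LBINT x. v x)"
 proof (rule integral_mono[OF integrable_norm2_mult[OF adm_bdens[OF v]] integrable_bdens[OF adm_bdens[OF v]]])
  fix x show "(norm x)^2 * v x \<le> v x"
  proof (cases "x \<in> D")
   case True
   then have "(norm x)^2 \<le> 1" by (simp add: D_iff abs_square_le_1)
   then show ?thesis using v by (simp add: adm_def mult_left_le_one_le)
  qed (use v in \<open>simp add: adm_def\<close>)
 qed
 then show "(LBINT x. (norm x)^2 * v x) \<le> 1" using v by (simp add: adm_def)
qed

lemma Efun_bounded:
 assumes v: "adm lam v" shows "Efun Om v \<le> 40 * lam + \<bar>Om\<bar>"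
proof -
 have lam: "0 \<le> lam" using bdens_nonneg[OF adm_bdens[OF v]] .
 have "Gq v v \<le> (LBINT x. 80 * lam * v x)" unfolding Gq_def
 proof (rule integral_mono)
  show "integrable lborel (\<lambda>x. Gop v x * v x)" by (rule integrable_Gop_mult[OF adm_bdens[OF v] adm_bdens[OF v]])
  show "integrable lborel (\<lambda>x. 80 * lam * v x)" using integrable_bdens[OF adm_bdens[OF v]] by simp
  fix x show "Gop v x * v x \<le> 80 * lam * v x"
  proof (cases "x \<in> D")
   case True
   then show ?thesis using Gop_bound(2)[OF adm_bdens[OF v] True] v by (intro mult_right_mono) (auto simp: adm_def)
  qed (use v in \<open>simp add: adm_def\<close>)
 qed
 also have "\<dots> = 80 * lam" using v by (simp add: adm_def)
 finally have 1: "Gq v v \<le> 80 * lam" .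
 have "Om/2 * (LBINT x. (norm x)^2 * v x) \<le> \<bar>Om\<bar>/2 * 1"
  using adm_integral_norm2_le[OF v] by (intro mult_mono) auto
 then show ?thesis using 1 unfolding Efun_eq[OF adm_bdens[OF v]] by simp
qed

lemma amax_exists:
 assumes lam: "1/pi < lam"
 obtains v where "amax Om lam v"
proof -
 have l0: "0 < lam" using lam pi_gt_zero by (smt (verit) divide_pos_pos)
 define E where "E = Efun Om ` {u. adm lam u}"
 \<comment> \<open>The constant density 1/pi shows that the class is nonempty; this is where lam >
   1/pi enters.\<close>
 have "adm lam (\<lambda>x. (1/pi) * indicator D x)"
 proof -
  have "measure lborel D = pi" unfolding D_def using measure_ball_pt[of 1 0] by simp
  then show ?thesis using lam l0 by (auto simp: adm_def split: split_indicator)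
 qed
 then have ne: "E \<noteq> {}" by (auto simp: E_def)
 have bdd: "bdd_above E" unfolding bdd_above_def E_def using Efun_bounded by auto
 define S where "S = Sup E"
 have "\<exists>u. adm lam u \<and> S - 1 / Suc n < Efun Om u" for n
 proof -
  have "S - 1 / Suc n < Sup E" by (simp add: S_def)
  then obtain e where "e \<in> E" "S - 1 / Suc n < e" using less_cSup_iff[OF ne bdd] by blast
  then show ?thesis by (auto simp: E_def)
 qed
 then obtain u where u: "\<And>n. adm lam (u n)" "\<And>n. S - 1 / Suc n < Efun Om (u n)" by metis
 have uS: "Efun Om (u n) \<le> S" for n unfolding S_def using u(1) bdd by (intro cSup_upper) (auto simp: E_def)
 have fin: "emeasure lborel D < \<infinity>" unfolding D_def by (intro emeasure_bounded_finite bounded_ball)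
 obtain k v where k: "strict_mono (k::nat=>nat)" and v: "v \<in> borel_measurable borel" "\<And>x. 0 \<le> v x" "\<And>x. v x \<le> lam" "\<And>x. x \<notin> D ==> v x = 0"
  and conv: "\<And>f. integrable lborel f ==> (\<lambda>n. LBINT x. f x * u (k n) x) \<longlonglongrightarrow> (LBINT x. f x * v x)"
 proof (rule weak_star_compactness[of u lam D])
  show "u n \<in> borel_measurable borel" "0 \<le> u n x" "u n x \<le> lam" for n x using u(1)[of n] by (auto simp: adm_def)
  show "x \<notin> D ==> u n x = 0" for n x using u(1)[of n] by (auto simp: adm_def)
  show "D \<in> sets borel" by simp
  show "emeasure lborel D < \<infinity>" by (rule fin)
 qed blast
 have iD: "integrable lborel (indicator D :: pt => real)" unfolding D_def by (rule integrable_indicator_ball)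
 have u0: "x \<notin> D --> u n x = 0" for n x using u(1)[of n] by (auto simp: adm_def)
 have v0: "x \<notin> D --> v x = 0" for x using v by auto
 have uD: "a * indicator D x * u n x = a * u n x" for a n x using u0[of x n] by (auto split: split_indicator)
 have vD: "a * indicator D x * v x = a * v x" for a x using v0[of x] by (auto split: split_indicator)
 have v1: "(LBINT x. v x) = 1"
 proof -
  have "(\<lambda>n. LBINT x. (1 * indicator D x) * u (k n) x) \<longlonglongrightarrow> (LBINT x. (1 * indicator D x) * v x)"
   by (rule conv) (use iD in simp)
  then have "(\<lambda>n. LBINT x. u (k n) x) \<longlonglongrightarrow> (LBINT x. v x)"
   unfolding uD vD by simp
  moreover have "(LBINT x. u (k n) x) = 1" for n using u(1) by (simp add: adm_def)
  ultimately show ?thesis by (simp add: LIMSEQ_const_iff)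
 qed
 have vadm: "adm lam v" using v v1 by (simp add: adm_def)
 have c1: "(\<lambda>n. LBINT x. (norm x)^2 * u (k n) x) \<longlonglongrightarrow> (LBINT x. (norm x)^2 * v x)"
 proof -
  have "(\<lambda>n. LBINT x. ((norm x)^2 * indicator D x) * u (k n) x) \<longlonglongrightarrow> (LBINT x. ((norm x)^2 * indicator D x) * v x)"
   by (rule conv) (rule integrable_norm2_mult[OF bdens_indicator_D])
  then show ?thesis unfolding uD vD .
 qed
 have c2: "(\<lambda>n. Gq (u (k n)) (u (k n))) \<longlonglongrightarrow> Gq v v"
 proof -
  have "(\<lambda>n. LBINT x. (LBINT y. (\<lambda>(x,y). Gfun x y) (x,y) * u (k n) y) * u (k n) x) \<longlonglongrightarrow> (LBINT x. (LBINT y. (\<lambda>(x,y). Gfun x y) (x,y) * v y) * v x)"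
  proof (rule weak_star_double_integral[where S=D and L=lam])
   show "u (k n) \<in> borel_measurable borel" "\<bar>u (k n) x\<bar> \<le> lam" for n x using u(1)[of "k n"] by (auto simp: adm_def)
   have "(\<lambda>(x, y). indicator D x * indicator D y * (case (x, y) of (x, y) => Gfun x y)) = (\<lambda>(x,y). Gfun x y * indicator D y * indicator D x)"
    by (auto simp: fun_eq_iff)
   then show "integrable (lborel \<Otimes>\<^sub>M lborel) (\<lambda>(x, y). indicator D x * indicator D y * (case (x, y) of (x, y) => Gfun x y))"
    using integrable_Gfun_pair[OF bdens_indicator_D bdens_indicator_D] by simp
  qed (use v u0 conv in auto)
  then show ?thesis unfolding Gq_def using Gop_eq_lborel[OF adm_bdens[OF u(1)]] Gop_eq_lborel[OF adm_bdens[OF vadm]] by simp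
 qed
 have "(\<lambda>n. Efun Om (u (k n))) \<longlonglongrightarrow> Efun Om v"
  unfolding Efun_eq[OF adm_bdens[OF u(1)]] Efun_eq[OF adm_bdens[OF vadm]]
  by (intro tendsto_add tendsto_mult tendsto_const c1 c2)
 moreover have "(\<lambda>n. Efun Om (u (k n))) \<longlonglongrightarrow> S"
 proof (rule tendsto_sandwich[OF _ _ _ tendsto_const])
  show "\<forall>\<^sub>F n in sequentially. S - 1 / Suc (k n) \<le> Efun Om (u (k n))" by (intro always_eventually allI less_imp_le u(2))
  show "\<forall>\<^sub>F n in sequentially. Efun Om (u (k n)) \<le> S" using uS by auto
  have "(\<lambda>n. S - 1 / real (Suc n)) \<longlonglongrightarrow> S - 0" by (intro tendsto_diff tendsto_const LIMSEQ_inverse_real_of_nat[unfolded inverse_eq_divide])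
  from LIMSEQ_subseq_LIMSEQ[OF this k] show "(\<lambda>n. S - 1 / real (Suc (k n))) \<longlonglongrightarrow> S" by (simp add: o_def)
 qed
 ultimately have "Efun Om v = S" by (rule LIMSEQ_unique)
 then have "amax Om lam v" unfolding amax_def
  using vadm bdd by (auto simp: S_def E_def intro!: cSup_upper)
 then show thesis by (rule that)
qed

lemma amax_variation:
 assumes v: "amax Om lam v" and g: "bdens M 1 g" and a: "adm lam (\<lambda>x. v x + 1 * g x)"
 shows "(LBINT x. psi0 Om v x * g x) + Gq g g / 2 \<le> 0"
proof -
 have "bdens lam 1 v" using v by (simp add: amax_def adm_bdens)
 from Efun_add_scale[OF this g, of Om 1] v a show ?thesis by (auto simp: amax_def)
qed

lemma amax_first_variation:
 assumes v: "amax Om lam v" and g: "bdens M 1 g" and c0: "0 < c0" and a: "\<And>c. 0 < c ==> c \<le> c0 ==> adm lam (\<lambda>x. v x + c * g x)"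
 shows "(LBINT x. psi0 Om v x * g x) \<le> 0"
proof (rule ccontr)
 assume neg: "\<not> ?thesis"
 define I where "I = (LBINT x. psi0 Om v x * g x)"
 have I: "0 < I" using neg by (simp add: I_def)
 \<comment> \<open>Small enough that the quadratic term consumes at most half of the linear
   gain.\<close>
 define c where "c = min c0 (I / (\<bar>Gq g g\<bar> + 1))"
 have c: "0 < c" "c \<le> c0" "c \<le> I / (\<bar>Gq g g\<bar> + 1)" using c0 I by (auto simp: c_def)
 have "bdens lam 1 v" using v by (simp add: amax_def adm_bdens)
 from Efun_add_scale[OF this g, of Om c] v a[OF c(1,2)] have "c * I + c^2/2 * Gq g g \<le> 0"
  unfolding I_def by (auto simp: amax_def)
 then have "c * (I + c/2 * Gq g g) \<le> 0" by (simp add: power2_eq_square algebra_simps)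
 then have 1: "I + c/2 * Gq g g \<le> 0" using c(1) by (simp add: mult_le_0_iff)
 have "c * (\<bar>Gq g g\<bar> + 1) \<le> I" using c(3) by (simp add: pos_le_divide_eq)
 then have "c * \<bar>Gq g g\<bar> \<le> I" using c(1) by (simp add: distrib_left)
 moreover have "- (c * \<bar>Gq g g\<bar>) \<le> c * Gq g g" using mult_left_mono[OF abs_ge_minus_self[of "Gq g g"], of c] c(1) by simp
 ultimately show False using 1 I by simp
qed

section \<open>Exchange of mass and level sets\<close>

text \<open>Unit mass spread evenly over \<open>P\<close>: integrating against it is averaging, so
  pointwise bounds on \<open>P\<close> carry over without constants.\<close>

definition unif :: "pt set => pt => real" where
 "unif P x = indicator P x / measure lborel P"

lemma fmeasurable_subset_D: "P \<in> sets borel ==> P \<subseteq> D ==> P \<in> fmeasurable lborel"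
 using bounded_subset[of D P] emeasure_bounded_finite[of P] by (auto simp: fmeasurable_def D_def)

lemma bdens_unif:
 assumes "P \<in> sets borel" "P \<subseteq> D" shows "bdens (1 / measure lborel P) 1 (unif P)"
proof -
 have "unif P \<in> borel_measurable borel" unfolding unif_def[abs_def] using assms by measurable
 moreover have "\<bar>unif P x\<bar> \<le> 1 / measure lborel P" for x by (simp add: unif_def split: split_indicator)
 moreover have "unif P x = 0" if "x \<notin> ball 0 1" for x
  using that assms by (auto simp: unif_def D_def split: split_indicator)
 ultimately show ?thesis by (simp add: bdens_def)
qed

lemma integral_unif:
 assumes "P \<in> sets borel" "P \<subseteq> D" "0 < measure lborel P" shows "(LBINT x. unif P x) = 1"
 using assms by (simp add: unif_def)

text \<open>\<open>\<kappa>\<close> is the room on both sides: below the ceiling \<open>lam\<close>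
  on \<open>P\<close> and above 0 on \<open>Q\<close>. Moving mass \<open>c\<close> changes the
  density by \<open>c\<close> divided by the respective area, which the bounds on \<open>c\<close>
  keep within that room.\<close>

lemma adm_swap:
 assumes v: "adm lam v" and P: "P \<in> sets borel" "P \<subseteq> D" "0 < measure lborel P"
  and Q: "Q \<in> sets borel" "Q \<subseteq> D" "0 < measure lborel Q"
  and rP: "\<And>x. x \<in> P ==> v x \<le> lam - \<kappa>" and rQ: "\<And>x. x \<in> Q ==> \<kappa> \<le> v x"
  and c: "0 \<le> c" "c \<le> \<kappa> * measure lborel P" "c \<le> \<kappa> * measure lborel Q"
 shows "adm lam (\<lambda>x. v x + c * (unif P x - unif Q x))"
proof -
 have 1: "c / measure lborel P \<le> \<kappa>" "c / measure lborel Q \<le> \<kappa>" using c P Q by (auto simp: divide_le_eq)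
 have 2: "0 \<le> c / measure lborel P" "0 \<le> c / measure lborel Q" using c P Q by auto
 have e: "c * (unif P x - unif Q x) = indicator P x * (c / measure lborel P) - indicator Q x * (c / measure lborel Q)" for x
  by (simp add: unif_def right_diff_distrib mult.commute)
 have b: "0 \<le> v x + c * (unif P x - unif Q x) \<and> v x + c * (unif P x - unif Q x) \<le> lam" for x
 proof -
  have "0 \<le> v x" "v x \<le> lam" using v by (auto simp: adm_def)
  then show ?thesis unfolding e using rP[of x] rQ[of x] 1 2
   by (cases "x \<in> P"; cases "x \<in> Q") auto
 qed
 have [measurable]: "v \<in> borel_measurable borel" using v by (simp add: adm_def)
 have m: "(\<lambda>x. v x + c * (unif P x - unif Q x)) \<in> borel_measurable borel"
  using P Q unfolding unif_def by measurable
 have z: "v x + c * (unif P x - unif Q x) = 0" if "x \<notin> D" for x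
  using that v P Q by (auto simp: adm_def unif_def split: split_indicator)
 have "(LBINT x. v x + c * (unif P x - unif Q x)) = (LBINT x. v x) + c * ((LBINT x. unif P x) - (LBINT x. unif Q x))"
  using integrable_bdens[OF adm_bdens[OF v]] integrable_bdens[OF bdens_unif[OF P(1,2)]] integrable_bdens[OF bdens_unif[OF Q(1,2)]] by simp
 also have "\<dots> = 1" using v integral_unif[OF P] integral_unif[OF Q] by (simp add: adm_def)
 finally show ?thesis using b m z by (simp add: adm_def)
qed

lemma bdens_unif_diff:
 assumes P: "P \<in> sets borel" "P \<subseteq> D" and Q: "Q \<in> sets borel" "Q \<subseteq> D"
 shows "bdens (1 / measure lborel P + \<bar>-1\<bar> * (1 / measure lborel Q)) 1 (\<lambda>x. unif P x - unif Q x)"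
 using bdens_add_scale[OF bdens_unif[OF P] bdens_unif[OF Q], of "-1"] by simp

lemma integral_mult_unif_le:
 assumes P: "P \<in> sets borel" "P \<subseteq> D" "0 < measure lborel P" and i: "integrable lborel (\<lambda>x. f x * unif P x)"
  and le: "AE x in lborel. x \<in> P --> f x \<le> a"
 shows "(LBINT x. f x * unif P x) \<le> a"
proof -
 have "(LBINT x. f x * unif P x) \<le> (LBINT x. a * unif P x)"
 proof (rule integral_mono_AE[OF i])
  show "integrable lborel (\<lambda>x. a * unif P x)" using integrable_bdens[OF bdens_unif[OF P(1,2)]] by simp
  show "AE x in lborel. f x * unif P x \<le> a * unif P x" using le
   by eventually_elim (auto simp: unif_def divide_right_mono split: split_indicator)
 qed
 then show ?thesis using integral_unif[OF P] by simp
qed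

lemma integral_mult_unif_ge:
 assumes P: "P \<in> sets borel" "P \<subseteq> D" "0 < measure lborel P" and i: "integrable lborel (\<lambda>x. f x * unif P x)"
  and le: "AE x in lborel. x \<in> P --> a \<le> f x"
 shows "a \<le> (LBINT x. f x * unif P x)"
 using integral_mult_unif_le[OF P, of "\<lambda>x. - f x" "-a"] i le by simp

lemma Gop_unif_le:
 assumes P: "P \<in> sets borel" "P \<subseteq> D" "0 < measure lborel P" and x: "x \<in> D"
  and le: "\<And>y. y \<in> P ==> y \<noteq> 0 ==> y \<noteq> x ==> Gfun x y \<le> b"
 shows "Gop (unif P) x \<le> b"
 unfolding Gop_eq_lborel[OF bdens_unif[OF P(1,2)]]
proof (rule integral_mult_unif_le[OF P])
 show "integrable lborel (\<lambda>y. Gfun x y * unif P y)" by (rule integrable_Gop(1)[OF bdens_unif[OF P(1,2)] x])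
 show "AE y in lborel. y \<in> P --> Gfun x y \<le> b" using AE_lborel_neq[of 0] AE_lborel_neq[of x]
  by eventually_elim (use le in auto)
qed

lemma Gop_unif_ge:
 assumes P: "P \<in> sets borel" "P \<subseteq> D" "0 < measure lborel P" and x: "x \<in> D"
  and le: "\<And>y. y \<in> P ==> y \<noteq> 0 ==> y \<noteq> x ==> b \<le> Gfun x y"
 shows "b \<le> Gop (unif P) x"
 unfolding Gop_eq_lborel[OF bdens_unif[OF P(1,2)]]
proof (rule integral_mult_unif_ge[OF P])
 show "integrable lborel (\<lambda>y. Gfun x y * unif P y)" by (rule integrable_Gop(1)[OF bdens_unif[OF P(1,2)] x])
 show "AE y in lborel. y \<in> P --> b \<le> Gfun x y" using AE_lborel_neq[of 0] AE_lborel_neq[of x]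
  by eventually_elim (use le in auto)
qed

lemma measurable_psi0:
 assumes "bdens L 1 v" shows "psi0 Om v \<in> borel_measurable borel"
 unfolding psi0_def using measurable_Gop[OF assms] by measurable

text \<open>The sign \<open>\<sigma>\<close> tells whether the mass \<open>m\<close> moves into
  \<open>P\<close> or out of it. The second-order term of the energy is even in
  \<open>\<sigma>\<close>, so the self-interaction of \<open>P\<close> is a gain in both directions;
  maximality says that it cannot exceed the first-order loss, at most
  \<open>m * \<delta>\<close>.\<close>

lemma exchange_bound:
 assumes v: "amax Om lam v" and P: "P \<in> sets borel" "P \<subseteq> D" "0 < measure lborel P"
  and Q: "Q \<in> sets borel" "Q \<subseteq> D" "0 < measure lborel Q"
  and s: "\<sigma>^2 = 1" and m: "0 < m"
  and a: "adm lam (\<lambda>x. v x + (\<sigma> * m) * (unif P x - unif Q x))"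
  and psiP: "\<And>x. x \<in> P ==> psi0 Om v x = \<mu>" and psiQ: "\<And>x. x \<in> Q ==> \<sigma> * (psi0 Om v x - \<mu>) \<le> \<delta>"
  and PP: "\<And>x y. x \<in> P ==> y \<in> P ==> y \<noteq> 0 ==> y \<noteq> x ==> \<Lambda> \<le> Gfun x y"
  and PQ: "\<And>x y. x \<in> P ==> y \<in> Q ==> y \<noteq> 0 ==> y \<noteq> x ==> Gfun x y \<le> b"
 shows "m * (\<Lambda> - 2 * b) \<le> 2 * \<delta>"
proof -
 let ?p = "unif P" and ?q = "unif Q"
 have vb: "bdens lam 1 v" using v by (simp add: amax_def adm_bdens)
 note pb = bdens_unif[OF P(1,2)] and qb = bdens_unif[OF Q(1,2)]
 note gb = bdens_unif_diff[OF P(1,2) Q(1,2)]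
 have ip: "integrable lborel (\<lambda>x. psi0 Om v x * ?p x)" and iq: "integrable lborel (\<lambda>x. psi0 Om v x * ?q x)"
  by (rule integrable_psi0_mult[OF vb pb], rule integrable_psi0_mult[OF vb qb])
 define I where "I = (LBINT x. psi0 Om v x * (?p x - ?q x))"
 have I: "I = (LBINT x. psi0 Om v x * ?p x) - (LBINT x. psi0 Om v x * ?q x)"
  unfolding I_def using ip iq by (simp add: right_diff_distrib)
 have Ip: "(LBINT x. psi0 Om v x * ?p x) = \<mu>"
  using integral_mult_unif_le[OF P ip, of \<mu>] integral_mult_unif_ge[OF P ip, of \<mu>] psiP by force
 have "(LBINT x. (\<sigma> * (psi0 Om v x - \<mu>)) * ?q x) \<le> \<delta>"
 proof (rule integral_mult_unif_le[OF Q])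
  have "integrable lborel (\<lambda>x. \<sigma> * (psi0 Om v x * ?q x) - \<sigma> * \<mu> * ?q x)"
   using iq integrable_bdens[OF qb] by simp
  then show "integrable lborel (\<lambda>x. (\<sigma> * (psi0 Om v x - \<mu>)) * ?q x)" by (simp add: algebra_simps)
 qed (use psiQ in auto)
 moreover have "(LBINT x. (\<sigma> * (psi0 Om v x - \<mu>)) * ?q x) = \<sigma> * (LBINT x. psi0 Om v x * ?q x) - \<sigma> * \<mu>"
 proof -
  have "(LBINT x. (\<sigma> * (psi0 Om v x - \<mu>)) * ?q x) = (LBINT x. \<sigma> * (psi0 Om v x * ?q x) - \<sigma> * \<mu> * ?q x)"
   by (simp add: algebra_simps)
  then show ?thesis using iq integrable_bdens[OF qb] integral_unif[OF Q] by simp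
 qed
 ultimately have sI: "- \<delta> \<le> \<sigma> * I" unfolding I Ip by (simp add: algebra_simps)
 have E: "Efun Om (\<lambda>x. v x + (\<sigma> * m) * (?p x - ?q x)) = Efun Om v + (\<sigma> * m) * I + (\<sigma> * m)^2 / 2 * Gq (\<lambda>x. ?p x - ?q x) (\<lambda>x. ?p x - ?q x)"
  unfolding I_def by (rule Efun_add_scale[OF vb gb])
 have "Efun Om (\<lambda>x. v x + (\<sigma> * m) * (?p x - ?q x)) \<le> Efun Om v" using v a by (simp add: amax_def)
 then have 1: "m * (\<sigma> * I) + m^2 / 2 * Gq (\<lambda>x. ?p x - ?q x) (\<lambda>x. ?p x - ?q x) \<le> 0"
  unfolding E power_mult_distrib s by (simp add: algebra_simps)
 have G: "Gq (\<lambda>x. ?p x - ?q x) (\<lambda>x. ?p x - ?q x) = Gq ?p ?p - 2 * Gq ?q ?p + Gq ?q ?q"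
 proof -
  have e: "(\<lambda>x. ?p x - ?q x) = (\<lambda>x. ?p x + (-1) * ?q x)" by simp
  have g: "bdens (1 / measure lborel P + \<bar>-1\<bar> * (1 / measure lborel Q)) 1 (\<lambda>x. ?p x + (-1) * ?q x)" using gb unfolding e .
  have "Gq (\<lambda>x. ?p x + (-1) * ?q x) (\<lambda>x. ?p x + (-1) * ?q x) = Gq (\<lambda>x. ?p x + (-1) * ?q x) ?p + (-1) * Gq (\<lambda>x. ?p x + (-1) * ?q x) ?q"
   by (rule Gq_add_scale_right[OF pb qb g])
  also have "Gq (\<lambda>x. ?p x + (-1) * ?q x) ?p = Gq ?p (\<lambda>x. ?p x + (-1) * ?q x)" by (rule Gq_commute[OF g pb])
  also have "\<dots> = Gq ?p ?p + (-1) * Gq ?p ?q" by (rule Gq_add_scale_right[OF pb qb pb])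
  also have "Gq (\<lambda>x. ?p x + (-1) * ?q x) ?q = Gq ?q (\<lambda>x. ?p x + (-1) * ?q x)" by (rule Gq_commute[OF g qb])
  also have "\<dots> = Gq ?q ?p + (-1) * Gq ?q ?q" by (rule Gq_add_scale_right[OF pb qb qb])
  also have "Gq ?p ?q = Gq ?q ?p" by (rule Gq_commute[OF pb qb])
  finally show ?thesis unfolding e by simp
 qed
 have pp: "\<Lambda> \<le> Gq ?p ?p" unfolding Gq_def
 proof (rule integral_mult_unif_ge[OF P integrable_Gop_mult[OF pb pb]], intro AE_I2 impI)
  fix x assume "x \<in> P"
  then show "\<Lambda> \<le> Gop (unif P) x" using PP P by (intro Gop_unif_ge[OF P]) auto
 qed
 have qp: "Gq ?q ?p \<le> b" unfolding Gq_def
 proof (rule integral_mult_unif_le[OF P integrable_Gop_mult[OF qb pb]], intro AE_I2 impI)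
  fix x assume "x \<in> P"
  then show "Gop (unif Q) x \<le> b" using PQ P by (intro Gop_unif_le[OF Q]) auto
 qed
 have qq: "0 \<le> Gq ?q ?q" unfolding Gq_def
 proof (rule integral_mult_unif_ge[OF Q integrable_Gop_mult[OF qb qb]], intro AE_I2 impI)
  fix x assume "x \<in> Q"
  then show "0 \<le> Gop (unif Q) x" using Q Gop_nonneg[OF qb, of x] by (auto simp: unif_def)
 qed
 have "m * (- \<delta>) + m^2 / 2 * (\<Lambda> - 2 * b) \<le> m * (\<sigma> * I) + m^2 / 2 * Gq (\<lambda>x. ?p x - ?q x) (\<lambda>x. ?p x - ?q x)"
  unfolding G using sI m pp qp qq by (intro add_mono mult_left_mono) auto
 then have "m * (m * (\<Lambda> - 2 * b) - 2 * \<delta>) \<le> 0" using 1 by (simp add: power2_eq_square algebra_simps)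
 then show ?thesis using m by (simp add: mult_le_0_iff)
qed

text \<open>Two points of the ball are at most 2r apart, which makes the logarithm large, while the
  distance kept from the unit circle bounds the regular part.\<close>

lemma Gfun_ge_ball:
 assumes x0: "x0 \<in> D" and r: "0 < r" "r \<le> (1 - norm x0) / 2"
  and x: "x \<in> ball x0 r" and y: "y \<in> ball x0 r" "y \<noteq> 0" "y \<noteq> x"
 shows "(1/(2*pi)) * ln ((1 - norm x0) / 2 / (2 * r)) \<le> Gfun x y"
proof -
 define d where "d = (1 - norm x0) / 2"
 have d: "0 < d" using x0 by (simp add: d_def D_iff)
 have "norm u \<le> 1 - d" if "u \<in> ball x0 r" for u
 proof -
  have "norm u \<le> norm x0 + norm (u - x0)" using norm_triangle_ineq[of x0 "u - x0"] by simp
  moreover have "norm (u - x0) < r" using that by (simp add: dist_norm norm_minus_commute)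
  ultimately have "norm u \<le> norm x0 + (1 - norm x0) / 2" using r(2) by linarith
  also have "\<dots> = 1 - d" by (simp add: d_def field_simps)
  finally show ?thesis .
 qed
 then have nx: "norm x \<le> 1 - d" "norm y \<le> 1 - d" using x y(1) by auto
 have D: "x \<in> D" "y \<in> D" using nx d by (auto simp: D_iff)
 have xy: "norm (x - y) \<le> 2 * r" using x y(1) dist_triangle_less_add[of x x0 r y r] by (simp add: dist_norm dist_commute norm_minus_commute)
 have p: "0 < norm (x - y)" using y by simp
 have "ln (norm (x - y)) \<le> ln (2 * r)" using xy p by (intro ln_mono) auto
 moreover have "hreg x y \<le> - (1/(2*pi)) * ln d" using nx d by (intro hreg_le) auto
 moreover have "ln (d / (2 * r)) = ln d - ln (2 * r)" using d r by (simp add: ln_div)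
 ultimately show ?thesis unfolding Gfun_eq[OF D y(2)] d_def[symmetric]
  by (simp add: divide_right_mono diff_divide_distrib) (smt (verit) divide_right_mono pi_ge_zero)
qed

text \<open>Concentrating the mass \<open>m\<close> near \<open>x0\<close> gains about \<open>m\<^sup>2 ln (1/r)\<close> in the self-energy,
 while moving it across a strip of \<open>psi\<close>-width \<open>\<delta>\<close> costs at most \<open>\<delta> m\<close> with \<open>m\<close> proportional to \<open>\<delta>\<close>;
 for small \<open>r\<close> the gain wins.\<close>

lemma no_exchange_into_level_set:
 assumes v: "amax Om lam v" and P: "P \<in> sets borel" "P \<subseteq> D" and psiP: "\<And>x. x \<in> P ==> psi0 Om v x = \<mu>"
  and x0: "x0 \<in> D" "\<And>r. 0 < r ==> 0 < measure lborel (P \<inter> ball x0 r)"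
  and s: "\<sigma> = 1 \<or> \<sigma> = -1" and \<kappa>: "0 < \<kappa>" and c: "0 < c" and d: "0 < d" and \<delta>0: "0 < \<delta>0"
  and roomP: "\<And>x. x \<in> P ==> \<kappa> \<le> (if \<sigma> = 1 then lam - v x else v x)"
  and strip: "\<And>\<delta>. 0 < \<delta> ==> \<delta> < \<delta>0 ==> \<exists>Q. Q \<in> sets borel \<and> Q \<subseteq> D - ball x0 d \<and> c * \<delta> \<le> measure lborel Q \<and>
    (\<forall>x\<in>Q. \<sigma> * (psi0 Om v x - \<mu>) \<le> \<delta> \<and> \<kappa> \<le> (if \<sigma> = 1 then v x else lam - v x))"
 shows False
proof -
 define e where "e = (1 - norm x0) / 2"
 have e: "0 < e" using x0 by (simp add: e_def D_iff)
 \<comment> \<open>4/d offsets the interaction 2 * (2/d) of the two sets, and the other summand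
   makes the gain equal to 3 \<delta>, above the admissible 2 \<delta>.\<close>
 define T where "T = 4 / d + 3 / (\<kappa> * c)"
 \<comment> \<open>So small that the Green function is at least \<open>T\<close> on the ball and
   that the ball keeps distance d/2 from the strip.\<close>
 define r where "r = min (min (d/2) e) (e / 2 * exp (- (2*pi*T)))"
 have r: "0 < r" "r \<le> d/2" "r \<le> e" "r \<le> e / 2 * exp (- (2*pi*T))" using d e by (auto simp: r_def)
 have T: "T \<le> (1/(2*pi)) * ln (e / (2 * r))"
 proof -
  have "exp (2*pi*T) \<le> e / (2 * r)"
  proof -
   have "exp (2*pi*T) * (2 * r) \<le> exp (2*pi*T) * (2 * (e / 2 * exp (- (2*pi*T))))" using r(4) by (intro mult_left_mono) auto
   also have "\<dots> = e" by (simp add: exp_minus)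
   finally show ?thesis using r(1) by (simp add: pos_le_divide_eq)
  qed
  then have "2*pi*T \<le> ln (e / (2*r))" using r e by (simp add: ln_ge_iff)
  then show ?thesis by (simp add: field_simps)
 qed
 define P' where "P' = P \<inter> ball x0 r"
 have P': "P' \<in> sets borel" "P' \<subseteq> D" "0 < measure lborel P'" using P x0(2)[OF r(1)] by (auto simp: P'_def)
 \<comment> \<open>\<open>P'\<close> may be much smaller than \<open>P\<close>; the width of the
   strip is adapted to it so that both sets have room for the mass \<open>m\<close>.\<close>
 define \<delta> where "\<delta> = min (\<delta>0 / 2) (measure lborel P' / c)"
 have \<delta>: "0 < \<delta>" "\<delta> < \<delta>0" "c * \<delta> \<le> measure lborel P'" using \<delta>0 P' c by (auto simp: \<delta>_def min_def field_simps)
 obtain Q where Q: "Q \<in> sets borel" "Q \<subseteq> D - ball x0 d" "c * \<delta> \<le> measure lborel Q"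
  "\<And>x. x \<in> Q ==> \<sigma> * (psi0 Om v x - \<mu>) \<le> \<delta>" "\<And>x. x \<in> Q ==> \<kappa> \<le> (if \<sigma> = 1 then v x else lam - v x)"
  using strip[OF \<delta>(1,2)] by blast
 have Q': "Q \<subseteq> D" "0 < measure lborel Q" using Q \<delta> c by (auto intro: less_le_trans[OF mult_pos_pos])
 define m where "m = \<kappa> * (c * \<delta>)"
 have m: "0 < m" "m \<le> \<kappa> * measure lborel P'" "m \<le> \<kappa> * measure lborel Q"
  using \<kappa> c \<delta> Q by (auto simp: m_def)
 have v': "adm lam v" using v by (simp add: amax_def)
 have a: "adm lam (\<lambda>x. v x + (\<sigma> * m) * (unif P' x - unif Q x))"
 proof (cases "\<sigma> = 1")
  case True
  have "adm lam (\<lambda>x. v x + m * (unif P' x - unif Q x))"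
  proof (rule adm_swap[OF v' P' Q(1) Q'])
   show "v x \<le> lam - \<kappa>" if "x \<in> P'" for x using roomP[of x] that True by (simp add: P'_def)
   show "\<kappa> \<le> v x" if "x \<in> Q" for x using Q(5)[OF that] True by simp
  qed (use m in auto)
  then show ?thesis using True by simp
 next
  case False
  have "adm lam (\<lambda>x. v x + m * (unif Q x - unif P' x))"
  proof (rule adm_swap[OF v' Q(1) Q' P'])
   show "\<kappa> \<le> v x" if "x \<in> P'" for x using roomP[of x] that False by (simp add: P'_def)
   show "v x \<le> lam - \<kappa>" if "x \<in> Q" for x using Q(5)[OF that] False by simp
  qed (use m in auto)
  then show ?thesis using False s by (simp add: algebra_simps)
 qed
 have "m * (T - 2 * (2 / d)) \<le> 2 * \<delta>"
 proof (rule exchange_bound[OF v P' Q(1) Q' _ m(1) a, of \<mu>])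
  show "\<sigma>^2 = 1" using s by auto
  show "psi0 Om v x = \<mu>" if "x \<in> P'" for x using that psiP by (simp add: P'_def)
  show "\<sigma> * (psi0 Om v x - \<mu>) \<le> \<delta>" if "x \<in> Q" for x using Q(4)[OF that] .
  show "T \<le> Gfun x y" if "x \<in> P'" "y \<in> P'" "y \<noteq> 0" "y \<noteq> x" for x y
   using Gfun_ge_ball[OF x0(1) r(1), of x y] T r(3) that unfolding e_def[symmetric] by (simp add: P'_def)
  show "Gfun x y \<le> 2 / d" if "x \<in> P'" "y \<in> Q" "y \<noteq> 0" "y \<noteq> x" for x y
  proof -
   have D: "x \<in> D" "y \<in> D" using that P' Q' by auto
   have "dist x0 x < r" "d \<le> dist x0 y" using that Q(2) by (auto simp: P'_def)
   then have n: "d/2 \<le> norm (x - y)" using r(2) dist_triangle[of x0 y x] by (simp add: dist_norm)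
   have "Gfun x y \<le> 1 / norm (x - y)" using that by (intro Gfun_nonneg_le(2)[OF D]) auto
   also have "\<dots> \<le> 1 / (d/2)" by (rule frac_le) (use n d in auto)
   finally show ?thesis by simp
  qed
 qed
 moreover have "m * (T - 2 * (2 / d)) = 3 * \<delta>" using \<kappa> c by (simp add: T_def m_def)
 ultimately show False using \<delta> by simp
qed

text \<open>Otherwise each point of \<open>P\<close> has a ball meeting \<open>P\<close> in a null
  set, and by Lindelof countably many of these balls cover \<open>P\<close>.\<close>

lemma support_point:
 assumes P: "P \<in> sets borel" "P \<subseteq> D" "0 < measure lborel P"
 obtains x0 where "x0 \<in> P" "\<And>r. 0 < r ==> 0 < measure lborel (P \<inter> ball x0 r)"
proof -
 have "\<exists>x0\<in>P. \<forall>r>0. 0 < measure lborel (P \<inter> ball x0 r)"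
 proof (rule ccontr)
  assume "\<not> ?thesis"
  then have "\<forall>x\<in>P. \<exists>r>0. measure lborel (P \<inter> ball x r) = 0"
   by (metis measure_nonneg order_le_less)
  then obtain r where r: "\<And>x. x \<in> P ==> 0 < r x" "\<And>x. x \<in> P ==> measure lborel (P \<inter> ball x (r x)) = 0" by metis
  define F where "F = (\<lambda>x. ball x (r x)) ` P"
  obtain F' where F': "F' \<subseteq> F" "countable F'" "\<Union>F' = \<Union>F"
   by (rule Lindelof[of F]) (auto simp: F_def)
  have "P = (\<Union>B\<in>F'. P \<inter> B)"
  proof -
   have "P \<subseteq> \<Union>F" using r(1) by (auto simp: F_def)
   then show ?thesis using F'(3) by blast
  qed
  moreover have "(\<Union>B\<in>F'. P \<inter> B) \<in> null_sets lborel"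
  proof (rule null_sets_UN'[OF F'(2)])
   fix B assume "B \<in> F'"
   then obtain x where x: "x \<in> P" "B = ball x (r x)" using F' by (auto simp: F_def)
   have "P \<inter> B \<in> fmeasurable lborel" using P x by (intro fmeasurable_subset_D) auto
   then show "P \<inter> B \<in> null_sets lborel" using r(2)[OF x(1)] x P
    by (intro null_setsI) (auto simp: emeasure_eq_measure2)
  qed
  ultimately show False using P(3) by (metis measure_eq_0_null_sets less_irrefl)
 qed
 then show thesis using that by blast
qed

text \<open>One point will host the concentrated mass and the other will be the base of the strip,
  so that the two can be kept apart; see \<open>not_in_both_segments\<close>.\<close>

lemma two_support_points:
 assumes P: "P \<in> sets borel" "P \<subseteq> D" "0 < measure lborel P"
 obtains x0 x1 where "x0 \<in> P" "x1 \<in> P" "x0 \<noteq> x1" "\<And>r. 0 < r ==> 0 < measure lborel (P \<inter> ball x0 r)"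
  "\<And>r. 0 < r ==> 0 < measure lborel (P \<inter> ball x1 r)"
proof -
 obtain x0 where x0: "x0 \<in> P" "\<And>r. 0 < r ==> 0 < measure lborel (P \<inter> ball x0 r)" using support_point[OF P] by blast
 have m: "measure lborel (P - {x0}) = measure lborel P"
  using P fmeasurable_subset_D[OF P(1,2)] by (intro measure_Diff_null_set) (auto intro!: null_setsI)
 obtain x1 where x1: "x1 \<in> P - {x0}" "\<And>r. 0 < r ==> 0 < measure lborel ((P - {x0}) \<inter> ball x1 r)"
  using support_point[of "P - {x0}"] P m by auto
 have "0 < measure lborel (P \<inter> ball x1 r)" if "0 < r" for r
 proof -
  have "measure lborel ((P - {x0}) \<inter> ball x1 r) \<le> measure lborel (P \<inter> ball x1 r)"
   using P by (intro measure_mono_fmeasurable fmeasurable_subset_D) auto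
  then show ?thesis using x1(2)[OF that] by linarith
 qed
 then show thesis using that[of x0 x1] x0 x1 by auto
qed

text \<open>The interval runs from the last nonpositive value to the first time that
  \<open>\<delta>\<close> is reached; with Lipschitz constant \<open>C\<close> the climb takes at
  least \<open>\<delta> / C\<close>.\<close>

lemma crossing_interval:
 fixes f :: "real => real"
 assumes f: "\<And>s t. s \<in> {0..1} ==> t \<in> {0..1} ==> \<bar>f s - f t\<bar> \<le> C * \<bar>s - t\<bar>" and C: "0 < C"
  and f0: "f 0 \<le> 0" and f1: "\<delta> \<le> f 1" and \<delta>: "0 < \<delta>"
 obtains a b where "0 \<le> a" "a \<le> b" "b \<le> 1" "\<delta> / C \<le> b - a" "\<And>t. a < t ==> t < b ==> 0 < f t \<and> f t < \<delta>"
proof -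
 have cont: "continuous_on {0..1} f"
 proof (rule continuous_on_iff[THEN iffD2], intro ballI allI impI)
  fix x e :: real assume x: "x \<in> {0..1}" and e: "0 < e"
  show "\<exists>d>0. \<forall>x'\<in>{0..1}. dist x' x < d --> dist (f x') (f x) < e"
  proof (intro exI[of _ "e / C"] conjI ballI impI)
   fix x' assume "x' \<in> {0..1}" "dist x' x < e / C"
   then have "\<bar>f x' - f x\<bar> \<le> C * \<bar>x' - x\<bar>" "C * \<bar>x' - x\<bar> < e" using f x C by (auto simp: dist_real_def field_simps)
   then show "dist (f x') (f x) < e" by (simp add: dist_real_def)
  qed (use e C in auto)
 qed
 define S where "S = {0..1} \<inter> f -` {\<delta>..}"
 have Sc: "closed S" unfolding S_def by (rule continuous_closed_preimage[OF cont]) auto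
 have S1: "1 \<in> S" using f1 by (simp add: S_def)
 define b where "b = Inf S"
 have Sb: "bdd_below S" by (rule bdd_belowI[of _ 0]) (auto simp: S_def)
 have bS: "b \<in> S" unfolding b_def using closed_contains_Inf[OF _ Sb Sc] S1 by auto
 have before: "f t < \<delta>" if "0 \<le> t" "t < b" for t
 proof (rule ccontr)
  assume "\<not> f t < \<delta>"
  then have "t \<in> S" using that bS by (auto simp: S_def)
  then have "b \<le> t" unfolding b_def by (rule cInf_lower[OF _ Sb])
  then show False using that by simp
 qed
 have b01: "0 \<le> b" "b \<le> 1" "\<delta> \<le> f b" using bS by (auto simp: S_def)
 define Z where "Z = {0..b} \<inter> f -` {..0}"
 have "continuous_on {0..b} f" using cont b01 by (auto intro: continuous_on_subset)
 then have Zc: "closed Z" unfolding Z_def by (rule continuous_closed_preimage) auto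
 have Z0: "0 \<in> Z" using f0 b01 by (simp add: Z_def)
 have Zb: "bdd_above Z" by (rule bdd_aboveI[of _ b]) (auto simp: Z_def)
 define a where "a = Sup Z"
 have aZ: "a \<in> Z" unfolding a_def using closed_contains_Sup[OF _ Zb Zc] Z0 by auto
 have a: "0 \<le> a" "a \<le> b" "f a \<le> 0" using aZ by (auto simp: Z_def)
 have after: "0 < f t" if "a < t" "t \<le> b" for t
 proof (rule ccontr)
  assume "\<not> 0 < f t"
  then have "t \<in> Z" using that a by (auto simp: Z_def)
  then have "t \<le> a" unfolding a_def by (rule cSup_upper[OF _ Zb])
  then show False using that by simp
 qed
 have "\<delta> \<le> \<bar>f b - f a\<bar>" using a b01 by linarith
 also have "\<dots> \<le> C * \<bar>b - a\<bar>" using a b01 by (intro f) auto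
 finally have "\<delta> / C \<le> b - a" using C a by (simp add: divide_le_eq mult.commute)
 then show thesis using that[of a b] a b01 before after by auto
qed

text \<open>The segment from \<open>b0\<close> to \<open>p\<close> is translated so that it starts
  at the points of \<open>P\<close> near \<open>b0\<close>. Along every translate psi moves from its
  level past the strip and, being Lipschitz, spends a time of order \<open>\<delta>\<close> inside
  it; Fubini turns these times into area.\<close>

lemma strip_measure:
 assumes v: "bdens L 1 v" and P: "P \<in> sets borel" "P \<subseteq> D" and psiP: "\<And>x. x \<in> P ==> psi0 Om v x = \<mu>"
  and b0: "b0 \<in> D" "\<And>r. 0 < r ==> 0 < measure lborel (P \<inter> ball b0 r)"
  and p: "p \<in> D" "0 < \<sigma> * (psi0 Om v p - \<mu>)" and s: "\<sigma> = 1 \<or> \<sigma> = -1"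
  and x0: "x0 \<notin> closed_segment b0 p"
 obtains c d \<delta>0 where "0 < c" "0 < d" "0 < \<delta>0"
  "\<And>\<delta>. 0 < \<delta> ==> \<delta> < \<delta>0 ==> \<exists>Q. Q \<in> sets borel \<and> Q \<subseteq> D - ball x0 d \<and> c * \<delta> \<le> measure lborel Q \<and>
    (\<forall>x\<in>Q. 0 < \<sigma> * (psi0 Om v x - \<mu>) \<and> \<sigma> * (psi0 Om v x - \<mu>) < \<delta>)"
proof -
 define e where "e = p - b0"
 define d1 where "d1 = (1 - max (norm b0) (norm p)) / 2"
 have "max (norm b0) (norm p) < 1" using b0(1) p(1) by (simp add: D_iff)
 moreover from this have pb: "norm p \<le> 1 - d1"
 proof -
  have "x \<le> 1 - (1 - M) / 2" if "M < 1" "x \<le> M" for x M :: real using that by (simp add: field_simps)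
  from this[OF \<open>max (norm b0) (norm p) < 1\<close> max.cobounded2] show ?thesis unfolding d1_def .
 qed
 moreover have "0 \<le> max (norm b0) (norm p)" by (simp add: le_max_iff_disj)
 ultimately have d1: "0 < d1" "d1 \<le> 1" unfolding d1_def by simp_all
 obtain C where C: "0 < C" "\<And>x x'. norm x \<le> 1 - d1 ==> norm x' \<le> 1 - d1 ==> \<bar>psi0 Om v x - psi0 Om v x'\<bar> \<le> C * norm (x - x')"
  using psi0_lipschitz[OF v d1] by blast
 define f where "f x = \<sigma> * (psi0 Om v x - \<mu>)" for x
 have fm [measurable]: "f \<in> borel_measurable borel" unfolding f_def using measurable_psi0[OF v] by measurable
 have fl: "\<bar>f x - f x'\<bar> \<le> C * norm (x - x')" if "norm x \<le> 1 - d1" "norm x' \<le> 1 - d1" for x x'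
  using C(2)[OF that] s unfolding f_def by (auto simp: algebra_simps abs_minus_commute)
 define \<delta>0 where "\<delta>0 = f p / 2"
 have \<delta>0: "0 < \<delta>0" using p by (simp add: \<delta>0_def f_def)
 define d where "d = infdist x0 (closed_segment b0 p) / 2"
 have d: "0 < d"
 proof -
  have "infdist x0 (closed_segment b0 p) \<noteq> 0" using x0 in_closed_iff_infdist_zero[of "closed_segment b0 p" x0] by auto
  then show ?thesis using infdist_nonneg[of x0 "closed_segment b0 p"] by (simp add: d_def)
 qed
 \<comment> \<open>Three demands on the tube around the segment: distance from \<open>x0\<close>,
   distance from the unit circle, and psi still beyond the strip at the far end.\<close>
 define \<rho> where "\<rho> = min (min d d1) (\<delta>0 / C)"
 have "\<rho> \<le> \<delta>0 / C" by (simp add: \<rho>_def)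
 then have "C * \<rho> \<le> \<delta>0" using C(1) by (simp add: pos_le_divide_eq mult.commute)
 moreover have "0 < \<rho>" "\<rho> \<le> d" "\<rho> \<le> d1" using d d1 \<delta>0 C(1) by (auto simp: \<rho>_def)
 ultimately have \<rho>: "0 < \<rho>" "\<rho> \<le> d" "\<rho> \<le> d1" "C * \<rho> \<le> \<delta>0" by auto
 define P' where "P' = P \<inter> ball b0 \<rho>"
 have P': "P' \<in> sets borel" "P' \<subseteq> D" "0 < measure lborel P'" using P b0(2)[OF \<rho>(1)] by (auto simp: P'_def)
 have [measurable]: "P' \<in> sets borel" by fact
 have seg: "b0 + t *\<^sub>R e \<in> closed_segment b0 p" if "0 \<le> t" "t \<le> 1" for t
  using that unfolding closed_segment_def e_def by (auto intro!: exI[of _ t] simp: algebra_simps)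
 have tube: "norm (b + t *\<^sub>R e) \<le> 1 - d1" "d \<le> dist x0 (b + t *\<^sub>R e)" if "b \<in> P'" "0 \<le> t" "t \<le> 1" for b t
 proof -
  have bb: "norm (b - b0) < \<rho>" using that by (simp add: P'_def dist_norm norm_minus_commute)
  have eq: "b + t *\<^sub>R e = (b0 + t *\<^sub>R e) + (b - b0)" by simp
  have "norm (b0 + t *\<^sub>R e) \<le> max (norm b0) (norm p)"
  proof -
   have "closed_segment b0 p \<subseteq> cball 0 (max (norm b0) (norm p))"
    by (rule closed_segment_subset) auto
   then show ?thesis using seg[OF that(2,3)] by auto
  qed
  then show "norm (b + t *\<^sub>R e) \<le> 1 - d1" unfolding eq using bb \<rho>(3) norm_triangle_ineq[of "b0 + t *\<^sub>R e" "b - b0"]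
   by (simp add: d1_def field_simps)
  have "2 * d \<le> dist x0 (b0 + t *\<^sub>R e)" using infdist_le[OF seg[OF that(2,3)], of x0] by (simp add: d_def)
  moreover have "dist (b0 + t *\<^sub>R e) (b + t *\<^sub>R e) < \<rho>" using bb by (simp add: dist_norm norm_minus_commute)
  ultimately show "d \<le> dist x0 (b + t *\<^sub>R e)" using \<rho>(2) dist_triangle[of x0 "b0 + t *\<^sub>R e" "b + t *\<^sub>R e"] by (simp add: dist_commute)
 qed
 \<comment> \<open>Lipschitz constant in the segment parameter; adding 1 keeps it positive.\<close>
 define C' where "C' = C * norm e + 1"
 have C': "0 < C'" using C by (simp add: C'_def add_nonneg_pos)
 have "\<exists>Q. Q \<in> sets borel \<and> Q \<subseteq> D - ball x0 d \<and> (measure lborel P' / C') * \<delta> \<le> measure lborel Q \<and> (\<forall>x\<in>Q. 0 < f x \<and> f x < \<delta>)"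
  if \<delta>: "0 < \<delta>" "\<delta> < \<delta>0" for \<delta>
 proof -
  define Q where "Q = {x. norm x \<le> 1 - d1 \<and> d \<le> dist x0 x \<and> 0 < f x \<and> f x < \<delta>}"
  have Qb [measurable]: "Q \<in> sets borel" unfolding Q_def by measurable
  have QD: "Q \<subseteq> D - ball x0 d" using d1 by (auto simp: Q_def D_iff)
  have len: "ennreal (\<delta> / C') \<le> (\<integral>\<^sup>+t. indicator {0..1} t * indicator Q (b + t *\<^sub>R e) \<partial>lborel)" if b: "b \<in> P'" for b
  proof -
   obtain t0 t1 where t: "0 \<le> t0" "t0 \<le> t1" "t1 \<le> 1" "\<delta> / C' \<le> t1 - t0" "\<And>t. t0 < t ==> t < t1 ==> 0 < f (b + t *\<^sub>R e) \<and> f (b + t *\<^sub>R e) < \<delta>"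
   proof (rule crossing_interval[of "\<lambda>t. f (b + t *\<^sub>R e)" C' \<delta>])
    fix s t :: real assume st: "s \<in> {0..1}" "t \<in> {0..1}"
    have "\<bar>f (b + s *\<^sub>R e) - f (b + t *\<^sub>R e)\<bar> \<le> C * norm ((b + s *\<^sub>R e) - (b + t *\<^sub>R e))"
     using st by (intro fl tube[OF b]) auto
    also have "(b + s *\<^sub>R e) - (b + t *\<^sub>R e) = (s - t) *\<^sub>R e" by (simp add: algebra_simps)
    also have "C * norm ((s - t) *\<^sub>R e) \<le> C' * \<bar>s - t\<bar>" unfolding norm_scaleR by (simp add: C'_def algebra_simps)
    finally show "\<bar>f (b + s *\<^sub>R e) - f (b + t *\<^sub>R e)\<bar> \<le> C' * \<bar>s - t\<bar>" .
   next
    show "f (b + 0 *\<^sub>R e) \<le> 0" using b psiP by (simp add: f_def P'_def)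
    have "\<bar>f p - f (b + 1 *\<^sub>R e)\<bar> \<le> C * norm (p - (b + 1 *\<^sub>R e))"
     by (intro fl tube[OF b] pb) auto
    also have "norm (p - (b + 1 *\<^sub>R e)) < \<rho>" using b by (simp add: e_def P'_def dist_norm)
    then have "C * norm (p - (b + 1 *\<^sub>R e)) \<le> C * \<rho>" using C by simp
    finally show "\<delta> \<le> f (b + 1 *\<^sub>R e)" using \<rho>(4) \<delta> by (simp add: \<delta>0_def)
   qed (use C' \<delta> that in auto)
   have "ennreal (\<delta> / C') \<le> ennreal (t1 - t0)" using t(4) by (rule ennreal_leI)
   also have "\<dots> = (\<integral>\<^sup>+t. indicator {t0<..<t1} t \<partial>lborel)" using t by simp
   also have "\<dots> \<le> (\<integral>\<^sup>+t. indicator {0..1} t * indicator Q (b + t *\<^sub>R e) \<partial>lborel)"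
   proof (rule nn_integral_mono)
    fix u :: real
    show "indicator {t0<..<t1} u \<le> (indicator {0..1} u * indicator Q (b + u *\<^sub>R e) :: ennreal)"
    proof (cases "u \<in> {t0<..<t1}")
     case True
     then have "0 \<le> u" "u \<le> 1" using t by auto
     then have "b + u *\<^sub>R e \<in> Q" using tube[OF b] t(5)[of u] True by (auto simp: Q_def)
     then show ?thesis using True t by (auto split: split_indicator)
    qed auto
   qed
   finally show ?thesis .
  qed
  have "ennreal (\<delta> / C') * emeasure lborel P' = (\<integral>\<^sup>+b. ennreal (\<delta> / C') * indicator P' b \<partial>lborel)"
   by (simp add: nn_integral_cmult)
  also have "\<dots> \<le> (\<integral>\<^sup>+b. (\<integral>\<^sup>+t. indicator {0..1::real} t * (indicator Q (b + t *\<^sub>R e) * indicator P' b) \<partial>lborel) \<partial>lborel)"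
  proof (rule nn_integral_mono)
   fix b
   show "ennreal (\<delta> / C') * indicator P' b \<le> (\<integral>\<^sup>+t. indicator {0..1::real} t * (indicator Q (b + t *\<^sub>R e) * indicator P' b) \<partial>lborel)"
    using len[of b] by (cases "b \<in> P'") auto
  qed
  also have "\<dots> = (\<integral>\<^sup>+t. (\<integral>\<^sup>+b. indicator {0..1::real} t * (indicator Q (b + t *\<^sub>R e) * indicator P' b) \<partial>lborel) \<partial>lborel)"
   by (rule lborel_pair.Fubini') measurable
  \<comment> \<open>For fixed \<open>t\<close> the starting points are merely translated by
    \<open>t *\<^sub>R e\<close>, so the inner integral is at most the area of
    \<open>Q\<close>.\<close>
  also have "\<dots> \<le> (\<integral>\<^sup>+t. indicator {0..1::real} t * emeasure lborel Q \<partial>lborel)"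
  proof (rule nn_integral_mono)
   fix t :: real
   have "(\<integral>\<^sup>+b. indicator {0..1::real} t * (indicator Q (b + t *\<^sub>R e) * indicator P' b) \<partial>lborel) \<le> (\<integral>\<^sup>+b. indicator {0..1::real} t * indicator Q (t *\<^sub>R e + 1 *\<^sub>R b) \<partial>lborel)"
    by (rule nn_integral_mono) (auto simp: add.commute split: split_indicator)
   also have "\<dots> = indicator {0..1::real} t * (\<integral>\<^sup>+b. indicator Q (t *\<^sub>R e + 1 *\<^sub>R b) \<partial>lborel)"
    by (rule nn_integral_cmult) measurable
   also have "(\<integral>\<^sup>+b. indicator Q (t *\<^sub>R e + 1 *\<^sub>R b) \<partial>lborel) = emeasure lborel Q"
    using nn_integral_lborel_affine[of "indicator Q" 1 "t *\<^sub>R e"] by simp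
   finally show "(\<integral>\<^sup>+b. indicator {0..1::real} t * (indicator Q (b + t *\<^sub>R e) * indicator P' b) \<partial>lborel) \<le> indicator {0..1::real} t * emeasure lborel Q" .
  qed
  also have "\<dots> = emeasure lborel Q" by (simp add: nn_integral_multc)
  finally have "ennreal (\<delta> / C') * emeasure lborel P' \<le> emeasure lborel Q" .
  moreover have "emeasure lborel P' = ennreal (measure lborel P')" "emeasure lborel Q = ennreal (measure lborel Q)"
   using fmeasurable_subset_D[OF P'(1,2)] fmeasurable_subset_D[OF Qb] QD by (blast intro: emeasure_eq_measure2)+
  ultimately have "ennreal (\<delta> / C' * measure lborel P') \<le> ennreal (measure lborel Q)"
   using \<delta> C' by (simp only: ennreal_mult' divide_nonneg_pos less_imp_le)
  then have "\<delta> / C' * measure lborel P' \<le> measure lborel Q" by (simp add: ennreal_le_iff)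
  then show ?thesis using QD Qb by (intro exI[of _ Q]) (auto simp: Q_def mult.commute)
 qed
 then show thesis using that[of "measure lborel P' / C'" d \<delta>0] P'(3) C' d \<delta>0 unfolding f_def by auto
qed

lemma measure_pos_of_not_AE:
 assumes "S \<in> sets borel" "S \<subseteq> D" "\<not> (AE x in lborel. x \<notin> S)"
 shows "0 < measure lborel S"
proof (rule ccontr)
 assume "\<not> ?thesis"
 then have "measure lborel S = 0" by (simp add: measure_le_0_iff not_less)
 then have "emeasure lborel S = 0" using emeasure_eq_measure2[OF fmeasurable_subset_D[OF assms(1,2)]] by simp
 then have "S \<in> null_sets lborel" using assms by (simp add: null_sets_def)
 then show False using assms(3) AE_not_in by blast
qed

text \<open>Strict inequalities are exhausted by inequalities with margin 1/(n+1). A non-null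
  exceptional set thus has a non-null part with uniform room, which is what an exchange of mass
  requires.\<close>

lemma AE_by_reciprocals:
 assumes "\<And>n::nat. AE x in M. \<not> P (1 / Suc n) x" and "\<And>x. Q x ==> \<exists>n. P (1 / Suc n) x"
 shows "AE x in M. \<not> Q x"
proof -
 have "AE x in M. \<forall>n. \<not> P (1 / Suc n) x" using assms(1) by (simp add: AE_all_countable)
 then show ?thesis by eventually_elim (use assms(2) in blast)
qed

lemma ex_reciprocal_less: "0 < (d::real) ==> \<exists>n::nat. 1 / Suc n < d"
 using reals_Archimedean[of d] by (auto simp: inverse_eq_divide)

text \<open>\<open>\<mu>\<close> is the infimum of the levels above which the density is saturated.
  If mass remained below it, some could be moved to unsaturated places with larger psi, a gain of
  first order.\<close>

lemma bathtub:
 assumes v: "amax Om lam v" and lam: "1/pi < lam"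
 obtains \<mu> where "AE x in lborel. x \<in> D --> \<mu> < psi0 Om v x --> v x = lam"
  "AE x in lborel. x \<in> D --> psi0 Om v x < \<mu> --> v x = 0"
proof -
 have va: "adm lam v" and vb: "bdens lam 1 v" using v by (auto simp: amax_def adm_bdens)
 have [measurable]: "v \<in> borel_measurable borel" using vb by (rule bdens_measurable)
 have vle: "0 \<le> v x" "v x \<le> lam" for x using va by (auto simp: adm_def)
 define psi where "psi = psi0 Om v"
 have psim [measurable]: "psi \<in> borel_measurable borel" unfolding psi_def by (rule measurable_psi0[OF vb])
 define b where "b = 80 * lam + \<bar>Om\<bar>"
 have psib: "\<bar>psi x\<bar> \<le> b" if "x \<in> D" for x
 proof -
  have "(norm x)^2 \<le> 1" using that by (simp add: D_iff abs_square_le_1)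
  then have "\<bar>Om\<bar>/2 * (norm x)^2 \<le> \<bar>Om\<bar>/2 * 1" by (intro mult_left_mono) auto
  then have "\<bar>Om/2 * (norm x)^2\<bar> \<le> \<bar>Om\<bar>" by (simp add: abs_mult)
  then show ?thesis using Gop_bound(2)[OF vb that] unfolding psi_def psi0_def b_def by linarith
 qed
 \<comment> \<open>Levels above which the ceiling is attained. A level below every value of psi
   cannot occur, since it would fill the disk and give total mass lam * pi > 1.\<close>
 define T where "T = {s. AE x in lborel. x \<in> D --> v x < lam --> psi x \<le> s}"
 have bT: "b \<in> T" unfolding T_def using psib by (auto intro!: AE_I2 simp: abs_le_iff)
 have Tb: "- b \<le> s" if "s \<in> T" for s
 proof (rule ccontr)
  assume "\<not> - b \<le> s"
  then have s: "s < - b" by simp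
  have "AE x in lborel. v x = lam * indicator D x" using that unfolding T_def mem_Collect_eq
  proof eventually_elim
   case (elim x)
   show ?case
   proof (cases "x \<in> D")
    case True
    then have "\<not> v x < lam" using elim psib[OF True] s by (auto simp: abs_le_iff)
    then show ?thesis using True vle(2)[of x] by simp
   qed (use bdens_D[OF vb] in simp)
  qed
  then have "(LBINT x. v x) = (LBINT x. lam * indicator D x)" by (intro integral_cong_AE) auto
  also have "\<dots> = lam * pi" unfolding D_def using measure_ball_pt[of 1 0] by simp
  finally show False using va lam by (simp add: adm_def field_simps)
 qed
 define \<mu> where "\<mu> = Inf T"
 have bdd: "bdd_below T" using Tb by (rule bdd_belowI)
 have 1: "AE x in lborel. \<not> (x \<in> D \<and> v x < lam \<and> \<mu> < psi x)"
 proof (rule AE_by_reciprocals[where P="\<lambda>e x. x \<in> D \<and> v x < lam \<and> \<mu> + e < psi x"])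
  fix n :: nat
  have "\<mu> < \<mu> + 1 / Suc n" by simp
  then obtain t where t: "t \<in> T" "t < \<mu> + 1 / Suc n" unfolding \<mu>_def using cInf_less_iff[OF _ bdd] bT by blast
  then show "AE x in lborel. \<not> (x \<in> D \<and> v x < lam \<and> \<mu> + 1 / Suc n < psi x)"
   unfolding T_def by (auto elim!: eventually_mono)
 next
  fix x assume x: "x \<in> D \<and> v x < lam \<and> \<mu> < psi x"
  then obtain n :: nat where "1 / Suc n < psi x - \<mu>" using ex_reciprocal_less[of "psi x - \<mu>"] by auto
  then show "\<exists>n. x \<in> D \<and> v x < lam \<and> \<mu> + 1 / Suc n < psi x" using x by (intro exI[of _ n]) auto
 qed
 have 2: "AE x in lborel. \<not> (x \<in> D \<and> 0 < v x \<and> psi x < \<mu>)"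
 proof (rule AE_by_reciprocals[where P="\<lambda>e x. x \<in> D \<and> e \<le> v x \<and> psi x < \<mu> - 2 * e"])
  fix n :: nat
  define e where "e = 1 / Suc n"
  have e: "0 < e" by (simp add: e_def)
  define Q where "Q = {x \<in> D. e \<le> v x \<and> psi x < \<mu> - 2 * e}"
  have Q: "Q \<in> sets borel" "Q \<subseteq> D" unfolding Q_def by auto
  have "AE x in lborel. x \<notin> Q"
  proof (rule ccontr)
   assume "\<not> ?thesis"
   then have Qpos: "0 < measure lborel Q" by (rule measure_pos_of_not_AE[OF Q])
   \<comment> \<open>Saturation fails just below the infimum. This supplies a set with room where
     psi exceeds \<mu> - e, to be fed from \<open>Q\<close> where psi is below \<mu> - 2 e: a gain
     of at least \<open>e\<close> per unit of mass.\<close>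
   have "\<mu> - e \<notin> T" using e cInf_lower[OF _ bdd, of "\<mu> - e"] by (auto simp: \<mu>_def)
   then have "\<not> (AE x in lborel. \<not> (x \<in> D \<and> v x < lam \<and> \<mu> - e < psi x))"
    unfolding T_def mem_Collect_eq by (rule contrapos_nn) (auto elim!: eventually_mono)
   then have "\<not> (\<forall>m::nat. AE x in lborel. \<not> (x \<in> D \<and> v x \<le> lam - 1 / Suc m \<and> \<mu> - e < psi x))"
   proof (rule contrapos_nn)
    assume a: "\<forall>m::nat. AE x in lborel. \<not> (x \<in> D \<and> v x \<le> lam - 1 / Suc m \<and> \<mu> - e < psi x)"
    show "AE x in lborel. \<not> (x \<in> D \<and> v x < lam \<and> \<mu> - e < psi x)"
    proof (rule AE_by_reciprocals[where P="\<lambda>e' x. x \<in> D \<and> v x \<le> lam - e' \<and> \<mu> - e < psi x"])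
     fix x assume x: "x \<in> D \<and> v x < lam \<and> \<mu> - e < psi x"
     then obtain m :: nat where "1 / Suc m < lam - v x" using ex_reciprocal_less[of "lam - v x"] by auto
     then show "\<exists>m. x \<in> D \<and> v x \<le> lam - 1 / Suc m \<and> \<mu> - e < psi x" using x by (intro exI[of _ m]) auto
    qed (use a in auto)
   qed
   then obtain m :: nat where m: "\<not> (AE x in lborel. \<not> (x \<in> D \<and> v x \<le> lam - 1 / Suc m \<and> \<mu> - e < psi x))" by blast
   define P where "P = {x \<in> D. v x \<le> lam - 1 / Suc m \<and> \<mu> - e < psi x}"
   have P: "P \<in> sets borel" "P \<subseteq> D" unfolding P_def by auto
   have Ppos: "0 < measure lborel P" by (rule measure_pos_of_not_AE[OF P]) (use m in \<open>simp add: P_def\<close>)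
   define \<kappa> where "\<kappa> = min e (1 / Suc m)"
   have \<kappa>: "0 < \<kappa>" "\<kappa> \<le> e" "\<kappa> \<le> 1 / Suc m" using e by (auto simp: \<kappa>_def)
   define c0 where "c0 = \<kappa> * min (measure lborel P) (measure lborel Q)"
   have c0: "0 < c0" using \<kappa> Ppos Qpos by (simp add: c0_def)
   have "(LBINT x. psi0 Om v x * (unif P x - unif Q x)) \<le> 0"
   proof (rule amax_first_variation[OF v bdens_unif_diff[OF P Q] c0])
    fix c assume c: "0 < c" "c \<le> c0"
    have c': "c \<le> \<kappa> * measure lborel P" "c \<le> \<kappa> * measure lborel Q"
     using c \<kappa> order_trans[OF c(2)] unfolding c0_def by (auto intro!: mult_left_mono)
    show "adm lam (\<lambda>x. v x + c * (unif P x - unif Q x))"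
    proof (rule adm_swap[OF va P Ppos Q Qpos _ _ _ c'])
     show "v x \<le> lam - \<kappa>" if "x \<in> P" for x using that \<kappa>(3) by (simp add: P_def)
     show "\<kappa> \<le> v x" if "x \<in> Q" for x using that \<kappa>(2) by (simp add: Q_def)
    qed (use c in simp)
   qed
   moreover have ip: "integrable lborel (\<lambda>x. psi0 Om v x * unif P x)" and iq: "integrable lborel (\<lambda>x. psi0 Om v x * unif Q x)"
    by (rule integrable_psi0_mult[OF vb bdens_unif[OF P]], rule integrable_psi0_mult[OF vb bdens_unif[OF Q]])
   moreover have "\<mu> - e \<le> (LBINT x. psi0 Om v x * unif P x)"
    by (rule integral_mult_unif_ge[OF P Ppos ip]) (auto simp: P_def psi_def)
   moreover have "(LBINT x. psi0 Om v x * unif Q x) \<le> \<mu> - 2 * e"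
    by (rule integral_mult_unif_le[OF Q Qpos iq]) (auto simp: Q_def psi_def)
   ultimately show False using e by (simp add: right_diff_distrib)
  qed
  then show "AE x in lborel. \<not> (x \<in> D \<and> 1 / Suc n \<le> v x \<and> psi x < \<mu> - 2 * (1 / Suc n))"
   unfolding Q_def e_def by simp
 next
  fix x assume x: "x \<in> D \<and> 0 < v x \<and> psi x < \<mu>"
  then obtain n :: nat where "1 / Suc n < min (v x) ((\<mu> - psi x) / 2)" using ex_reciprocal_less[of "min (v x) ((\<mu> - psi x) / 2)"] by auto
  then show "\<exists>n. x \<in> D \<and> 1 / Suc n \<le> v x \<and> psi x < \<mu> - 2 * (1 / Suc n)" using x by (intro exI[of _ n]) auto
 qed
 show thesis
 proof (rule that[of \<mu>])
  show "AE x in lborel. x \<in> D --> \<mu> < psi0 Om v x --> v x = lam" using 1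
  proof eventually_elim
   case (elim x) then show ?case using vle(2)[of x] by (auto simp: psi_def)
  qed
  show "AE x in lborel. x \<in> D --> psi0 Om v x < \<mu> --> v x = 0" using 2
  proof eventually_elim
   case (elim x) then show ?case using vle(1)[of x] by (auto simp: psi_def)
  qed
 qed
qed

text \<open>If both points lay on these segments, adding the two equalities in the triangle
  inequality would give dist x0 x1 = 0. So of two support points, one can always be concentrated at
  while the segment starts at the other.\<close>

lemma not_in_both_segments:
 fixes x0 x1 p :: "'a::euclidean_space"
 assumes "x0 \<noteq> x1"
 shows "x0 \<notin> closed_segment x1 p \<or> x1 \<notin> closed_segment x0 p"
proof (rule ccontr)
 assume "\<not> ?thesis"
 then have "x0 \<in> closed_segment x1 p" "x1 \<in> closed_segment x0 p" by auto
 then have "dist x1 p = dist x1 x0 + dist x0 p" "dist x0 p = dist x0 x1 + dist x1 p"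
  by (auto simp: between_mem_segment[symmetric] between)
 then have "dist x0 x1 = 0" by (simp add: dist_commute)
 then show False using assms by simp
qed

text \<open>The support point off the segment hosts the concentration and the other starts the
  strip. On the chosen side of the level the density is extremal, so the strip has the full room
  \<open>lam\<close> for giving or receiving mass.\<close>

lemma level_set_exchange_impossible:
 assumes v: "amax Om lam v" and P: "P \<in> sets borel" "P \<subseteq> D" "0 < measure lborel P"
  and psiP: "\<And>x. x \<in> P ==> psi0 Om v x = \<mu>"
  and s: "\<sigma> = 1 \<or> \<sigma> = -1" and \<kappa>: "0 < \<kappa>" "\<kappa> \<le> lam"
  and roomP: "\<And>x. x \<in> P ==> \<kappa> \<le> (if \<sigma> = 1 then lam - v x else v x)"
  and p: "p \<in> D" "0 < \<sigma> * (psi0 Om v p - \<mu>)"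
  and side: "AE x in lborel. x \<in> D --> 0 < \<sigma> * (psi0 Om v x - \<mu>) --> v x = (if \<sigma> = 1 then lam else 0)"
 shows False
proof -
 have vb: "bdens lam 1 v" using v by (auto simp: amax_def adm_bdens)
 have vm [measurable]: "v \<in> borel_measurable borel" using vb by (rule bdens_measurable)
 obtain a b where ab: "a \<in> P" "b \<in> P" "a \<noteq> b" "\<And>r. 0 < r ==> 0 < measure lborel (P \<inter> ball a r)"
  "\<And>r. 0 < r ==> 0 < measure lborel (P \<inter> ball b r)"
  using two_support_points[OF P] by blast
 have "\<exists>x0 b0. x0 \<in> D \<and> b0 \<in> D \<and> x0 \<notin> closed_segment b0 p \<and> (\<forall>r>0. 0 < measure lborel (P \<inter> ball x0 r)) \<and> (\<forall>r>0. 0 < measure lborel (P \<inter> ball b0 r))"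
  using not_in_both_segments[OF ab(3), of p] ab P(2) by blast
 then obtain x0 b0 where x: "x0 \<in> D" "b0 \<in> D" "x0 \<notin> closed_segment b0 p" "\<And>r. 0 < r ==> 0 < measure lborel (P \<inter> ball x0 r)"
  "\<And>r. 0 < r ==> 0 < measure lborel (P \<inter> ball b0 r)" by blast
 obtain c d \<delta>0 where cd: "0 < c" "0 < d" "0 < \<delta>0" and st:
  "\<And>\<delta>. 0 < \<delta> ==> \<delta> < \<delta>0 ==> \<exists>Q. Q \<in> sets borel \<and> Q \<subseteq> D - ball x0 d \<and> c * \<delta> \<le> measure lborel Q \<and>
    (\<forall>x\<in>Q. 0 < \<sigma> * (psi0 Om v x - \<mu>) \<and> \<sigma> * (psi0 Om v x - \<mu>) < \<delta>)"
  using strip_measure[OF vb P(1,2) psiP x(2,5) p s x(3)] by blast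
 show False
 proof (rule no_exchange_into_level_set[OF v P(1,2) psiP x(1,4) s \<kappa>(1) cd roomP])
  fix \<delta> assume \<delta>: "0 < \<delta>" "\<delta> < \<delta>0"
  from st[OF \<delta>] obtain Q where "Q \<in> sets borel \<and> Q \<subseteq> D - ball x0 d \<and> c * \<delta> \<le> measure lborel Q \<and>
    (\<forall>x\<in>Q. 0 < \<sigma> * (psi0 Om v x - \<mu>) \<and> \<sigma> * (psi0 Om v x - \<mu>) < \<delta>)" ..
  then have Q: "Q \<in> sets borel" "Q \<subseteq> D - ball x0 d" "c * \<delta> \<le> measure lborel Q"
   "\<And>x. x \<in> Q ==> 0 < \<sigma> * (psi0 Om v x - \<mu>) \<and> \<sigma> * (psi0 Om v x - \<mu>) < \<delta>" by simp_all
  \<comment> \<open>Only points where the extremal value is really attained are kept; this removes a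
    null set.\<close>
  define Q' where "Q' = Q \<inter> {x. v x = (if \<sigma> = 1 then lam else 0)}"
  have Q'm: "Q' \<in> sets borel" unfolding Q'_def using Q(1) by measurable
  have "measure lborel Q' = measure lborel Q"
  proof (rule measure_eq_AE)
   show "AE x in lborel. (x \<in> Q') = (x \<in> Q)" using side
    by eventually_elim (use Q(2,4) in \<open>auto simp: Q'_def\<close>)
  qed (use Q Q'm in auto)
  then show "\<exists>Q. Q \<in> sets borel \<and> Q \<subseteq> D - ball x0 d \<and> c * \<delta> \<le> measure lborel Q \<and>
    (\<forall>x\<in>Q. \<sigma> * (psi0 Om v x - \<mu>) \<le> \<delta> \<and> \<kappa> \<le> (if \<sigma> = 1 then v x else lam - v x))"
   using Q Q'm \<kappa> by (intro exI[of _ Q']) (auto simp: Q'_def less_imp_le)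
 qed auto
qed

text \<open>Suppose the level set is not null. An unsaturated part of it excludes points above
  \<open>\<mu>\<close>, and a part carrying mass excludes points below. What remains is a density
  equal to \<open>lam\<close> on the whole disk, a density equal to 0, or a constant psi; the total
  mass rules out the first two, and an exchange without first-order cost the third.\<close>

lemma amax_patch:
 assumes v: "amax Om lam v" and lam: "1/pi < lam"
 obtains \<mu> where "AE x in lborel. v x = lam * indicator (Aset Om v \<mu>) x" "emeasure lborel (Bset Om v \<mu>) = 0"
proof -
 have va: "adm lam v" and vb: "bdens lam 1 v" using v by (auto simp: amax_def adm_bdens)
 have vm [measurable]: "v \<in> borel_measurable borel" using vb by (rule bdens_measurable)
 have vle: "0 \<le> v x" "v x \<le> lam" for x using va by (auto simp: adm_def)
 have psim [measurable]: "psi0 Om v \<in> borel_measurable borel" by (rule measurable_psi0[OF vb])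
 have l0: "0 < lam" using lam pi_gt_zero by (smt (verit) divide_pos_pos)
 obtain \<mu> where \<mu>: "AE x in lborel. x \<in> D --> \<mu> < psi0 Om v x --> v x = lam"
  "AE x in lborel. x \<in> D --> psi0 Om v x < \<mu> --> v x = 0" using bathtub[OF v lam] by blast
 let ?B = "Bset Om v \<mu>"
 have B: "?B \<in> sets borel" "?B \<subseteq> D" unfolding Bset_def by auto
 \<comment> \<open>Room below the ceiling on the level set: mass could be drawn into it from a strip
   just above the level.\<close>
 have I: False if a: "\<not> (AE x in lborel. \<not> (x \<in> ?B \<and> v x < lam))" and p: "p \<in> D" "\<mu> < psi0 Om v p" for p
 proof -
  have "\<not> (\<forall>m::nat. AE x in lborel. \<not> (x \<in> ?B \<and> v x \<le> lam - 1 / Suc m))"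
  proof
   assume *: "\<forall>m::nat. AE x in lborel. \<not> (x \<in> ?B \<and> v x \<le> lam - 1 / Suc m)"
   have "AE x in lborel. \<not> (x \<in> ?B \<and> v x < lam)"
   proof (rule AE_by_reciprocals[where P="\<lambda>e x. x \<in> ?B \<and> v x \<le> lam - e"])
    fix x assume x: "x \<in> ?B \<and> v x < lam"
    then obtain m :: nat where "1 / Suc m < lam - v x" using ex_reciprocal_less[of "lam - v x"] by auto
    then show "\<exists>m. x \<in> ?B \<and> v x \<le> lam - 1 / Suc m" using x by (intro exI[of _ m]) auto
   qed (use * in auto)
   then show False using a by blast
  qed
  then obtain m :: nat where m: "\<not> (AE x in lborel. \<not> (x \<in> ?B \<and> v x \<le> lam - 1 / Suc m))" by blast
  define P where "P = {x \<in> ?B. v x \<le> lam - 1 / Suc m}"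
  have "P = ?B \<inter> {x. v x \<le> lam - 1 / Suc m}" by (auto simp: P_def)
  then have P: "P \<in> sets borel" "P \<subseteq> D" using B by auto
  have Ppos: "0 < measure lborel P" by (rule measure_pos_of_not_AE[OF P]) (use m in \<open>simp add: P_def\<close>)
  show False
  proof (rule level_set_exchange_impossible[OF v P Ppos, of \<mu> 1 "min lam (1 / Suc m)" p])
   show "psi0 Om v x = \<mu>" if "x \<in> P" for x using that by (simp add: P_def Bset_def)
   show "min lam (1 / Suc m) \<le> (if (1::real) = 1 then lam - v x else v x)" if "x \<in> P" for x using that by (auto simp: P_def)
   show "AE x in lborel. x \<in> D --> 0 < 1 * (psi0 Om v x - \<mu>) --> v x = (if (1::real) = 1 then lam else 0)" using \<mu>(1) by simp
  qed (use p l0 in auto)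
 qed
 \<comment> \<open>Mass on the level set: it could be moved into a strip just below the level, and
   the self-energy of the change is a gain again.\<close>
 have II: False if a: "\<not> (AE x in lborel. \<not> (x \<in> ?B \<and> 0 < v x))" and p: "p \<in> D" "psi0 Om v p < \<mu>" for p
 proof -
  have "\<not> (\<forall>m::nat. AE x in lborel. \<not> (x \<in> ?B \<and> 1 / Suc m \<le> v x))"
  proof
   assume *: "\<forall>m::nat. AE x in lborel. \<not> (x \<in> ?B \<and> 1 / Suc m \<le> v x)"
   have "AE x in lborel. \<not> (x \<in> ?B \<and> 0 < v x)"
   proof (rule AE_by_reciprocals[where P="\<lambda>e x. x \<in> ?B \<and> e \<le> v x"])
    fix x assume x: "x \<in> ?B \<and> 0 < v x"
    then obtain m :: nat where "1 / Suc m < v x" using ex_reciprocal_less[of "v x"] by auto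
    then show "\<exists>m. x \<in> ?B \<and> 1 / Suc m \<le> v x" using x by (intro exI[of _ m]) auto
   qed (use * in auto)
   then show False using a by blast
  qed
  then obtain m :: nat where m: "\<not> (AE x in lborel. \<not> (x \<in> ?B \<and> 1 / Suc m \<le> v x))" by blast
  define P where "P = {x \<in> ?B. 1 / Suc m \<le> v x}"
  have "P = ?B \<inter> {x. 1 / Suc m \<le> v x}" by (auto simp: P_def)
  then have P: "P \<in> sets borel" "P \<subseteq> D" using B by auto
  have Ppos: "0 < measure lborel P" by (rule measure_pos_of_not_AE[OF P]) (use m in \<open>simp add: P_def\<close>)
  show False
  proof (rule level_set_exchange_impossible[OF v P Ppos, of \<mu> "-1" "min lam (1 / Suc m)" p])
   show "psi0 Om v x = \<mu>" if "x \<in> P" for x using that by (simp add: P_def Bset_def)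
   show "min lam (1 / Suc m) \<le> (if (-1::real) = 1 then lam - v x else v x)" if "x \<in> P" for x using that by (auto simp: P_def)
   show "AE x in lborel. x \<in> D --> 0 < -1 * (psi0 Om v x - \<mu>) --> v x = (if (-1::real) = 1 then lam else 0)" using \<mu>(2) by simp
  qed (use p l0 in auto)
 qed
 have massD: False if "AE x in lborel. x \<in> D --> v x = lam"
 proof -
  have "AE x in lborel. v x = lam * indicator D x" using that by eventually_elim (use bdens_D[OF vb] in \<open>auto split: split_indicator\<close>)
  then have "(LBINT x. v x) = (LBINT x. lam * indicator D x)" by (intro integral_cong_AE) auto
  also have "\<dots> = lam * pi" unfolding D_def using measure_ball_pt[of 1 0] by simp
  finally show False using va lam by (simp add: adm_def field_simps)
 qed
 have mass0: False if "AE x in lborel. x \<in> D --> v x = 0"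
 proof -
  have "AE x in lborel. v x = 0" using that by eventually_elim (use bdens_D[OF vb] in auto)
  then have "(LBINT x. v x) = (\<integral>x. 0 \<partial>(lborel::pt measure))" by (intro integral_cong_AE) auto
  then show False using va by (simp add: adm_def)
 qed
 have Bnull: "AE x in lborel. x \<notin> ?B"
 proof (rule ccontr)
  assume nn: "\<not> ?thesis"
  show False
  proof (cases "AE x in lborel. \<not> (x \<in> ?B \<and> v x < lam)")
   case True
   have "\<not> (AE x in lborel. \<not> (x \<in> ?B \<and> 0 < v x))"
   proof
    assume "AE x in lborel. \<not> (x \<in> ?B \<and> 0 < v x)"
    with True have "AE x in lborel. x \<notin> ?B" by eventually_elim (use vle l0 in force)
    then show False using nn by blast
   qed
   then have noC: "\<not> (psi0 Om v x < \<mu>)" if "x \<in> D" for x using II that by blast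
   have "AE x in lborel. x \<in> D --> v x = lam" using \<mu>(1) True
   proof eventually_elim
    case (elim x)
    then show ?case using vle(2)[of x] noC[of x] by (cases "psi0 Om v x = \<mu>") (auto simp: Bset_def)
   qed
   then show False by (rule massD)
  next
   case False
   then have noA: "\<not> (\<mu> < psi0 Om v x)" if "x \<in> D" for x using I that by blast
   have B1: "\<not> (AE x in lborel. \<not> (x \<in> ?B \<and> 0 < v x))"
   proof
    assume "AE x in lborel. \<not> (x \<in> ?B \<and> 0 < v x)"
    with \<mu>(2) have "AE x in lborel. x \<in> D --> v x = 0"
    proof eventually_elim
     case (elim x)
     then show ?case using vle(1)[of x] noA[of x] by (cases "psi0 Om v x = \<mu>") (auto simp: Bset_def)
    qed
    then show False by (rule mass0)
   qed
   then have noC: "\<not> (psi0 Om v x < \<mu>)" if "x \<in> D" for x using II that by blast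
   have const: "psi0 Om v x = \<mu>" if "x \<in> D" for x using noA[OF that] noC[OF that] by simp
   \<comment> \<open>\<open>psi\<close> is constant on the disk, so any two places may exchange mass at no first-order cost.\<close>
   have BD: "?B = D" using const by (auto simp: Bset_def)
   have "\<not> (\<forall>m::nat. AE x in lborel. \<not> (x \<in> D \<and> v x \<le> lam - 1 / Suc m))"
   proof
    assume *: "\<forall>m::nat. AE x in lborel. \<not> (x \<in> D \<and> v x \<le> lam - 1 / Suc m)"
    have "AE x in lborel. \<not> (x \<in> D \<and> v x < lam)"
    proof (rule AE_by_reciprocals[where P="\<lambda>e x. x \<in> D \<and> v x \<le> lam - e"])
     fix x assume x: "x \<in> D \<and> v x < lam"
     then obtain m :: nat where "1 / Suc m < lam - v x" using ex_reciprocal_less[of "lam - v x"] by auto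
     then show "\<exists>m. x \<in> D \<and> v x \<le> lam - 1 / Suc m" using x by (intro exI[of _ m]) auto
    qed (use * in auto)
    then show False using False unfolding BD by blast
   qed
   then obtain m :: nat where m: "\<not> (AE x in lborel. \<not> (x \<in> D \<and> v x \<le> lam - 1 / Suc m))" by blast
   define P where "P = {x \<in> D. v x \<le> lam - 1 / Suc m}"
   have P: "P \<in> sets borel" "P \<subseteq> D" unfolding P_def by auto
   have Ppos: "0 < measure lborel P" by (rule measure_pos_of_not_AE[OF P]) (use m in \<open>simp add: P_def\<close>)
   obtain x0 where x0: "x0 \<in> P" "\<And>r. 0 < r ==> 0 < measure lborel (P \<inter> ball x0 r)" using support_point[OF P Ppos] by blast
   \<comment> \<open>The mass cannot sit at the single point \<open>x0\<close>, so a set carrying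
     mass exists at positive distance from it.\<close>
   have "\<not> (\<forall>k::nat. AE x in lborel. \<not> (x \<in> D - ball x0 (1 / Suc k) \<and> 1 / Suc k \<le> v x))"
   proof
    assume *: "\<forall>k::nat. AE x in lborel. \<not> (x \<in> D - ball x0 (1 / Suc k) \<and> 1 / Suc k \<le> v x)"
    have "AE x in lborel. \<not> (x \<in> D \<and> x \<noteq> x0 \<and> 0 < v x)"
    proof (rule AE_by_reciprocals[where P="\<lambda>e x. x \<in> D - ball x0 e \<and> e \<le> v x"])
     fix x assume x: "x \<in> D \<and> x \<noteq> x0 \<and> 0 < v x"
     then obtain k :: nat where "1 / Suc k < min (v x) (dist x0 x)" using ex_reciprocal_less[of "min (v x) (dist x0 x)"] by auto
     then show "\<exists>k. x \<in> D - ball x0 (1 / Suc k) \<and> 1 / Suc k \<le> v x" using x by (intro exI[of _ k]) auto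
    qed (use * in auto)
    then have "AE x in lborel. x \<in> D --> v x = 0" using AE_lborel_neq[of x0]
    proof eventually_elim
     case (elim x)
     then show ?case using vle(1)[of x] by auto
    qed
    then show False by (rule mass0)
   qed
   then obtain k :: nat where k: "\<not> (AE x in lborel. \<not> (x \<in> D - ball x0 (1 / Suc k) \<and> 1 / Suc k \<le> v x))" by blast
   define Q where "Q = {x \<in> D - ball x0 (1 / Suc k). 1 / Suc k \<le> v x}"
   have "Q = (D - ball x0 (1 / Suc k)) \<inter> {x. 1 / Suc k \<le> v x}" by (auto simp: Q_def)
   then have Q: "Q \<in> sets borel" "Q \<subseteq> D" by auto
   have Qpos: "0 < measure lborel Q" by (rule measure_pos_of_not_AE[OF Q]) (use k in \<open>simp add: Q_def\<close>)
   show False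
   proof (rule no_exchange_into_level_set[OF v P, of \<mu> x0 1 "min (1 / Suc m) (1 / Suc k)" "measure lborel Q" "1 / Suc k" 1])
    show "psi0 Om v x = \<mu>" if "x \<in> P" for x using that const by (simp add: P_def)
    show "x0 \<in> D" using x0 P by auto
    show "0 < measure lborel (P \<inter> ball x0 r)" if "0 < r" for r by (rule x0(2)[OF that])
    show "min (1 / Suc m) (1 / Suc k) \<le> (if (1::real) = 1 then lam - v x else v x)" if "x \<in> P" for x using that by (auto simp: P_def)
    fix \<delta> :: real assume \<delta>: "0 < \<delta>" "\<delta> < 1"
    show "\<exists>Q'. Q' \<in> sets borel \<and> Q' \<subseteq> D - ball x0 (1 / Suc k) \<and> measure lborel Q * \<delta> \<le> measure lborel Q' \<and>
     (\<forall>x\<in>Q'. 1 * (psi0 Om v x - \<mu>) \<le> \<delta> \<and> min (1 / Suc m) (1 / Suc k) \<le> (if (1::real) = 1 then v x else lam - v x))"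
     using Q \<delta> const by (intro exI[of _ Q]) (auto simp: Q_def mult_left_le)
   qed (use Qpos in auto)
  qed
 qed
 show thesis
 proof (rule that[of \<mu>])
  show "emeasure lborel ?B = 0" using AE_iff_null_sets[of ?B lborel] Bnull B(1) by (auto simp: null_sets_def)
  show "AE x in lborel. v x = lam * indicator (Aset Om v \<mu>) x" using Bnull \<mu>
  proof eventually_elim
   case (elim x)
   show ?case
   proof (cases "x \<in> D")
    case True
    then show ?thesis using elim by (cases "psi0 Om v x" \<mu> rule: linorder_cases) (auto simp: Aset_def Bset_def)
   qed (use bdens_D[OF vb] in \<open>auto simp: Aset_def\<close>)
  qed
 qed
qed

section \<open>The weak form of the equation\<close>

lemma has_real_derivative_along:
 fixes \<zeta> :: "pt => real"
 assumes "\<zeta> differentiable (at (x + s *\<^sub>R a))"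
 shows "((\<lambda>s. \<zeta> (x + s *\<^sub>R a)) has_real_derivative frechet_derivative \<zeta> (at (x + s *\<^sub>R a)) a) (at s)"
proof -
 let ?D = "frechet_derivative \<zeta> (at (x + s *\<^sub>R a))"
 have d: "(\<zeta> has_derivative ?D) (at (x + s *\<^sub>R a))" using assms by (simp add: frechet_derivative_works)
 have "((\<lambda>s. x + s *\<^sub>R a) has_derivative (\<lambda>t. t *\<^sub>R a)) (at s)"
  by (auto intro!: derivative_eq_intros)
 from has_derivative_compose[OF this d] have "((\<lambda>s. \<zeta> (x + s *\<^sub>R a)) has_derivative (\<lambda>t. ?D (t *\<^sub>R a))) (at s)" .
 moreover have "?D (t *\<^sub>R a) = ?D a * t" for t
  using has_derivative_linear[OF d] by (simp add: linear_cmul mult.commute)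
 ultimately show ?thesis by (simp add: has_field_derivative_def mult_commute_abs)
qed

lemma MVT_along:
 fixes \<zeta> :: "pt => real"
 assumes "\<And>x. \<zeta> differentiable (at x)" and h: "0 < h"
 obtains \<theta> where "0 < \<theta>" "\<theta> < h" "\<zeta> (x + h *\<^sub>R a) - \<zeta> x = h * frechet_derivative \<zeta> (at (x + \<theta> *\<^sub>R a)) a"
proof -
 from MVT2[OF h, of "\<lambda>s. \<zeta> (x + s *\<^sub>R a)" "\<lambda>s. frechet_derivative \<zeta> (at (x + s *\<^sub>R a)) a"]
 obtain z where "0 < z" "z < h" "\<zeta> (x + h *\<^sub>R a) - \<zeta> (x + 0 *\<^sub>R a) = (h - 0) * frechet_derivative \<zeta> (at (x + z *\<^sub>R a)) a"
  using has_real_derivative_along[OF assms(1)] by blast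
 then show thesis using that by simp
qed

text \<open>Mean value theorem twice: in direction \<open>a\<close> for the increment of
  \<open>\<phi>\<close> along \<open>b\<close>, and in direction \<open>b\<close> for the resulting
  derivative along \<open>a\<close>.\<close>

lemma mixed_difference:
 assumes sm: "smooth_fun \<phi>" and h: "0 < h"
 obtains s t where "0 < s" "s < h" "0 < t" "t < h"
  "\<phi> (x + h *\<^sub>R a + h *\<^sub>R b) - \<phi> (x + h *\<^sub>R a) - \<phi> (x + h *\<^sub>R b) + \<phi> x = h * h * iter_deriv [b, a] \<phi> (x + s *\<^sub>R a + t *\<^sub>R b)"
proof -
 have d0: "\<phi> differentiable (at y)" for y using sm[unfolded smooth_fun_def, rule_format, of "[]"] by simp
 have d1: "iter_deriv [a] \<phi> differentiable (at y)" for y using sm[unfolded smooth_fun_def, rule_format, of "[a]"] .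
 define u where "u y = \<phi> (y + h *\<^sub>R b) - \<phi> y" for y
 have dshift: "((\<lambda>y. \<phi> (y + h *\<^sub>R b)) has_derivative frechet_derivative \<phi> (at (y + h *\<^sub>R b))) (at y)" for y
 proof -
  have "((\<lambda>y. y + h *\<^sub>R b) has_derivative (\<lambda>t. t)) (at y)" by (auto intro!: derivative_eq_intros)
  from has_derivative_compose[OF this frechet_derivative_works[THEN iffD1, OF d0]] show ?thesis .
 qed
 have du: "(u has_derivative (\<lambda>t. frechet_derivative \<phi> (at (y + h *\<^sub>R b)) t - frechet_derivative \<phi> (at y) t)) (at y)" for y
  unfolding u_def by (intro has_derivative_diff dshift frechet_derivative_works[THEN iffD1, OF d0])
 have ud: "u differentiable (at y)" for y using du differentiable_def by blast
 obtain s where s: "0 < s" "s < h" "u (x + h *\<^sub>R a) - u x = h * frechet_derivative u (at (x + s *\<^sub>R a)) a"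
  using MVT_along[OF ud h] by blast
 have fu: "frechet_derivative u (at (x + s *\<^sub>R a)) a = iter_deriv [a] \<phi> (x + s *\<^sub>R a + h *\<^sub>R b) - iter_deriv [a] \<phi> (x + s *\<^sub>R a)"
  using frechet_derivative_at[OF du[of "x + s *\<^sub>R a"], symmetric] by (simp add: fun_eq_iff)
 obtain t where t: "0 < t" "t < h" "iter_deriv [a] \<phi> (x + s *\<^sub>R a + h *\<^sub>R b) - iter_deriv [a] \<phi> (x + s *\<^sub>R a) = h * frechet_derivative (iter_deriv [a] \<phi>) (at (x + s *\<^sub>R a + t *\<^sub>R b)) b"
  using MVT_along[OF d1 h] by blast
 have i: "frechet_derivative (iter_deriv [a] \<phi>) (at y) b = iter_deriv [b, a] \<phi> y" for y by simp
 have "u (x + h *\<^sub>R a) - u x = h * (h * iter_deriv [b, a] \<phi> (x + s *\<^sub>R a + t *\<^sub>R b))"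
  unfolding s(3) fu t(3) i ..
 then show thesis using that[of s t] s t by (simp only: u_def mult.assoc)
qed

text \<open>The second difference does not change when \<open>a\<close> and \<open>b\<close> are
  exchanged, and divided by h^2 it tends to either mixed derivative. Continuity of these derivatives
  comes from their differentiability.\<close>

lemma smooth_fun_mixed_partials:
 assumes sm: "smooth_fun \<phi>"
 shows "iter_deriv [a, b] \<phi> x = iter_deriv [b, a] \<phi> x"
proof -
 have cont: "isCont (iter_deriv vs \<phi>) x" for vs
  using sm[unfolded smooth_fun_def, rule_format, of vs x] by (rule differentiable_imp_continuous_within)
 define h where "h n = 1 / real (Suc n)" for n
 have h0: "0 < h n" for n by (simp add: h_def)
 have hl: "h \<longlonglongrightarrow> 0" unfolding h_def using LIMSEQ_inverse_real_of_nat by (simp add: inverse_eq_divide)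
 have conv: "\<exists>y. y \<longlonglongrightarrow> x \<and> (\<forall>n. \<phi> (x + h n *\<^sub>R a + h n *\<^sub>R b) - \<phi> (x + h n *\<^sub>R a) - \<phi> (x + h n *\<^sub>R b) + \<phi> x = h n * h n * iter_deriv [b, a] \<phi> (y n))" for a b
 proof -
  have "\<exists>s t. 0 < s \<and> s < h n \<and> 0 < t \<and> t < h n \<and> \<phi> (x + h n *\<^sub>R a + h n *\<^sub>R b) - \<phi> (x + h n *\<^sub>R a) - \<phi> (x + h n *\<^sub>R b) + \<phi> x = h n * h n * iter_deriv [b, a] \<phi> (x + s *\<^sub>R a + t *\<^sub>R b)" for n
   using mixed_difference[OF sm h0] by metis
  then obtain s t where st: "\<And>n. 0 < s n \<and> s n < h n \<and> 0 < t n \<and> t n < h n \<and> \<phi> (x + h n *\<^sub>R a + h n *\<^sub>R b) - \<phi> (x + h n *\<^sub>R a) - \<phi> (x + h n *\<^sub>R b) + \<phi> x = h n * h n * iter_deriv [b, a] \<phi> (x + s n *\<^sub>R a + t n *\<^sub>R b)"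
   by metis
  have "s \<longlonglongrightarrow> 0" by (rule tendsto_sandwich[OF _ _ tendsto_const hl]) (intro always_eventually allI less_imp_le; use st in blast)+
  moreover have "t \<longlonglongrightarrow> 0" by (rule tendsto_sandwich[OF _ _ tendsto_const hl]) (intro always_eventually allI less_imp_le; use st in blast)+
  ultimately have "(\<lambda>n. x + s n *\<^sub>R a + t n *\<^sub>R b) \<longlonglongrightarrow> x + 0 *\<^sub>R a + 0 *\<^sub>R b"
   by (intro tendsto_add tendsto_const tendsto_scaleR)
  then show ?thesis using st by (intro exI[of _ "\<lambda>n. x + s n *\<^sub>R a + t n *\<^sub>R b"]) simp
 qed
 obtain y where y: "y \<longlonglongrightarrow> x" "\<And>n. \<phi> (x + h n *\<^sub>R a + h n *\<^sub>R b) - \<phi> (x + h n *\<^sub>R a) - \<phi> (x + h n *\<^sub>R b) + \<phi> x = h n * h n * iter_deriv [b, a] \<phi> (y n)"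
  using conv[of a b] by blast
 obtain z where z: "z \<longlonglongrightarrow> x" "\<And>n. \<phi> (x + h n *\<^sub>R b + h n *\<^sub>R a) - \<phi> (x + h n *\<^sub>R b) - \<phi> (x + h n *\<^sub>R a) + \<phi> x = h n * h n * iter_deriv [a, b] \<phi> (z n)"
  using conv[of b a] by blast
 have eq: "iter_deriv [b, a] \<phi> (y n) = iter_deriv [a, b] \<phi> (z n)" for n
 proof -
  have e: "x + h n *\<^sub>R b + h n *\<^sub>R a = x + h n *\<^sub>R a + h n *\<^sub>R b" by simp
  have "h n * h n * iter_deriv [b, a] \<phi> (y n) = h n * h n * iter_deriv [a, b] \<phi> (z n)"
   using y(2)[of n] z(2)[of n] unfolding e by linarith
  then show ?thesis using h0[of n] by simp
 qed
 have "(\<lambda>n. iter_deriv [b, a] \<phi> (y n)) \<longlonglongrightarrow> iter_deriv [b, a] \<phi> x" by (rule isCont_tendsto_compose[OF cont y(1)])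
 moreover have "(\<lambda>n. iter_deriv [a, b] \<phi> (z n)) \<longlonglongrightarrow> iter_deriv [a, b] \<phi> x" by (rule isCont_tendsto_compose[OF cont z(1)])
 ultimately show ?thesis unfolding eq by (rule LIMSEQ_unique[THEN sym])
qed

lemma iter_deriv_zero_outside:
 assumes "x \<notin> closure {x. \<phi> x \<noteq> 0}"
 shows "iter_deriv vs \<phi> x = 0"
 using assms
proof (induction vs arbitrary: x)
 case Nil
 then show ?case using closure_subset[of "{x. \<phi> x \<noteq> 0}"] by auto
next
 case (Cons v vs)
 have "((\<lambda>_. 0) has_derivative (\<lambda>_. 0)) (at x)" by (rule has_derivative_const)
 then have "(iter_deriv vs \<phi> has_derivative (\<lambda>_. 0)) (at x)"
  by (rule has_derivative_transform_within_open[where s="- closure {x. \<phi> x \<noteq> 0}"]) (use Cons in auto)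
 then have "frechet_derivative (iter_deriv vs \<phi>) (at x) = (\<lambda>_. 0)" using frechet_derivative_at by metis
 then show ?case by simp
qed

text \<open>Integration by parts for a Lipschitz \<open>F\<close> whose derivative is known only
  almost everywhere where \<open>\<zeta>\<close> is nonzero: translation invariance moves the
  difference quotient from \<open>F\<close> to \<open>\<zeta>\<close>, and dominated convergence
  passes to the limit on both sides.\<close>

lemma integral_difference_quotient_parts:
 fixes F \<zeta> G :: "pt => real"
 assumes Fl: "\<And>x y. \<bar>F x - F y\<bar> \<le> C * norm (x - y)" and Fb: "\<And>x. \<bar>F x\<bar> \<le> B"
  and zd: "\<And>x. \<zeta> differentiable (at x)" and z0: "\<And>x. x \<notin> ball 0 R ==> \<zeta> x = 0"
  and zb: "\<And>x. \<bar>frechet_derivative \<zeta> (at x) a\<bar> \<le> M"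
  and zB: "\<And>x. \<bar>\<zeta> x\<bar> \<le> M"
  and Gm: "G \<in> borel_measurable borel"
  and G: "AE x in lborel. \<zeta> x \<noteq> 0 --> ((\<lambda>s. F (x + s *\<^sub>R a)) has_real_derivative G x) (at 0)"
 shows "(LBINT x. G x * \<zeta> x) = - (LBINT x. F x * frechet_derivative \<zeta> (at x) a)"
proof -
 have M0: "0 \<le> M" using zB[of 0] by linarith
 have B0: "0 \<le> B" using Fb[of 0] by linarith
 have C0: "0 \<le> C" using Fl[of "axis 1 1" 0] by (simp add: norm_axis_1)
 have zc: "continuous_on UNIV \<zeta>" using zd by (auto intro!: continuous_at_imp_continuous_on differentiable_imp_continuous_within)
 have Fc: "continuous_on UNIV F"
 proof (rule continuous_on_iff[THEN iffD2], intro ballI allI impI)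
  fix x :: pt and e :: real assume e: "0 < e"
  show "\<exists>d>0. \<forall>x'\<in>UNIV. dist x' x < d --> dist (F x') (F x) < e"
  proof (intro exI[of _ "e / (C + 1)"] conjI ballI impI)
   fix x' assume x': "dist x' x < e / (C + 1)"
   have "\<bar>F x' - F x\<bar> \<le> (C + 1) * norm (x' - x)" using Fl[of x' x] by (simp add: algebra_simps) (smt (verit) norm_ge_zero)
   also have "\<dots> < e" using x' C0 by (simp add: dist_norm pos_less_divide_eq mult.commute)
   finally show "dist (F x') (F x) < e" by (simp add: dist_real_def)
  qed (use e C0 in auto)
 qed
 have [measurable]: "F \<in> borel_measurable borel" "\<zeta> \<in> borel_measurable borel" "G \<in> borel_measurable borel"
  using Fc zc Gm by (auto intro: borel_measurable_continuous_onI)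
 define h where "h n = 1 / real (Suc n)" for n
 have h0: "0 < h n" "h n \<le> 1" for n by (auto simp: h_def)
 have hl: "h \<longlonglongrightarrow> 0" unfolding h_def using LIMSEQ_inverse_real_of_nat by (simp add: inverse_eq_divide)
 define z' where "z' x = frechet_derivative \<zeta> (at x) a" for x
 have zder: "((\<lambda>s. \<zeta> (x + s *\<^sub>R a)) has_real_derivative z' x) (at 0)" for x
  using has_real_derivative_along[where x=x and s=0 and a=a, OF zd] by (simp add: z'_def)
 have zlim: "(\<lambda>n. (\<zeta> (x - h n *\<^sub>R a) - \<zeta> x) / h n) \<longlonglongrightarrow> - z' x" for x
 proof -
  have "(\<lambda>s. (\<zeta> (x + (0 + s) *\<^sub>R a) - \<zeta> (x + 0 *\<^sub>R a)) / s) \<midarrow>0\<rightarrow> z' x"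
   using zder[of x] unfolding has_field_derivative_iff by simp
  moreover have "filterlim (\<lambda>n. - h n) (at 0) sequentially"
   unfolding filterlim_at using hl h0 tendsto_minus[OF hl] by (auto simp: less_imp_neq[symmetric])
  ultimately have "(\<lambda>n. (\<zeta> (x + (0 + - h n) *\<^sub>R a) - \<zeta> (x + 0 *\<^sub>R a)) / - h n) \<longlonglongrightarrow> z' x"
   by (rule filterlim_compose)
  from tendsto_minus[OF this] show ?thesis by simp
 qed
 have z'm [measurable]: "z' \<in> borel_measurable borel"
 proof (rule borel_measurable_LIMSEQ_real)
  show "(\<lambda>n. - ((\<zeta> (x - h n *\<^sub>R a) - \<zeta> x) / h n)) \<longlonglongrightarrow> z' x" for x using tendsto_minus[OF zlim[of x]] by simp
 qed measurable
 define R' where "R' = R + norm a"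
 have far: "\<zeta> (x - h n *\<^sub>R a) = 0 \<and> \<zeta> x = 0" if "x \<notin> ball 0 R'" for x n
 proof -
  have "norm x \<le> norm (x - h n *\<^sub>R a) + norm (h n *\<^sub>R a)" using norm_triangle_ineq[of "x - h n *\<^sub>R a" "h n *\<^sub>R a"] by simp
  also have "norm (h n *\<^sub>R a) \<le> norm a" using h0[of n] by (simp add: mult_left_le_one_le)
  finally have "R \<le> norm (x - h n *\<^sub>R a)" "R \<le> norm x" using that by (auto simp: R'_def) (smt (verit) norm_ge_zero)
  then show ?thesis using z0[of x] z0[of "x - h n *\<^sub>R a"] by (auto simp: not_less)
 qed
 have zquot: "\<bar>(\<zeta> (x - h n *\<^sub>R a) - \<zeta> x) / h n\<bar> \<le> M * indicator (ball 0 R') x" for x n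
 proof (cases "x \<in> ball 0 R'")
  case True
  obtain \<theta> where "\<zeta> ((x - h n *\<^sub>R a) + h n *\<^sub>R a) - \<zeta> (x - h n *\<^sub>R a) = h n * frechet_derivative \<zeta> (at (x - h n *\<^sub>R a + \<theta> *\<^sub>R a)) a"
   using MVT_along[OF zd h0(1)] by blast
  then have "\<bar>\<zeta> (x - h n *\<^sub>R a) - \<zeta> x\<bar> = h n * \<bar>frechet_derivative \<zeta> (at (x - h n *\<^sub>R a + \<theta> *\<^sub>R a)) a\<bar>"
   using h0[of n] by (simp add: abs_mult abs_minus_commute)
  also have "\<dots> \<le> h n * M" using zb h0[of n] by (intro mult_left_mono) (auto intro: less_imp_le)
  finally show ?thesis using True h0(1)[of n] by (simp add: abs_divide divide_le_eq mult.commute)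
 qed (use far in auto)
 have ib: "integrable lborel (\<lambda>x. K * indicator (ball (0::pt) r) x)" for K r :: real
  using integrable_indicator_ball[of 0 r] by simp
 have r: "(\<lambda>n. LBINT x. F x * ((\<zeta> (x - h n *\<^sub>R a) - \<zeta> x) / h n)) \<longlonglongrightarrow> (LBINT x. F x * (- z' x))"
 proof (rule integral_dominated_convergence[OF _ _ ib[of "B * M" R']])
  show "AE x in lborel. (\<lambda>n. F x * ((\<zeta> (x - h n *\<^sub>R a) - \<zeta> x) / h n)) \<longlonglongrightarrow> F x * (- z' x)"
   by (intro AE_I2 tendsto_mult tendsto_const zlim)
  show "AE x in lborel. norm (F x * ((\<zeta> (x - h n *\<^sub>R a) - \<zeta> x) / h n)) \<le> B * M * indicator (ball 0 R') x" for n
  proof (intro AE_I2)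
   fix x
   have "\<bar>F x\<bar> * \<bar>(\<zeta> (x - h n *\<^sub>R a) - \<zeta> x) / h n\<bar> \<le> B * (M * indicator (ball 0 R') x)"
    using Fb zquot B0 by (intro mult_mono) auto
   then show "norm (F x * ((\<zeta> (x - h n *\<^sub>R a) - \<zeta> x) / h n)) \<le> B * M * indicator (ball 0 R') x"
    by (simp only: real_norm_def abs_mult mult.assoc)
  qed
 qed measurable
 have l: "(\<lambda>n. LBINT x. ((F (x + h n *\<^sub>R a) - F x) / h n) * \<zeta> x) \<longlonglongrightarrow> (LBINT x. G x * \<zeta> x)"
 proof (rule integral_dominated_convergence[OF _ _ ib[of "C * norm a * M" R]])
  show "AE x in lborel. (\<lambda>n. ((F (x + h n *\<^sub>R a) - F x) / h n) * \<zeta> x) \<longlonglongrightarrow> G x * \<zeta> x" using G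
  proof eventually_elim
   case (elim x)
   show ?case
   proof (cases "\<zeta> x = 0")
    case False
    then have "(\<lambda>s. (F (x + (0 + s) *\<^sub>R a) - F (x + 0 *\<^sub>R a)) / s) \<midarrow>0\<rightarrow> G x"
     using elim unfolding has_field_derivative_iff by simp
    moreover have "filterlim h (at 0) sequentially"
     unfolding filterlim_at using hl h0 by (auto simp: less_imp_neq[symmetric])
    ultimately have "(\<lambda>n. (F (x + (0 + h n) *\<^sub>R a) - F (x + 0 *\<^sub>R a)) / h n) \<longlonglongrightarrow> G x"
     by (rule filterlim_compose)
    then show ?thesis by (intro tendsto_mult tendsto_const) simp
   qed simp
  qed
  show "AE x in lborel. norm (((F (x + h n *\<^sub>R a) - F x) / h n) * \<zeta> x) \<le> C * norm a * M * indicator (ball 0 R) x" for n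
  proof (intro AE_I2)
   fix x
   have "\<bar>F (x + h n *\<^sub>R a) - F x\<bar> \<le> C * (h n * norm a)" using Fl[of "x + h n *\<^sub>R a" x] h0[of n] by simp
   then have "\<bar>(F (x + h n *\<^sub>R a) - F x) / h n\<bar> \<le> C * norm a" using h0(1)[of n] by (simp add: abs_divide divide_le_eq mult_ac)
   moreover have "\<bar>\<zeta> x\<bar> \<le> M * indicator (ball 0 R) x" using zB[of x] z0[of x] by (auto split: split_indicator)
   ultimately have "\<bar>(F (x + h n *\<^sub>R a) - F x) / h n\<bar> * \<bar>\<zeta> x\<bar> \<le> (C * norm a) * (M * indicator (ball 0 R) x)"
    using C0 by (intro mult_mono) auto
   then show "norm (((F (x + h n *\<^sub>R a) - F x) / h n) * \<zeta> x) \<le> C * norm a * M * indicator (ball 0 R) x"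
    by (simp only: real_norm_def abs_mult mult.assoc)
  qed
 qed measurable
 have eq: "(LBINT x. ((F (x + h n *\<^sub>R a) - F x) / h n) * \<zeta> x) = (LBINT x. F x * ((\<zeta> (x - h n *\<^sub>R a) - \<zeta> x) / h n))" for n
 proof -
  have zb': "\<bar>\<zeta> x\<bar> \<le> M * indicator (ball 0 R) x" for x using zB[of x] z0[of x] by (auto split: split_indicator)
  have bnd: "integrable lborel (\<lambda>x. F (x + w) * \<zeta> x)" for w
  proof (rule Bochner_Integration.integrable_bound[OF ib[of "B * M" R]])
   show "AE x in lborel. norm (F (x + w) * \<zeta> x) \<le> norm (B * M * indicator (ball 0 R) x)" (is "AE x in _. ?P x")
   proof (intro AE_I2)
    fix x
    have "\<bar>F (x + w)\<bar> * \<bar>\<zeta> x\<bar> \<le> B * (M * indicator (ball 0 R) x)" using Fb zb' B0 by (intro mult_mono) auto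
    then show "?P x" using B0 M0 by (simp add: abs_mult mult.assoc)
   qed
  qed measurable
  define w where "w = h n *\<^sub>R a"
  have i1: "integrable lborel (\<lambda>x. F (x + w) * \<zeta> x)" "integrable lborel (\<lambda>x. F x * \<zeta> x)" using bnd[of w] bnd[of 0] by auto
  have i2: "integrable lborel (\<lambda>x. F x * \<zeta> (x - w))"
   using integrable_lborel_affine[OF i1(1), of 1 "-w"] by simp
  have tr: "(LBINT x. F (x + w) * \<zeta> x) = (LBINT x. F x * \<zeta> (x - w))"
   using integral_lborel_affine[of 1 "\<lambda>x. F (x + w) * \<zeta> x" "-w"] by simp
  have "(LBINT x. ((F (x + w) - F x) / h n) * \<zeta> x) = (LBINT x. (F (x + w) * \<zeta> x - F x * \<zeta> x) / h n)"
   by (simp add: algebra_simps)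
  also have "\<dots> = ((LBINT x. F (x + w) * \<zeta> x) - (LBINT x. F x * \<zeta> x)) / h n" using i1 by simp
  also have "\<dots> = (LBINT x. (F x * \<zeta> (x - w) - F x * \<zeta> x) / h n)" unfolding tr using i1 i2 by simp
  also have "\<dots> = (LBINT x. F x * ((\<zeta> (x - w) - \<zeta> x) / h n))" by (simp add: algebra_simps)
  finally show ?thesis unfolding w_def .
 qed
 have "(LBINT x. G x * \<zeta> x) = (LBINT x. F x * (- z' x))"
  using l r unfolding eq by (rule LIMSEQ_unique)
 then show ?thesis by (simp add: z'_def)
qed

lemma measurable_lgrad: "f \<in> borel_measurable borel ==> lgrad f \<in> borel_measurable borel"
proof -
 assume [measurable]: "f \<in> borel_measurable borel"
 have "(\<lambda>x. LBINT y. f y *\<^sub>R ((1 / (norm (x - y))^2) *\<^sub>R (x - y))) \<in> borel_measurable (lborel :: pt measure)"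
  by (rule lborel.borel_measurable_lebesgue_integral) measurable
 then show ?thesis by (simp add: lgrad_def[abs_def])
qed

lemma measurable_hgrad: "f \<in> borel_measurable borel ==> hgrad f \<in> borel_measurable borel"
proof -
 assume [measurable]: "f \<in> borel_measurable borel"
 have "(\<lambda>x. LBINT y. f y *\<^sub>R hgk x y) \<in> borel_measurable (lborel :: pt measure)"
  unfolding hgk_def Nker_def by (rule lborel.borel_measurable_lebesgue_integral) measurable
 then show ?thesis by (simp add: hgrad_def[abs_def])
qed

lemma measurable_pgrad: "f \<in> borel_measurable borel ==> pgrad Om f \<in> borel_measurable borel"
 unfolding pgrad_def[abs_def]
 by (intro borel_measurable_add borel_measurable_diff borel_measurable_scaleR measurable_lgrad measurable_hgrad) auto

text \<open>On the patch the integrand is the gradient of the Lipschitz function \<open>(psi - \<mu>)\<^sup>+\<close>, whose curl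
 vanishes weakly; the level set itself is negligible.\<close>

lemma patch_weak_form:
 assumes f: "bdens L 1 f" and \<phi>: "test_fun D \<phi>" and B: "emeasure lborel (Bset Om f \<mu>) = 0"
 shows "(LBINT x. indicator (Aset Om f \<mu>) x * (pgrad Om f x \<bullet> perp (grad \<phi> x))) = 0"
proof -
 have sm: "smooth_fun \<phi>" and cS: "compact (closure {x. \<phi> x \<noteq> 0})" and SD: "closure {x. \<phi> x \<noteq> 0} \<subseteq> D"
  using \<phi> by (auto simp: test_fun_def)
 define S where "S = closure {x. \<phi> x \<noteq> 0}"
 obtain \<rho> where \<rho>: "0 < \<rho>" "\<rho> < 1" "S \<subseteq> ball 0 \<rho>"
 proof -
  have "compact (norm ` S)" using cS unfolding S_def by (intro compact_continuous_image continuous_intros)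
  show thesis
  proof (cases "S = {}")
   case True then show thesis using that[of "1/2"] by auto
  next
   case False
   then obtain x where x: "x \<in> S" "\<And>y. y \<in> S ==> norm y \<le> norm x"
    using compact_attains_sup[OF \<open>compact (norm ` S)\<close>] by auto
   have "norm x < 1" using x SD by (auto simp: S_def D_iff)
   then have "S \<subseteq> ball 0 ((1 + norm x) / 2)" using x by fastforce
   then show thesis using that[of "(1 + norm x) / 2"] \<open>norm x < 1\<close> by (auto simp: add_pos_nonneg)
  qed
 qed
 define psi where "psi = psi0 Om f"
 obtain C where C: "0 < C" "\<And>x x'. norm x \<le> \<rho> ==> norm x' \<le> \<rho> ==> \<bar>psi x - psi x'\<bar> \<le> C * norm (x - x')"
  using psi0_lipschitz[OF f, of "1 - \<rho>" Om] \<rho> unfolding psi_def by auto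
 \<comment> \<open>Metric projection onto a disk around the support of \<open>\<phi>\<close>: it
   makes the truncated psi globally bounded and Lipschitz without changing it near that
   support.\<close>
 define pr where "pr x = closest_point (cball 0 \<rho>) x" for x :: pt
 have pr: "norm (pr x) \<le> \<rho>" for x
  using closest_point_in_set[of "cball (0::pt) \<rho>" x] \<rho> by (auto simp: pr_def)
 have prl: "norm (pr x - pr y) \<le> norm (x - y)" for x y
  using closest_point_lipschitz[of "cball (0::pt) \<rho>" x y] \<rho> by (auto simp: pr_def dist_norm)
 have pri: "pr x = x" if "x \<in> ball 0 \<rho>" for x using that by (simp add: pr_def closest_point_self)
 define F where "F x = max (psi (pr x) - \<mu>) 0" for x
 have Fl: "\<bar>F x - F y\<bar> \<le> C * norm (x - y)" for x y
 proof -
  have "\<bar>F x - F y\<bar> \<le> \<bar>psi (pr x) - psi (pr y)\<bar>" by (simp add: F_def)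
  also have "\<dots> \<le> C * norm (pr x - pr y)" by (rule C(2)[OF pr pr])
  also have "\<dots> \<le> C * norm (x - y)" using C(1) prl by simp
  finally show ?thesis .
 qed
 define B1 where "B1 = \<bar>F 0\<bar> + C * (2 * \<rho>)"
 have Fb: "\<bar>F x\<bar> \<le> B1" for x
 proof -
  have "\<bar>F x - F 0\<bar> \<le> \<bar>psi (pr x) - psi (pr 0)\<bar>" by (simp add: F_def)
  also have "\<dots> \<le> C * norm (pr x - pr 0)" by (rule C(2)[OF pr pr])
  also have "norm (pr x - pr 0) \<le> 2 * \<rho>" using norm_triangle_ineq4[of "pr x" "pr 0"] pr[of x] pr[of 0] by linarith
  then have "C * norm (pr x - pr 0) \<le> C * (2 * \<rho>)" using C(1) by (intro mult_left_mono) auto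
  finally show ?thesis unfolding B1_def by linarith
 qed
 have bS: "x \<in> ball 0 \<rho>" if "iter_deriv vs \<phi> x \<noteq> 0" for vs x
  using iter_deriv_zero_outside[of x \<phi> vs] that \<rho>(3) unfolding S_def by blast
 have dif: "iter_deriv vs \<phi> differentiable (at x)" for vs x using sm by (simp add: smooth_fun_def)
 have cont: "continuous_on UNIV (iter_deriv vs \<phi>)" for vs
  using dif by (auto intro!: continuous_at_imp_continuous_on differentiable_imp_continuous_within)
 have "\<exists>M. \<forall>x. \<bar>iter_deriv vs \<phi> x\<bar> \<le> M" for vs
 proof -
  have "compact (iter_deriv vs \<phi> ` S)" using cS cont unfolding S_def by (intro compact_continuous_image) (auto intro: continuous_on_subset)
  then obtain M where M: "\<And>x. x \<in> S ==> \<bar>iter_deriv vs \<phi> x\<bar> \<le> M" using compact_imp_bounded bounded_iff by (metis imageI real_norm_def)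
  then have "\<bar>iter_deriv vs \<phi> x\<bar> \<le> max M 0" for x
   using iter_deriv_zero_outside[of x \<phi> vs] by (cases "x \<in> S") (auto simp: S_def le_max_iff_disj)
  then show ?thesis by blast
 qed
 then obtain M where M: "\<And>vs x. \<bar>iter_deriv vs \<phi> x\<bar> \<le> M vs" by metis
 have [measurable]: "psi0 Om f \<in> borel_measurable borel" "pgrad Om f \<in> borel_measurable borel"
  using measurable_psi0[OF f] measurable_pgrad[OF bdens_measurable[OF f]] by auto
 have [measurable]: "Aset Om f \<mu> \<in> sets borel" "Bset Om f \<mu> \<in> sets borel" unfolding Aset_def Bset_def by measurable
 have key: "(LBINT x. (indicator (Aset Om f \<mu>) x * (pgrad Om f x \<bullet> a)) * iter_deriv [b] \<phi> x) = - (LBINT x. F x * iter_deriv [a, b] \<phi> x)" for a b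
 proof -
  have "(LBINT x. (indicator (Aset Om f \<mu>) x * (pgrad Om f x \<bullet> a)) * iter_deriv [b] \<phi> x) = - (LBINT x. F x * frechet_derivative (iter_deriv [b] \<phi>) (at x) a)"
  proof (rule integral_difference_quotient_parts[OF Fl Fb dif, where R=\<rho> and M="max (M [b]) (M [a, b])"])
   show "iter_deriv [b] \<phi> x = 0" if "x \<notin> ball 0 \<rho>" for x using bS that by blast
   show "\<bar>frechet_derivative (iter_deriv [b] \<phi>) (at x) a\<bar> \<le> max (M [b]) (M [a, b])" for x
    using M[of "[a, b]" x] by (simp add: le_max_iff_disj)
   show "\<bar>iter_deriv [b] \<phi> x\<bar> \<le> max (M [b]) (M [a, b])" for x using M[of "[b]" x] by (simp only: le_max_iff_disj) blast
   show "(\<lambda>x. indicator (Aset Om f \<mu>) x * (pgrad Om f x \<bullet> a)) \<in> borel_measurable borel" by measurable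
   have "AE x in lborel. x \<notin> Bset Om f \<mu>" using B by (intro AE_not_in) (simp add: null_sets_def)
   then show "AE x in lborel. iter_deriv [b] \<phi> x \<noteq> 0 -->
    ((\<lambda>s. F (x + s *\<^sub>R a)) has_real_derivative indicator (Aset Om f \<mu>) x * (pgrad Om f x \<bullet> a)) (at 0)"
   proof eventually_elim
    case (elim x)
    show ?case
    proof
     assume "iter_deriv [b] \<phi> x \<noteq> 0"
     then have x: "x \<in> ball 0 \<rho>" by (rule bS)
     have xD: "x \<in> D" using x \<rho> by (simp add: D_iff)
     have ne: "psi x \<noteq> \<mu>" using elim xD by (simp add: Bset_def psi_def)
     have pd: "(psi has_derivative (\<lambda>t. pgrad Om f x \<bullet> t)) (at x)" unfolding psi_def by (rule psi0_has_derivative[OF f xD])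
     have pc: "isCont psi x" using pd has_derivative_continuous by blast
     \<comment> \<open>As \<open>x\<close> is off the level set, continuity makes \<open>F\<close>
       coincide near \<open>x\<close> with psi - \<mu> or with 0.\<close>
     have Fd: "(F has_derivative (\<lambda>t. indicator (Aset Om f \<mu>) x * (pgrad Om f x \<bullet> t))) (at x)"
     proof (cases "\<mu> < psi x")
      case True
      then have ev: "\<forall>\<^sub>F y in at x. \<mu> < psi y" by (intro order_tendstoD(1)[OF pc[unfolded isCont_def]])
      have ev2: "\<forall>\<^sub>F y in at x. y \<in> ball 0 \<rho>" using x by (intro eventually_at_topological[THEN iffD2]) (auto intro!: exI[of _ "ball 0 \<rho>"])
      have "((\<lambda>y. psi y - \<mu>) has_derivative (\<lambda>t. pgrad Om f x \<bullet> t)) (at x)"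
       using has_derivative_diff[OF pd has_derivative_const[of \<mu>]] by simp
      then have "(F has_derivative (\<lambda>t. pgrad Om f x \<bullet> t)) (at x)"
      proof (rule has_derivative_transform_eventually)
       show "\<forall>\<^sub>F y in at x. psi y - \<mu> = F y" using ev ev2 by eventually_elim (auto simp: F_def pri)
       show "psi x - \<mu> = F x" using True x by (simp add: F_def pri)
      qed simp
      then show ?thesis using True xD by (simp add: Aset_def psi_def)
     next
      case False
      then have "psi x < \<mu>" using ne by simp
      then have ev: "\<forall>\<^sub>F y in at x. psi y < \<mu>" using pc unfolding isCont_def by (intro order_tendstoD)
      have ev2: "\<forall>\<^sub>F y in at x. y \<in> ball 0 \<rho>" using x by (intro eventually_at_topological[THEN iffD2]) (auto intro!: exI[of _ "ball 0 \<rho>"])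
      have "((\<lambda>y. 0) has_derivative (\<lambda>t. 0)) (at x)" by (rule has_derivative_const)
      then have "(F has_derivative (\<lambda>t. 0)) (at x)"
      proof (rule has_derivative_transform_eventually)
       show "\<forall>\<^sub>F y in at x. 0 = F y" using ev ev2 by eventually_elim (auto simp: F_def pri)
       show "0 = F x" using False x by (simp add: F_def pri)
      qed simp
      then show ?thesis using False by (simp add: Aset_def psi_def)
     qed
     have "F differentiable (at (x + 0 *\<^sub>R a))" using Fd differentiable_def by auto
     from has_real_derivative_along[OF this] have "((\<lambda>s. F (x + s *\<^sub>R a)) has_real_derivative frechet_derivative F (at x) a) (at 0)" by simp
     moreover have "frechet_derivative F (at x) a = indicator (Aset Om f \<mu>) x * (pgrad Om f x \<bullet> a)"
      using frechet_derivative_at[OF Fd] by metis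
     ultimately show "((\<lambda>s. F (x + s *\<^sub>R a)) has_real_derivative indicator (Aset Om f \<mu>) x * (pgrad Om f x \<bullet> a)) (at 0)" by simp
    qed
   qed
  qed
  then show ?thesis by simp
 qed
 let ?e1 = "axis 1 1 :: pt" and ?e2 = "axis 2 1 :: pt"
 have pt: "indicator (Aset Om f \<mu>) x * (pgrad Om f x \<bullet> perp (grad \<phi> x)) =
   (indicator (Aset Om f \<mu>) x * (pgrad Om f x \<bullet> ?e1)) * iter_deriv [?e2] \<phi> x - (indicator (Aset Om f \<mu>) x * (pgrad Om f x \<bullet> ?e2)) * iter_deriv [?e1] \<phi> x" for x
  by (simp add: inner_vec_def sum_2 perp_def grad_def axis_def algebra_simps)
 have int: "integrable lborel (\<lambda>x. (indicator (Aset Om f \<mu>) x * (pgrad Om f x \<bullet> a)) * iter_deriv [b] \<phi> x)" for a b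
 proof -
  define d where "d = 1 - \<rho>"
  have d: "0 < d" "d \<le> 1" using \<rho> by (auto simp: d_def)
  obtain P where P: "\<And>x. x \<in> ball 0 \<rho> ==> norm (pgrad Om f x) \<le> P"
  proof
   fix x :: pt assume x: "x \<in> ball 0 \<rho>"
   have 1: "norm (lgrad f x - lgrad f 0) \<le> 160 * L * sqrt 2 * sqrt (norm (x - 0))"
    using x \<rho> by (intro lgrad_holder[OF f]) auto
   have "160 * L * sqrt 2 * sqrt (norm (x - 0)) \<le> 160 * L * sqrt 2 * 1"
    using x \<rho> bdens_nonneg[OF f] by (intro mult_left_mono) auto
   then have l: "norm (lgrad f x) \<le> norm (lgrad f 0) + 160 * L * sqrt 2" using 1 norm_triangle_ineq2[of "lgrad f x" "lgrad f 0"] by linarith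
   have hh: "norm (hgrad f x) \<le> 1 / d^2 * (LBINT y. \<bar>f y\<bar>)" using x d by (intro norm_hgrad_le[OF f]) (auto simp: d_def)
   have "norm (pgrad Om f x) \<le> norm (- (1/(2*pi)) *\<^sub>R lgrad f x) + norm (hgrad f x) + norm (Om *\<^sub>R x)"
    unfolding pgrad_def using norm_triangle_ineq[of "- (1/(2*pi)) *\<^sub>R lgrad f x - hgrad f x" "Om *\<^sub>R x"] norm_triangle_ineq4[of "- (1/(2*pi)) *\<^sub>R lgrad f x" "hgrad f x"] by linarith
   also have "norm (- (1/(2*pi)) *\<^sub>R lgrad f x) \<le> norm (lgrad f x)"
    using pi_ge_two by (simp add: divide_le_eq mult_le_cancel_left1)
   also have "norm (Om *\<^sub>R x) \<le> \<bar>Om\<bar>" using x \<rho> by (simp add: mult_left_le)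
   finally show "norm (pgrad Om f x) \<le> norm (lgrad f 0) + 160 * L * sqrt 2 + 1 / d^2 * (LBINT y. \<bar>f y\<bar>) + \<bar>Om\<bar>" using l hh by linarith
  qed
  have im: "iter_deriv [b] \<phi> \<in> borel_measurable borel" by (rule borel_measurable_continuous_onI[OF cont])
  show ?thesis
  proof (rule Bochner_Integration.integrable_bound)
   show "integrable lborel (\<lambda>x. (P * norm a * M [b]) * indicator (ball (0::pt) \<rho>) x)" using integrable_indicator_ball[of 0 \<rho>] by simp
   show "(\<lambda>x. (indicator (Aset Om f \<mu>) x * (pgrad Om f x \<bullet> a)) * iter_deriv [b] \<phi> x) \<in> borel_measurable lborel"
    unfolding measurable_lborel2 by (intro borel_measurable_times im) measurable
   show "AE x in lborel. norm ((indicator (Aset Om f \<mu>) x * (pgrad Om f x \<bullet> a)) * iter_deriv [b] \<phi> x) \<le> norm ((P * norm a * M [b]) * indicator (ball (0::pt) \<rho>) x)" (is "AE x in _. ?P x")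
   proof (intro AE_I2)
    fix x
    show "?P x"
    proof (cases "x \<in> ball 0 \<rho>")
     case True
     have "\<bar>pgrad Om f x \<bullet> a\<bar> \<le> P * norm a"
      using Cauchy_Schwarz_ineq2[of "pgrad Om f x" a] P[OF True] mult_right_mono[of "norm (pgrad Om f x)" P "norm a"] by simp
     then have "\<bar>indicator (Aset Om f \<mu>) x * (pgrad Om f x \<bullet> a)\<bar> \<le> P * norm a" by (auto split: split_indicator intro: order_trans[OF abs_ge_zero])
     then have "\<bar>indicator (Aset Om f \<mu>) x * (pgrad Om f x \<bullet> a)\<bar> * \<bar>iter_deriv [b] \<phi> x\<bar> \<le> (P * norm a) * M [b]"
      using M[of "[b]" x] by (intro mult_mono) (auto intro: order_trans[OF abs_ge_zero])
     also have "\<dots> \<le> \<bar>P * norm a * M [b]\<bar>" by simp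
     finally show ?thesis using True by (simp only: real_norm_def abs_mult indicator_simps) simp
    next
     case False
     then have "iter_deriv [b] \<phi> x = 0" using bS by blast
     then show ?thesis by (simp only: mult_zero_right norm_zero norm_ge_zero)
    qed
   qed
  qed
 qed
 \<comment> \<open>Integration by parts leaves \<open>F\<close> against the two orders of the mixed
   partial derivative of \<open>\<phi>\<close>, which cancel.\<close>
 have "(LBINT x. indicator (Aset Om f \<mu>) x * (pgrad Om f x \<bullet> perp (grad \<phi> x)))
  = - (LBINT x. F x * iter_deriv [?e1, ?e2] \<phi> x) - - (LBINT x. F x * iter_deriv [?e2, ?e1] \<phi> x)"
  unfolding pt key[symmetric] by (rule Bochner_Integration.integral_diff[OF int int])
 also have "\<dots> = 0" unfolding smooth_fun_mixed_partials[OF sm, of ?e1 ?e2] by simp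
 finally show ?thesis .
qed

section \<open>Minimizers of the logarithmic energy\<close>

text \<open>The kernel is ln|x - y| without a minus sign, so rescaled patches of maximal energy lead
  to minimizers of this form.\<close>

definition Lq :: "(pt => real) => (pt => real) => real" where
 "Lq f g = (LBINT x. lpot f x * g x)"

lemma measurable_lpot: assumes f: "f \<in> borel_measurable borel" shows "lpot f \<in> borel_measurable borel"
proof -
 note [measurable] = f
 have "(\<lambda>x. LBINT y. ln (norm (x - y)) * f y) \<in> borel_measurable (lborel :: pt measure)"
  by (rule lborel.borel_measurable_lebesgue_integral) measurable
 then show ?thesis by (simp add: lpot_def[abs_def])
qed

lemma lpot_bound:
 obtains C where "0 \<le> C" "\<And>f x. bdens L R f ==> x \<in> ball 0 R ==> (LBINT y. \<bar>ln (norm (x - y)) * f y\<bar>) \<le> C"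
proof -
 define C where "C = (LBINT z. indicator (ball (0::pt) (2 * R)) z * \<bar>ln (norm z)\<bar>)"
 have km: "(\<lambda>z::pt. ln (norm z)) \<in> borel_measurable borel" by measurable
 have "(LBINT y. \<bar>ln (norm (x - y)) * f y\<bar>) \<le> \<bar>L\<bar> * C" if f: "bdens L R f" and x: "x \<in> ball 0 R" for f x
 proof -
  have "(LBINT y. \<bar>ln (norm (x - y)) * f y\<bar>) \<le> L * C" unfolding C_def
   using x by (intro kernel_conv_bound[OF integrable_ln_ball km f]) simp
  then show ?thesis using bdens_nonneg[OF f] by simp
 qed
 moreover have "0 \<le> \<bar>L\<bar> * C" unfolding C_def by (intro mult_nonneg_nonneg Bochner_Integration.integral_nonneg) auto
 ultimately show thesis by (rule that[rotated])
qed

lemma bdens_zero: "bdens L R f ==> x \<notin> ball 0 R ==> f x = 0"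
 by (simp add: bdens_def)

lemma integrable_ln_pair:
 assumes f: "bdens L R f" and g: "bdens M R g"
 shows "integrable (lborel \<Otimes>\<^sub>M lborel) (\<lambda>(x,y). ln (norm (x - y)) * f y * g x)"
proof (rule lborel_pair.Fubini_integrable)
 have [measurable]: "f \<in> borel_measurable borel" "g \<in> borel_measurable borel"
  using bdens_measurable f g by auto
 show "(\<lambda>(x,y). ln (norm (x - y)) * f y * g x) \<in> borel_measurable (lborel \<Otimes>\<^sub>M lborel)" by measurable
 show "AE x in lborel. integrable lborel (\<lambda>y. case (x, y) of (x, y) => ln (norm (x - y)) * f y * g x)"
  using integrable_lpot[OF f] by simp
 obtain C where C: "0 \<le> C" "\<And>f x. bdens L R f ==> x \<in> ball 0 R ==> (LBINT y. \<bar>ln (norm (x - y)) * f y\<bar>) \<le> C"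
  using lpot_bound[of L R] by blast
 have m: "(\<lambda>x. LBINT y. norm (ln (norm (x - y)) * f y * g x)) \<in> borel_measurable lborel"
  by (rule lborel.borel_measurable_lebesgue_integral) measurable
 have "integrable lborel (\<lambda>x. LBINT y. norm (ln (norm (x - y)) * f y * g x))"
 proof (rule Bochner_Integration.integrable_bound)
  show "integrable lborel (\<lambda>x. C * g x)" using integrable_bdens[OF g] by simp
  show "AE x in lborel. norm (LBINT y. norm (ln (norm (x - y)) * f y * g x)) \<le> norm (C * g x)" (is "AE x in _. ?P x")
  proof (intro AE_I2)
   fix x
   have e: "(LBINT y. norm (ln (norm (x - y)) * f y * g x)) = (LBINT y. \<bar>ln (norm (x - y)) * f y\<bar>) * \<bar>g x\<bar>"
    by (simp add: abs_mult)
   have n: "0 \<le> (LBINT y. \<bar>ln (norm (x - y)) * f y\<bar>)" by simp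
   show "?P x"
   proof (cases "x \<in> ball 0 R")
    case True
    have "(LBINT y. \<bar>ln (norm (x - y)) * f y\<bar>) * \<bar>g x\<bar> \<le> C * \<bar>g x\<bar>"
     using C(2)[OF f True] by (intro mult_right_mono) auto
    then show ?thesis unfolding e using n C(1) by (simp add: abs_mult)
   qed (simp add: bdens_zero[OF g])
  qed
 qed (rule m)
 then show "integrable lborel (\<lambda>x. LBINT y. norm (case (x, y) of (x, y) => ln (norm (x - y)) * f y * g x))" by simp
qed

lemma integrable_lpot_mult:
 assumes f: "bdens L R f" and g: "bdens M R g"
 shows "integrable lborel (\<lambda>x. lpot f x * g x)"
proof -
 have "integrable lborel (\<lambda>x. LBINT y. ln (norm (x - y)) * f y * g x)"
  using lborel_pair.integrable_fst'[OF integrable_ln_pair[OF f g]] by simp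
 then show ?thesis by (simp add: lpot_def)
qed

lemma Lq_commute:
 assumes f: "bdens L R f" and g: "bdens M R g"
 shows "Lq f g = Lq g f"
proof -
 have "Lq f g = (LBINT x. (LBINT y. ln (norm (x - y)) * f y * g x))" unfolding Lq_def lpot_def by simp
 also have "\<dots> = (LBINT y. (LBINT x. ln (norm (x - y)) * f y * g x))"
  using lborel_pair.Fubini_integral[of "\<lambda>x y. ln (norm (x - y)) * f y * g x"] integrable_ln_pair[OF f g] by simp
 also have "\<dots> = (LBINT y. (LBINT x. ln (norm (y - x)) * g x) * f y)"
  by (simp add: norm_minus_commute mult_ac flip: integral_mult_left_zero)
 finally show ?thesis unfolding Lq_def lpot_def .
qed

lemma lpot_add_scale:
 assumes f: "bdens L R f" and g: "bdens M R g"
 shows "lpot (\<lambda>x. f x + c * g x) x = lpot f x + c * lpot g x"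
proof -
 have "lpot (\<lambda>x. f x + c * g x) x = (LBINT y. ln (norm (x - y)) * f y + c * (ln (norm (x - y)) * g y))"
  unfolding lpot_def by (simp add: algebra_simps)
 then show ?thesis using integrable_lpot[OF f] integrable_lpot[OF g] by (simp add: lpot_def)
qed

lemma Lq_add_scale_right:
 assumes f: "bdens L R f" and g: "bdens M R g" and h: "bdens P R h"
 shows "Lq h (\<lambda>x. f x + c * g x) = Lq h f + c * Lq h g"
proof -
 have "Lq h (\<lambda>x. f x + c * g x) = (LBINT x. lpot h x * f x + c * (lpot h x * g x))"
  unfolding Lq_def by (simp add: algebra_simps)
 then show ?thesis using integrable_lpot_mult[OF h f] integrable_lpot_mult[OF h g] by (simp add: Lq_def)
qed

lemma Lq_add_scale_left:
 assumes f: "bdens L R f" and g: "bdens M R g" and h: "bdens P R h"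
 shows "Lq (\<lambda>x. f x + c * g x) h = Lq f h + c * Lq g h"
 using Lq_add_scale_right[OF f g h, of c] Lq_commute[OF bdens_add_scale[OF f g] h] Lq_commute[OF f h] Lq_commute[OF g h] by simp

section \<open>Reflections in lines through the origin\<close>

definition refl_line :: "pt => pt => pt" where
 "refl_line n x = x - (2 * (x \<bullet> n)) *\<^sub>R n"

context
 fixes n :: pt
 assumes n: "norm n = 1"
begin

lemma inner_n: "n \<bullet> n = 1" using n by (simp add: norm_eq_1)

lemma refl_line_inner: "refl_line n x \<bullet> n = - (x \<bullet> n)"
 by (simp add: refl_line_def inner_diff inner_n)

lemma refl_line_refl_line: "refl_line n (refl_line n x) = x"
 unfolding refl_line_def[of n "refl_line n x"] refl_line_inner by (simp add: refl_line_def)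

lemma refl_line_orthogonal: "orthogonal_transformation (refl_line n)"
 unfolding orthogonal_transformation_def
proof
 show "linear (refl_line n)"
  by (intro linearI) (auto simp: refl_line_def inner_add algebra_simps)
 show "\<forall>v w. refl_line n v \<bullet> refl_line n w = v \<bullet> w"
  by (auto simp: refl_line_def inner_diff inner_n inner_commute algebra_simps)
qed

lemma norm_refl_line: "norm (refl_line n x) = norm x"
 using orthogonal_transformation_norm[OF refl_line_orthogonal] .

lemma refl_line_diff: "refl_line n x - refl_line n y = refl_line n (x - y)"
 by (simp add: refl_line_def inner_diff algebra_simps)

lemma measurable_refl_line [measurable]: "refl_line n \<in> borel_measurable borel"
 unfolding refl_line_def by measurable

lemma integral_refl_line:
 fixes f :: "pt => real"
 assumes [measurable]: "f \<in> borel_measurable borel"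
 shows "(LBINT x. f (refl_line n x)) = (LBINT x. f x)"
proof -
 have "(LBINT x. f x) = (\<integral>x. f x \<partial>(distr lborel borel (refl_line n)))"
  by (simp add: distr_lborel_orthogonal[OF refl_line_orthogonal])
 also have "\<dots> = (LBINT x. f (refl_line n x))" by (rule integral_distr) auto
 finally show ?thesis ..
qed

lemma AE_refl_line:
 assumes "AE x in lborel. P x" shows "AE x in lborel. P (refl_line n x)"
proof -
 obtain N where N: "{x. \<not> P x} \<subseteq> N" "N \<in> null_sets lborel" using assms by (auto simp: eventually_ae_filter)
 have "emeasure (distr lborel borel (refl_line n)) N = 0" using N by (simp add: distr_lborel_orthogonal[OF refl_line_orthogonal] null_sets_def)
 moreover have "emeasure (distr lborel borel (refl_line n)) N = emeasure lborel (refl_line n -` N)"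
  using N by (subst emeasure_distr) auto
 moreover have "refl_line n -` N \<in> sets borel" using N measurable_sets[OF measurable_refl_line, of N] by auto
 ultimately have "refl_line n -` N \<in> null_sets lborel" by (simp add: null_sets_def)
 from AE_not_in[OF this] show ?thesis by eventually_elim (use N in auto)
qed

lemma bdens_refl_line: "bdens L R f ==> bdens L R (\<lambda>x. f (refl_line n x))"
 by (auto simp: bdens_def norm_refl_line)

lemma lpot_refl_line:
 assumes f: "bdens L R f" shows "lpot (\<lambda>x. f (refl_line n x)) x = lpot f (refl_line n x)"
proof -
 have [measurable]: "f \<in> borel_measurable borel" by (rule bdens_measurable[OF f])
 have e: "norm (x - refl_line n y) = norm (refl_line n x - y)" for x y
  using refl_line_diff[of "refl_line n x" y] norm_refl_line[of "refl_line n x - y"] by (simp add: refl_line_refl_line)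
 have "lpot f (refl_line n x) = (LBINT y. ln (norm (refl_line n x - refl_line n y)) * f (refl_line n y))"
  unfolding lpot_def by (rule integral_refl_line[symmetric]) measurable
 then show ?thesis by (simp add: lpot_def refl_line_diff norm_refl_line)
qed

lemma Lq_refl_line:
 assumes f: "bdens L R f" and g: "bdens M R g"
 shows "Lq (\<lambda>x. f (refl_line n x)) (\<lambda>x. g (refl_line n x)) = Lq f g"
proof -
 have [measurable]: "lpot f \<in> borel_measurable borel" "g \<in> borel_measurable borel"
  using measurable_lpot bdens_measurable f g by auto
 show ?thesis unfolding Lq_def lpot_refl_line[OF f] by (rule integral_refl_line) measurable
qed

end

text \<open>The class of rescaled patches: height \<open>lam\<close> becomes 1 and mass 1 becomes
  pi, the area of the unit disk.\<close>

definition planar :: "real => (pt => real) => bool" where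
 "planar R f \<longleftrightarrow> f \<in> borel_measurable borel \<and> (\<forall>x. 0 \<le> f x \<and> f x \<le> 1) \<and> (\<forall>x. x \<notin> ball 0 R --> f x = 0)
   \<and> (LBINT x. f x) = pi"

lemma planar_bdens: "planar R f ==> bdens 1 R f"
 by (auto simp: planar_def bdens_def)

lemma integral_zero_AE:
 fixes f :: "'a => real"
 assumes "integrable M f" "AE x in M. 0 \<le> f x" "(\<integral>x. f x \<partial>M) \<le> 0"
 shows "AE x in M. f x = 0"
 using integral_nonneg_eq_0_iff_AE[OF assms(1,2)] assms(3) integral_nonneg_AE[OF assms(2)] by linarith

lemma integrable_inner_mult:
 assumes g: "bdens L R g" shows "integrable lborel (\<lambda>x. (x \<bullet> n) * g x)"
proof (rule Bochner_Integration.integrable_bound)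
 have [measurable]: "g \<in> borel_measurable borel" by (rule bdens_measurable[OF g])
 show "integrable lborel (\<lambda>x. (\<bar>R\<bar> * norm n) * g x)" using integrable_bdens[OF g] by simp
 show "(\<lambda>x. (x \<bullet> n) * g x) \<in> borel_measurable lborel" by simp
 show "AE x in lborel. norm ((x \<bullet> n) * g x) \<le> norm ((\<bar>R\<bar> * norm n) * g x)" (is "AE x in _. ?P x")
 proof (intro AE_I2)
  fix x show "?P x"
  proof (cases "x \<in> ball 0 R")
   case True
   have "\<bar>x \<bullet> n\<bar> \<le> norm x * norm n" by (rule Cauchy_Schwarz_ineq2)
   also have "\<dots> \<le> \<bar>R\<bar> * norm n" using True by (intro mult_right_mono) auto
   finally have "\<bar>x \<bullet> n\<bar> * \<bar>g x\<bar> \<le> (\<bar>R\<bar> * norm n) * \<bar>g x\<bar>" by (intro mult_right_mono) auto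
   then show ?thesis by (simp add: abs_mult)
  qed (simp add: bdens_zero[OF g])
 qed
qed

text \<open>Polarization: replacing the odd part of \<open>\<eta>\<close> by its absolute value on one side of the line
 changes the energy by four times the interaction of the positive and the negative odd parts, which is negative
 because a point is closer to the points on its own side than to their mirror images.\<close>

lemma minimizer_reflection_symmetric:
 assumes \<eta>: "planar R \<eta>" and min: "\<And>f. planar R f ==> Lq \<eta> \<eta> \<le> Lq f f"
  and cen: "(LBINT x. (x \<bullet> n) * \<eta> x) = 0" and n: "norm n = 1"
 shows "AE x in lborel. \<eta> (refl_line n x) = \<eta> x"
proof -
 let ?\<sigma> = "refl_line n"
 note \<sigma> = refl_line_inner[OF n] refl_line_refl_line[OF n] norm_refl_line[OF n]
 note [measurable] = measurable_refl_line[OF n]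
 have \<eta>b: "bdens 1 R \<eta>" by (rule planar_bdens[OF \<eta>])
 have \<eta>m [measurable]: "\<eta> \<in> borel_measurable borel" by (rule bdens_measurable[OF \<eta>b])
 have \<eta>01: "0 \<le> \<eta> x" "\<eta> x \<le> 1" for x using \<eta> by (auto simp: planar_def)
 \<comment> \<open>The odd part of \<open>\<eta>\<close>; \<open>P\<close> and \<open>M\<close> are
   its positive and negative parts on the side where x . n > 0.\<close>
 define d where "d x = (\<eta> x - \<eta> (?\<sigma> x)) / 2" for x
 define P where "P x = (if 0 < x \<bullet> n then max (d x) 0 else 0)" for x
 define M where "M x = (if 0 < x \<bullet> n then max (- d x) 0 else 0)" for x
 have dm [measurable]: "d \<in> borel_measurable borel" unfolding d_def by measurable
 have Pm [measurable]: "P \<in> borel_measurable borel" "M \<in> borel_measurable borel" unfolding P_def M_def by measurable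
 have d1: "\<bar>d x\<bar> \<le> 1" for x using \<eta>01[of x] \<eta>01[of "?\<sigma> x"] by (simp add: d_def)
 have d0: "d x = 0" if "x \<notin> ball 0 R" for x using that bdens_zero[OF \<eta>b] by (simp add: d_def \<sigma>)
 have d\<sigma>: "d (?\<sigma> x) = - d x" for x by (simp add: d_def \<sigma> field_simps)
 have PM0: "0 \<le> P x" "0 \<le> M x" for x by (auto simp: P_def M_def)
 have Pb: "bdens 1 R P" and Mb: "bdens 1 R M"
  using d1 d0 by (auto simp: bdens_def P_def M_def max_def abs_le_iff)
 define m where "m x = M x + (-1) * M (?\<sigma> x)" for x
 define p where "p x = P x + (-1) * P (?\<sigma> x)" for x
 have M\<sigma>b: "bdens 1 R (\<lambda>x. M (?\<sigma> x))" and P\<sigma>b: "bdens 1 R (\<lambda>x. P (?\<sigma> x))"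
  by (rule bdens_refl_line[OF n Mb], rule bdens_refl_line[OF n Pb])
 have mb: "bdens (1 + \<bar>-1\<bar> * 1) R m" and pb: "bdens (1 + \<bar>-1\<bar> * 1) R p"
  unfolding m_def p_def by (rule bdens_add_scale[OF Mb M\<sigma>b], rule bdens_add_scale[OF Pb P\<sigma>b])
 have dpm: "d x = p x - m x" for x
 proof (cases "x \<bullet> n" "0::real" rule: linorder_cases)
  case equal
  then have "?\<sigma> x = x" by (simp add: refl_line_def)
  then show ?thesis using equal by (simp add: p_def m_def P_def M_def d_def)
 qed (auto simp: p_def m_def P_def M_def \<sigma> d\<sigma>)
 define s where "s x = \<eta> x + (-1) * d x" for x
 have db: "bdens 1 R d" using d1 d0 by (auto simp: bdens_def)
 have sb: "bdens (1 + \<bar>-1\<bar> * 1) R s" unfolding s_def by (rule bdens_add_scale[OF \<eta>b db])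
 have s\<sigma>: "s (?\<sigma> x) = s x" for x by (simp add: s_def d_def \<sigma> field_simps)
 have m\<sigma>: "m (?\<sigma> x) = -1 * m x" for x by (simp add: m_def \<sigma>)
 \<comment> \<open>Adding 2 m replaces \<open>\<eta>\<close> on the positive side by the larger of
   its values at a point and its mirror image, and on the other side by the smaller; bounds and
   total mass survive.\<close>
 define f where "f x = \<eta> x + 2 * m x" for x
 have intm: "(LBINT x. m x) = 0"
 proof -
  have "(LBINT x. m (?\<sigma> x)) = (LBINT x. m x)" by (rule integral_refl_line[OF n bdens_measurable[OF mb]])
  then show ?thesis by (simp add: m\<sigma>)
 qed
 have f: "planar R f"
 proof -
  have "0 \<le> f x \<and> f x \<le> 1" for x
   using \<eta>01[of x] \<eta>01[of "?\<sigma> x"]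
   by (cases "x \<bullet> n" "0::real" rule: linorder_cases) (auto simp: f_def m_def M_def \<sigma> d\<sigma> d_def max_def field_simps)
  moreover have "f \<in> borel_measurable borel" unfolding f_def using bdens_measurable[OF mb] by measurable
  moreover have "f x = 0" if "x \<notin> ball 0 R" for x using bdens_zero[OF \<eta>b that] bdens_zero[OF mb that] by (simp add: f_def)
  moreover have "(LBINT x. f x) = pi" unfolding f_def
   using integrable_bdens[OF \<eta>b] integrable_bdens[OF mb] intm \<eta> by (simp add: planar_def)
  ultimately show ?thesis by (simp add: planar_def)
 qed
 \<comment> \<open>Even and odd functions are orthogonal for a reflection invariant energy.\<close>
 have Lsm: "Lq s m = 0"
 proof -
  have "Lq (\<lambda>x. s (?\<sigma> x)) (\<lambda>x. m (?\<sigma> x)) = Lq s m" by (rule Lq_refl_line[OF n sb mb])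
  then have "Lq s (\<lambda>x. -1 * m x) = Lq s m" unfolding s\<sigma> m\<sigma> .
  moreover have "Lq s (\<lambda>x. -1 * m x) = - Lq s m" unfolding Lq_def by simp
  ultimately show ?thesis by simp
 qed
 have \<eta>m_eq: "Lq \<eta> m = Lq p m - Lq m m"
 proof -
  have "\<eta> = (\<lambda>x. s x + 1 * d x)" by (simp add: s_def)
  then have "Lq \<eta> m = Lq s m + 1 * Lq d m" using Lq_add_scale_left[OF sb db mb, of 1] by simp
  moreover have "d = (\<lambda>x. p x + (-1) * m x)" using dpm by auto
  then have "Lq d m = Lq p m + (-1) * Lq m m" using Lq_add_scale_left[OF pb mb mb, of "-1"] by simp
  ultimately show ?thesis using Lsm by simp
 qed
 have "Lq f f = Lq \<eta> \<eta> + 4 * Lq p m"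
 proof -
  have fb: "bdens (1 + \<bar>2\<bar> * (1 + \<bar>-1\<bar> * 1)) R f" unfolding f_def by (rule bdens_add_scale[OF \<eta>b mb])
  have "Lq f f = Lq f \<eta> + 2 * Lq f m" using Lq_add_scale_right[OF \<eta>b mb fb, of 2] unfolding f_def .
  also have "Lq f \<eta> = Lq \<eta> \<eta> + 2 * Lq m \<eta>" using Lq_add_scale_left[OF \<eta>b mb \<eta>b, of 2] unfolding f_def .
  also have "Lq f m = Lq \<eta> m + 2 * Lq m m" using Lq_add_scale_left[OF \<eta>b mb mb, of 2] unfolding f_def .
  also have "Lq m \<eta> = Lq \<eta> m" by (rule Lq_commute[OF mb \<eta>b])
  finally show ?thesis using \<eta>m_eq by simp
 qed
 then have pm: "0 \<le> Lq p m" using min[OF f] by linarith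
 have Lpm: "Lq p m = 2 * (Lq P M - Lq (\<lambda>x. P (?\<sigma> x)) M)"
 proof -
  have "Lq p m = Lq p M + (-1) * Lq p (\<lambda>x. M (?\<sigma> x))" unfolding m_def by (rule Lq_add_scale_right[OF Mb M\<sigma>b pb])
  also have "Lq p M = Lq P M + (-1) * Lq (\<lambda>x. P (?\<sigma> x)) M" unfolding p_def by (rule Lq_add_scale_left[OF Pb P\<sigma>b Mb])
  also have "Lq p (\<lambda>x. M (?\<sigma> x)) = Lq P (\<lambda>x. M (?\<sigma> x)) + (-1) * Lq (\<lambda>x. P (?\<sigma> x)) (\<lambda>x. M (?\<sigma> x))"
   unfolding p_def by (rule Lq_add_scale_left[OF Pb P\<sigma>b M\<sigma>b])
  also have "Lq (\<lambda>x. P (?\<sigma> x)) (\<lambda>x. M (?\<sigma> x)) = Lq P M" by (rule Lq_refl_line[OF n Pb Mb])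
  also have "Lq P (\<lambda>x. M (?\<sigma> x)) = Lq (\<lambda>x. P (?\<sigma> x)) M"
   using Lq_refl_line[OF n P\<sigma>b Mb] by (simp add: \<sigma>)
  finally show ?thesis by simp
 qed
 have closer: "norm (x - y) < norm (?\<sigma> x - y)" if "0 < x \<bullet> n" "0 < y \<bullet> n" for x y
 proof -
  have "(norm (?\<sigma> x - y))^2 = (norm (x - y))^2 + 4 * ((x \<bullet> n) * (y \<bullet> n))"
   unfolding refl_line_def power2_norm_eq_inner
   using inner_n[OF n] by (simp add: inner_diff inner_commute algebra_simps)
  moreover have "0 < (x \<bullet> n) * (y \<bullet> n)" using that by simp
  ultimately have "(norm (x - y))^2 < (norm (?\<sigma> x - y))^2" by linarith
  then show ?thesis by (rule power2_less_imp_less) simp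
 qed
 define \<kappa> where "\<kappa> x y = (ln (norm (?\<sigma> x - y)) - ln (norm (x - y))) * P y" for x y
 have \<kappa>i: "integrable lborel (\<kappa> x)" for x
  unfolding \<kappa>_def left_diff_distrib by (intro Bochner_Integration.integrable_diff integrable_lpot[OF Pb])
 have \<kappa>e: "(LBINT y. \<kappa> x y) = lpot P (?\<sigma> x) - lpot P x" for x
  unfolding \<kappa>_def left_diff_distrib lpot_def by (intro Bochner_Integration.integral_diff integrable_lpot[OF Pb])
 have \<kappa>pos: "0 < ln (norm (?\<sigma> x - y)) - ln (norm (x - y))" if "0 < x \<bullet> n" "0 < y \<bullet> n" "x \<noteq> y" for x y
 proof -
  have "0 < norm (x - y)" using that by simp
  with closer[OF that(1,2)] have "ln (norm (x - y)) < ln (norm (?\<sigma> x - y))" by (subst ln_less_cancel_iff) linarith+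
  then show ?thesis by simp
 qed
 have \<kappa>0: "AE y in lborel. 0 \<le> \<kappa> x y" if "0 < x \<bullet> n" for x
  using AE_lborel_neq[of x]
 proof eventually_elim
  case (elim y)
  show ?case using \<kappa>pos[OF that, of y] elim PM0[of y] by (cases "0 < y \<bullet> n") (auto simp: \<kappa>_def P_def)
 qed
 \<comment> \<open>Minimality makes \<open>Lq p m\<close> nonnegative, but two points on the same
   side are strictly closer than a point and a mirror image. So \<open>P\<close> and
   \<open>M\<close> cannot both be present.\<close>
 have alt: "(AE x in lborel. P x = 0) \<or> (AE x in lborel. M x = 0)"
 proof (rule disjCI)
  assume nM: "\<not> (AE x in lborel. M x = 0)"
  have nn: "0 \<le> (lpot P (?\<sigma> x) - lpot P x) * M x" for x
  proof (cases "0 < x \<bullet> n")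
   case True
   have "0 \<le> (LBINT y. \<kappa> x y)" by (rule integral_nonneg_AE[OF \<kappa>0[OF True]])
   then show ?thesis using PM0[of x] by (simp add: \<kappa>e)
  qed (simp add: M_def)
  have i: "integrable lborel (\<lambda>x. (lpot P (?\<sigma> x) - lpot P x) * M x)"
   using integrable_lpot_mult[OF P\<sigma>b Mb] integrable_lpot_mult[OF Pb Mb] by (simp add: left_diff_distrib lpot_refl_line[OF n Pb])
  have "(LBINT x. (lpot P (?\<sigma> x) - lpot P x) * M x) = Lq (\<lambda>x. P (?\<sigma> x)) M - Lq P M"
   using integrable_lpot_mult[OF P\<sigma>b Mb] integrable_lpot_mult[OF Pb Mb] unfolding Lq_def by (simp add: left_diff_distrib lpot_refl_line[OF n Pb])
  also have "\<dots> \<le> 0" using pm Lpm by simp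
  finally have "AE x in lborel. (lpot P (?\<sigma> x) - lpot P x) * M x = 0" using nn by (intro integral_zero_AE[OF i]) auto
  then have "\<exists>x. M x \<noteq> 0 \<and> lpot P (?\<sigma> x) - lpot P x = 0"
  proof (rule contrapos_pp)
   assume "\<not> (\<exists>x. M x \<noteq> 0 \<and> lpot P (?\<sigma> x) - lpot P x = 0)"
   then have "(lpot P (?\<sigma> x) - lpot P x) * M x = 0 \<longleftrightarrow> M x = 0" for x by auto
   then show "\<not> (AE x in lborel. (lpot P (?\<sigma> x) - lpot P x) * M x = 0)" using nM by simp
  qed
  then obtain x where x: "M x \<noteq> 0" "lpot P (?\<sigma> x) - lpot P x = 0" by blast
  then have xn: "0 < x \<bullet> n" by (auto simp: M_def split: if_splits)
  have "AE y in lborel. \<kappa> x y = 0" by (rule integral_zero_AE[OF \<kappa>i \<kappa>0[OF xn]]) (simp add: \<kappa>e x)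
  then show "AE y in lborel. P y = 0" using AE_lborel_neq[of x]
  proof eventually_elim
   case (elim y)
   show ?case
   proof (rule ccontr)
    assume "P y \<noteq> 0"
    then have "0 < y \<bullet> n" by (auto simp: P_def split: if_splits)
    then show False using \<kappa>pos[OF xn, of y] elim \<open>P y \<noteq> 0\<close> by (auto simp: \<kappa>_def)
   qed
  qed
 qed
 have iP: "integrable lborel (\<lambda>x. (x \<bullet> n) * P x)" and iM: "integrable lborel (\<lambda>x. (x \<bullet> n) * M x)"
  and int_s: "integrable lborel (\<lambda>x. (x \<bullet> n) * s x)" and id: "integrable lborel (\<lambda>x. (x \<bullet> n) * d x)"
  by (rule integrable_inner_mult[OF Pb], rule integrable_inner_mult[OF Mb], rule integrable_inner_mult[OF sb], rule integrable_inner_mult[OF db])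
 have sm [measurable]: "s \<in> borel_measurable borel" by (rule bdens_measurable[OF sb])
 \<comment> \<open>The even part has no first moment along \<open>n\<close>, so the centroid
   condition falls on \<open>d\<close> alone; with \<open>P\<close> or \<open>M\<close> absent, (x .
   n) d has one sign and therefore vanishes.\<close>
 have s0: "(LBINT x. (x \<bullet> n) * s x) = 0"
 proof -
  have "(LBINT x. (?\<sigma> x \<bullet> n) * s (?\<sigma> x)) = (LBINT x. (x \<bullet> n) * s x)" by (rule integral_refl_line[OF n]) measurable
  then show ?thesis by (simp add: \<sigma> s\<sigma>)
 qed
 have "(LBINT x. (x \<bullet> n) * \<eta> x) = (LBINT x. (x \<bullet> n) * s x + (x \<bullet> n) * d x)" by (simp add: s_def algebra_simps)
 also have "\<dots> = (LBINT x. (x \<bullet> n) * d x)" using int_s id s0 by simp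
 finally have d0': "(LBINT x. (x \<bullet> n) * d x) = 0" using cen by simp
 have nd: "(x \<bullet> n) * d x = (\<bar>x \<bullet> n\<bar> * (P x + P (?\<sigma> x))) - (\<bar>x \<bullet> n\<bar> * (M x + M (?\<sigma> x)))" for x
  unfolding dpm p_def m_def
  by (cases "x \<bullet> n" "0::real" rule: linorder_cases) (auto simp: P_def M_def \<sigma> algebra_simps)
 have "AE x in lborel. (x \<bullet> n) * d x = 0"
  using alt
 proof
  assume "AE x in lborel. P x = 0"
  with AE_refl_line[OF n this] have "AE x in lborel. 0 \<le> - ((x \<bullet> n) * d x)"
   by eventually_elim (simp add: nd PM0)
  then have "AE x in lborel. - ((x \<bullet> n) * d x) = 0" by (intro integral_zero_AE) (use id d0' in auto)
  then show ?thesis by simp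
 next
  assume "AE x in lborel. M x = 0"
  with AE_refl_line[OF n this] have "AE x in lborel. 0 \<le> (x \<bullet> n) * d x"
   by eventually_elim (simp add: nd PM0)
  then show ?thesis by (intro integral_zero_AE) (use id d0' in auto)
 qed
 then show ?thesis
 proof eventually_elim
  case (elim x)
  show ?case
  proof (cases "x \<bullet> n = 0")
   case True then show ?thesis by (simp add: refl_line_def)
  next
   case False then show ?thesis using elim by (simp add: d_def)
  qed
 qed
qed

text \<open>Mean value property: ln|1 + c z| is the real part of \<open>Ln (1 + c * z)\<close>,
  which is holomorphic on the closed unit disk for |c| < 1 and vanishes at the centre.\<close>

lemma circle_mean_ln_less:
 assumes ab: "norm b < norm (a::complex)"
 shows "((\<lambda>t. ln (norm (a + exp (2 * of_real pi * \<i> * of_real t) * b))) has_integral ln (norm a)) {0..1}"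
proof -
 have a0: "a \<noteq> 0" using ab by auto
 define c where "c = b / a"
 have c: "norm c < 1" using ab a0 by (simp add: c_def norm_divide divide_less_eq)
 define f where "f z = Ln (1 + c * z)" for z
 have re: "0 < Re (1 + c * z)" if "norm z \<le> 1" for z
 proof -
  have "norm (c * z) \<le> norm c * 1" unfolding norm_mult using that by (intro mult_left_mono) auto
  then have "\<bar>Re (c * z)\<bar> < 1" using abs_Re_le_cmod[of "c * z"] c by linarith
  then show ?thesis by simp
 qed
 have hol: "f holomorphic_on cball 0 1"
  unfolding f_def
 proof (rule holomorphic_on_Ln')
  show "(\<lambda>z. 1 + c * z) holomorphic_on cball 0 1" by (intro holomorphic_intros)
  show "1 + c * z \<notin> \<real>\<^sub>\<le>\<^sub>0" if "z \<in> cball 0 1" for z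
   using re[of z] that by (auto simp: complex_nonpos_Reals_iff)
 qed
 have "((\<lambda>u. f u / (u - 0)) has_contour_integral (2 * of_real pi * \<i> * f 0)) (circlepath 0 1)"
  by (rule Cauchy_integral_circlepath_simple[OF hol]) simp
 then have "((\<lambda>t. f (circlepath 0 1 t) / (circlepath 0 1 t) * vector_derivative (circlepath 0 1) (at t within {0..1})) has_integral 0) {0..1}"
  unfolding has_contour_integral_def by (simp add: f_def)
 moreover have "f (circlepath 0 1 t) / (circlepath 0 1 t) * vector_derivative (circlepath 0 1) (at t within {0..1}) = 2 * pi * \<i> * f (exp (2 * of_real pi * \<i> * of_real t))"
  if "t \<in> {0..1}" for t
  using that by (simp add: vector_derivative_circlepath01) (simp add: circlepath)
 ultimately have "((\<lambda>t. 2 * pi * \<i> * f (exp (2 * of_real pi * \<i> * of_real t))) has_integral 0) {0..1}"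
  by (subst (asm) has_integral_cong) auto
 from has_integral_mult_right[OF this, of "1 / (2 * pi * \<i>)"]
 have "((\<lambda>t. f (exp (2 * of_real pi * \<i> * of_real t))) has_integral 0) {0..1}" by simp
 from has_integral_linear[OF this bounded_linear_Re]
 have 1: "((\<lambda>t. Re (f (exp (2 * of_real pi * \<i> * of_real t)))) has_integral 0) {0..1}" by (simp add: o_def)
 have e: "ln (norm (a + exp (2 * of_real pi * \<i> * of_real t) * b)) = ln (norm a) + Re (f (exp (2 * of_real pi * \<i> * of_real t)))" for t
 proof -
  let ?z = "exp (2 * of_real pi * \<i> * of_real t) :: complex"
  have nz: "norm ?z = 1" by simp
  have n0: "1 + c * ?z \<noteq> 0" using re[of ?z] nz by (metis less_irrefl order_refl zero_complex.sel(1))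
  have "a + ?z * b = a * (1 + c * ?z)" using a0 by (simp add: c_def field_simps)
  then have "ln (norm (a + ?z * b)) = ln (norm a * norm (1 + c * ?z))" by (simp only: norm_mult)
  also have "\<dots> = ln (norm a) + ln (norm (1 + c * ?z))" using a0 n0 by (intro ln_mult_pos) auto
  also have "ln (norm (1 + c * ?z)) = Re (f ?z)" unfolding f_def using n0 by (simp add: Re_Ln)
  finally show ?thesis .
 qed
 have "((\<lambda>t. ln (norm a) + Re (f (exp (2 * of_real pi * \<i> * of_real t)))) has_integral (ln (norm a) * (1 - 0) + 0)) {0..1}"
  using has_integral_const_real[of "ln (norm a)" 0 1] by (intro has_integral_add 1) simp
 then show ?thesis unfolding e by simp
qed

text \<open>For |z| = 1 the numbers a + z b and cnj b + z cnj a have the same modulus, which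
  exchanges the roles of \<open>a\<close> and \<open>b\<close>.\<close>

lemma circle_mean_ln:
 assumes ab: "norm b \<noteq> norm (a::complex)"
 shows "((\<lambda>t. ln (norm (a + exp (2 * of_real pi * \<i> * of_real t) * b))) has_integral ln (max (norm a) (norm b))) {0..1}"
proof (cases "norm b < norm a")
 case True
 then show ?thesis using circle_mean_ln_less[OF True] by (simp add: max_def)
next
 case False
 then have lt: "norm (cnj a) < norm (cnj b)" using ab by simp
 have "norm (cnj b + exp (2 * of_real pi * \<i> * of_real t) * cnj a) = norm (a + exp (2 * of_real pi * \<i> * of_real t) * b)" for t
 proof -
  let ?z = "exp (2 * of_real pi * \<i> * of_real t) :: complex"
  have nz: "norm ?z = 1" by simp
  have "?z * cnj ?z = of_real ((norm ?z)^2)" by (simp only: complex_norm_square)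
  then have z: "cnj ?z * ?z = 1" unfolding nz by (simp add: mult.commute)
  have "norm (cnj b + ?z * cnj a) = norm (cnj (cnj b + ?z * cnj a))" by (simp only: complex_mod_cnj)
  also have "\<dots> = norm (b + cnj ?z * a)" by simp
  also have "\<dots> = norm ?z * norm (b + cnj ?z * a)" by simp
  also have "\<dots> = norm (?z * b + (cnj ?z * ?z) * a)" unfolding norm_mult[symmetric] by (simp add: algebra_simps)
  finally show ?thesis unfolding z by (simp add: add.commute)
 qed
 then show ?thesis using circle_mean_ln_less[OF lt] lt by (simp add: max_def)
qed

text \<open>The angle is pi t because reflecting with normal \<open>dir t\<close> is complex
  conjugation followed by multiplication with -exp(2 pi i t): as \<open>t\<close> runs over [0, 1],
  the image of a point runs once around its circle.\<close>

definition dir :: "real => pt" where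
 "dir t = cos (pi * t) *\<^sub>R axis 1 1 + sin (pi * t) *\<^sub>R axis 2 1"

lemma dir_nth [simp]: "dir t $ 1 = cos (pi * t)" "dir t $ 2 = sin (pi * t)"
 by (auto simp: dir_def axis_def)

lemma norm_pt: "norm (x::pt) = norm (Complex (x$1) (x$2))"
 by (simp add: norm_vec_def L2_set_def sum_2 cmod_def)

lemma norm_dir: "norm (dir t) = 1"
 unfolding norm_pt by (simp add: cmod_def)

lemma measurable_dir [measurable]: "dir \<in> borel_measurable borel"
 unfolding dir_def by measurable

lemma norm_diff_refl_dir:
 "norm (x - refl_line (dir t) y) = norm (Complex (x$1) (x$2) + exp (2 * of_real pi * \<i> * of_real t) * cnj (Complex (y$1) (y$2)))"
proof -
 let ?c = "cos (pi * t)" and ?s = "sin (pi * t)"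
 have c2: "cos (2 * pi * t) = 2 * ?c^2 - 1" using cos_double_cos[of "pi * t"] by (simp add: mult.assoc)
 have c2': "cos (2 * pi * t) = 1 - 2 * ?s^2" using cos_double_sin[of "pi * t"] by (simp add: mult.assoc)
 have s2: "sin (2 * pi * t) = 2 * ?s * ?c" using sin_double[of "pi * t"] by (simp add: mult.assoc)
 have e: "exp (2 * of_real pi * \<i> * of_real t) = Complex (cos (2 * pi * t)) (sin (2 * pi * t))"
 proof -
  have eq: "2 * of_real pi * \<i> * of_real t = \<i> * of_real (2 * pi * t)" by simp
  show ?thesis unfolding eq cis_conv_exp[symmetric] by (simp add: complex_eq_iff)
 qed
 have inn: "y \<bullet> dir t = y$1 * ?c + y$2 * ?s" by (simp add: inner_vec_def sum_2)
 have 1: "(x - refl_line (dir t) y) $ 1 = x$1 + (cos (2 * pi * t) * y$1 + sin (2 * pi * t) * y$2)"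
  unfolding refl_line_def inn c2 s2 by (simp add: algebra_simps power2_eq_square)
 have 2: "(x - refl_line (dir t) y) $ 2 = x$2 + (sin (2 * pi * t) * y$1 - cos (2 * pi * t) * y$2)"
  unfolding refl_line_def inn c2' s2 by (simp add: algebra_simps power2_eq_square)
 have "Complex (x$1) (x$2) + exp (2 * of_real pi * \<i> * of_real t) * cnj (Complex (y$1) (y$2))
   = Complex ((x - refl_line (dir t) y) $ 1) ((x - refl_line (dir t) y) $ 2)"
  unfolding e 1 2 by (simp add: complex_eq_iff)
 then show ?thesis by (simp only: norm_pt)
qed

lemma integral_ln_refl_dir:
 assumes "norm x \<noteq> norm (y::pt)"
 shows "(LBINT t. indicator {0..1} t * ln (norm (x - refl_line (dir t) y))) = ln (max (norm x) (norm y))"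
proof -
 let ?X = "Complex (x$1) (x$2)" and ?Y = "cnj (Complex (y$1) (y$2))"
 let ?g = "\<lambda>t::real. ln (norm (?X + exp (2 * of_real pi * \<i> * of_real t) * ?Y))"
 have nn: "norm ?Y = norm y" "norm ?X = norm x" by (simp_all only: complex_mod_cnj norm_pt[symmetric])
 have ne: "norm ?Y \<noteq> norm ?X" unfolding nn using assms by simp
 have n0: "?X + exp (2 * of_real pi * \<i> * of_real t) * ?Y \<noteq> 0" for t :: real
 proof
  assume "?X + exp (2 * of_real pi * \<i> * of_real t) * ?Y = 0"
  then have "?X = - (exp (2 * of_real pi * \<i> * of_real t) * ?Y)" by (simp only: eq_neg_iff_add_eq_0)
  then have "norm ?X = norm (exp (2 * of_real pi * \<i> * of_real t) * ?Y)" by (simp only: norm_minus_cancel)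
  then have "norm ?X = norm ?Y" by (simp only: norm_mult) simp
  then show False using ne by simp
 qed
 have "continuous_on {0..1} ?g"
  by (intro continuous_intros) (use n0 in auto)
 then have si: "set_integrable lborel {0..1} ?g"
  using borel_integrable_atLeastAtMost'[of 0 1 ?g] by simp
 have "(LBINT t. indicator {0..1} t * ?g t) = (LINT t:{0..1}|lborel. ?g t)" by (simp add: set_lebesgue_integral_def)
 also have "\<dots> = integral {0..1} ?g" by (rule set_borel_integral_eq_integral(2)[OF si])
 also have "\<dots> = ln (max (norm ?X) (norm ?Y))" by (rule integral_unique[OF circle_mean_ln[OF ne]])
 finally show ?thesis unfolding nn norm_diff_refl_dir .
qed

lemma integrable_refl_line:
 fixes g :: "pt => real"
 assumes n: "norm n = 1" and g: "integrable lborel g"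
 shows "integrable lborel (\<lambda>x. g (refl_line n x))"
proof -
 have "integrable (distr lborel borel (refl_line n)) g" using g by (simp add: distr_lborel_orthogonal[OF refl_line_orthogonal[OF n]])
 then show ?thesis by (rule integrable_distr[rotated]) (use measurable_refl_line[OF n] in simp)
qed

lemma AE_norm_neq: "AE y in lborel. norm (y::pt) \<noteq> r"
proof -
 have "sphere (0::pt) r \<in> null_sets lebesgue" using negligible_sphere[of "0::pt" r] by (simp add: negligible_iff_null_sets)
 then have "sphere (0::pt) r \<in> null_sets lborel" by (subst (asm) null_sets_completion_iff) auto
 from AE_not_in[OF this] show ?thesis by (simp add: dist_norm)
qed

text \<open>Newton's theorem, averaged over reflections instead of rotations since invariance under
  reflections is what is known. Each reflection preserves \<open>f\<close> only up to a null set, so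
  the potential is evaluated for each \<open>t\<close> separately and the average over
  \<open>t\<close> is exchanged with the integral by Fubini.\<close>

lemma radial_lpot:
 assumes f: "bdens L R f" and sym: "\<And>n. norm n = 1 ==> AE y in lborel. f (refl_line n y) = f y"
 shows "lpot f x = (LBINT y. ln (max (norm x) (norm y)) * f y)"
proof -
 have fm [measurable]: "f \<in> borel_measurable borel" by (rule bdens_measurable[OF f])
 define \<rho> where "\<rho> = R + norm x"
 define C where "C = L * (LBINT z. indicator (ball (0::pt) \<rho>) z * \<bar>ln (norm z)\<bar>)"
 have km: "(\<lambda>z::pt. ln (norm z)) \<in> borel_measurable borel" by measurable
 let ?g = "\<lambda>t y. ln (norm (x - refl_line (dir t) y)) * f y"
 have gi: "integrable lborel (?g t)" and gC: "(LBINT y. \<bar>?g t y\<bar>) \<le> C" and gl: "(LBINT y. ?g t y) = lpot f x" for t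
 proof -
  note d = norm_dir[of t]
  note [measurable] = measurable_refl_line[OF d]
  have fr: "bdens L R (\<lambda>y. f (refl_line (dir t) y))" by (rule bdens_refl_line[OF d f])
  have i: "integrable lborel (\<lambda>y. ln (norm (x - y)) * f (refl_line (dir t) y))" by (rule integrable_lpot[OF fr])
  from integrable_refl_line[OF d i] show "integrable lborel (?g t)" by (simp add: refl_line_refl_line[OF d])
  have "(LBINT y. \<bar>ln (norm (x - refl_line (dir t) y)) * f (refl_line (dir t) (refl_line (dir t) y))\<bar>) = (LBINT y. \<bar>ln (norm (x - y)) * f (refl_line (dir t) y)\<bar>)"
   by (rule integral_refl_line[OF d]) measurable
  also have "\<dots> \<le> C" unfolding C_def by (rule kernel_conv_bound[OF integrable_ln_ball km fr]) (simp add: \<rho>_def)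
  finally show "(LBINT y. \<bar>?g t y\<bar>) \<le> C" by (simp add: refl_line_refl_line[OF d])
  have "(LBINT y. ln (norm (x - refl_line (dir t) y)) * f (refl_line (dir t) y)) = lpot f x"
   unfolding lpot_def by (rule integral_refl_line[OF d]) measurable
  moreover have "(LBINT y. ln (norm (x - refl_line (dir t) y)) * f (refl_line (dir t) y)) = (LBINT y. ?g t y)"
   by (rule integral_cong_AE) (use sym[OF d] in auto)
  ultimately show "(LBINT y. ?g t y) = lpot f x" by simp
 qed
 have m [measurable]: "(\<lambda>(t, y). indicator {0..1::real} t * ?g t y) \<in> borel_measurable (lborel \<Otimes>\<^sub>M lborel)"
  unfolding refl_line_def by measurable
 have int: "integrable (lborel \<Otimes>\<^sub>M lborel) (\<lambda>(t, y). indicator {0..1::real} t * ?g t y)"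
 proof (rule lborel_pair.Fubini_integrable[OF m])
  show "AE t in lborel. integrable lborel (\<lambda>y. case (t, y) of (t, y) => indicator {0..1::real} t * ?g t y)" using gi by simp
  have mm: "(\<lambda>t. LBINT y. norm (indicator {0..1::real} t * ?g t y)) \<in> borel_measurable lborel"
   by (rule lborel.borel_measurable_lebesgue_integral) (unfold refl_line_def, measurable)
  have "integrable lborel (\<lambda>t. LBINT y. norm (indicator {0..1::real} t * ?g t y))"
  proof (rule Bochner_Integration.integrable_bound[OF _ mm])
   show "integrable lborel (\<lambda>t. C * indicator {0..1::real} t)" by simp
   show "AE t in lborel. norm (LBINT y. norm (indicator {0..1::real} t * ?g t y)) \<le> norm (C * indicator {0..1::real} t)" (is "AE x in _. ?P x")
   proof (intro AE_I2)
    fix t :: real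
    have "0 \<le> (LBINT y. \<bar>?g t y\<bar>)" by simp
    then show "?P t"
     using gC[of t] by (auto split: split_indicator)
   qed
  qed
  then show "integrable lborel (\<lambda>t. LBINT y. norm (case (t, y) of (t, y) => indicator {0..1::real} t * ?g t y))" by simp
 qed
 have "lpot f x = (LBINT t. indicator {0..1::real} t * lpot f x)" by simp
 also have "\<dots> = (LBINT t. (LBINT y. indicator {0..1::real} t * ?g t y))" by (simp add: gl)
 also have "\<dots> = (LBINT y. (LBINT t. indicator {0..1::real} t * ?g t y))"
  using lborel_pair.Fubini_integral[of "\<lambda>t y. indicator {0..1::real} t * ?g t y"] int by simp
 also have "\<dots> = (LBINT y. ln (max (norm x) (norm y)) * f y)"
 proof (rule integral_cong_AE)
  show "(\<lambda>y. LBINT t. indicator {0..1::real} t * ?g t y) \<in> borel_measurable lborel"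
   by (rule lborel.borel_measurable_lebesgue_integral) (unfold refl_line_def, measurable)
  show "(\<lambda>y. ln (max (norm x) (norm y)) * f y) \<in> borel_measurable lborel" by simp
  show "AE y in lborel. (LBINT t. indicator {0..1::real} t * ?g t y) = ln (max (norm x) (norm y)) * f y"
   using AE_norm_neq[of "norm x"]
  proof eventually_elim
   case (elim y)
   have "(LBINT t. indicator {0..1::real} t * ?g t y) = (LBINT t. (indicator {0..1} t * ln (norm (x - refl_line (dir t) y))) * f y)"
    by (simp add: mult.assoc)
   also have "\<dots> = (LBINT t. indicator {0..1} t * ln (norm (x - refl_line (dir t) y))) * f y" by (rule integral_mult_left_zero)
   finally show ?case using integral_ln_refl_dir[of x y] elim by simp
  qed
 qed
 finally show ?thesis .
qed

lemma integrable_ln_max: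
 assumes f: "bdens L R f" and r: "0 \<le> r"
 shows "integrable lborel (\<lambda>y. ln (max r (norm y)) * f y)"
proof (rule Bochner_Integration.integrable_bound)
 have [measurable]: "f \<in> borel_measurable borel" by (rule bdens_measurable[OF f])
 have "integrable lborel (\<lambda>y. \<bar>ln (norm (0 - y)) * f y\<bar> + \<bar>ln r\<bar> * \<bar>f y\<bar>)"
  using integrable_lpot[OF f, of 0] integrable_bdens[OF f] by (intro Bochner_Integration.integrable_add integrable_mult_right integrable_abs)
 then show "integrable lborel (\<lambda>y. (\<bar>ln (norm y)\<bar> + \<bar>ln r\<bar>) * \<bar>f y\<bar>)" by (simp add: abs_mult distrib_right)
 show "AE y in lborel. norm (ln (max r (norm y)) * f y) \<le> norm ((\<bar>ln (norm y)\<bar> + \<bar>ln r\<bar>) * \<bar>f y\<bar>)" (is "AE x in _. ?P x")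
 proof (intro AE_I2)
  fix y :: pt
  have "\<bar>ln (max r (norm y))\<bar> \<le> \<bar>ln (norm y)\<bar> + \<bar>ln r\<bar>" by (simp add: max_def)
  then show "?P y"
   by (simp add: abs_mult mult_right_mono)
 qed
 show "(\<lambda>y. ln (max r (norm y)) * f y) \<in> borel_measurable lborel" by simp
qed

section \<open>The unit disk as the only centred minimizer\<close>

definition disc :: "pt => real" where "disc = indicator (ball 0 1)"

lemma bdens_disc: "1 \<le> R ==> bdens 1 R disc"
 by (auto simp: bdens_def disc_def split: split_indicator)

lemma planar_disc: "1 \<le> R ==> planar R disc"
 using bdens_disc[of R] by (auto simp: planar_def bdens_def disc_def measure_ball_pt)

lemma disc_refl_line: "norm n = 1 ==> disc (refl_line n y) = disc y"
 by (auto simp: disc_def norm_refl_line split: split_indicator)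

lemma lpot_disc: "lpot disc x = (LBINT y. ln (max (norm x) (norm y)) * disc y)"
 by (rule radial_lpot[OF bdens_disc[OF order_refl]]) (simp add: disc_refl_line)

text \<open>For the sum h and the difference g of \<open>\<eta>\<close> and \<open>disc\<close>,
  symmetry gives \<open>Lq h g = Lq \<eta> \<eta> - Lq disc disc\<close>, which is at most 0. The
  potential of the radial h grows across |x| = 1, exactly where g turns from nonpositive to
  nonnegative, and g has integral 0. So (u |x| - u 1) g is nonnegative with nonpositive integral,
  and g vanishes.\<close>

lemma minimizer_unique:
 assumes \<eta>: "planar R \<eta>" and R: "1 \<le> R" and min: "\<And>f. planar R f ==> Lq \<eta> \<eta> \<le> Lq f f"
  and cen: "\<And>n. (LBINT x. (x \<bullet> n) * \<eta> x) = 0"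
 shows "AE x in lborel. \<eta> x = disc x"
proof -
 have \<eta>b: "bdens 1 R \<eta>" by (rule planar_bdens[OF \<eta>])
 have db: "bdens 1 R disc" by (rule bdens_disc[OF R])
 define h where "h x = \<eta> x + 1 * disc x" for x
 define g where "g x = \<eta> x + (-1) * disc x" for x
 have hb: "bdens (1 + \<bar>1\<bar> * 1) R h" and gb: "bdens (1 + \<bar>-1\<bar> * 1) R g"
  unfolding h_def g_def by (rule bdens_add_scale[OF \<eta>b db])+
 have hsym: "AE y in lborel. h (refl_line n y) = h y" if "norm n = 1" for n
 proof -
  have "AE y in lborel. \<eta> (refl_line n y) = \<eta> y"
   by (rule minimizer_reflection_symmetric[OF \<eta>]) (use min cen that in auto)
  then show ?thesis by eventually_elim (simp add: h_def disc_refl_line[OF that])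
 qed
 define u where "u r = (LBINT y. ln (max r (norm y)) * h y)" for r
 have lh: "lpot h x = u (norm x)" for x unfolding u_def by (rule radial_lpot[OF hb hsym])
 have h0: "0 \<le> h x" "disc x \<le> h x" for x using \<eta> by (auto simp: h_def planar_def disc_def)
 \<comment> \<open>Strictness is due to the part \<open>disc\<close> of \<open>h\<close>: for |y| <
   1 <= r' the maximum in the kernel really increases.\<close>
 have mono: "u r < u r'" if r: "0 \<le> r" "r < r'" "1 \<le> r'" for r r'
 proof (rule ccontr)
  assume "\<not> u r < u r'"
  have i: "integrable lborel (\<lambda>y. ln (max r' (norm y)) * h y - ln (max r (norm y)) * h y)"
   using integrable_ln_max[OF hb] r by auto
  have pos: "0 \<le> (ln (max r' (norm y)) - ln (max r (norm y))) * h y" if "y \<noteq> 0" for y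
  proof -
   have "0 < max r (norm y)" "max r (norm y) \<le> max r' (norm y)" using that r by (auto simp: less_max_iff_disj)
   then have "ln (max r (norm y)) \<le> ln (max r' (norm y))" by (intro ln_mono) auto
   then show ?thesis using h0[of y] by simp
  qed
  have "(LBINT y. ln (max r' (norm y)) * h y - ln (max r (norm y)) * h y) = u r' - u r"
   unfolding u_def using integrable_ln_max[OF hb] r by simp
  then have "AE y in lborel. ln (max r' (norm y)) * h y - ln (max r (norm y)) * h y = 0"
   using pos \<open>\<not> u r < u r'\<close> AE_lborel_neq[of 0]
   by (intro integral_zero_AE[OF i]) (auto simp: left_diff_distrib[symmetric])
  then have "AE y in lborel. y \<notin> ball (0::pt) 1" using AE_lborel_neq[of 0]
  proof eventually_elim
   case (elim y)
   show ?case
   proof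
    assume y: "y \<in> ball 0 1"
    then have "0 < h y" using h0(2)[of y] by (simp add: disc_def)
    moreover have "0 < max r (norm y)" "max r (norm y) < max r' (norm y)" using r y elim(2) by (auto simp: less_max_iff_disj)
    then have "ln (max r (norm y)) < ln (max r' (norm y))" by (subst ln_less_cancel_iff) linarith+
    ultimately show False using elim(1) by (simp add: left_diff_distrib[symmetric])
   qed
  qed
  then have "ball (0::pt) 1 \<in> null_sets lborel" by (subst AE_iff_null_sets) auto
  then show False using emeasure_ball_pt[of 1 0] by (auto simp: null_sets_def)
 qed
 have gi: "integrable lborel g" by (rule integrable_bdens[OF gb])
 have gint: "(LBINT x. g x) = 0" unfolding g_def
  using integrable_bdens[OF \<eta>b] integrable_bdens[OF db] \<eta> planar_disc[OF R] by (simp add: planar_def)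
 have "Lq h g = Lq \<eta> \<eta> - Lq disc disc"
 proof -
  have "Lq h g = Lq h \<eta> + (-1) * Lq h disc" unfolding g_def by (rule Lq_add_scale_right[OF \<eta>b db hb])
  also have "Lq h \<eta> = Lq \<eta> \<eta> + 1 * Lq disc \<eta>" unfolding h_def by (rule Lq_add_scale_left[OF \<eta>b db \<eta>b])
  also have "Lq h disc = Lq \<eta> disc + 1 * Lq disc disc" unfolding h_def by (rule Lq_add_scale_left[OF \<eta>b db db])
  also have "Lq disc \<eta> = Lq \<eta> disc" by (rule Lq_commute[OF db \<eta>b])
  finally show ?thesis by simp
 qed
 then have le: "Lq h g \<le> 0" using min[OF planar_disc[OF R]] by simp
 have i: "integrable lborel (\<lambda>x. (u (norm x) - u 1) * g x)"
  using integrable_lpot_mult[OF hb gb] gi unfolding lh by (simp add: left_diff_distrib)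
 have "(LBINT x. (u (norm x) - u 1) * g x) = Lq h g - u 1 * (LBINT x. g x)"
  using integrable_lpot_mult[OF hb gb] gi unfolding Lq_def lh by (simp add: left_diff_distrib)
 then have le': "(LBINT x. (u (norm x) - u 1) * g x) \<le> 0" using le gint by simp
 have nn: "0 \<le> (u (norm x) - u 1) * g x" for x
 proof (cases "norm x" "1::real" rule: linorder_cases)
  case less
  then have "u (norm x) < u 1" "g x \<le> 0" using mono[of "norm x" 1] \<eta> by (auto simp: g_def disc_def planar_def)
  then show ?thesis by (simp add: mult_nonpos_nonpos)
 next
  case greater
  then have "u 1 < u (norm x)" "0 \<le> g x" using mono[of 1 "norm x"] \<eta> by (auto simp: g_def disc_def planar_def)
  then show ?thesis by simp
 qed simp
 have "AE x in lborel. (u (norm x) - u 1) * g x = 0" by (rule integral_zero_AE[OF i _ le']) (use nn in auto)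
 then show ?thesis using AE_norm_neq[of 1]
 proof eventually_elim
  case (elim x)
  have "u (norm x) \<noteq> u 1"
   using mono[of "norm x" 1] mono[of 1 "norm x"] elim by (cases "norm x" "1::real" rule: linorder_cases) auto
  then show ?case using elim by (simp add: g_def)
 qed
qed

lemma lpot_disc_outside:
 assumes "1 \<le> norm x" shows "lpot disc x = pi * ln (norm x)"
proof -
 have "lpot disc x = (LBINT y. ln (norm x) * disc y)" unfolding lpot_disc
  using assms by (intro Bochner_Integration.integral_cong) (auto simp: disc_def max_def split: split_indicator)
 then show ?thesis by (simp add: disc_def measure_ball_pt)
qed

text \<open>Layer cake: -ln max(r, |y|) is the integral of 1/t over [max(r, |y|), 1]. Exchanging the
  order of integration leaves (1/t) pi t^2 = pi t to be integrated from r to 1.\<close>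

lemma lpot_disc_inside:
 assumes r: "norm x < 1" shows "lpot disc x = - (pi / 2) * (1 - (norm x)^2)"
proof -
 define r where "r = norm x"
 have r01: "0 \<le> r" "r < 1" using assms by (auto simp: r_def)
 have i: "integrable lborel (\<lambda>y. - (ln (max r (norm y)) * disc y))"
  using integrable_ln_max[OF bdens_disc[OF order_refl] r01(1)] by simp
 have nonpos: "ln (max r (norm y)) * disc y \<le> 0" for y
 proof (cases "norm y < 1")
  case True
  then have "max r (norm y) \<le> 1" "0 \<le> max r (norm y)" using r01 by auto
  then have "ln (max r (norm y)) \<le> 0" by (cases "max r (norm y) = 0") auto
  then show ?thesis by (simp add: disc_def split: split_indicator)
 qed (simp add: disc_def)
 have log: "(\<integral>\<^sup>+t. ennreal (1 / t) * indicator {a..1} t \<partial>lborel) = ennreal (- ln a)" if "0 < a" "a \<le> 1" for a :: real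
 proof -
  have "(\<integral>\<^sup>+t. ennreal (1 / t) * indicator {a..1} t \<partial>lborel) = ennreal (ln 1 - ln a)"
   by (rule nn_integral_FTC_Icc) (use that in \<open>auto intro!: DERIV_ln_divide\<close>)
  then show ?thesis by simp
 qed
 have "ennreal (LBINT y. - (ln (max r (norm y)) * disc y)) = (\<integral>\<^sup>+y. ennreal (- (ln (max r (norm y)) * disc y)) \<partial>lborel)"
  by (rule nn_integral_eq_integral[OF i, symmetric]) (use nonpos in simp)
 also have "\<dots> = (\<integral>\<^sup>+y. (\<integral>\<^sup>+t. ennreal (1 / t) * indicator {r..1} t * indicator (cball (0::pt) t) y \<partial>lborel) \<partial>lborel)"
 proof (rule nn_integral_cong_AE)
  show "AE y in lborel. ennreal (- (ln (max r (norm y)) * disc y)) = (\<integral>\<^sup>+t. ennreal (1 / t) * indicator {r..1} t * indicator (cball (0::pt) t) y \<partial>lborel)"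
   using AE_lborel_neq[of 0] AE_norm_neq[of 1]
  proof eventually_elim
   case (elim y)
   show ?case
   proof (cases "norm y < 1")
    case True
    have "(\<integral>\<^sup>+t. ennreal (1 / t) * indicator {r..1} t * indicator (cball (0::pt) t) y \<partial>lborel) = (\<integral>\<^sup>+t. ennreal (1 / t) * indicator {max r (norm y)..1} t \<partial>lborel)"
     by (intro nn_integral_cong) (auto split: split_indicator)
    also have "\<dots> = ennreal (- ln (max r (norm y)))" using True r01 elim by (intro log) (auto simp: less_max_iff_disj)
    finally show ?thesis using True by (simp add: disc_def)
   next
    case False
    have "(\<integral>\<^sup>+t. ennreal (1 / t) * indicator {r..1} t * indicator (cball (0::pt) t) y \<partial>lborel) = (\<integral>\<^sup>+(t::real). 0 \<partial>lborel)"
     using False elim by (intro nn_integral_cong) (auto split: split_indicator)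
    then show ?thesis using False by (simp add: disc_def)
   qed
  qed
 qed
 also have "\<dots> = (\<integral>\<^sup>+t. (\<integral>\<^sup>+y. ennreal (1 / t) * indicator {r..1} t * indicator (cball (0::pt) t) y \<partial>lborel) \<partial>lborel)"
 proof (rule lborel_pair.Fubini')
  have "(\<lambda>(t::real, y::pt). ennreal (1 / t) * indicator {r..1} t * indicator {p. norm (snd p) \<le> fst p} (t, y)) \<in> borel_measurable (lborel \<Otimes>\<^sub>M lborel)"
   by measurable
  moreover have "indicator {p. norm (snd p) \<le> fst p} (t, y) = (indicator (cball (0::pt) t) y :: ennreal)" for t and y :: pt by (auto split: split_indicator)
  ultimately show "(\<lambda>(t::real, y::pt). ennreal (1 / t) * indicator {r..1} t * indicator (cball 0 t) y) \<in> borel_measurable (lborel \<Otimes>\<^sub>M lborel)" by simp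
 qed
 also have "\<dots> = (\<integral>\<^sup>+t. ennreal (pi * t) * indicator {r..1} t \<partial>lborel)"
 proof (rule nn_integral_cong_AE)
  show "AE t in lborel. (\<integral>\<^sup>+y. ennreal (1 / t) * indicator {r..1} t * indicator (cball (0::pt) t) y \<partial>lborel) = ennreal (pi * t) * indicator {r..1} t" (is "AE x in _. ?P x")
  proof (intro AE_I2)
   fix t :: real
   show "?P t"
   proof (cases "t \<in> {r..1}")
    case True
    then have t0: "0 \<le> t" using r01 by simp
    have "(\<integral>\<^sup>+y. ennreal (1 / t) * indicator {r..1} t * indicator (cball (0::pt) t) y \<partial>lborel) = ennreal (1 / t) * emeasure lborel (cball (0::pt) t)"
     using True by (simp add: nn_integral_cmult)
    also have "\<dots> = ennreal (1 / t * (pi * t^2))" unfolding emeasure_cball_pt[OF t0] using t0 by (intro ennreal_mult'[symmetric]) simp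
    also have "1 / t * (pi * t^2) = pi * t" by (simp add: power2_eq_square)
    finally show ?thesis using True by simp
   qed simp
  qed
 qed
 also have "\<dots> = ennreal (pi * 1^2 / 2 - pi * r^2 / 2)"
  by (rule nn_integral_FTC_Icc) (use r01 in \<open>auto intro!: derivative_eq_intros\<close>)
 finally have e: "ennreal (LBINT y. - (ln (max r (norm y)) * disc y)) = ennreal (pi / 2 * (1 - r^2))"
  by (simp add: right_diff_distrib)
 have "0 \<le> (LBINT y. - (ln (max r (norm y)) * disc y))"
  using nonpos by (intro Bochner_Integration.integral_nonneg) simp
 moreover have "0 \<le> pi / 2 * (1 - r^2)" using r01 by (simp add: abs_square_le_1)
 ultimately have "(LBINT y. - (ln (max r (norm y)) * disc y)) = pi / 2 * (1 - r^2)" using e by (simp add: ennreal_inj)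
 then show ?thesis unfolding lpot_disc r_def[symmetric] by simp
qed

lemma Vstar_eq: "Vstar y = - (1/(2*pi)) * lpot disc y"
proof (cases "norm y < 1")
 case True
 then show ?thesis by (simp add: Vstar_def lpot_disc_inside)
next
 case False
 then have "1 \<le> norm y" by simp
 then show ?thesis by (cases "norm y = 1") (auto simp: Vstar_def lpot_disc_outside ln_div)
qed

section \<open>Concentration\<close>

lemma epsl_pos: "0 < lam ==> 0 < epsl lam"
 by (simp add: epsl_def)

lemma epsl_sq: "0 < lam ==> lam * (pi * (epsl lam)^2) = 1"
 by (simp add: epsl_def power_divide)

text \<open>For a density of mass 1 this is the integral of ln(e/|x - y|) v(y), the negative
  logarithmic potential measured in units of the core size \<open>e\<close>.\<close>

definition Jf :: "real => (pt => real) => pt => real" where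
 "Jf e v x = ln e - lpot v x"

lemma adm_integral_const:
 assumes v: "adm lam v" shows "(LBINT y. c * v y) = c" "integrable lborel (\<lambda>y. c * v y)"
 using v integrable_bdens[OF adm_bdens[OF v]] by (auto simp: adm_def)

lemma Jf_eq:
 assumes v: "adm lam v" and e: "0 < e"
 shows "Jf e v x = (LBINT y. ln (e / norm (x - y)) * v y)" "integrable lborel (\<lambda>y. ln (e / norm (x - y)) * v y)"
proof -
 have [measurable]: "v \<in> borel_measurable borel" using v by (simp add: adm_def)
 have ae: "AE y in lborel. ln e * v y - ln (norm (x - y)) * v y = ln (e / norm (x - y)) * v y"
  using AE_lborel_neq[of x] by eventually_elim (use e in \<open>simp add: ln_div left_diff_distrib\<close>)
 have i: "integrable lborel (\<lambda>y. ln e * v y - ln (norm (x - y)) * v y)"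
  by (intro Bochner_Integration.integrable_diff adm_integral_const(2)[OF v] integrable_lpot[OF adm_bdens[OF v]])
 show "integrable lborel (\<lambda>y. ln (e / norm (x - y)) * v y)"
  by (rule integrable_cong_AE_imp[OF i]) (use ae in \<open>auto elim: eventually_mono\<close>)
 have "Jf e v x = (LBINT y. ln e * v y) - (LBINT y. ln (norm (x - y)) * v y)"
  unfolding Jf_def lpot_def adm_integral_const(1)[OF v] ..
 also have "\<dots> = (LBINT y. ln e * v y - ln (norm (x - y)) * v y)"
  by (rule Bochner_Integration.integral_diff[symmetric]) (intro adm_integral_const(2)[OF v] integrable_lpot[OF adm_bdens[OF v]])+
 also have "\<dots> = (LBINT y. ln (e / norm (x - y)) * v y)" by (rule integral_cong_AE) (use ae in auto)
 finally show "Jf e v x = (LBINT y. ln (e / norm (x - y)) * v y)" .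
qed

text \<open>The relation lam * pi * epsl^2 = 1 turns the bound 40 epsl for the integral of 1/|z|
  into 40/pi at every scale, and 14 is above that.\<close>

lemma near_mass_bound:
 assumes v: "adm lam v" and lam: "0 < lam"
 shows "integrable lborel (\<lambda>y. epsl lam / norm (x - y) * indicator (ball x (epsl lam)) y * v y)"
  and "(LBINT y. epsl lam / norm (x - y) * indicator (ball x (epsl lam)) y * v y) \<le> 14"
proof -
 let ?e = "epsl lam"
 have e: "0 < ?e" using epsl_pos[OF lam] .
 have [measurable]: "v \<in> borel_measurable borel" using v by (simp add: adm_def)
 have v01: "0 \<le> v y" "v y \<le> lam" for y using v by (auto simp: adm_def)
 have "integrable lborel (\<lambda>y. indicator (ball (0::pt) ?e) (x + (-1) *\<^sub>R y) * (1 / norm (x + (-1) *\<^sub>R y)))"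
  by (rule integrable_lborel_affine[OF integrable_inverse_ball]) simp
 moreover have "indicator (ball (0::pt) ?e) (x - y) = (indicator (ball x ?e) y :: real)" for y
  by (simp add: indicator_def dist_norm norm_minus_commute)
 ultimately have i0: "integrable lborel (\<lambda>y. indicator (ball x ?e) y * (1 / norm (x - y)))" by simp
 have i: "integrable lborel (\<lambda>y. lam * ?e * (indicator (ball x ?e) y * (1 / norm (x - y))))"
  by (rule integrable_mult_right[OF i0])
 have le: "0 \<le> ?e / norm (x - y) * indicator (ball x ?e) y * v y"
  "?e / norm (x - y) * indicator (ball x ?e) y * v y \<le> lam * ?e * (indicator (ball x ?e) y * (1 / norm (x - y)))" for y
 proof -
  have "0 \<le> ?e / norm (x - y) * indicator (ball x ?e) y" using e by simp
  then show "0 \<le> ?e / norm (x - y) * indicator (ball x ?e) y * v y" using v01(1)[of y] by (rule mult_nonneg_nonneg)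
  have "?e / norm (x - y) * indicator (ball x ?e) y * v y \<le> ?e / norm (x - y) * indicator (ball x ?e) y * lam"
   using v01(2)[of y] e by (intro mult_left_mono) auto
  then show "?e / norm (x - y) * indicator (ball x ?e) y * v y \<le> lam * ?e * (indicator (ball x ?e) y * (1 / norm (x - y)))" by (simp add: mult_ac)
 qed
 show int: "integrable lborel (\<lambda>y. ?e / norm (x - y) * indicator (ball x ?e) y * v y)"
 proof (rule Bochner_Integration.integrable_bound[OF i])
  show "AE y in lborel. norm (?e / norm (x - y) * indicator (ball x ?e) y * v y) \<le> norm (lam * ?e * (indicator (ball x ?e) y * (1 / norm (x - y))))" (is "AE x in _. ?P x")
  proof (intro AE_I2)
   fix y
   show "?P y"
    using le[of y] by (simp only: real_norm_def abs_of_nonneg)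
  qed
 qed measurable
 have "(LBINT y. ?e / norm (x - y) * indicator (ball x ?e) y * v y) \<le> (LBINT y. lam * ?e * (indicator (ball x ?e) y * (1 / norm (x - y))))"
  by (rule integral_mono[OF int i le(2)])
 also have "\<dots> = lam * ?e * (LBINT y. indicator (ball x ?e) y * (1 / norm (x - y)))" by (rule integral_mult_right_zero)
 also have "(LBINT y. indicator (ball x ?e) y * (1 / norm (x - y))) = (LBINT z. indicator (ball (0::pt) ?e) z * (1 / norm z))"
  using integral_lborel_affine[of "-1" "\<lambda>z. indicator (ball (0::pt) ?e) z * (1 / norm z)" x]
  by (simp add: indicator_def dist_norm norm_minus_commute)
 also have "lam * ?e * \<dots> \<le> lam * ?e * (40 * ?e)"
  using integral_inverse_ball_le[OF e] lam e by (intro mult_left_mono) auto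
 also have "\<dots> = 40 / pi" using epsl_sq[OF lam] by (simp add: power2_eq_square field_simps)
 also have "\<dots> \<le> 14" using pi_gt3 by (simp add: divide_le_eq)
 finally show "(LBINT y. ?e / norm (x - y) * indicator (ball x ?e) y * v y) \<le> 14" .
qed

definition massin :: "(pt => real) => pt => real => real" where
 "massin v x r = (LBINT y. indicator (ball x r) y * v y)"

lemma integrable_massin:
 assumes v: "adm lam v" shows "integrable lborel (\<lambda>y. indicator (ball x r) y * v y)"
proof -
 have "(\<lambda>y. v y * indicator (ball x r) y) = (\<lambda>y. indicator (ball x r) y * v y)" by (simp add: mult.commute)
 moreover have "integrable lborel (\<lambda>y. v y * indicator (ball x r) y)"
  by (rule bounded_density_integrable_mult[OF integrable_bdens[OF adm_bdens[OF v]], of _ 1]) (auto split: split_indicator)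
 ultimately show ?thesis by simp
qed

text \<open>With t = |x - y| and e the core size, ln(e/t) is at most e/t for t < e, at most 0 for e
  <= t < R e, and at most -ln R beyond. Mass far from \<open>x\<close> is thus penalized by ln
  R.\<close>

lemma Jf_le:
 assumes v: "adm lam v" and lam: "0 < lam" and R: "1 \<le> R"
 shows "Jf (epsl lam) v x \<le> 14 - ln R * (1 - massin v x (R * epsl lam))"
proof -
 let ?e = "epsl lam"
 have e: "0 < ?e" using epsl_pos[OF lam] .
 let ?b = "\<lambda>y. ?e / norm (x - y) * indicator (ball x ?e) y * v y"
 let ?m = "\<lambda>y. indicator (ball x (R * ?e)) y * v y"
 note ib = near_mass_bound[OF v lam, of x] and im = integrable_massin[OF v, of x "R * ?e"] and iv = adm_integral_const(2)[OF v, of 1]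
 have "Jf ?e v x \<le> (LBINT y. ?b y - ln R * (1 * v y - ?m y))"
  unfolding Jf_eq(1)[OF v e]
 proof (rule integral_mono_AE[OF Jf_eq(2)[OF v e]])
  show "integrable lborel (\<lambda>y. ?b y - ln R * (1 * v y - ?m y))" using ib(1) im iv by auto
  show "AE y in lborel. ln (?e / norm (x - y)) * v y \<le> ?b y - ln R * (1 * v y - ?m y)"
   using AE_lborel_neq[of x]
  proof eventually_elim
   case (elim y)
   define t where "t = norm (x - y)"
   have t: "0 < t" using elim by (simp add: t_def)
   have "ln (?e / t) \<le> ?e / t * indicator (ball x ?e) y - ln R * (1 - indicator (ball x (R * ?e)) y)"
   proof (cases "t < ?e")
    case True
    have "?e * 1 \<le> ?e * R" using R e by (intro mult_left_mono) auto
    then have "t < R * ?e" using True by (simp add: mult.commute)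
    moreover have "ln (?e / t) \<le> ?e / t" using ln_le_minus_one[of "?e / t"] e t by simp
    ultimately show ?thesis using True by (simp add: dist_norm t_def)
   next
    case False
    show ?thesis
    proof (cases "t < R * ?e")
     case True
     have "?e / t \<le> 1" using False t by simp
     then have "ln (?e / t) \<le> 0" using e t by simp
     then show ?thesis using False True by (simp add: dist_norm t_def)
    next
     case nR: False
     have "?e / t \<le> 1 / R" using nR e R t by (simp add: field_simps)
     then have "ln (?e / t) \<le> ln (1 / R)" using e t by (intro ln_mono) auto
     also have "\<dots> = - ln R" using R by (simp add: ln_div)
     finally show ?thesis using False nR by (simp add: dist_norm t_def)
    qed
   qed
   then have "ln (?e / t) * v y \<le> (?e / t * indicator (ball x ?e) y - ln R * (1 - indicator (ball x (R * ?e)) y)) * v y"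
    using v by (intro mult_right_mono) (auto simp: adm_def)
   then show ?case unfolding t_def by (simp add: algebra_simps)
  qed
 qed
 also have "\<dots> = (LBINT y. ?b y) - ln R * ((LBINT y. 1 * v y) - (LBINT y. ?m y))"
  using ib(1) im iv by simp
 also have "\<dots> \<le> 14 - ln R * (1 - massin v x (R * ?e))"
  using ib(2) unfolding adm_integral_const(1)[OF v] massin_def by simp
 finally show ?thesis .
qed

text \<open>A lower bound \<open>c\<close> on the ball and \<open>c - d\<close> elsewhere is
  averaged with the mass inside and outside the ball.\<close>

lemma hpot_ge:
 assumes v: "adm lam v" and x: "x \<in> D" and h: "\<And>y. y \<in> D ==> c - d * (1 - indicator S y) \<le> hreg x y" and S: "S = ball x r"
 shows "c - d * (1 - massin v x r) \<le> hpot v x"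
proof -
 note im = integrable_massin[OF v, of x r] and iv = adm_integral_const(2)[OF v, of 1]
 have "(LBINT y. c * v y - d * (1 * v y - indicator (ball x r) y * v y)) \<le> hpot v x"
  unfolding hpot_def
 proof (rule integral_mono)
  show "integrable lborel (\<lambda>y. c * v y - d * (1 * v y - indicator (ball x r) y * v y))"
   using im iv by auto
  show "integrable lborel (\<lambda>y. hreg x y * v y)" by (rule integrable_hpot[OF adm_bdens[OF v] x])
  fix y
  show "c * v y - d * (1 * v y - indicator (ball x r) y * v y) \<le> hreg x y * v y"
  proof (cases "y \<in> D")
   case True
   have "(c - d * (1 - indicator S y)) * v y \<le> hreg x y * v y"
    using h[OF True] v by (intro mult_right_mono) (auto simp: adm_def)
   then show ?thesis unfolding S by (simp add: algebra_simps)
  qed (use bdens_D[OF adm_bdens[OF v]] in simp)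
 qed
 moreover have "(LBINT y. c * v y - d * (1 * v y - indicator (ball x r) y * v y)) = c - d * (1 - massin v x r)"
 proof -
  have "(LBINT y. c * v y - d * (1 * v y - indicator (ball x r) y * v y)) = (LBINT y. c * v y) - d * ((LBINT y. 1 * v y) - (LBINT y. indicator (ball x r) y * v y))"
   using im iv adm_integral_const(2)[OF v, of c] by simp
  then show ?thesis unfolding adm_integral_const(1)[OF v] massin_def .
 qed
 ultimately show ?thesis by simp
qed

lemma hpot_ge_const:
 assumes v: "adm lam v" and x: "x \<in> D" shows "- (1/(4*pi)) * ln 4 \<le> hpot v x"
 using hpot_ge[OF v x, of "- (1/(4*pi)) * ln 4" 0 "ball x 1" 1] hreg_bounds[OF x] by simp

lemma hpot_le:
 assumes v: "adm lam v" and d: "0 < d" and x: "norm x \<le> 1 - d"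
 shows "hpot v x \<le> - (1/(2*pi)) * ln d"
proof -
 have xD: "x \<in> D" using d x by (simp add: D_iff)
 have "hpot v x \<le> (LBINT y. - (1/(2*pi)) * ln d * v y)" unfolding hpot_def
 proof (rule integral_mono[OF integrable_hpot[OF adm_bdens[OF v] xD] adm_integral_const(2)[OF v]])
  fix y show "hreg x y * v y \<le> - (1/(2*pi)) * ln d * v y"
  proof (cases "y \<in> D")
   case True
   then show ?thesis using v hreg_le[OF x d, of y] by (intro mult_right_mono) (auto simp: D_iff adm_def)
  qed (use bdens_D[OF adm_bdens[OF v]] in simp)
 qed
 then show ?thesis unfolding adm_integral_const(1)[OF v] .
qed

lemma psi0_Jf:
 assumes v: "adm lam v" and x: "x \<in> D"
 shows "psi0 Om v x = (1/(2*pi)) * (Jf e v x - ln e) - hpot v x + Om/2 * (norm x)^2"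
 unfolding psi0_eq[OF adm_bdens[OF v] x] Jf_def by simp

text \<open>If \<open>x\<close> is near the unit circle and \<open>y\<close> near \<open>x\<close>,
  then \<open>Nker\<close> is small and the regular part of the Green function large. This is what
  repels a concentrated mass from the boundary.\<close>

lemma Nker_le_sq:
 assumes x: "x \<in> D" and y: "y \<in> D" and r: "norm (x - y) \<le> r"
 shows "Nker x y \<le> (r + (1 - (norm x)^2))^2"
proof -
 define d where "d = 1 - (norm x)^2"
 have d: "0 \<le> d" using x by (simp add: d_def D_iff abs_square_le_1)
 have r0: "0 \<le> r" using r norm_ge_zero order_trans by blast
 have "(norm x)^2 - (norm y)^2 = (norm x + norm y) * (norm x - norm y)" by (simp add: power2_eq_square algebra_simps)
 also have "\<dots> \<le> (norm x + norm y) * norm (x - y)" using norm_triangle_ineq2[of x y] by (intro mult_left_mono) auto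
 also have "\<dots> \<le> 2 * r" using x y r by (intro mult_mono) (auto simp: D_iff)
 finally have "1 - (norm y)^2 \<le> d + 2 * r" by (simp add: d_def)
 then have "d * (1 - (norm y)^2) \<le> d * (d + 2 * r)" using d by (intro mult_left_mono) auto
 moreover have "(norm (x - y))^2 \<le> r^2" using r by (intro power_mono) auto
 ultimately have "Nker x y \<le> r^2 + d * (d + 2 * r)" unfolding Nker_eq d_def[symmetric] by linarith
 also have "\<dots> = (r + d)^2" by (simp add: power2_eq_square algebra_simps)
 finally show ?thesis unfolding d_def .
qed

text \<open>A value of psi near (1/(2 pi)) ln(1/epsl) bounds \<open>Jf\<close> from below because
  the regular part is bounded below, and \<open>Jf_le\<close> then puts more than half of the mass
  within R * epsl of \<open>x\<close>. Close to the unit circle this mass would make the regular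
  part large, whereas the value of psi also bounds it from above.\<close>

lemma high_point_concentrated:
 assumes Om: "0 < Om" and C: "0 \<le> C"
 obtains R c e0 where "1 < R" "0 < c" "c < 1" "0 < e0"
  "\<And>lam v x. 0 < lam ==> epsl lam < e0 ==> adm lam v ==> x \<in> D ==> - (1/(2*pi)) * ln (epsl lam) - C \<le> psi0 Om v x ==>
    1/2 < massin v x (R * epsl lam) \<and> norm x \<le> 1 - c \<and> - (2*pi) * (C + (1/(4*pi)) * ln 4 + Om/2) \<le> Jf (epsl lam) v x"
proof -
 define C1 where "C1 = 2*pi * (C + (1/(4*pi)) * ln 4 + Om/2)"
 have C1: "0 \<le> C1" using C Om unfolding C1_def by (intro mult_nonneg_nonneg add_nonneg_nonneg) auto
 \<comment> \<open>With at most half of the mass nearby, 14 - (ln R)/2 would already be below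
   -C1.\<close>
 define R where "R = exp (2 * (14 + C1) + 1)"
 have lnR: "ln R = 2 * (14 + C1) + 1" by (simp add: R_def)
 have R: "1 < R" using C1 by (simp add: R_def)
 \<comment> \<open>\<open>k\<close>, the exponential of -C3, will bound R * epsl + 1 - |x|^2 from
   below; \<open>e0\<close> keeps R * epsl under k/2 and leaves k/2 for 1 - |x|^2.\<close>
 define C3 where "C3 = 4*pi * (C + 14 / (2*pi) + Om/2 + (1/(4*pi)) * ln 4)"
 have C3: "0 < C3" unfolding C3_def using C Om by (intro mult_pos_pos add_nonneg_pos add_pos_nonneg) auto
 define k where "k = exp (- C3)"
 have k: "0 < k" "k < 1" using C3 by (auto simp: k_def)
 define e0 where "e0 = k / (2 * R)"
 have e0: "0 < e0" using k R by (simp add: e0_def)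
 have main: "1/2 < massin v x (R * epsl lam) \<and> norm x \<le> 1 - k/4 \<and> - C1 \<le> Jf (epsl lam) v x"
  if lam: "0 < lam" and el: "epsl lam < e0" and v: "adm lam v" and x: "x \<in> D" and hi: "- (1/(2*pi)) * ln (epsl lam) - C \<le> psi0 Om v x" for lam v x
 proof -
  define e where "e = epsl lam"
  have e: "0 < e" using epsl_pos[OF lam] by (simp add: e_def)
  define J where "J = Jf e v x"
  have nx: "(norm x)^2 \<le> 1" using x by (simp add: D_iff abs_square_le_1)
  have omx: "Om/2 * (norm x)^2 \<le> Om/2" using Om nx by (simp add: mult_left_le)
  have psi: "psi0 Om v x = (1/(2*pi)) * J - (1/(2*pi)) * ln e - hpot v x + Om/2 * (norm x)^2"
   unfolding psi0_Jf[OF v x, of Om e] J_def by (simp add: right_diff_distrib)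
  have "- C - (1/(4*pi)) * ln 4 - Om/2 \<le> (1/(2*pi)) * J"
   using hi hpot_ge_const[OF v x] omx unfolding psi e_def[symmetric] by linarith
  then have "(2*pi) * (- C - (1/(4*pi)) * ln 4 - Om/2) \<le> (2*pi) * ((1/(2*pi)) * J)" by (intro mult_left_mono) auto
  then have J1: "- C1 \<le> J" unfolding C1_def by (simp add: algebra_simps)
  have J2: "J \<le> 14 - ln R * (1 - massin v x (R * e))" unfolding J_def e_def by (rule Jf_le[OF v lam]) (use R in simp)
  have m: "1/2 < massin v x (R * e)"
  proof (rule ccontr)
   assume "\<not> ?thesis"
   then have "ln R * (1/2) \<le> ln R * (1 - massin v x (R * e))" using lnR C1 by (intro mult_left_mono) auto
   then show False using J1 J2 lnR by simp
  qed
  have J14: "J \<le> 14" using Jf_le[OF v lam, of 1 x] unfolding J_def e_def by simp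
  define q where "q = R * e + (1 - (norm x)^2)"
  have q0: "0 < q" using R e nx unfolding q_def by (intro add_pos_nonneg) auto
  have kq: "k \<le> q"
  proof (cases "q < 1")
   case True
   have "hpot v x \<le> C + (1/(2*pi)) * J + Om/2" using hi omx unfolding psi e_def[symmetric] by linarith
   also have "(1/(2*pi)) * J \<le> (1/(2*pi)) * 14" using J14 by (intro mult_left_mono) auto
   finally have up: "hpot v x \<le> C + 14 / (2*pi) + Om/2" by simp
   \<comment> \<open>The regular part is at least \<open>\<alpha>\<close> near \<open>x\<close> and
     at least \<open>- \<beta>\<close> everywhere; more than half of the mass feels
     \<open>\<alpha>\<close>.\<close>
   define \<alpha> where "\<alpha> = - (1/(2*pi)) * ln q"
   define \<beta> where "\<beta> = (1/(4*pi)) * ln 4"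
   have \<alpha>0: "0 \<le> \<alpha>" "0 \<le> \<beta>" using True q0 by (auto simp: \<alpha>_def \<beta>_def divide_nonpos_pos)
   have "\<alpha> - (\<alpha> + \<beta>) * (1 - massin v x (R * e)) \<le> hpot v x"
   proof (rule hpot_ge[OF v x _ refl])
    fix y assume y: "y \<in> D"
    show "\<alpha> - (\<alpha> + \<beta>) * (1 - indicator (ball x (R * e)) y) \<le> hreg x y"
    proof (cases "y \<in> ball x (R * e)")
     case True
     then have "norm (x - y) \<le> R * e" by (simp add: dist_norm)
     then have "Nker x y \<le> q^2" unfolding q_def by (rule Nker_le_sq[OF x y])
     then have "ln (Nker x y) \<le> ln (q^2)" using Nker_pos[OF x y] by (intro ln_mono) auto
     then have "ln (Nker x y) \<le> 2 * ln q" using q0 by (simp add: ln_realpow)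
     then have "\<alpha> \<le> hreg x y" unfolding \<alpha>_def hreg_def by (simp add: field_simps)
     then show ?thesis using True by simp
    next
     case False
     then show ?thesis using hreg_bounds[OF x y] by (simp add: \<beta>_def)
    qed
   qed
   moreover have "(\<alpha> + \<beta>) * (1 - massin v x (R * e)) \<le> (\<alpha> + \<beta>) * (1/2)" using m \<alpha>0 by (intro mult_left_mono) auto
   ultimately have "\<alpha> \<le> 2 * (C + 14 / (2*pi) + Om/2 + \<beta>)" using up \<alpha>0 by simp
   then have "2*pi * \<alpha> \<le> 2*pi * (2 * (C + 14 / (2*pi) + Om/2 + \<beta>))" by (intro mult_left_mono) auto
   then have "- ln q \<le> C3" unfolding \<alpha>_def C3_def \<beta>_def by (simp add: algebra_simps)
   then have "exp (- C3) \<le> exp (ln q)" by simp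
   then show ?thesis using q0 by (simp add: k_def)
  qed (use k in simp)
  have "R * e < R * e0" using el R by (simp add: e_def)
  also have "R * e0 = k / 2" using R by (simp add: e0_def)
  finally have "k/2 \<le> 1 - (norm x)^2" using kq unfolding q_def by linarith
  also have "\<dots> = (1 - norm x) * (1 + norm x)" by (simp add: power2_eq_square algebra_simps)
  also have "\<dots> \<le> (1 - norm x) * 2" using x by (intro mult_left_mono) (auto simp: D_iff)
  finally have "norm x \<le> 1 - k/4" by simp
  then show ?thesis using m J1 unfolding J_def e_def by blast
 qed
 show thesis
  by (rule that[OF R _ _ e0, of "k/4"]) (use k main in \<open>auto simp: C1_def\<close>)
qed

text \<open>\<open>epsl lam\<close> is the radius at which height \<open>lam\<close> gives mass 1.
  Points of the ball are within twice that radius, which bounds the Green function below.\<close>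

lemma concentrated_competitor_energy:
 assumes lam: "0 < lam" and e: "epsl lam \<le> 1/2" and Om: "0 < Om"
 shows "adm lam (\<lambda>x. lam * indicator (ball 0 (epsl lam)) x)"
  and "(1/(4*pi)) * (- ln (epsl lam) - ln 4) \<le> Efun Om (\<lambda>x. lam * indicator (ball 0 (epsl lam)) x)"
proof -
 let ?e = "epsl lam" and ?B = "ball (0::pt) (epsl lam)"
 have e0: "0 < ?e" using epsl_pos[OF lam] .
 have mB: "measure lborel ?B = pi * ?e^2" using e0 by (simp add: measure_ball_pt)
 have BD: "?B \<subseteq> D" using e by (auto simp: D_iff)
 have Bpos: "0 < measure lborel ?B" unfolding mB using e0 by simp
 have u: "unif ?B = (\<lambda>x. lam * indicator ?B x)"
 proof
  fix x
  have "1 / measure lborel ?B = lam" unfolding mB using epsl_sq[OF lam] e0 by (simp add: field_simps)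
  then show "unif ?B x = lam * indicator ?B x" by (simp add: unif_def indicator_def)
 qed
 show ad: "adm lam (\<lambda>x. lam * indicator ?B x)"
  using lam BD epsl_sq[OF lam] mB by (auto simp: adm_def split: split_indicator)
 note B = _ BD Bpos
 have sB: "?B \<in> sets borel" by simp
 have g: "(1/(2*pi)) * ln (1 / 2 / (2 * ?e)) \<le> Gq (unif ?B) (unif ?B)" unfolding Gq_def
 proof (rule integral_mult_unif_ge[OF sB BD Bpos integrable_Gop_mult[OF bdens_unif[OF sB BD] bdens_unif[OF sB BD]]], intro AE_I2 impI)
  fix x assume x: "x \<in> ?B"
  show "(1/(2*pi)) * ln (1 / 2 / (2 * ?e)) \<le> Gop (unif ?B) x"
  proof (rule Gop_unif_ge[OF sB BD Bpos])
   show "x \<in> D" using x BD by auto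
   fix y assume y: "y \<in> ?B" "y \<noteq> 0" "y \<noteq> x"
   have "(1/(2*pi)) * ln ((1 - norm (0::pt)) / 2 / (2 * ?e)) \<le> Gfun x y"
    by (rule Gfun_ge_ball[OF _ e0 _ x y]) (use e in \<open>auto simp: D_iff\<close>)
   then show "(1/(2*pi)) * ln (1 / 2 / (2 * ?e)) \<le> Gfun x y" by simp
  qed
 qed
 have l: "ln (1 / 2 / (2 * ?e)) = - ln ?e - ln 4"
 proof -
  have "1 / 2 / (2 * ?e) = 1 / (4 * ?e)" by simp
  then show ?thesis using e0 by (simp add: ln_div ln_mult)
 qed
 have "0 \<le> Om/2 * (LBINT x. (norm x)^2 * (lam * indicator ?B x))"
  using Om adm_integral_norm2_le(1)[OF ad] by simp
 then have "1/2 * ((1/(2*pi)) * (- ln ?e - ln 4)) \<le> Efun Om (\<lambda>x. lam * indicator ?B x)"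
  using g[unfolded l u] unfolding Efun_eq[OF adm_bdens[OF ad]] by linarith
 then show "(1/(4*pi)) * (- ln ?e - ln 4) \<le> Efun Om (\<lambda>x. lam * indicator ?B x)" by simp
qed

text \<open>With t = |x0 - y| one has |x - y| <= t + 2 epsl, and ln(1 + 2 epsl/t) is at most 2
  epsl/t for t < epsl and at most 2 otherwise. By \<open>near_mass_bound\<close> this costs 2 * 14 +
  2 = 30.\<close>

lemma Jf_shift:
 assumes v: "adm lam v" and lam: "0 < lam" and x: "norm (x - x0) < 2 * epsl lam"
 shows "Jf (epsl lam) v x0 - 30 \<le> Jf (epsl lam) v x"
proof -
 let ?e = "epsl lam"
 have e: "0 < ?e" using epsl_pos[OF lam] .
 let ?b = "\<lambda>y. ?e / norm (x0 - y) * indicator (ball x0 ?e) y * v y"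
 note ib = near_mass_bound[OF v lam, of x0] and iv = adm_integral_const(2)[OF v, of 2]
 have "(LBINT y. ln (?e / norm (x0 - y)) * v y - 2 * ?b y - 2 * v y) \<le> Jf ?e v x"
  unfolding Jf_eq(1)[OF v e]
 proof (rule integral_mono_AE[OF _ Jf_eq(2)[OF v e]])
  show "integrable lborel (\<lambda>y. ln (?e / norm (x0 - y)) * v y - 2 * ?b y - 2 * v y)"
   by (intro Bochner_Integration.integrable_diff integrable_mult_right Jf_eq(2)[OF v e] ib(1) iv)
  show "AE y in lborel. ln (?e / norm (x0 - y)) * v y - 2 * ?b y - 2 * v y \<le> ln (?e / norm (x - y)) * v y"
   using AE_lborel_neq[of x0] AE_lborel_neq[of x]
  proof eventually_elim
   case (elim y)
   define t where "t = norm (x0 - y)"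
   have t: "0 < t" and s: "0 < norm (x - y)" using elim by (auto simp: t_def)
   have "norm (x - y) \<le> t + 2 * ?e" using norm_triangle_ineq[of "x - x0" "x0 - y"] x by (simp add: t_def)
   then have "ln (norm (x - y)) \<le> ln (t + 2 * ?e)" using s by (intro ln_mono) auto
   also have "t + 2 * ?e = t * (1 + 2 * ?e / t)" using t by (simp add: field_simps)
   also have "ln (t * (1 + 2 * ?e / t)) = ln t + ln (1 + 2 * ?e / t)" using t e by (intro ln_mult_pos) (auto intro: add_pos_nonneg)
   also have "ln (1 + 2 * ?e / t) \<le> 2 * (?e / t * indicator (ball x0 ?e) y) + 2"
   proof (cases "y \<in> ball x0 ?e")
    case True
    have "ln (1 + 2 * ?e / t) \<le> 2 * ?e / t" using e t by (intro ln_add_one_self_le_self) auto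
    then show ?thesis using True by simp
   next
    case False
    then have "?e \<le> t" by (simp add: t_def dist_norm)
    then have "1 + 2 * ?e / t \<le> 3" using t by (simp add: divide_le_eq)
    then have "ln (1 + 2 * ?e / t) \<le> ln 3" using e t by (intro ln_mono) (auto intro: add_pos_nonneg)
    also have "ln 3 \<le> (2::real)" using ln_le_minus_one[of 3] by simp
    finally show ?thesis using False by simp
   qed
   finally have "ln (?e / t) - 2 * (?e / t * indicator (ball x0 ?e) y) - 2 \<le> ln (?e / norm (x - y))"
    using e t s by (simp add: ln_div)
   then have "(ln (?e / t) - 2 * (?e / t * indicator (ball x0 ?e) y) - 2) * v y \<le> ln (?e / norm (x - y)) * v y"
    using v by (intro mult_right_mono) (auto simp: adm_def)
   then show ?case unfolding t_def by (simp add: algebra_simps)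
  qed
 qed
 moreover have "(LBINT y. ln (?e / norm (x0 - y)) * v y - 2 * ?b y - 2 * v y) = Jf ?e v x0 - 2 * (LBINT y. ?b y) - 2"
 proof -
  note f = Jf_eq(2)[OF v e, of x0] and b2 = integrable_mult_right[OF ib(1), of 2]
  have "(LBINT y. ln (?e / norm (x0 - y)) * v y - 2 * ?b y - 2 * v y) = (LBINT y. ln (?e / norm (x0 - y)) * v y) - 2 * (LBINT y. ?b y) - (LBINT y. 2 * v y)"
   by (simp only: Bochner_Integration.integral_diff[OF Bochner_Integration.integrable_diff[OF f b2] iv] Bochner_Integration.integral_diff[OF f b2] integral_mult_right_zero)
  then show ?thesis unfolding adm_integral_const(1)[OF v] Jf_eq(1)[OF v e] .
 qed
 ultimately show ?thesis using ib(2) by linarith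
qed

text \<open>A high point exists, psi stays high on the ball of radius 2 epsl around it, and that
  ball is too large to fit into the patch. A point of the ball outside the patch shows that
  \<open>\<mu>\<close> is high, hence so is psi on the whole patch. Two balls each holding more than
  half of the mass must meet, which bounds the diameter.\<close>

lemma concentration:
 assumes Om: "0 < Om"
 obtains R c e0 where "1 < R" "0 < c" "c < 1" "0 < e0"
  "\<And>lam v \<mu>. 0 < lam ==> epsl lam < e0 ==> amax Om lam v ==> (AE x in lborel. v x = lam * indicator (Aset Om v \<mu>) x) ==>
    (\<forall>x\<in>Aset Om v \<mu>. \<forall>y\<in>Aset Om v \<mu>. dist x y \<le> R * epsl lam) \<and> (\<forall>x\<in>Aset Om v \<mu>. norm x \<le> 1 - c)"
proof -
 \<comment> \<open>ln 4 / (2 pi) is lost in the self-energy of the competitor and Om/2 in the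
   rotation term; the 1 makes the contradiction strict.\<close>
 define Cb where "Cb = (1/(2*pi)) * ln 4 + Om/2 + 1"
 have Cb: "0 \<le> Cb" using Om unfolding Cb_def by simp
 obtain R1 c1 e1 where 1: "1 < R1" "0 < c1" "c1 < 1" "0 < e1" and high1:
  "\<And>lam v x. 0 < lam ==> epsl lam < e1 ==> adm lam v ==> x \<in> D ==> - (1/(2*pi)) * ln (epsl lam) - Cb \<le> psi0 Om v x ==>
    1/2 < massin v x (R1 * epsl lam) \<and> norm x \<le> 1 - c1 \<and> - (2*pi) * (Cb + (1/(4*pi)) * ln 4 + Om/2) \<le> Jf (epsl lam) v x"
  using high_point_concentrated[OF Om Cb] by blast
 define J0 where "J0 = 2*pi * (Cb + (1/(4*pi)) * ln 4 + Om/2) + 30"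
 have J0: "0 \<le> J0" unfolding J0_def using Cb Om by simp
 \<comment> \<open>Admissible deficit of psi on the whole ball around the high point.
   \<open>high_point_concentrated\<close> is applied again with this larger loss, now for the points
   of the patch.\<close>
 define Cd where "Cd = (1/(2*pi)) * J0 + \<bar>(1/(2*pi)) * ln (c1/2)\<bar>"
 have Cd: "0 \<le> Cd" unfolding Cd_def using J0 by simp
 obtain R2 c2 e2 where 2: "1 < R2" "0 < c2" "c2 < 1" "0 < e2" and high2:
  "\<And>lam v x. 0 < lam ==> epsl lam < e2 ==> adm lam v ==> x \<in> D ==> - (1/(2*pi)) * ln (epsl lam) - Cd \<le> psi0 Om v x ==>
    1/2 < massin v x (R2 * epsl lam) \<and> norm x \<le> 1 - c2 \<and> - (2*pi) * (Cd + (1/(4*pi)) * ln 4 + Om/2) \<le> Jf (epsl lam) v x"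
  using high_point_concentrated[OF Om Cd] by blast
 define e0 where "e0 = min (min e1 e2) (min (1/2) (c1/4))"
 have e0: "0 < e0" using 1 2 by (simp add: e0_def)
 show thesis
 proof (rule that[of "2 * R2" c2 e0])
  show "1 < 2 * R2" using 2 by simp
  show "0 < c2" "c2 < 1" "0 < e0" using 2 e0 by auto
  fix lam v \<mu> assume lam: "0 < lam" and el: "epsl lam < e0" and v: "amax Om lam v" and pf: "AE x in lborel. v x = lam * indicator (Aset Om v \<mu>) x"
  define e where "e = epsl lam"
  have e: "0 < e" "e < e1" "e < e2" "e \<le> 1/2" "4 * e < c1" using epsl_pos[OF lam] el by (auto simp: e_def e0_def)
  have va: "adm lam v" using v by (simp add: amax_def)
  note vb = adm_bdens[OF va]
  let ?A = "Aset Om v \<mu>"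
  have Am: "?A \<in> sets borel" unfolding Aset_def using measurable_psi0[OF vb, of Om] by measurable
  have AD: "?A \<subseteq> D" by (auto simp: Aset_def)
  define L where "L = - (1/(2*pi)) * ln e"
  \<comment> \<open>The energy of the concentrated competitor forces \<open>psi\<close> to be large somewhere.\<close>
  have "\<exists>x0\<in>D. L - Cb \<le> psi0 Om v x0"
  proof (rule ccontr)
   assume "\<not> ?thesis"
   then have lt: "psi0 Om v x \<le> L - Cb" if "x \<in> D" for x using that by force
   have "(LBINT x. psi0 Om v x * v x) \<le> (LBINT x. (L - Cb) * v x)"
   proof (rule integral_mono[OF integrable_psi0_mult[OF vb vb] adm_integral_const(2)[OF va]])
    fix x show "psi0 Om v x * v x \<le> (L - Cb) * v x"
     using lt[of x] va bdens_D[OF vb, of x] by (cases "x \<in> D") (auto simp: adm_def intro!: mult_right_mono)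
   qed
   then have up: "(LBINT x. psi0 Om v x * v x) \<le> L - Cb" unfolding adm_integral_const(1)[OF va] .
   have "(LBINT x. psi0 Om v x * v x) = Gq v v + Om/2 * (LBINT x. (norm x)^2 * v x)"
   proof -
    have "(LBINT x. psi0 Om v x * v x) = (LBINT x. Gop v x * v x + Om/2 * ((norm x)^2 * v x))"
     by (simp add: psi0_def algebra_simps)
    then show ?thesis using integrable_Gop_mult[OF vb vb] integrable_norm2_mult[OF vb] by (simp add: Gq_def)
   qed
   also have "\<dots> = 2 * Efun Om v - Om/2 * (LBINT x. (norm x)^2 * v x)" unfolding Efun_eq[OF vb] by simp
   finally have eq: "(LBINT x. psi0 Om v x * v x) = 2 * Efun Om v - Om/2 * (LBINT x. (norm x)^2 * v x)" .
   have "Om/2 * (LBINT x. (norm x)^2 * v x) \<le> Om/2 * 1" using Om adm_integral_norm2_le(2)[OF va] by (intro mult_left_mono) auto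
   moreover have "(1/(4*pi)) * (- ln e - ln 4) \<le> Efun Om v"
    using concentrated_competitor_energy[OF lam _ Om] e(4) v unfolding e_def amax_def by force
   then have "2 * ((1/(4*pi)) * (- ln e - ln 4)) \<le> 2 * Efun Om v" by (rule mult_left_mono) simp
   moreover have "2 * ((1/(4*pi)) * (- ln e - ln 4)) = L - (1/(2*pi)) * ln 4" unfolding L_def by (simp add: field_simps)
   ultimately show False using up eq unfolding Cb_def by linarith
  qed
  then obtain x0 where x0: "x0 \<in> D" "L - Cb \<le> psi0 Om v x0" by blast
  have h0: "norm x0 \<le> 1 - c1" "- (2*pi) * (Cb + (1/(4*pi)) * ln 4 + Om/2) \<le> Jf e v x0"
   using high1[OF lam _ va x0(1)] x0(2) e unfolding L_def e_def by auto
  have nb: "norm x \<le> 1 - c1/2" if "x \<in> ball x0 (2 * e)" for x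
  proof -
   have "norm x \<le> norm x0 + norm (x - x0)" using norm_triangle_ineq[of x0 "x - x0"] by simp
   moreover have "norm (x - x0) < 2 * e" using that by (simp add: dist_norm norm_minus_commute)
   ultimately show ?thesis using h0(1) e(5) by linarith
  qed
  have low: "L - Cd \<le> psi0 Om v x" if x: "x \<in> ball x0 (2 * e)" for x
  proof -
   have xD: "x \<in> D" using nb[OF x] 1 by (simp add: D_iff)
   have "norm (x - x0) < 2 * epsl lam" using x by (simp add: dist_norm norm_minus_commute e_def)
   from Jf_shift[OF va lam this] have "- J0 \<le> Jf e v x" using h0(2) unfolding J0_def e_def by simp
   then have "(1/(2*pi)) * (- J0) \<le> (1/(2*pi)) * Jf e v x" by (intro mult_left_mono) auto
   moreover have "hpot v x \<le> - (1/(2*pi)) * ln (c1/2)" using nb[OF x] 1 by (intro hpot_le[OF va]) auto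
   moreover have "0 \<le> Om/2 * (norm x)^2" using Om by simp
   moreover have "psi0 Om v x = (1/(2*pi)) * Jf e v x + L - hpot v x + Om/2 * (norm x)^2"
    unfolding psi0_Jf[OF va xD, of Om e] L_def by (simp add: right_diff_distrib)
   ultimately show ?thesis unfolding Cd_def by linarith
  qed
  have measA: "lam * measure lborel ?A = 1"
  proof -
   have "1 = (LBINT x. v x)" using va by (simp add: adm_def)
   also have "\<dots> = (LBINT x. lam * indicator ?A x)" using pf Am bdens_measurable[OF vb] by (intro integral_cong_AE) auto
   also have "\<dots> = lam * measure lborel ?A" using Am by simp
   finally show ?thesis by simp
  qed
  \<comment> \<open>The ball has area 4 pi epsl^2 = 4/lam, the patch only 1/lam.\<close>
  have "\<not> ball x0 (2 * e) \<subseteq> ?A"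
  proof
   assume "ball x0 (2 * e) \<subseteq> ?A"
   then have "measure lborel (ball x0 (2 * e)) \<le> measure lborel ?A"
    using Am by (intro measure_mono_fmeasurable fmeasurable_subset_D[OF Am AD]) auto
   then have "lam * (pi * (2 * e)^2) \<le> 1" using lam measA e(1) mult_left_mono[of "measure lborel (ball x0 (2 * e))" "measure lborel ?A" lam] by (simp add: measure_ball_pt)
   then show False using epsl_sq[OF lam] unfolding e_def by (simp add: power_mult_distrib)
  qed
  then obtain x1 where x1: "x1 \<in> ball x0 (2 * e)" "x1 \<notin> ?A" by blast
  have "x1 \<in> D" using nb[OF x1(1)] 1 by (simp add: D_iff)
  then have "psi0 Om v x1 \<le> \<mu>" using x1(2) by (simp add: Aset_def)
  then have \<mu>: "L - Cd \<le> \<mu>" using low[OF x1(1)] by linarith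
  have inA: "1/2 < massin v x (R2 * e) \<and> norm x \<le> 1 - c2" if "x \<in> ?A" for x
  proof -
   have "x \<in> D" "\<mu> < psi0 Om v x" using that by (auto simp: Aset_def)
   then show ?thesis using high2[OF lam _ va, of x] e \<mu> unfolding L_def e_def by auto
  qed
  have "dist x y \<le> 2 * R2 * e" if x: "x \<in> ?A" and y: "y \<in> ?A" for x y
  proof (rule ccontr)
   assume "\<not> ?thesis"
   then have far: "2 * R2 * e < dist x y" by simp
   have disj: "indicator (ball x (R2 * e)) z + indicator (ball y (R2 * e)) z \<le> (1::real)" for z
   proof (rule ccontr)
    assume "\<not> ?thesis"
    then have "dist x z < R2 * e" "dist y z < R2 * e" by (auto split: split_indicator_asm)
    then show False using far dist_triangle[of x y z] by (simp add: dist_commute)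
   qed
   have "massin v x (R2 * e) + massin v y (R2 * e) = (LBINT z. indicator (ball x (R2 * e)) z * v z + indicator (ball y (R2 * e)) z * v z)"
    unfolding massin_def using integrable_massin[OF va] by simp
   also have "\<dots> \<le> (LBINT z. 1 * v z)"
   proof (rule integral_mono[OF _ adm_integral_const(2)[OF va]])
    show "integrable lborel (\<lambda>z. indicator (ball x (R2 * e)) z * v z + indicator (ball y (R2 * e)) z * v z)" using integrable_massin[OF va] by simp
    fix z
    have "(indicator (ball x (R2 * e)) z + indicator (ball y (R2 * e)) z) * v z \<le> 1 * v z" using disj va by (intro mult_right_mono) (auto simp: adm_def)
    then show "indicator (ball x (R2 * e)) z * v z + indicator (ball y (R2 * e)) z * v z \<le> 1 * v z" by (simp add: distrib_right)
   qed
   also have "\<dots> = 1" by (rule adm_integral_const(1)[OF va])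
   finally show False using inA[OF x] inA[OF y] by linarith
  qed
  then show "(\<forall>x\<in>?A. \<forall>y\<in>?A. dist x y \<le> 2 * R2 * epsl lam) \<and> (\<forall>x\<in>?A. norm x \<le> 1 - c2)" using inA unfolding e_def by blast
 qed
qed

section \<open>Blow-up\<close>

text \<open>The inverse of the blow-up: a profile of height 1 and mass pi becomes a density of
  height \<open>lam\<close> and mass 1 at scale \<open>epsl lam\<close> around
  \<open>X\<close>.\<close>

definition place :: "real => pt => (pt => real) => pt => real" where
 "place lam X f x = lam * f ((1 / epsl lam) *\<^sub>R (x - X))"

text \<open>Energy of the regular part of the Green function; for a unit mass concentrating at a
  point it tends to \<open>hreg\<close> on the diagonal, twice the Robin function.\<close>

definition Hq :: "(pt => real) => real" where
 "Hq u = (LBINT x. hpot u x * u x)"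

lemma place_at: "0 < lam ==> place lam X f (X + epsl lam *\<^sub>R y) = lam * f y"
 using epsl_pos[of lam] by (simp add: place_def)

lemma measurable_place: "f \<in> borel_measurable borel ==> place lam X f \<in> borel_measurable borel"
proof -
 assume f: "f \<in> borel_measurable borel"
 have "(\<lambda>x. (1 / epsl lam) *\<^sub>R (x - X)) \<in> borel_measurable borel" by measurable
 from measurable_compose[OF this f] show ?thesis unfolding place_def[abs_def] by simp
qed

lemma integral_place_scaleR:
 fixes g :: "pt => 'a::{banach, second_countable_topology}"
 assumes lam: "0 < lam"
 shows "(LBINT x. place lam X f x *\<^sub>R g x) = (1/pi) *\<^sub>R (LBINT y. f y *\<^sub>R g (X + epsl lam *\<^sub>R y))"
proof -
 have e: "epsl lam \<noteq> 0" using epsl_pos[OF lam] by simp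
 have "(LBINT x. place lam X f x *\<^sub>R g x) = (epsl lam)^2 *\<^sub>R (LBINT y. (lam * f y) *\<^sub>R g (X + epsl lam *\<^sub>R y))"
  by (subst integral_lborel_affine[OF e, of _ X]) (simp only: place_at[OF lam])
 also have "(LBINT y. (lam * f y) *\<^sub>R g (X + epsl lam *\<^sub>R y)) = lam *\<^sub>R (LBINT y. f y *\<^sub>R g (X + epsl lam *\<^sub>R y))"
  by (simp flip: scaleR_scaleR)
 also have "(epsl lam)^2 *\<^sub>R lam *\<^sub>R (LBINT y. f y *\<^sub>R g (X + epsl lam *\<^sub>R y)) = (1/pi) *\<^sub>R (LBINT y. f y *\<^sub>R g (X + epsl lam *\<^sub>R y))"
 proof -
  have "(epsl lam)^2 * lam = 1 / pi" using epsl_sq[OF lam] by (simp add: field_simps)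
  then show ?thesis by simp
 qed
 finally show ?thesis .
qed

lemma integral_place:
 fixes g :: "pt => real"
 assumes lam: "0 < lam"
 shows "(LBINT x. g x * place lam X f x) = (1/pi) * (LBINT y. g (X + epsl lam *\<^sub>R y) * f y)"
 using integral_place_scaleR[OF lam, of X f g] by (simp add: mult.commute)

lemma place_zero:
 assumes lam: "0 < lam" and f: "planar R f" and x: "x \<notin> ball X (R * epsl lam)"
 shows "place lam X f x = 0"
proof -
 have e: "0 < epsl lam" using epsl_pos[OF lam] .
 have "R * epsl lam \<le> norm (x - X)" using x by (simp add: dist_norm norm_minus_commute)
 then have "R \<le> norm ((1 / epsl lam) *\<^sub>R (x - X))" unfolding norm_scaleR using e by (simp add: pos_le_divide_eq)
 then have "(1 / epsl lam) *\<^sub>R (x - X) \<notin> ball 0 R" by simp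
 then show ?thesis using f by (simp add: planar_def place_def)
qed

lemma adm_place:
 assumes lam: "0 < lam" and f: "planar R f" and X: "norm X + R * epsl lam \<le> 1"
 shows "adm lam (place lam X f)"
proof -
 have fm: "f \<in> borel_measurable borel" and f1: "(LBINT x. f x) = pi" and f01: "\<And>x. 0 \<le> f x \<and> f x \<le> 1"
  using f by (auto simp: planar_def)
 have "place lam X f x = 0" if "x \<notin> D" for x
 proof (rule place_zero[OF lam f])
  show "x \<notin> ball X (R * epsl lam)"
  proof
   assume "x \<in> ball X (R * epsl lam)"
   then have "norm (x - X) < R * epsl lam" by (simp add: dist_norm norm_minus_commute)
   then have "norm x < 1" using norm_triangle_ineq[of "x - X" X] X by simp
   then show False using that by (simp add: D_iff)
  qed
 qed
 moreover have "(LBINT x. place lam X f x) = 1"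
  using integral_place[OF lam, of "\<lambda>_. 1" X f] f1 by simp
 moreover have "0 \<le> place lam X f x \<and> place lam X f x \<le> lam" for x
  using f01 lam by (simp add: place_def mult_left_le)
 ultimately show ?thesis using measurable_place[OF fm] by (simp add: adm_def)
qed

lemma lpot_place:
 assumes lam: "0 < lam" and f: "planar R f"
 shows "lpot (place lam X f) (X + epsl lam *\<^sub>R y) = ln (epsl lam) + (1/pi) * lpot f y"
proof -
 have e: "0 < epsl lam" using epsl_pos[OF lam] .
 note fb = planar_bdens[OF f]
 have [measurable]: "f \<in> borel_measurable borel" by (rule bdens_measurable[OF fb])
 have "lpot (place lam X f) (X + epsl lam *\<^sub>R y) = (1/pi) * (LBINT z. ln (norm (X + epsl lam *\<^sub>R y - (X + epsl lam *\<^sub>R z))) * f z)"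
  unfolding lpot_def by (rule integral_place[OF lam])
 also have "(LBINT z. ln (norm (X + epsl lam *\<^sub>R y - (X + epsl lam *\<^sub>R z))) * f z) = (LBINT z. ln (epsl lam) * f z + ln (norm (y - z)) * f z)"
 proof (rule integral_cong_AE)
  show "AE z in lborel. ln (norm (X + epsl lam *\<^sub>R y - (X + epsl lam *\<^sub>R z))) * f z = ln (epsl lam) * f z + ln (norm (y - z)) * f z"
   using AE_lborel_neq[of y]
  proof eventually_elim
   case (elim z)
   have "X + epsl lam *\<^sub>R y - (X + epsl lam *\<^sub>R z) = epsl lam *\<^sub>R (y - z)" by (simp add: scaleR_diff_right)
   then have "norm (X + epsl lam *\<^sub>R y - (X + epsl lam *\<^sub>R z)) = epsl lam * norm (y - z)" using e by simp
   then show ?case using e elim by (simp add: ln_mult distrib_right)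
  qed
 qed measurable
 also have "\<dots> = ln (epsl lam) * pi + lpot f y"
  using integrable_bdens[OF fb] integrable_lpot[OF fb] f by (simp add: lpot_def planar_def)
 finally show ?thesis by (simp add: field_simps)
qed

lemma lgrad_place:
 assumes lam: "0 < lam"
 shows "lgrad (place lam X f) (X + epsl lam *\<^sub>R y) = (1 / (pi * epsl lam)) *\<^sub>R lgrad f y"
proof -
 have e: "0 < epsl lam" using epsl_pos[OF lam] .
 let ?e = "epsl lam"
 have "lgrad (place lam X f) (X + ?e *\<^sub>R y) = (1/pi) *\<^sub>R (LBINT z. f z *\<^sub>R ((1 / (norm (X + ?e *\<^sub>R y - (X + ?e *\<^sub>R z)))^2) *\<^sub>R (X + ?e *\<^sub>R y - (X + ?e *\<^sub>R z))))"
  unfolding lgrad_def by (rule integral_place_scaleR[OF lam])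
 also have "(\<lambda>z. f z *\<^sub>R ((1 / (norm (X + ?e *\<^sub>R y - (X + ?e *\<^sub>R z)))^2) *\<^sub>R (X + ?e *\<^sub>R y - (X + ?e *\<^sub>R z)))) = (\<lambda>z. (1 / ?e) *\<^sub>R (f z *\<^sub>R ((1 / (norm (y - z))^2) *\<^sub>R (y - z))))"
 proof
  fix z
  have d: "X + ?e *\<^sub>R y - (X + ?e *\<^sub>R z) = ?e *\<^sub>R (y - z)" by (simp add: scaleR_diff_right)
  have n: "norm (X + ?e *\<^sub>R y - (X + ?e *\<^sub>R z)) = ?e * norm (y - z)" unfolding d using e by simp
  show "f z *\<^sub>R ((1 / (norm (X + ?e *\<^sub>R y - (X + ?e *\<^sub>R z)))^2) *\<^sub>R (X + ?e *\<^sub>R y - (X + ?e *\<^sub>R z))) = (1 / ?e) *\<^sub>R (f z *\<^sub>R ((1 / (norm (y - z))^2) *\<^sub>R (y - z)))"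
   unfolding n unfolding d using e by (simp add: power2_eq_square)
 qed
 finally have "lgrad (place lam X f) (X + ?e *\<^sub>R y) = (1/pi) *\<^sub>R ((1 / ?e) *\<^sub>R lgrad f y)"
  unfolding lgrad_def integral_scaleR_right .
 then show ?thesis by simp
qed

lemma Gq_self:
 assumes u: "adm lam u"
 shows "Gq u u = - (1/(2*pi)) * (LBINT x. lpot u x * u x) - Hq u"
  and integrable_Hq: "integrable lborel (\<lambda>x. hpot u x * u x)"
proof -
 note ub = adm_bdens[OF u]
 have eq: "Gop u x * u x = - (1/(2*pi)) * (lpot u x * u x) - hpot u x * u x" for x
 proof (cases "x \<in> D")
  case True
  show ?thesis unfolding Gop_eq[OF ub True] by (simp add: left_diff_distrib)
 qed (simp add: bdens_D[OF ub])
 have i1: "integrable lborel (\<lambda>x. - (1/(2*pi)) * (lpot u x * u x))" by (intro integrable_mult_right integrable_lpot_mult[OF ub ub])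
 have "(\<lambda>x. hpot u x * u x) = (\<lambda>x. - (1/(2*pi)) * (lpot u x * u x) - Gop u x * u x)" using eq by (simp add: fun_eq_iff)
 then show i2: "integrable lborel (\<lambda>x. hpot u x * u x)"
  using Bochner_Integration.integrable_diff[OF i1 integrable_Gop_mult[OF ub ub]] by simp
 have "Gq u u = (LBINT x. - (1/(2*pi)) * (lpot u x * u x)) - (LBINT x. hpot u x * u x)"
  unfolding Gq_def eq by (rule Bochner_Integration.integral_diff[OF i1 i2])
 then show "Gq u u = - (1/(2*pi)) * (LBINT x. lpot u x * u x) - Hq u"
  by (simp only: integral_mult_right_zero Hq_def)
qed

text \<open>The first two terms do not depend on the position \<open>X\<close>, and the limits of
  the last two depend on the position alone. The factor 1/(4 pi^3) is 1/2 times 1/(2 pi) from the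
  Green energy and 1/pi^2 from normalizing the mass twice.\<close>

lemma Efun_place:
 assumes lam: "0 < lam" and f: "planar R f" and X: "norm X + R * epsl lam \<le> 1"
 shows "Efun Om (place lam X f) = - (1/(4*pi)) * ln (epsl lam) - (1/(4*pi^3)) * Lq f f
   - 1/2 * Hq (place lam X f) + Om/2 * (LBINT x. (norm x)^2 * place lam X f x)"
proof -
 note u = adm_place[OF lam f X] and fb = planar_bdens[OF f]
 have "(LBINT x. lpot (place lam X f) x * place lam X f x) = (1/pi) * (LBINT y. lpot (place lam X f) (X + epsl lam *\<^sub>R y) * f y)"
  by (rule integral_place[OF lam])
 also have "(LBINT y. lpot (place lam X f) (X + epsl lam *\<^sub>R y) * f y) = (LBINT y. ln (epsl lam) * f y + (1/pi) * (lpot f y * f y))"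
  unfolding lpot_place[OF lam f] by (simp add: algebra_simps)
 also have "\<dots> = ln (epsl lam) * pi + (1/pi) * Lq f f"
  using integrable_bdens[OF fb] integrable_lpot_mult[OF fb fb] f by (simp add: Lq_def planar_def)
 finally have l: "(LBINT x. lpot (place lam X f) x * place lam X f x) = ln (epsl lam) + (1/pi^2) * Lq f f"
  by (simp add: field_simps power2_eq_square)
 show ?thesis unfolding Efun_eq[OF adm_bdens[OF u]] Gq_self(1)[OF u] l
  by (simp add: field_simps power2_eq_square power3_eq_cube)
qed

lemma hreg_isCont:
 assumes "x \<in> D" shows "isCont (\<lambda>p. hreg (fst p) (snd p)) (x, x)"
 unfolding hreg_def Nker_def
 using Nker_pos[OF assms assms, unfolded Nker_def] by (intro continuous_intros) auto

text \<open>A unit mass concentrated near \<open>X\<close> averages a continuous function to nearly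
  its value at \<open>X\<close>, with the same radius for all such densities.\<close>

lemma place_energy_close:
 assumes X: "X \<in> D" and \<delta>: "0 < \<delta>"
 obtains \<rho> where "0 < \<rho>" "\<And>lam u. adm lam u ==> (\<And>x. x \<notin> ball X \<rho> ==> u x = 0) ==>
  \<bar>Hq u - hreg X X\<bar> \<le> \<delta> \<and> \<bar>(LBINT x. (norm x)^2 * u x) - (norm X)^2\<bar> \<le> \<delta>"
proof -
 obtain r1 where r1: "0 < r1" "\<And>p. dist p (X, X) < r1 ==> \<bar>hreg (fst p) (snd p) - hreg X X\<bar> < \<delta>"
  using hreg_isCont[OF X] \<delta> unfolding continuous_at_eps_delta dist_real_def by (metis fst_conv snd_conv)
 have "isCont (\<lambda>x::pt. (norm x)^2) X" by (intro continuous_intros)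
 then obtain r2 where r2: "0 < r2" "\<And>x. dist x X < r2 ==> \<bar>(norm x)^2 - (norm X)^2\<bar> < \<delta>"
  using \<delta> unfolding continuous_at_eps_delta dist_real_def by metis
 define \<rho> where "\<rho> = min (min (r1/2) r2) (1 - norm X)"
 have \<rho>: "0 < \<rho>" "\<rho> \<le> r1/2" "\<rho> \<le> r2" "\<rho> \<le> 1 - norm X" using r1(1) r2(1) X unfolding \<rho>_def
  by (simp_all add: D_iff min_def)
 have bD: "x \<in> D" if "x \<in> ball X \<rho>" for x
 proof -
  have "norm x \<le> norm X + norm (x - X)" using norm_triangle_ineq[of X "x - X"] by simp
  then show ?thesis using that \<rho>(4) by (simp add: D_iff dist_norm norm_minus_commute)
 qed
 have hb: "\<bar>hreg x y - hreg X X\<bar> \<le> \<delta>" if "x \<in> ball X \<rho>" "y \<in> ball X \<rho>" for x y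
 proof -
  have "dist (x, y) (X, X) \<le> dist x X + dist y X" by (simp add: dist_Pair_Pair sqrt_sum_squares_le_sum)
  also have "\<dots> < r1" using that \<rho>(2) by (simp add: dist_commute)
  finally show ?thesis using r1(2)[of "(x, y)"] by simp
 qed
 show thesis
 proof (rule that[OF \<rho>(1)])
  fix lam u assume u: "adm lam u" and u0: "\<And>x. x \<notin> ball X \<rho> ==> u x = 0"
  note ub = adm_bdens[OF u]
  have unn: "0 \<le> u x" for x using u by (simp add: adm_def)
  have avg: "\<bar>(LBINT x. g x * u x) - a\<bar> \<le> \<delta>" if gi: "integrable lborel (\<lambda>x. g x * u x)" and g: "\<And>x. x \<in> ball X \<rho> ==> \<bar>g x - a\<bar> \<le> \<delta>" for g a
  proof -
   have "(LBINT x. g x * u x) \<le> (LBINT x. (a + \<delta>) * u x)"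
   proof (rule integral_mono[OF gi adm_integral_const(2)[OF u]])
    fix x show "g x * u x \<le> (a + \<delta>) * u x"
     using g[of x] u0[of x] unn[of x] by (cases "x \<in> ball X \<rho>") (auto simp: abs_le_iff intro!: mult_right_mono)
   qed
   moreover have "(LBINT x. (a - \<delta>) * u x) \<le> (LBINT x. g x * u x)"
   proof (rule integral_mono[OF adm_integral_const(2)[OF u] gi])
    fix x show "(a - \<delta>) * u x \<le> g x * u x"
     using g[of x] u0[of x] unn[of x] by (cases "x \<in> ball X \<rho>") (auto simp: abs_le_iff intro!: mult_right_mono)
   qed
   ultimately show ?thesis unfolding adm_integral_const(1)[OF u] by (simp add: abs_le_iff)
  qed
  have "\<bar>hpot u x - hreg X X\<bar> \<le> \<delta>" if "x \<in> ball X \<rho>" for x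
   unfolding hpot_def by (rule avg[OF integrable_hpot[OF ub bD[OF that]]]) (rule hb[OF that])
  then have "\<bar>Hq u - hreg X X\<bar> \<le> \<delta>" unfolding Hq_def by (intro avg[OF integrable_Hq[OF u]])
  moreover have "\<bar>(LBINT x. (norm x)^2 * u x) - (norm X)^2\<bar> \<le> \<delta>"
  proof (rule avg[OF integrable_norm2_mult[OF ub]])
   fix x assume "x \<in> ball X \<rho>"
   then have "dist x X < r2" using \<rho>(3) by (simp add: dist_commute)
   from r2(2)[OF this] show "\<bar>(norm x)^2 - (norm X)^2\<bar> \<le> \<delta>" by simp
  qed
  ultimately show "\<bar>Hq u - hreg X X\<bar> \<le> \<delta> \<and> \<bar>(LBINT x. (norm x)^2 * u x) - (norm X)^2\<bar> \<le> \<delta>" ..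
 qed
qed

lemma epsl_at_top: "(epsl \<longlongrightarrow> 0) at_top"
 unfolding epsl_def by real_asymp

lemma epsl_tendsto: "filterlim l at_top sequentially ==> (\<lambda>n. epsl (l n)) \<longlonglongrightarrow> 0"
 using epsl_at_top by (rule filterlim_compose)

lemma place_limits:
 assumes l: "filterlim l at_top sequentially" "\<And>n. 0 < l n" and Xl: "X \<longlonglongrightarrow> X0" and X0: "X0 \<in> D"
  and f: "\<And>n. planar R (f n)" and R: "0 < R"
 shows "\<forall>\<^sub>F n in sequentially. norm (X n) + R * epsl (l n) \<le> 1"
  and "(\<lambda>n. Hq (place (l n) (X n) (f n))) \<longlonglongrightarrow> hreg X0 X0"
  and "(\<lambda>n. LBINT x. (norm x)^2 * place (l n) (X n) (f n) x) \<longlonglongrightarrow> (norm X0)^2"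
proof -
 have el: "(\<lambda>n. epsl (l n)) \<longlonglongrightarrow> 0" by (rule epsl_tendsto[OF l(1)])
 have "(\<lambda>n. norm (X n) + R * epsl (l n)) \<longlonglongrightarrow> norm X0 + R * 0"
  by (intro tendsto_add tendsto_norm Xl tendsto_mult tendsto_const el)
 then show ev: "\<forall>\<^sub>F n in sequentially. norm (X n) + R * epsl (l n) \<le> 1"
  using X0 order_tendstoD(2)[of "\<lambda>n. norm (X n) + R * epsl (l n)" "norm X0 + R * 0" sequentially 1]
  by (auto simp: D_iff elim: eventually_mono)
 have close: "\<forall>\<^sub>F n in sequentially. \<bar>Hq (place (l n) (X n) (f n)) - hreg X0 X0\<bar> \<le> \<delta> \<and>
   \<bar>(LBINT x. (norm x)^2 * place (l n) (X n) (f n) x) - (norm X0)^2\<bar> \<le> \<delta>" if \<delta>: "0 < \<delta>" for \<delta>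
 proof -
  obtain \<rho> where \<rho>: "0 < \<rho>" "\<And>lam u. adm lam u ==> (\<And>x. x \<notin> ball X0 \<rho> ==> u x = 0) ==>
   \<bar>Hq u - hreg X0 X0\<bar> \<le> \<delta> \<and> \<bar>(LBINT x. (norm x)^2 * u x) - (norm X0)^2\<bar> \<le> \<delta>"
   using place_energy_close[OF X0 \<delta>] by blast
  have "(\<lambda>n. dist (X n) X0 + R * epsl (l n)) \<longlonglongrightarrow> 0 + R * 0"
   by (intro tendsto_add tendsto_mult tendsto_const el tendsto_dist_iff[THEN iffD1, OF Xl])
  then have "\<forall>\<^sub>F n in sequentially. dist (X n) X0 + R * epsl (l n) < \<rho>" using \<rho>(1) by (intro order_tendstoD(2)) auto
  then show ?thesis using ev
  proof eventually_elim
   case (elim n)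
   show ?case
   proof (rule \<rho>(2)[OF adm_place[OF l(2) f elim(2)]])
    fix x assume x: "x \<notin> ball X0 \<rho>"
    show "place (l n) (X n) (f n) x = 0"
    proof (rule place_zero[OF l(2) f])
     show "x \<notin> ball (X n) (R * epsl (l n))"
     proof
      assume "x \<in> ball (X n) (R * epsl (l n))"
      then have "dist X0 x < \<rho>" using elim(1) dist_triangle[of X0 x "X n"] by (simp add: dist_commute)
      then show False using x by simp
     qed
    qed
   qed
  qed
 qed
 show "(\<lambda>n. Hq (place (l n) (X n) (f n))) \<longlonglongrightarrow> hreg X0 X0"
 proof (rule tendstoI)
  fix e :: real assume "0 < e"
  from close[of "e/2"] \<open>0 < e\<close> show "\<forall>\<^sub>F n in sequentially. dist (Hq (place (l n) (X n) (f n))) (hreg X0 X0) < e"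
   by (auto simp: dist_real_def elim!: eventually_mono)
 qed
 show "(\<lambda>n. LBINT x. (norm x)^2 * place (l n) (X n) (f n) x) \<longlonglongrightarrow> (norm X0)^2"
 proof (rule tendstoI)
  fix e :: real assume "0 < e"
  from close[of "e/2"] \<open>0 < e\<close> show "\<forall>\<^sub>F n in sequentially. dist (LBINT x. (norm x)^2 * place (l n) (X n) (f n) x) ((norm X0)^2) < e"
   by (auto simp: dist_real_def elim!: eventually_mono)
 qed
qed

lemma hreg_diag: assumes "x \<in> D" shows "hreg x x = 2 * Robin x"
proof -
 have "0 < 1 - (norm x)^2" using assms by (simp add: D_iff abs_square_less_1)
 moreover have "Nker x x = (1 - (norm x)^2)^2" unfolding Nker_eq by (simp add: power2_eq_square)
 ultimately show ?thesis by (simp add: hreg_def Robin_def ln_realpow)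
qed

text \<open>Translating the rescaled patch keeps its logarithmic self-energy, so only the regular part of the
 Green function and the rotation term compete.\<close>

lemma limit_center_minimizes:
 assumes l: "filterlim l at_top sequentially" "\<And>n. 0 < l n" and Xl: "X \<longlonglongrightarrow> X0" and X0: "X0 \<in> D"
  and f: "\<And>n. planar R (f n)" and R: "0 < R" and v: "\<And>n. amax Om (l n) (place (l n) (X n) (f n))" and x0: "x0 \<in> D"
 shows "Robin X0 - Om/2 * (norm X0)^2 \<le> Robin x0 - Om/2 * (norm x0)^2"
proof -
 note A = place_limits[OF l Xl X0 f R] and B = place_limits[OF l tendsto_const x0 f R]
 have "- 1/2 * hreg x0 x0 + Om/2 * (norm x0)^2 \<le> - 1/2 * hreg X0 X0 + Om/2 * (norm X0)^2"
 proof (rule tendsto_le[OF sequentially_bot])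
  show "(\<lambda>n. - 1/2 * Hq (place (l n) (X n) (f n)) + Om/2 * (LBINT x. (norm x)^2 * place (l n) (X n) (f n) x)) \<longlonglongrightarrow> - 1/2 * hreg X0 X0 + Om/2 * (norm X0)^2"
   by (intro tendsto_add tendsto_mult tendsto_const A(2,3))
  show "(\<lambda>n. - 1/2 * Hq (place (l n) x0 (f n)) + Om/2 * (LBINT x. (norm x)^2 * place (l n) x0 (f n) x)) \<longlonglongrightarrow> - 1/2 * hreg x0 x0 + Om/2 * (norm x0)^2"
   by (intro tendsto_add tendsto_mult tendsto_const B(2,3))
  show "\<forall>\<^sub>F n in sequentially. - 1/2 * Hq (place (l n) x0 (f n)) + Om/2 * (LBINT x. (norm x)^2 * place (l n) x0 (f n) x)
   \<le> - 1/2 * Hq (place (l n) (X n) (f n)) + Om/2 * (LBINT x. (norm x)^2 * place (l n) (X n) (f n) x)"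
   using A(1) B(1)
  proof eventually_elim
   case (elim n)
   have "Efun Om (place (l n) x0 (f n)) \<le> Efun Om (place (l n) (X n) (f n))"
    using v[of n] adm_place[OF l(2) f elim(2)] by (simp add: amax_def)
   then show ?case unfolding Efun_place[OF l(2) f elim(1)] Efun_place[OF l(2) f elim(2)] by linarith
  qed
 qed
 then show ?thesis unfolding hreg_diag[OF X0] hreg_diag[OF x0] by simp
qed

text \<open>Any profile placed at the same centres is a competitor. Its regular and rotation terms
  have the same limits as those of the maximizers, so comparing energies leaves
  \<open>Lq g g\<close> <= \<open>Lq h h\<close>, the logarithmic energy being weak-star continuous.
  The vanishing first moments survive in the limit, which removes the freedom of
  translation.\<close>

lemma weak_limit_is_disc:
 assumes l: "filterlim l at_top sequentially" "\<And>n. 0 < l n" and Xl: "X \<longlonglongrightarrow> X0" and X0: "X0 \<in> D"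
  and f: "\<And>n. planar R (f n)" and R: "1 \<le> R" and v: "\<And>n. amax Om (l n) (place (l n) (X n) (f n))"
  and cen: "\<And>n u. (LBINT x. (x \<bullet> u) * f n x) = 0"
  and g: "g \<in> borel_measurable borel" "\<And>x. 0 \<le> g x" "\<And>x. g x \<le> 1" "\<And>x. x \<notin> ball 0 R ==> g x = 0"
  and conv: "\<And>h. integrable lborel h ==> (\<lambda>n. LBINT x. h x * f n x) \<longlonglongrightarrow> (LBINT x. h x * g x)"
 shows "AE x in lborel. g x = disc x"
proof (rule minimizer_unique[OF _ R])
 have R0: "0 < R" using R by simp
 note fb = planar_bdens[OF f]
 have fR: "a * indicator (ball 0 R) x * f n x = a * f n x" for a n x using bdens_zero[OF fb, of x n] by (auto split: split_indicator)
 have gR: "a * indicator (ball 0 R) x * g x = a * g x" for a x using g(4)[of x] by (auto split: split_indicator)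
 have bi: "bdens 1 R (indicator (ball 0 R))" by (auto simp: bdens_def split: split_indicator)
 have "(\<lambda>n. LBINT x. (1 * indicator (ball 0 R) x) * f n x) \<longlonglongrightarrow> (LBINT x. (1 * indicator (ball 0 R) x) * g x)"
  by (rule conv) (use integrable_indicator_ball[of 0 R] in simp)
 then have "(\<lambda>n. LBINT x. 1 * f n x) \<longlonglongrightarrow> (LBINT x. 1 * g x)" unfolding fR gR .
 moreover have "(LBINT x. 1 * f n x) = pi" for n using f[of n] by (simp add: planar_def)
 ultimately have "(LBINT x. g x) = pi" by (simp add: LIMSEQ_const_iff)
 then show gp: "planar R g" using g by (simp add: planar_def)
 note gb = planar_bdens[OF gp]
 show "(LBINT x. (x \<bullet> u) * g x) = 0" for u
 proof -
  have "(\<lambda>n. LBINT x. ((x \<bullet> u) * indicator (ball 0 R) x) * f n x) \<longlonglongrightarrow> (LBINT x. ((x \<bullet> u) * indicator (ball 0 R) x) * g x)"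
   by (rule conv) (rule integrable_inner_mult[OF bi])
  then have "(\<lambda>n. LBINT x. (x \<bullet> u) * f n x) \<longlonglongrightarrow> (LBINT x. (x \<bullet> u) * g x)" unfolding fR gR .
  then show ?thesis unfolding cen by (simp add: LIMSEQ_const_iff)
 qed
 fix h assume h: "planar R h"
 have Lconv: "(\<lambda>n. Lq (f n) (f n)) \<longlonglongrightarrow> Lq g g"
 proof -
  have "(\<lambda>n. LBINT x. (LBINT y. (\<lambda>(x,y). ln (norm (x - y))) (x,y) * f n y) * f n x) \<longlonglongrightarrow> (LBINT x. (LBINT y. (\<lambda>(x,y). ln (norm (x - y))) (x,y) * g y) * g x)"
  proof (rule weak_star_double_integral[where S="ball 0 R" and L=1])
   show "f n \<in> borel_measurable borel" "\<bar>f n x\<bar> \<le> 1" "x \<notin> ball 0 R ==> f n x = 0" for n x using fb[of n] by (auto simp: bdens_def)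
   show "g \<in> borel_measurable borel" "\<bar>g x\<bar> \<le> 1" "x \<notin> ball 0 R ==> g x = 0" for x using gb by (auto simp: bdens_def)
   have "(\<lambda>(x, y). indicator (ball 0 R) x * indicator (ball 0 R) y * (case (x, y) of (x, y) => ln (norm (x - y)))) = (\<lambda>(x::pt,y). ln (norm (x - y)) * indicator (ball 0 R) y * indicator (ball 0 R) x)"
    by (auto simp: fun_eq_iff)
   then show "integrable (lborel \<Otimes>\<^sub>M lborel) (\<lambda>(x::pt, y). indicator (ball 0 R) x * indicator (ball 0 R) y * (case (x, y) of (x, y) => ln (norm (x - y))))"
    using integrable_ln_pair[OF bi bi] by simp
   show "(\<lambda>(x::pt, y). ln (norm (x - y))) \<in> borel_measurable (lborel \<Otimes>\<^sub>M lborel)" by measurable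
  qed (use conv in auto)
  then show ?thesis by (simp add: Lq_def lpot_def)
 qed
 note A = place_limits[OF l Xl X0 f R0] and B = place_limits[OF l Xl X0 h R0]
 have "- (1/(4*pi^3)) * Lq h h - 1/2 * hreg X0 X0 + Om/2 * (norm X0)^2 \<le> - (1/(4*pi^3)) * Lq g g - 1/2 * hreg X0 X0 + Om/2 * (norm X0)^2"
 proof (rule tendsto_le[OF sequentially_bot])
  show "(\<lambda>n. - (1/(4*pi^3)) * Lq (f n) (f n) - 1/2 * Hq (place (l n) (X n) (f n)) + Om/2 * (LBINT x. (norm x)^2 * place (l n) (X n) (f n) x)) \<longlonglongrightarrow> - (1/(4*pi^3)) * Lq g g - 1/2 * hreg X0 X0 + Om/2 * (norm X0)^2"
   by (intro tendsto_add tendsto_diff tendsto_mult tendsto_const A(2,3) Lconv)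
  show "(\<lambda>n. - (1/(4*pi^3)) * Lq h h - 1/2 * Hq (place (l n) (X n) h) + Om/2 * (LBINT x. (norm x)^2 * place (l n) (X n) h x)) \<longlonglongrightarrow> - (1/(4*pi^3)) * Lq h h - 1/2 * hreg X0 X0 + Om/2 * (norm X0)^2"
   by (intro tendsto_add tendsto_diff tendsto_mult tendsto_const B(2,3))
  show "\<forall>\<^sub>F n in sequentially. - (1/(4*pi^3)) * Lq h h - 1/2 * Hq (place (l n) (X n) h) + Om/2 * (LBINT x. (norm x)^2 * place (l n) (X n) h x)
   \<le> - (1/(4*pi^3)) * Lq (f n) (f n) - 1/2 * Hq (place (l n) (X n) (f n)) + Om/2 * (LBINT x. (norm x)^2 * place (l n) (X n) (f n) x)"
   using A(1)
  proof eventually_elim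
   case (elim n)
   have "Efun Om (place (l n) (X n) h) \<le> Efun Om (place (l n) (X n) (f n))"
    using v[of n] adm_place[OF l(2) h elim] by (simp add: amax_def)
   then show ?case unfolding Efun_place[OF l(2) f elim] Efun_place[OF l(2) h elim] by linarith
  qed
 qed
 then have "(1/(4*pi^3)) * Lq g g \<le> (1/(4*pi^3)) * Lq h h" by simp
 then show "Lq g g \<le> Lq h h" by (simp add: divide_le_cancel)
qed

section \<open>Maximizers as exact patches and their rescaling\<close>

lemma measurable_Aset: assumes "bdens L 1 v" shows "Aset Om v \<mu> \<in> sets borel"
proof -
 have "{x \<in> space borel. x \<in> D \<and> \<mu> < psi0 Om v x} \<in> sets borel"
  using measurable_psi0[OF assms] by measurable
 then show ?thesis by (simp add: Aset_def)
qed

lemma amax_patch_representative: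
 assumes v: "amax Om lam v" and lam: "0 < lam" and AE: "AE x in lborel. v x = lam * indicator (Aset Om v \<mu>) x"
 defines "u \<equiv> (\<lambda>x. lam * indicator (Aset Om v \<mu>) x)"
 shows "amax Om lam u" "psi0 Om u = psi0 Om v" "Aset Om u \<mu> = Aset Om v \<mu>" "(LBINT x. u x *\<^sub>R x) = (LBINT x. v x *\<^sub>R x)"
proof -
 have va: "adm lam v" using v by (simp add: amax_def)
 have [measurable]: "Aset Om v \<mu> \<in> sets borel" by (rule measurable_Aset[OF adm_bdens[OF va]])
 have um [measurable]: "u \<in> borel_measurable borel" unfolding u_def by measurable
 have vm [measurable]: "v \<in> borel_measurable borel" using va by (simp add: adm_def)
 have eq: "AE x in lborel. u x = v x" using AE by (simp add: u_def eq_commute)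
 have "(LBINT x. u x) = (LBINT x. v x)" by (rule integral_cong_AE) (use eq in auto)
 then have ua: "adm lam u" using va lam um by (auto simp: adm_def u_def Aset_def indicator_def)
 have eqD: "AE x in lebesgue_on D. u x = v x" unfolding AE_lebesgue_on_D using eq by eventually_elim simp
 note rep = adm_Kset[OF ua] va eqD
 show "psi0 Om u = psi0 Om v" by (rule representative_psi0[OF rep])
 then show "Aset Om u \<mu> = Aset Om v \<mu>" by (simp add: Aset_def)
 show "amax Om lam u" using v ua representative_Efun[OF rep, of Om] by (simp add: amax_def)
 show "(LBINT x. u x *\<^sub>R x) = (LBINT x. v x *\<^sub>R x)" by (rule integral_cong_AE) (use eq in auto)
qed

lemma adm_average_bound:
 fixes f :: "pt => pt"
 assumes u: "adm lam u" and f: "f \<in> borel_measurable borel" and b: "\<And>y. u y \<noteq> 0 ==> norm (f y) \<le> B"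
 shows "integrable lborel (\<lambda>y. u y *\<^sub>R f y)" "norm (LBINT y. u y *\<^sub>R f y) \<le> B"
proof -
 have um: "u \<in> borel_measurable borel" and u0: "\<And>y. 0 \<le> u y" using u by (auto simp: adm_def)
 have le: "norm (u y *\<^sub>R f y) \<le> B * u y" for y
  using b[of y] u0[of y] by (cases "u y = 0") (simp_all add: mult.commute mult_left_mono)
 show i: "integrable lborel (\<lambda>y. u y *\<^sub>R f y)"
 proof (rule Bochner_Integration.integrable_bound[OF adm_integral_const(2)[OF u, of B]])
  show "(\<lambda>y. u y *\<^sub>R f y) \<in> borel_measurable lborel" using um f by simp
  show "AE y in lborel. norm (u y *\<^sub>R f y) \<le> norm (B * u y)" using le by (intro AE_I2) (metis abs_ge_self order_trans real_norm_def)
 qed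
 have "norm (LBINT y. u y *\<^sub>R f y) \<le> (LBINT y. norm (u y *\<^sub>R f y))" by (rule integral_norm_bound)
 also have "\<dots> \<le> (LBINT y. B * u y)"
  by (rule integral_mono[OF integrable_norm[OF i] adm_integral_const(2)[OF u] le])
 finally show "norm (LBINT y. u y *\<^sub>R f y) \<le> B" by (simp only: adm_integral_const(1)[OF u])
qed

text \<open>For \<open>x\<close> in the patch, x - X is an average of differences of points of the
  patch and hence at most R * epsl. The rescaled patch lies in the closed disk of radius R, and R +
  1 provides an open ball around it. The profile is centred because \<open>X\<close> is the centre
  of mass.\<close>

lemma blowup_planar:
 assumes lam: "0 < lam" and u: "adm lam u" and uA: "\<And>x. u x = lam * indicator A x"
  and diam: "\<And>x y. x \<in> A ==> y \<in> A ==> dist x y \<le> R * epsl lam" and c: "\<And>x. x \<in> A ==> norm x \<le> 1 - c"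
 defines "X \<equiv> (LBINT x. u x *\<^sub>R x)"
 defines "\<eta> \<equiv> (\<lambda>y. indicator A (X + epsl lam *\<^sub>R y))"
 shows "place lam X \<eta> = u" "planar (R + 1) \<eta>" "norm X \<le> 1 - c" "\<And>n. (LBINT y. (y \<bullet> n) * \<eta> y) = 0"
proof -
 let ?e = "epsl lam"
 have e: "0 < ?e" by (rule epsl_pos[OF lam])
 have um: "u \<in> borel_measurable borel" and u1: "(LBINT x. u x) = 1" using u by (auto simp: adm_def)
 have inA: "y \<in> A" if "u y \<noteq> 0" for y using that uA[of y] by (auto split: split_indicator_asm)
 have Xi: "integrable lborel (\<lambda>y. u y *\<^sub>R y)" by (rule adm_average_bound(1)[OF u, of _ "1 - c"]) (use c inA in auto)
 show "norm X \<le> 1 - c" unfolding X_def by (rule adm_average_bound(2)[OF u]) (use c inA in auto)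
 show pu: "place lam X \<eta> = u"
  using e by (simp add: fun_eq_iff place_def \<eta>_def uA)
 have ui: "integrable lborel (\<lambda>y. u y *\<^sub>R x)" for x :: pt
  by (rule adm_average_bound(1)[OF u, of _ "norm x"]) auto
 have AX: "norm (x - X) \<le> R * ?e" if x: "x \<in> A" for x
 proof -
  have "(LBINT y. u y *\<^sub>R (x - y)) = (LBINT y. u y *\<^sub>R x) - (LBINT y. u y *\<^sub>R y)"
   unfolding scaleR_diff_right by (rule Bochner_Integration.integral_diff[OF ui Xi])
  also have "(LBINT y. u y *\<^sub>R x) = x"
   using integral_scaleR_left[where M=lborel and f=u and c=x] adm_integral_const(2)[OF u, of 1] u1 by simp
  finally have "x - X = (LBINT y. u y *\<^sub>R (x - y))" by (simp add: X_def)
  also have "norm \<dots> \<le> R * ?e"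
   by (rule adm_average_bound(2)[OF u]) (use diam[OF x] inA in \<open>auto simp: dist_norm\<close>)
  finally show ?thesis .
 qed
 have \<eta>u: "\<eta> y = (1/lam) * u (X + ?e *\<^sub>R y)" for y using lam by (simp add: \<eta>_def uA)
 have "(\<lambda>y. X + ?e *\<^sub>R y) \<in> borel_measurable borel" by measurable
 from measurable_compose[OF this um] have \<eta>m: "\<eta> \<in> borel_measurable borel" unfolding \<eta>u[abs_def] by simp
 have "(LBINT y. \<eta> y) = pi"
  using integral_place[OF lam, of "\<lambda>_. 1" X \<eta>] u1 unfolding pu by (simp add: field_simps)
 moreover have "\<eta> y = 0" if "y \<notin> ball 0 (R + 1)" for y
 proof (rule ccontr)
  assume "\<eta> y \<noteq> 0"
  then have "X + ?e *\<^sub>R y \<in> A" by (auto simp: \<eta>_def split: split_indicator_asm)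
  from AX[OF this] have "norm y \<le> R" using e by simp
  then show False using that by simp
 qed
 moreover have "0 \<le> \<eta> y \<and> \<eta> y \<le> 1" for y by (simp add: \<eta>_def)
 ultimately show "planar (R + 1) \<eta>" using \<eta>m by (simp add: planar_def)
 show "(LBINT y. (y \<bullet> n) * \<eta> y) = 0" for n
 proof -
  have i: "integrable lborel (\<lambda>x. (x \<bullet> n) * u x)" using integrable_inner_left[OF Xi, of n] by (simp add: mult.commute)
  have "(LBINT x. ((x - X) \<bullet> n) * u x) = (LBINT x. (x \<bullet> n) * u x) - (LBINT x. (X \<bullet> n) * u x)"
   unfolding inner_diff_left left_diff_distrib by (rule Bochner_Integration.integral_diff[OF i adm_integral_const(2)[OF u]])
  also have "\<dots> = (LBINT x. (x \<bullet> n) * u x) - X \<bullet> n" by (simp only: adm_integral_const(1)[OF u])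
  also have "(LBINT x. (x \<bullet> n) * u x) = X \<bullet> n"
   unfolding X_def using integral_inner_left[OF Xi, of n] by (simp add: mult.commute)
  finally have "0 = (LBINT x. ((x - X) \<bullet> n) * place lam X \<eta> x)" by (simp add: pu)
  also have "\<dots> = (1/pi) * (LBINT y. ((X + ?e *\<^sub>R y - X) \<bullet> n) * \<eta> y)" by (rule integral_place[OF lam])
  also have "(LBINT y. ((X + ?e *\<^sub>R y - X) \<bullet> n) * \<eta> y) = ?e * (LBINT y. (y \<bullet> n) * \<eta> y)"
   by (simp add: mult.assoc)
  finally show ?thesis using e by simp
 qed
qed

section \<open>Limit of the rescaled potentials\<close>

lemma Vstar_ge: assumes "0 < \<delta>" "norm y \<le> 1 + \<delta>" shows "- \<delta> / 2 \<le> Vstar y"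
proof (cases "norm y \<le> 1")
 case True
 then have "(norm y)^2 \<le> 1" by (simp add: abs_square_le_1)
 then show ?thesis using True assms(1) by (simp add: Vstar_def)
next
 case False
 then have "ln (norm y) \<le> norm y - 1" by (intro ln_le_minus_one) auto
 then show ?thesis using False assms by (simp add: Vstar_def ln_div)
qed

text \<open>Inside the disk the assumption reads |y|^2 < 1 - 3 \<delta>, which is at most (1 -
  \<delta>)^2. The margin 3/4 \<delta> is what an error of \<delta>/4 leaves of a shift by
  \<delta>.\<close>

lemma norm_less_if_Vstar_gt: assumes \<delta>: "0 < \<delta>" "\<delta> < 1" and y: "3/4 * \<delta> < Vstar y" shows "norm y < 1 - \<delta>"
proof -
 have "norm y \<le> 1"
 proof (rule ccontr)
  assume n: "\<not> norm y \<le> 1"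
  then have "0 < ln (norm y)" by (intro ln_gt_zero) simp
  moreover have "ln (1 / norm y) = - ln (norm y)" using ln_inverse[of "norm y"] by (simp only: inverse_eq_divide)
  moreover have "Vstar y = 1/2 * ln (1 / norm y)" using n by (simp only: Vstar_def if_False)
  ultimately show False using y \<delta>(1) by linarith
 qed
 then have "3/4 * \<delta> < 1/4 * (1 - (norm y)^2)" using y by (simp add: Vstar_def)
 then have "(norm y)^2 < 1 - 3 * \<delta>" by simp
 also have "\<dots> \<le> (1 - \<delta>)^2" using \<delta> by (simp add: power2_eq_square algebra_simps)
 finally have "(norm y)^2 < (1 - \<delta>)^2" .
 then show ?thesis by (rule power2_less_imp_less) (use \<delta>(2) in simp)
qed

lemma Vstar_has_derivative: "(Vstar has_derivative (\<lambda>t. (- (1/(2*pi)) *\<^sub>R lgrad disc y) \<bullet> t)) (at y)"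
proof -
 have "Vstar = (\<lambda>y. - (1/(2*pi)) * lpot disc y)" using Vstar_eq by blast
 moreover have "((\<lambda>y. - (1/(2*pi)) * lpot disc y) has_derivative (\<lambda>t. - (1/(2*pi)) * (lgrad disc y \<bullet> t))) (at y)"
  by (intro has_derivative_mult_right lpot_has_derivative[OF bdens_disc[of 1]]) simp
 ultimately show ?thesis by (simp only: inner_scaleR_left)
qed

lemma scaled_potential_has_derivative:
 assumes u: "bdens L 1 u" and x: "X + e *\<^sub>R y \<in> D"
 shows "((\<lambda>z. pi * (psi0 Om u (X + e *\<^sub>R z) - \<mu>)) has_derivative (\<lambda>t. ((pi * e) *\<^sub>R pgrad Om u (X + e *\<^sub>R y)) \<bullet> t)) (at y)"
proof -
 have a: "((\<lambda>z. X + e *\<^sub>R z) has_derivative (\<lambda>t. e *\<^sub>R t)) (at y)" by (auto intro!: derivative_eq_intros)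
 have "((\<lambda>z. psi0 Om u (X + e *\<^sub>R z)) has_derivative (\<lambda>t. pgrad Om u (X + e *\<^sub>R y) \<bullet> (e *\<^sub>R t))) (at y)"
  using diff_chain_at[OF a psi0_has_derivative[OF u x]] by (simp add: o_def)
 then have "((\<lambda>z. psi0 Om u (X + e *\<^sub>R z) - \<mu>) has_derivative (\<lambda>t. pgrad Om u (X + e *\<^sub>R y) \<bullet> (e *\<^sub>R t) - 0)) (at y)"
  by (intro has_derivative_diff has_derivative_const)
 then have "((\<lambda>z. pi * (psi0 Om u (X + e *\<^sub>R z) - \<mu>)) has_derivative (\<lambda>t. pi * (pgrad Om u (X + e *\<^sub>R y) \<bullet> (e *\<^sub>R t) - 0))) (at y)"
  by (rule has_derivative_mult_right)
 then show ?thesis by (simp add: mult.assoc)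
qed

text \<open>The rescaled potential is the logarithmic potential of the profile plus a remainder made
  of the regular part, the rotation term and the level. The first converges with the profiles, and
  the remainder varies only by a multiple of epsl on compact sets, so its value at 0 is the one
  unknown.\<close>

lemma blowup_potential_limit:
 fixes l m :: "nat => real" and X :: "nat => pt" and \<eta> :: "nat => pt => real"
 assumes l: "filterlim l at_top sequentially" "\<And>n. 0 < l n" and Om: "0 < Om" and c: "0 < c" "c < 1" and R: "1 \<le> R"
  and Xc: "\<And>n. norm (X n) \<le> 1 - c" and pl: "\<And>n. planar R (\<eta> n)" and adm: "\<And>n. adm (l n) (u n)"
  and u: "\<And>n. u n = place (l n) (X n) (\<eta> n)"
  and \<eta>: "\<And>n y. \<eta> n y = indicator (Aset Om (u n) (m n)) (X n + epsl (l n) *\<^sub>R y)"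
  and conv: "\<And>h. integrable lborel h ==> (\<lambda>n. LBINT x. h x * \<eta> n x) \<longlonglongrightarrow> (LBINT x. h x * disc x)"
  and K: "compact K"
 defines "P \<equiv> (\<lambda>n z. pi * (psi0 Om (u n) (X n + epsl (l n) *\<^sub>R z) - m n))"
 shows "\<forall>\<^sub>F n in sequentially. \<forall>y\<in>K. X n + epsl (l n) *\<^sub>R y \<in> D \<and> P n differentiable (at y)"
  and "uniform_limit K P Vstar sequentially"
  and "uniform_limit K (\<lambda>n. grad (P n)) (grad Vstar) sequentially"
proof -
 define e where "e n = epsl (l n)" for n
 have e0: "0 < e n" for n unfolding e_def by (rule epsl_pos[OF l(2)])
 have el: "e \<longlonglongrightarrow> 0" unfolding e_def[abs_def] by (rule epsl_tendsto[OF l(1)])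
 note ub = adm_bdens[OF adm]
 have e_small: "\<forall>\<^sub>F n in sequentially. C * e n < \<delta>" if "0 < \<delta>" for C \<delta>
 proof -
  have "(\<lambda>n. C * e n) \<longlonglongrightarrow> C * 0" by (intro tendsto_mult tendsto_const el)
  then show ?thesis by (rule order_tendstoD(2)) (use that in simp)
 qed
 define k where "k n y = - 1/2 * ln (e n) - pi * hpot (u n) (X n + e n *\<^sub>R y) + pi * Om/2 * (norm (X n + e n *\<^sub>R y))^2 - pi * m n" for n y
 have split: "P n y = - (1/(2*pi)) * lpot (\<eta> n) y + k n y" if "X n + e n *\<^sub>R y \<in> D" for n y
 proof -
  have "lpot (u n) (X n + e n *\<^sub>R y) = ln (e n) + (1/pi) * lpot (\<eta> n) y"
   unfolding u e_def by (rule lpot_place[OF l(2) pl])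
  then show ?thesis unfolding P_def k_def e_def[symmetric] psi0_eq[OF ub that] by (simp add: field_simps)
 qed
 have inside: "\<forall>\<^sub>F n in sequentially. \<forall>y\<in>cball 0 B. norm (X n + e n *\<^sub>R y) \<le> 1 - c/2" if B: "0 \<le> B" for B
  using e_small[of "c/2" B, OF half_gt_zero[OF c(1)]]
 proof eventually_elim
  case (elim n)
  show ?case
  proof
   fix y :: pt assume "y \<in> cball 0 B"
   then have "e n * norm y \<le> B * e n" using e0[of n] by (simp add: mult.commute mult_left_mono)
   then have "norm (e n *\<^sub>R y) \<le> c/2" unfolding norm_scaleR using e0[of n] elim by linarith
   then show "norm (X n + e n *\<^sub>R y) \<le> 1 - c/2" using norm_triangle_ineq[of "X n" "e n *\<^sub>R y"] Xc[of n] by linarith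
  qed
 qed
 have u1: "(LBINT y. \<bar>u n y\<bar>) = 1" for n using adm[of n] by (simp add: adm_def)
 have d: "0 < c/2" "c/2 \<le> 1" using c by auto
 define Ck where "Ck = pi / (c/2)^2 + pi * Om"
 have Ck0: "0 \<le> Ck" using Om by (simp add: Ck_def)
 have kclose: "\<forall>\<^sub>F n in sequentially. \<forall>y\<in>cball 0 B. \<bar>k n y - k n 0\<bar> < \<delta>" if B: "0 \<le> B" and \<delta>: "0 < \<delta>" for B \<delta>
  using inside[OF B] e_small[OF \<delta>, of "Ck * B"]
 proof eventually_elim
  case (elim n)
  show ?case
  proof
   fix y :: pt assume y: "y \<in> cball 0 B"
   let ?x = "X n + e n *\<^sub>R y"
   have x: "norm ?x \<le> 1 - c/2" using elim(1) y by blast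
   have X: "norm (X n) \<le> 1 - c/2" using Xc[of n] c by simp
   have nx: "norm (?x - X n) \<le> e n * B" using y e0[of n] by (simp add: mult_left_mono)
   have h: "\<bar>hpot (u n) ?x - hpot (u n) (X n)\<bar> \<le> 1 / (c/2)^2 * norm (?x - X n)"
    using hpot_lipschitz[OF ub d x X] unfolding u1 by simp
   have "\<bar>(norm ?x)^2 - (norm (X n))^2\<bar> = \<bar>norm ?x - norm (X n)\<bar> * (norm ?x + norm (X n))"
   proof -
    have "(norm ?x)^2 - (norm (X n))^2 = (norm ?x - norm (X n)) * (norm ?x + norm (X n))"
     by (simp only: power2_eq_square square_diff_square_factored mult.commute)
    then show ?thesis by (simp only: abs_mult abs_of_nonneg[OF add_nonneg_nonneg[OF norm_ge_zero norm_ge_zero]])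
   qed
   also have "\<dots> \<le> norm (?x - X n) * 2"
    by (intro mult_mono norm_triangle_ineq3) (use x X c in auto)
   finally have q: "\<bar>(norm ?x)^2 - (norm (X n))^2\<bar> \<le> norm (?x - X n) * 2" .
   have "k n y - k n 0 = - (pi * (hpot (u n) ?x - hpot (u n) (X n))) + pi * Om/2 * ((norm ?x)^2 - (norm (X n))^2)"
    by (simp add: k_def algebra_simps)
   then have "\<bar>k n y - k n 0\<bar> \<le> \<bar>pi * (hpot (u n) ?x - hpot (u n) (X n))\<bar> + \<bar>pi * Om/2 * ((norm ?x)^2 - (norm (X n))^2)\<bar>"
    by linarith
   also have "\<dots> = pi * \<bar>hpot (u n) ?x - hpot (u n) (X n)\<bar> + pi * Om/2 * \<bar>(norm ?x)^2 - (norm (X n))^2\<bar>"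
    using Om by (simp add: abs_mult)
   also have "\<dots> \<le> pi * (1 / (c/2)^2 * norm (?x - X n)) + pi * Om/2 * (norm (?x - X n) * 2)"
    using Om by (intro add_mono mult_left_mono h q) auto
   also have "\<dots> = Ck * norm (?x - X n)" by (simp add: Ck_def algebra_simps)
   also have "\<dots> \<le> Ck * (e n * B)" by (rule mult_left_mono[OF nx Ck0])
   also have "\<dots> = Ck * B * e n" by simp
   also have "\<dots> < \<delta>" by (rule elim(2))
   finally show "\<bar>k n y - k n 0\<bar> < \<delta>" .
  qed
 qed
 note bd = planar_bdens[OF pl] and bdisc = bdens_disc[OF R]
 have close: "\<forall>\<^sub>F n in sequentially. \<forall>y\<in>cball 0 B. X n + e n *\<^sub>R y \<in> D \<and> \<bar>P n y - k n 0 - Vstar y\<bar> < \<delta>" if B: "0 \<le> B" and \<delta>: "0 < \<delta>" for B \<delta>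
 proof -
  have ul: "uniform_limit (cball 0 B) (\<lambda>n. lpot (\<eta> n)) (lpot disc) sequentially"
   by (rule weak_star_lpot_uniform(1)[OF bd bdisc compact_cball conv])
  have "0 < pi * \<delta>" using \<delta> by simp
  from uniform_limitD[OF ul this] inside[OF B] kclose[OF B half_gt_zero[OF \<delta>]] show ?thesis
  proof eventually_elim
   case (elim n)
   show ?case
   proof
    fix y :: pt assume y: "y \<in> cball 0 B"
    have "norm (X n + e n *\<^sub>R y) \<le> 1 - c/2" using elim(2) y by blast
    then have x: "X n + e n *\<^sub>R y \<in> D" using c by (simp add: D_iff)
    have "\<bar>lpot (\<eta> n) y - lpot disc y\<bar> < pi * \<delta>" using elim(1) y by (simp add: dist_real_def)
    then have "\<bar>- (1/(2*pi)) * (lpot (\<eta> n) y - lpot disc y)\<bar> < \<delta>/2" by (simp add: abs_mult field_simps)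
    moreover have "\<bar>k n y - k n 0\<bar> < \<delta>/2" using elim(3) y by blast
    moreover have "P n y - k n 0 - Vstar y = - (1/(2*pi)) * (lpot (\<eta> n) y - lpot disc y) + (k n y - k n 0)"
     unfolding split[OF x] Vstar_eq by (simp add: algebra_simps)
    ultimately show "X n + e n *\<^sub>R y \<in> D \<and> \<bar>P n y - k n 0 - Vstar y\<bar> < \<delta>" using x by linarith
   qed
  qed
 qed
 have \<eta>P: "\<eta> n y = (if 0 < P n y then 1 else 0)" if "X n + e n *\<^sub>R y \<in> D" for n y
  using that unfolding \<eta> e_def P_def by (simp add: Aset_def indicator_def zero_less_mult_iff)
 have \<eta>i: "integrable lborel (\<eta> n)" "(LBINT y. \<eta> n y) = pi" for n
  using integrable_bdens[OF bd] pl[of n] by (auto simp: planar_def)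
 have area: "(LBINT y. indicator (ball (0::pt) r) y) = pi * r^2" if "0 \<le> r" for r
  using that by (simp add: measure_ball_pt)
 \<comment> \<open>A remainder above \<delta> would put the disk of radius 1 + \<delta> inside the
   positive set of the potential, one below -\<delta> would confine that set to the disk of radius 1
   - \<delta>. Both contradict the area pi of the profile.\<close>
 have k0: "\<forall>\<^sub>F n in sequentially. \<bar>k n 0\<bar> \<le> \<delta>" if \<delta>: "0 < \<delta>" "\<delta> < 1" for \<delta>
 proof -
  \<comment> \<open>The radius R + 2 covers the support of the profile and the disk of radius 1 +
    \<delta> < 2.\<close>
  have "0 \<le> R + 2" "0 < \<delta>/4" using R \<delta> by auto
  from close[OF this] show ?thesis
  proof eventually_elim
   case (elim n)
   have cl: "X n + e n *\<^sub>R y \<in> D" "\<bar>P n y - k n 0 - Vstar y\<bar> < \<delta>/4" if "norm y \<le> R + 2" for y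
    using elim that by auto
   have "\<not> \<delta> < k n 0"
   proof
    assume a: "\<delta> < k n 0"
    have "(LBINT y. indicator (ball (0::pt) (1 + \<delta>)) y) \<le> (LBINT y. \<eta> n y)"
    proof (rule integral_mono[OF integrable_indicator_ball \<eta>i(1)])
     fix y :: pt
     show "indicator (ball 0 (1 + \<delta>)) y \<le> \<eta> n y"
     proof (cases "y \<in> ball 0 (1 + \<delta>)")
      case True
      then have y: "norm y \<le> R + 2" "norm y \<le> 1 + \<delta>" using R \<delta>(2) by auto
      have "0 < P n y" using cl(2)[OF y(1)] Vstar_ge[OF \<delta>(1) y(2)] a \<delta>(1) by linarith
      then show ?thesis unfolding \<eta>P[OF cl(1)[OF y(1)]] by (simp add: indicator_def)
     qed (use pl[of n] in \<open>simp add: planar_def\<close>)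
    qed
    then have "pi * (1 + \<delta>)^2 \<le> pi" unfolding \<eta>i(2) using area[of "1 + \<delta>"] \<delta>(1) by simp
    then have "(1 + \<delta>)^2 \<le> 1" by simp
    then show False using \<delta>(1) by (simp add: abs_square_le_1)
   qed
   moreover have "\<not> k n 0 < - \<delta>"
   proof
    assume a: "k n 0 < - \<delta>"
    have "(LBINT y. \<eta> n y) \<le> (LBINT y. indicator (ball (0::pt) (1 - \<delta>)) y)"
    proof (rule integral_mono[OF \<eta>i(1) integrable_indicator_ball])
     fix y :: pt
     show "\<eta> n y \<le> indicator (ball 0 (1 - \<delta>)) y"
     proof (cases "norm y < R")
      case True
      then have y: "norm y \<le> R + 2" by simp
      show ?thesis
      proof (cases "0 < P n y")
       case True
       then have "3/4 * \<delta> < Vstar y" using cl(2)[OF y] a by linarith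
       from norm_less_if_Vstar_gt[OF \<delta> this] show ?thesis by (simp add: \<eta> indicator_def)
      next
       case False
       then show ?thesis unfolding \<eta>P[OF cl(1)[OF y]] by simp
      qed
     qed (use pl[of n] in \<open>simp add: planar_def\<close>)
    qed
    then have "pi \<le> pi * (1 - \<delta>)^2" unfolding \<eta>i(2) using area[of "1 - \<delta>"] \<delta>(2) by simp
    then have "1 \<le> (1 - \<delta>)^2" by simp
    moreover have "(1 - \<delta>)^2 < 1" using \<delta> by (simp add: abs_square_less_1)
    ultimately show False by simp
   qed
   ultimately show ?case by linarith
  qed
 qed
 obtain B where B: "0 \<le> B" "K \<subseteq> cball 0 B"
 proof -
  obtain B0 where "0 < B0" "\<And>x. x \<in> K ==> norm x \<le> B0" using compact_imp_bounded[OF K] by (auto simp: bounded_pos)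
  then show thesis by (intro that[of B0]) auto
 qed
 have full: "\<forall>\<^sub>F n in sequentially. \<forall>y\<in>K. norm (X n + e n *\<^sub>R y) \<le> 1 - c/2"
  using inside[OF B(1)] by eventually_elim (use B(2) in blast)
 have hd: "(P n has_derivative (\<lambda>t. ((pi * e n) *\<^sub>R pgrad Om (u n) (X n + e n *\<^sub>R y)) \<bullet> t)) (at y)" if "X n + e n *\<^sub>R y \<in> D" for n y
  unfolding P_def e_def by (rule scaled_potential_has_derivative[OF ub]) (use that in \<open>simp add: e_def\<close>)
 show "\<forall>\<^sub>F n in sequentially. \<forall>y\<in>K. X n + epsl (l n) *\<^sub>R y \<in> D \<and> P n differentiable (at y)"
  using full
 proof eventually_elim
  case (elim n)
  show ?case
  proof
   fix y assume "y \<in> K"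
   then have x: "X n + e n *\<^sub>R y \<in> D" using elim c by (force simp: D_iff)
   show "X n + epsl (l n) *\<^sub>R y \<in> D \<and> P n differentiable (at y)"
    using x differentiableI[OF hd[OF x]] by (simp add: e_def)
  qed
 qed
 show "uniform_limit K P Vstar sequentially"
 proof (rule uniform_limitI)
  fix r :: real assume r: "0 < r"
  define \<delta> where "\<delta> = min (r/2) (1/2)"
  have \<delta>: "0 < \<delta>" "\<delta> < 1" "\<delta> \<le> r/2" using r by (simp_all add: \<delta>_def)
  from close[OF B(1) half_gt_zero[OF r]] k0[OF \<delta>(1,2)]
  show "\<forall>\<^sub>F n in sequentially. \<forall>y\<in>K. dist (P n y) (Vstar y) < r"
  proof eventually_elim
   case (elim n)
   show ?case
   proof
    fix y assume "y \<in> K"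
    then have "\<bar>P n y - k n 0 - Vstar y\<bar> < r/2" using elim(1) B(2) by blast
    then show "dist (P n y) (Vstar y) < r" unfolding dist_real_def using elim(2) \<delta>(3) by linarith
   qed
  qed
 qed
 show "uniform_limit K (\<lambda>n. grad (P n)) (grad Vstar) sequentially"
 proof (rule uniform_limitI)
  fix r :: real assume r: "0 < r"
  have ul: "uniform_limit K (\<lambda>n. lgrad (\<eta> n)) (lgrad disc) sequentially"
   by (rule weak_star_lpot_uniform(2)[OF bd bdisc K conv])
  have "0 < pi * r" using r by simp
  from uniform_limitD[OF ul this] full e_small[OF half_gt_zero[OF r], of "pi * (Om + 1 / (c/2)^2)"]
  show "\<forall>\<^sub>F n in sequentially. \<forall>y\<in>K. dist (grad (P n) y) (grad Vstar y) < r"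
  proof eventually_elim
   case (elim n)
   show ?case
   proof
    fix y assume y: "y \<in> K"
    let ?x = "X n + e n *\<^sub>R y"
    have nx: "norm ?x \<le> 1 - c/2" using elim(2) y by blast
    then have x: "?x \<in> D" using c by (simp add: D_iff)
    have lg: "lgrad (u n) ?x = (1 / (pi * e n)) *\<^sub>R lgrad (\<eta> n) y"
     unfolding u e_def by (rule lgrad_place[OF l(2)])
    \<comment> \<open>The factor pi * epsl cancels the scaling of the logarithmic gradient exactly;
      the other terms are bounded and vanish with it.\<close>
    have "grad (P n) y = (pi * e n) *\<^sub>R pgrad Om (u n) ?x" by (rule grad_eq[OF hd[OF x]])
    also have "\<dots> = - (1/(2*pi)) *\<^sub>R lgrad (\<eta> n) y + (pi * e n) *\<^sub>R (Om *\<^sub>R ?x - hgrad (u n) ?x)"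
     unfolding pgrad_def lg using e0[of n] by (simp add: scaleR_diff_right scaleR_add_right)
    finally have eq: "grad (P n) y - grad Vstar y = - (1/(2*pi)) *\<^sub>R (lgrad (\<eta> n) y - lgrad disc y) + (pi * e n) *\<^sub>R (Om *\<^sub>R ?x - hgrad (u n) ?x)"
     unfolding grad_eq[OF Vstar_has_derivative] by (simp add: scaleR_diff_right)
    have n1: "norm (- (1/(2*pi)) *\<^sub>R (lgrad (\<eta> n) y - lgrad disc y)) < r/2"
    proof -
     have "norm (lgrad (\<eta> n) y - lgrad disc y) < pi * r" using elim(1) y by (simp add: dist_norm)
     then show ?thesis unfolding norm_scaleR by (simp add: pos_divide_less_eq mult.commute)
    qed
    have "norm (Om *\<^sub>R ?x - hgrad (u n) ?x) \<le> norm (Om *\<^sub>R ?x) + norm (hgrad (u n) ?x)" by (rule norm_triangle_ineq4)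
    also have "\<dots> \<le> Om + 1 / (c/2)^2"
    proof (rule add_mono)
     show "norm (Om *\<^sub>R ?x) \<le> Om" using nx c Om by (simp add: mult_left_le)
     show "norm (hgrad (u n) ?x) \<le> 1 / (c/2)^2" using norm_hgrad_le[OF ub d nx] unfolding u1 by simp
    qed
    finally have p2: "(pi * e n) * norm (Om *\<^sub>R ?x - hgrad (u n) ?x) \<le> (pi * e n) * (Om + 1 / (c/2)^2)"
     by (rule mult_left_mono) (use e0[of n] in simp)
    have n2: "norm ((pi * e n) *\<^sub>R (Om *\<^sub>R ?x - hgrad (u n) ?x)) < r/2"
    proof -
     have "\<bar>pi * e n\<bar> = pi * e n" using e0[of n] by simp
     moreover have "(pi * e n) * (Om + 1 / (c/2)^2) = pi * (Om + 1 / (c/2)^2) * e n" by simp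
     ultimately show ?thesis unfolding norm_scaleR using elim(3) p2 by linarith
    qed
    show "dist (grad (P n) y) (grad Vstar y) < r"
     unfolding dist_norm eq using norm_triangle_ineq[of "- (1/(2*pi)) *\<^sub>R (lgrad (\<eta> n) y - lgrad disc y)" "(pi * e n) *\<^sub>R (Om *\<^sub>R ?x - hgrad (u n) ?x)"] n1 n2 by linarith
   qed
  qed
 qed
qed

text \<open>The rescaled maximizer is only known to agree almost everywhere with a Borel function;
  completeness of \<open>lebesgue\<close> makes this enough.\<close>

lemma borel_measurable_lebesgue_AE:
 fixes f h :: "pt => real"
 assumes h: "h \<in> borel_measurable borel" and ae: "AE x in lborel. f x = h x"
 shows "f \<in> borel_measurable lebesgue"
proof (rule measurableI)
 fix S :: "real set" assume S: "S \<in> sets borel"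
 have "h -` S \<inter> space lebesgue \<in> sets lebesgue"
  using measurable_sets[OF measurable_completion[of h lborel borel] S] h by simp
 then show "f -` S \<inter> space lebesgue \<in> sets lebesgue"
 proof (rule completion.in_sets_AE[rotated])
  show "AE x in lebesgue. x \<in> h -` S \<inter> space lebesgue \<longleftrightarrow> x \<in> f -` S \<inter> space lebesgue"
   by (rule AE_completion) (use ae in \<open>eventually_elim, simp\<close>)
 qed simp
qed simp

lemma LINT_lebesgue_on_eq_lborel:
 fixes f h :: "pt => real"
 assumes S: "S \<in> sets borel" and h: "h \<in> borel_measurable borel" and ae: "AE x in lborel. indicator S x * f x = h x"
 shows "(LINT x|lebesgue_on S. f x) = (LBINT x. h x)"
proof -
 have "(LINT x|lebesgue_on S. f x) = (\<integral>x. indicator S x *\<^sub>R f x \<partial>lebesgue)"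
  by (rule integral_restrict_space) (use S in simp)
 also have "\<dots> = (\<integral>x. h x \<partial>lebesgue)"
 proof (rule integral_cong_AE)
  show "(\<lambda>x. indicator S x *\<^sub>R f x) \<in> borel_measurable lebesgue"
   by (rule borel_measurable_lebesgue_AE[OF h]) (use ae in simp)
  show "h \<in> borel_measurable lebesgue" by (rule measurable_completion) (use h in simp)
  show "AE x in lebesgue. indicator S x *\<^sub>R f x = h x" by (rule AE_completion) (use ae in simp)
 qed
 also have "\<dots> = (LBINT x. h x)" by (rule integral_completion) (use h in simp)
 finally show ?thesis .
qed

lemma measurable_perp_grad:
 assumes "smooth_fun \<phi>" shows "(\<lambda>x. perp (grad \<phi> x)) \<in> borel_measurable borel"
proof -
 have [measurable]: "iter_deriv vs \<phi> \<in> borel_measurable borel" for vs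
  using assms by (intro borel_measurable_continuous_onI continuous_at_imp_continuous_on) (auto simp: smooth_fun_def intro: differentiable_imp_continuous_within)
 have "perp (grad \<phi> x) = iter_deriv [axis 2 1] \<phi> x *\<^sub>R axis 1 1 - iter_deriv [axis 1 1] \<phi> x *\<^sub>R axis 2 1" for x
  by (simp add: vec_eq_iff forall_2 perp_def grad_def axis_def)
 then show ?thesis by (simp del: iter_deriv.simps)
qed

section \<open>From representatives to arbitrary maximizers\<close>

lemma maximizer_weak_eq:
 assumes w: "maximizer Om lam w" and lam: "1/pi < lam"
 shows "weak_eq Om w" "\<exists>\<mu>. patch_form Om lam w \<mu>"
proof -
 have lam0: "0 < lam" using lam by (rule less_trans[rotated]) simp
 have wK: "w \<in> Kset lam" using w by (simp add: maximizer_def)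
 obtain v where v: "adm lam v" "AE x in lebesgue_on D. w x = v x"
  using Kset_representative[OF wK less_imp_le[OF lam0]] .
 note rep = wK v
 have vm: "amax Om lam v" by (rule representative_maximizer[OF rep w])
 note vb = adm_bdens[OF v(1)]
 have psi: "psi0 Om w = psi0 Om v" by (rule representative_psi0[OF rep])
 obtain \<mu> where \<mu>: "AE x in lborel. v x = lam * indicator (Aset Om v \<mu>) x" "emeasure lborel (Bset Om v \<mu>) = 0"
  using amax_patch[OF vm lam] .
 have sets: "Aset Om v \<mu> = Aset Om w \<mu>" "Bset Om v \<mu> = Bset Om w \<mu>" by (simp_all add: Aset_def Bset_def psi)
 have Am [measurable]: "Aset Om v \<mu> \<in> sets borel" by (rule measurable_Aset[OF vb])
 have "{x \<in> space borel. x \<in> D \<and> psi0 Om v x = \<mu>} \<in> sets borel" using measurable_psi0[OF vb] by measurable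
 then have Bm: "Bset Om v \<mu> \<in> sets borel" by (simp add: Bset_def)
 have wv: "AE x in lborel. x \<in> D --> w x = v x" using v(2) by (simp add: AE_lebesgue_on_D)
 have AEB: "AE x in lborel. x \<notin> Bset Om v \<mu>" by (rule AE_not_in) (use \<mu>(2) Bm in \<open>simp add: null_sets_def\<close>)
 have "AE x in lebesgue_on D. w x = lam * indicator (Aset Om w \<mu>) x + 2 * Om * indicator (Bset Om w \<mu>) x"
  unfolding AE_lebesgue_on_D using wv \<mu>(1) AEB by eventually_elim (simp add: sets)
 moreover have "emeasure lebesgue (Bset Om w \<mu>) = 0" using \<mu>(2) Bm by (simp add: sets)
 ultimately show "\<exists>\<mu>. patch_form Om lam w \<mu>" by (auto simp: patch_form_def)
 show "weak_eq Om w" unfolding weak_eq_def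
 proof (intro allI impI)
  fix \<phi> assume \<phi>: "test_fun D \<phi>"
  let ?p = "\<lambda>x. pgrad Om v x \<bullet> perp (grad \<phi> x)"
  have [measurable]: "(\<lambda>x. perp (grad \<phi> x)) \<in> borel_measurable borel"
   using \<phi> by (intro measurable_perp_grad) (simp add: test_fun_def)
  have [measurable]: "pgrad Om v \<in> borel_measurable borel" by (rule measurable_pgrad[OF bdens_measurable[OF vb]])
  have "(LINT x|lebesgue_on D. w x * (grad (psi0 Om w) x \<bullet> perp (grad \<phi> x))) = (LBINT x. lam * (indicator (Aset Om v \<mu>) x * ?p x))"
  proof (rule LINT_lebesgue_on_eq_lborel[OF sets_D])
   show "(\<lambda>x. lam * (indicator (Aset Om v \<mu>) x * ?p x)) \<in> borel_measurable borel" by measurable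
   show "AE x in lborel. indicator D x * (w x * (grad (psi0 Om w) x \<bullet> perp (grad \<phi> x))) = lam * (indicator (Aset Om v \<mu>) x * ?p x)"
    using wv \<mu>(1)
   proof eventually_elim
    case (elim x)
    show ?case
    proof (cases "x \<in> D")
     case True
     have "grad (psi0 Om w) x = pgrad Om v x" unfolding psi by (rule grad_eq[OF psi0_has_derivative[OF vb True]])
     then show ?thesis using elim True by simp
    qed (simp add: Aset_def)
   qed
  qed
  then show "(LINT x|lebesgue_on D. w x * (grad (psi0 Om w) x \<bullet> perp (grad \<phi> x))) = 0"
   using patch_weak_form[OF vb \<phi> \<mu>(2)] by (simp only: integral_mult_right_zero mult_zero_right)
 qed
qed

text \<open>Here \<open>\<mu>\<close> is any level with \<open>patch_form\<close>, not necessarily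
  the one found by \<open>amax_patch\<close>. For \<open>lam\<close> different from
  \<open>2 * Om\<close> the nullity of the level set is part of \<open>patch_form\<close>, so the
  maximizer is the patch over \<open>Aset\<close> almost everywhere.\<close>

lemma patch_representative:
 assumes w: "maximizer Om lam w" and p: "patch_form Om lam w \<mu>" and lam: "1/pi < lam" "lam \<noteq> 2 * Om"
 defines "u \<equiv> (\<lambda>x. lam * indicator (Aset Om w \<mu>) x)"
 shows "amax Om lam u" "psi0 Om u = psi0 Om w" "center w = (LBINT x. u x *\<^sub>R x)" "AE x in lborel. x \<in> D --> w x = u x"
proof -
 have lam0: "0 < lam" using lam(1) by (rule less_trans[rotated]) simp
 have wK: "w \<in> Kset lam" using w by (simp add: maximizer_def)
 obtain v where v: "adm lam v" "AE x in lebesgue_on D. w x = v x"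
  using Kset_representative[OF wK less_imp_le[OF lam0]] .
 note rep = wK v
 have vm: "amax Om lam v" by (rule representative_maximizer[OF rep w])
 have psi: "psi0 Om w = psi0 Om v" by (rule representative_psi0[OF rep])
 then have A: "Aset Om w \<mu> = Aset Om v \<mu>" by (simp add: Aset_def)
 have "{x \<in> space borel. x \<in> D \<and> psi0 Om v x = \<mu>} \<in> sets borel" using measurable_psi0[OF adm_bdens[OF v(1)]] by measurable
 then have Bm: "Bset Om w \<mu> \<in> sets borel" by (simp add: Bset_def psi)
 have "emeasure lebesgue (Bset Om w \<mu>) = 0" using p lam(2) by (simp add: patch_form_def)
 then have AEB: "AE x in lborel. x \<notin> Bset Om w \<mu>" by (intro AE_not_in) (use Bm in \<open>simp add: null_sets_def\<close>)
 have p': "AE x in lborel. x \<in> D --> w x = lam * indicator (Aset Om w \<mu>) x + 2 * Om * indicator (Bset Om w \<mu>) x"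
  using p by (simp add: patch_form_def AE_lebesgue_on_D)
 then show wu: "AE x in lborel. x \<in> D --> w x = u x" using AEB by eventually_elim (simp add: u_def)
 have wv: "AE x in lborel. x \<in> D --> w x = v x" using v(2) by (simp add: AE_lebesgue_on_D)
 have "AE x in lborel. v x = lam * indicator (Aset Om v \<mu>) x"
  using wu wv
 proof eventually_elim
  case (elim x)
  show ?case
  proof (cases "x \<in> D")
   case True then show ?thesis using elim by (simp add: u_def A)
  next
   case False then show ?thesis using v(1) by (simp add: adm_def Aset_def)
  qed
 qed
 note n = amax_patch_representative[OF vm lam0 this]
 show "amax Om lam u" "psi0 Om u = psi0 Om w" unfolding u_def A psi by (rule n(1), rule n(2))
 show "center w = (LBINT x. u x *\<^sub>R x)" unfolding u_def A n(4) by (rule representative_center[OF rep])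
qed

text \<open>Two successive extractions: the centres converge in a compact disk and the profiles in
  the weak-star sense. The limit profile is \<open>disc\<close> whichever subsequence is
  taken.\<close>

lemma blowup_subsequence:
 fixes l m :: "nat => real" and X :: "nat => pt" and u \<eta> :: "nat => pt => real"
 assumes Om: "0 < Om" and R: "1 < R" and c: "0 < c" "c < 1"
  and l: "filterlim l at_top sequentially" "\<And>n. 0 < l n" and am: "\<And>n. amax Om (l n) (u n)"
  and uA: "\<And>n x. u n x = l n * indicator (Aset Om (u n) (m n)) x"
  and diam: "\<And>n x y. x \<in> Aset Om (u n) (m n) ==> y \<in> Aset Om (u n) (m n) ==> dist x y \<le> R * epsl (l n)"
  and nA: "\<And>n x. x \<in> Aset Om (u n) (m n) ==> norm x \<le> 1 - c"
  and X: "\<And>n. X n = (LBINT x. u n x *\<^sub>R x)"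
  and \<eta>: "\<And>n y. \<eta> n y = indicator (Aset Om (u n) (m n)) (X n + epsl (l n) *\<^sub>R y)"
 obtains r X0 where "X0 \<in> D" "strict_mono (r::nat=>nat)" "(\<lambda>n. X (r n)) \<longlonglongrightarrow> X0"
  "\<And>x. x \<in> D ==> Robin X0 - Om/2 * (norm X0)^2 \<le> Robin x - Om/2 * (norm x)^2"
  "\<And>h. integrable lborel h ==> (\<lambda>n. LBINT x. h x * \<eta> (r n) x) \<longlonglongrightarrow> (LBINT x. h x * disc x)"
  "\<And>K. compact K ==> \<forall>\<^sub>F n in sequentially. \<forall>y\<in>K. X (r n) + epsl (l (r n)) *\<^sub>R y \<in> D \<and>
    (\<lambda>z. pi * (psi0 Om (u (r n)) (X (r n) + epsl (l (r n)) *\<^sub>R z) - m (r n))) differentiable (at y)"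
  "\<And>K. compact K ==> uniform_limit K (\<lambda>n z. pi * (psi0 Om (u (r n)) (X (r n) + epsl (l (r n)) *\<^sub>R z) - m (r n))) Vstar sequentially"
  "\<And>K. compact K ==> uniform_limit K (\<lambda>n. grad (\<lambda>z. pi * (psi0 Om (u (r n)) (X (r n) + epsl (l (r n)) *\<^sub>R z) - m (r n)))) (grad Vstar) sequentially"
proof -
 have ad: "adm (l n) (u n)" for n using am[of n] by (simp add: amax_def)
 have \<eta>': "\<eta> n = (\<lambda>y. indicator (Aset Om (u n) (m n)) ((LBINT x. u n x *\<^sub>R x) + epsl (l n) *\<^sub>R y))" for n
  using \<eta>[of n] by (simp add: fun_eq_iff X)
 note B = blowup_planar[OF l(2) ad uA diam nA]
 have pu: "u n = place (l n) (X n) (\<eta> n)" for n unfolding \<eta>' X by (rule B(1)[symmetric])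
 have pl: "planar (R + 1) (\<eta> n)" for n unfolding \<eta>' by (rule B(2))
 have Xc: "norm (X n) \<le> 1 - c" for n unfolding X by (rule B(3))
 have cen: "(LBINT y. (y \<bullet> a) * \<eta> n y) = 0" for n a unfolding \<eta>' by (rule B(4))
 have "\<forall>n. X n \<in> cball 0 (1 - c)" using Xc by simp
 then obtain X0 r1 where X0: "X0 \<in> cball 0 (1 - c)" and r1: "strict_mono (r1::nat=>nat)" and Xr1: "(X \<circ> r1) \<longlonglongrightarrow> X0"
  using compact_cball[of "0::pt" "1 - c"] unfolding compact_def by metis
 have X0D: "X0 \<in> D" using X0 c by (simp add: D_iff)
 have \<eta>m: "\<eta> n \<in> borel_measurable borel" "0 \<le> \<eta> n x" "\<eta> n x \<le> 1" "x \<notin> ball 0 (R + 1) ==> \<eta> n x = 0" for n x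
  using pl[of n] by (auto simp: planar_def)
 have fin: "emeasure lborel (ball (0::pt) (R + 1)) < \<infinity>" by (rule emeasure_bounded_finite[OF bounded_ball])
 obtain k g where k: "strict_mono (k::nat=>nat)" and g: "g \<in> borel_measurable borel" "\<And>x. 0 \<le> g x" "\<And>x. g x \<le> 1" "\<And>x. x \<notin> ball 0 (R + 1) ==> g x = 0"
  and conv: "\<And>f. integrable lborel f ==> (\<lambda>n. LBINT x. f x * \<eta> (r1 (k n)) x) \<longlonglongrightarrow> (LBINT x. f x * g x)"
  by (rule weak_star_compactness[where w="\<lambda>n. \<eta> (r1 n)" and L=1 and S="ball 0 (R + 1)", OF \<eta>m(1,2,3) _ fin \<eta>m(4)]) simp_all
 define r where "r = r1 \<circ> k"
 have r: "strict_mono r" unfolding r_def by (rule strict_mono_o[OF r1 k])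
 have Xr: "(\<lambda>n. X (r n)) \<longlonglongrightarrow> X0" using LIMSEQ_subseq_LIMSEQ[OF Xr1 k] by (simp add: r_def o_def)
 have lr: "filterlim (\<lambda>n. l (r n)) at_top sequentially" by (rule filterlim_compose[OF l(1) filterlim_subseq[OF r]])
 have am': "amax Om (l (r n)) (place (l (r n)) (X (r n)) (\<eta> (r n)))" for n using am[of "r n"] by (simp only: pu[of "r n", symmetric])
 have R1: "0 < R + 1" "1 \<le> R + 1" using R by auto
 have conv': "\<And>f. integrable lborel f ==> (\<lambda>n. LBINT x. f x * \<eta> (r n) x) \<longlonglongrightarrow> (LBINT x. f x * g x)"
  using conv by (simp add: r_def)
 have gd: "AE x in lborel. g x = disc x"
  by (rule weak_limit_is_disc[OF lr l(2) Xr X0D pl R1(2) am' cen g conv'])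
 have cd: "(\<lambda>n. LBINT x. h x * \<eta> (r n) x) \<longlonglongrightarrow> (LBINT x. h x * disc x)" if h: "integrable lborel h" for h
 proof -
  have hm: "h \<in> borel_measurable borel" using borel_measurable_integrable[OF h] by simp
  have "(LBINT x. h x * g x) = (LBINT x. h x * disc x)"
  proof (rule integral_cong_AE)
   show "AE x in lborel. h x * g x = h x * disc x" using gd by eventually_elim simp
   show "(\<lambda>x. h x * g x) \<in> borel_measurable lborel" using hm g(1) by simp
   show "(\<lambda>x. h x * disc x) \<in> borel_measurable lborel" using hm bdens_measurable[OF bdens_disc[OF R1(2)]] by simp
  qed
  then show ?thesis using conv'[OF h] by simp
 qed
 note P = blowup_potential_limit[where l="\<lambda>n. l (r n)" and X="\<lambda>n. X (r n)" and \<eta>="\<lambda>n. \<eta> (r n)" and u="\<lambda>n. u (r n)" and m="\<lambda>n. m (r n)", OF lr l(2) Om c R1(2) Xc pl ad pu \<eta> cd]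
 show thesis
  by (rule that[OF X0D r Xr limit_center_minimizes[OF lr l(2) Xr X0D pl R1(1) am'] cd P(1) P(2) P(3)])
qed

text \<open>If \<open>P\<close> failed for arbitrarily large parameters, failures would form a
  sequence tending to infinity, yet a subsequence of it satisfies \<open>P\<close> eventually. This
  carries sequential compactness over to the continuous parameter.\<close>

lemma eventually_at_top_subsequence:
 fixes P Q :: "real => bool"
 assumes Q: "eventually Q at_top"
  and P: "\<And>s. filterlim s at_top sequentially ==> (\<And>n. Q (s n)) ==> \<exists>r::nat=>nat. \<forall>\<^sub>F n in sequentially. P (s (r n))"
 shows "eventually P at_top"
proof (rule ccontr)
 assume nP: "\<not> eventually P at_top"
 have "\<exists>x. real n \<le> x \<and> Q x \<and> \<not> P x" for n
 proof (rule ccontr)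
  assume a: "\<not> (\<exists>x. real n \<le> x \<and> Q x \<and> \<not> P x)"
  have "eventually P at_top" using Q eventually_ge_at_top[of "real n"] by eventually_elim (use a in blast)
  then show False using nP by blast
 qed
 then obtain s where s: "\<And>n. real n \<le> s n" "\<And>n. Q (s n)" "\<And>n. \<not> P (s n)" by metis
 have "filterlim s at_top sequentially"
  by (rule filterlim_at_top_mono[OF filterlim_real_sequentially]) (simp add: s(1))
 from P[OF this s(2)] obtain r :: "nat => nat" where "\<forall>\<^sub>F n in sequentially. P (s (r n))" ..
 then show False using s(3) by simp
qed

lemma maximizer_asymptotics:
 fixes W :: "real => pt => real" and M :: "real => real"
 assumes "Om > 0" and WM: "\<forall>lam > 1/pi. maximizer Om lam (W lam) \<and> patch_form Om lam (W lam) (M lam)"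
 shows "\<exists>R0 > 1.
     (\<forall>\<^sub>F lam in at_top. diameter (Aset Om (W lam) (M lam)) \<le> R0 * epsl lam)
    \<and> (\<forall>g. integrable (lebesgue_on (ball 0 R0)) g -->
       ((\<lambda>lam. LINT y|lebesgue_on (ball 0 R0).
         (1/lam) * (indicator D (center (W lam) + epsl lam *\<^sub>R y)
              * W lam (center (W lam) + epsl lam *\<^sub>R y)) * g y)
       \<longlongrightarrow> (LINT y|lebesgue_on (ball 0 R0). indicator (ball 0 1) y * g y)) at_top)" (is ?diam)
  and "\<And>Xs. limit_point_at_top (\<lambda>lam. center (W lam)) Xs ==>
      Xs \<in> D \<and> (\<forall>x \<in> D. Robin Xs - Om/2 * (norm Xs)^2 \<le> Robin x - Om/2 * (norm x)^2)"
  and "\<And>K. compact K ==>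
     (\<forall>\<^sub>F lam in at_top. (\<lambda>y. center (W lam) + epsl lam *\<^sub>R y) ` K \<subseteq> D
       \<and> (\<forall>y \<in> K. (\<lambda>z. pi * (psi0 Om (W lam) (center (W lam) + epsl lam *\<^sub>R z) - M lam))
               differentiable (at y)))
    \<and> uniform_limit K
      (\<lambda>lam y. pi * (psi0 Om (W lam) (center (W lam) + epsl lam *\<^sub>R y) - M lam)) Vstar at_top
    \<and> uniform_limit K
      (\<lambda>lam y. grad (\<lambda>z. pi * (psi0 Om (W lam) (center (W lam) + epsl lam *\<^sub>R z) - M lam)) y)
      (grad Vstar) at_top" (is "\<And>K. _ ==> ?lim K")
proof -
 obtain R c e0 where R: "1 < R" and c: "0 < c" "c < 1" and e0: "0 < e0"
  and conc: "\<And>lam v \<mu>. 0 < lam ==> epsl lam < e0 ==> amax Om lam v ==> (AE x in lborel. v x = lam * indicator (Aset Om v \<mu>) x) ==>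
    (\<forall>x\<in>Aset Om v \<mu>. \<forall>y\<in>Aset Om v \<mu>. dist x y \<le> R * epsl lam) \<and> (\<forall>x\<in>Aset Om v \<mu>. norm x \<le> 1 - c)"
  by (rule concentration[OF assms(1)]) (rule that)
 \<comment> \<open>All three conditions hold for large \<open>lam\<close>. The value
   \<open>2 * Om\<close> is avoided because otherwise \<open>patch_form\<close> does not make the
   level set null.\<close>
 define Q where "Q lam \<longleftrightarrow> 1/pi < lam \<and> lam \<noteq> 2 * Om \<and> epsl lam < e0" for lam
 have evQ: "eventually Q at_top"
  using eventually_gt_at_top[of "1/pi"] eventually_gt_at_top[of "2 * Om"] order_tendstoD(2)[OF epsl_at_top e0]
  unfolding Q_def by eventually_elim simp
 define u where "u lam = (\<lambda>x. lam * indicator (Aset Om (W lam) (M lam)) x)" for lam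
 define X where "X lam = center (W lam)" for lam
 define \<eta> :: "real => pt => real" where "\<eta> lam y = indicator (Aset Om (W lam) (M lam)) (X lam + epsl lam *\<^sub>R y)" for lam y
 have Q0: "0 < lam" if "Q lam" for lam
  by (rule less_trans[of _ "1/pi"]) (use that in \<open>simp_all add: Q_def\<close>)
 have rep: "amax Om lam (u lam)" "psi0 Om (u lam) = psi0 Om (W lam)" "X lam = (LBINT x. u lam x *\<^sub>R x)"
  "AE x in lborel. x \<in> D --> W lam x = u lam x" if "Q lam" for lam
  using patch_representative[of Om lam "W lam" "M lam"] that WM by (auto simp: Q_def u_def X_def)
 have A: "Aset Om (u lam) (M lam) = Aset Om (W lam) (M lam)" if "Q lam" for lam using rep(2)[OF that] by (simp add: Aset_def)
 have co: "dist x y \<le> R * epsl lam" "norm x \<le> 1 - c" if q: "Q lam" and xy: "x \<in> Aset Om (W lam) (M lam)" "y \<in> Aset Om (W lam) (M lam)" for lam x y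
 proof -
  have "AE x in lborel. u lam x = lam * indicator (Aset Om (u lam) (M lam)) x" unfolding A[OF q] by (simp add: u_def)
  from conc[OF Q0[OF q] _ rep(1)[OF q] this] q xy show "dist x y \<le> R * epsl lam" "norm x \<le> 1 - c"
   unfolding A[OF q] Q_def by blast+
 qed
 define Psi where "Psi lam z = pi * (psi0 Om (W lam) (X lam + epsl lam *\<^sub>R z) - M lam)" for lam z
 \<comment> \<open>All subsequential limits in one statement: \<open>X0\<close> may depend on the
   subsequence, whereas the limits of profiles and potentials do not.\<close>
 define G where "G s r X0 \<longleftrightarrow> X0 \<in> D \<and> strict_mono r \<and> (\<lambda>n. X (s (r n))) \<longlonglongrightarrow> X0 \<and>
   (\<forall>x\<in>D. Robin X0 - Om/2 * (norm X0)^2 \<le> Robin x - Om/2 * (norm x)^2) \<and>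
   (\<forall>h. integrable lborel h --> (\<lambda>n. LBINT x. h x * \<eta> (s (r n)) x) \<longlonglongrightarrow> (LBINT x. h x * disc x)) \<and>
   (\<forall>K. compact K --> (\<forall>\<^sub>F n in sequentially. \<forall>y\<in>K. X (s (r n)) + epsl (s (r n)) *\<^sub>R y \<in> D \<and> Psi (s (r n)) differentiable (at y)) \<and>
    uniform_limit K (\<lambda>n. Psi (s (r n))) Vstar sequentially \<and> uniform_limit K (\<lambda>n. grad (Psi (s (r n)))) (grad Vstar) sequentially)" for s :: "nat => real" and r :: "nat => nat" and X0
 have G: "(\<lambda>n. LBINT x. h x * \<eta> (s (r n)) x) \<longlonglongrightarrow> (LBINT x. h x * disc x)" if "G s r X0" "integrable lborel h" for s r X0 h
  using that by (simp add: G_def)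
 have GK: "\<forall>\<^sub>F n in sequentially. \<forall>y\<in>K. X (s (r n)) + epsl (s (r n)) *\<^sub>R y \<in> D \<and> Psi (s (r n)) differentiable (at y)"
  "uniform_limit K (\<lambda>n. Psi (s (r n))) Vstar sequentially" "uniform_limit K (\<lambda>n. grad (Psi (s (r n)))) (grad Vstar) sequentially" if "G s r X0" "compact K" for s r X0 K
  using that unfolding G_def by simp_all
 have sub: "\<exists>r X0. G s r X0"
  if s: "filterlim s at_top sequentially" and q: "\<And>n. Q (s n)" for s :: "nat => real"
 proof (rule blowup_subsequence[where l=s and u="\<lambda>n. u (s n)" and m="\<lambda>n. M (s n)" and X="\<lambda>n. X (s n)" and \<eta>="\<lambda>n. \<eta> (s n)", OF assms(1) R c s])
  show "0 < s n" for n by (rule Q0[OF q])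
  show "amax Om (s n) (u (s n))" for n by (rule rep(1)[OF q])
  show "u (s n) x = s n * indicator (Aset Om (u (s n)) (M (s n))) x" for n x unfolding A[OF q] by (simp add: u_def)
  show "dist x y \<le> R * epsl (s n)" if "x \<in> Aset Om (u (s n)) (M (s n))" "y \<in> Aset Om (u (s n)) (M (s n))" for n x y
   using that unfolding A[OF q] by (rule co(1)[OF q])
  show "norm x \<le> 1 - c" if "x \<in> Aset Om (u (s n)) (M (s n))" for n x
   using that that unfolding A[OF q] by (rule co(2)[OF q])
  show "X (s n) = (LBINT x. u (s n) x *\<^sub>R x)" for n by (rule rep(3)[OF q])
  show "\<eta> (s n) y = indicator (Aset Om (u (s n)) (M (s n))) (X (s n) + epsl (s n) *\<^sub>R y)" for n y
   unfolding A[OF q] by (simp add: \<eta>_def)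
 next
  fix r X0
  assume r: "X0 \<in> D" "strict_mono (r::nat=>nat)" "(\<lambda>n. X (s (r n))) \<longlonglongrightarrow> X0"
   "\<And>x. x \<in> D ==> Robin X0 - Om/2 * (norm X0)^2 \<le> Robin x - Om/2 * (norm x)^2"
   "\<And>h. integrable lborel h ==> (\<lambda>n. LBINT x. h x * \<eta> (s (r n)) x) \<longlonglongrightarrow> (LBINT x. h x * disc x)"
   and P: "\<And>K. compact K ==> \<forall>\<^sub>F n in sequentially. \<forall>y\<in>K. X (s (r n)) + epsl (s (r n)) *\<^sub>R y \<in> D \<and>
     (\<lambda>z. pi * (psi0 Om (u (s (r n))) (X (s (r n)) + epsl (s (r n)) *\<^sub>R z) - M (s (r n)))) differentiable (at y)"
   "\<And>K. compact K ==> uniform_limit K (\<lambda>n z. pi * (psi0 Om (u (s (r n))) (X (s (r n)) + epsl (s (r n)) *\<^sub>R z) - M (s (r n)))) Vstar sequentially"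
   "\<And>K. compact K ==> uniform_limit K (\<lambda>n. grad (\<lambda>z. pi * (psi0 Om (u (s (r n))) (X (s (r n)) + epsl (s (r n)) *\<^sub>R z) - M (s (r n))))) (grad Vstar) sequentially"
  have Pe: "(\<lambda>z. pi * (psi0 Om (u (s n)) (X (s n) + epsl (s n) *\<^sub>R z) - M (s n))) = Psi (s n)" for n
   unfolding rep(2)[OF q] by (simp add: Psi_def fun_eq_iff)
  show ?thesis
   unfolding G_def by (intro exI[of _ r] exI[of _ X0] conjI allI impI ballI r P[unfolded Pe]; assumption)
 qed
 have evP: "eventually P at_top"
  if "\<And>s. filterlim s at_top sequentially ==> (\<And>n. Q (s n)) ==> \<exists>r::nat=>nat. \<forall>\<^sub>F n in sequentially. P (s (r n))" for P
  by (rule eventually_at_top_subsequence[OF evQ that])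
 \<comment> \<open>R already bounds the rescaled diameter; R + 1 is also the radius of a ball that
   carries every rescaled patch.\<close>
 show ?diam
 proof (intro exI[of _ "R + 1"] conjI allI impI)
  show "1 < R + 1" using R by simp
  show "\<forall>\<^sub>F lam in at_top. diameter (Aset Om (W lam) (M lam)) \<le> (R + 1) * epsl lam"
   using evQ
  proof eventually_elim
   case (elim lam)
   have e: "0 < epsl lam" by (rule epsl_pos[OF Q0[OF elim]])
   show ?case
   proof (rule diameter_le)
    show "Aset Om (W lam) (M lam) \<noteq> {} \<or> 0 \<le> (R + 1) * epsl lam" using e R by simp
    fix x y assume "x \<in> Aset Om (W lam) (M lam)" "y \<in> Aset Om (W lam) (M lam)"
    from co(1)[OF elim this] show "norm (x - y) \<le> (R + 1) * epsl lam" using e by (simp add: dist_norm distrib_right)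
   qed
  qed
  fix g assume g: "integrable (lebesgue_on (ball 0 (R + 1))) (g :: pt => real)"
  have gi: "integrable lebesgue (\<lambda>y. indicator (ball 0 (R + 1)) y *\<^sub>R g y)"
   using g by (subst (asm) integrable_restrict_space) simp_all
  obtain h where hm: "h \<in> borel_measurable borel" and h: "AE y in lborel. indicator (ball 0 (R + 1)) y *\<^sub>R g y = h y"
   using completion_ex_borel_measurable_real[OF borel_measurable_integrable[OF gi]] by auto
  have "integrable lebesgue h"
   by (rule integrable_cong_AE_imp[OF gi]) (use hm h in \<open>auto intro!: measurable_completion AE_completion elim!: eventually_mono\<close>)
  then have hi: "integrable lborel h" by (subst (asm) integrable_completion) (use hm in simp_all)
  have dm: "disc \<in> borel_measurable borel" by (rule bdens_measurable[OF bdens_disc[of 1]]) simp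
  have lim: "(LINT y|lebesgue_on (ball 0 (R + 1)). indicator (ball 0 1) y * g y) = (LBINT y. h y * disc y)"
  proof (rule LINT_lebesgue_on_eq_lborel)
   show "(\<lambda>y. h y * disc y) \<in> borel_measurable borel" using hm dm by simp
   show "AE y in lborel. indicator (ball 0 (R + 1)) y * (indicator (ball 0 1) y * g y) = h y * disc y"
    using h by eventually_elim (auto simp: disc_def)
  qed simp
  let ?F = "\<lambda>lam. LINT y|lebesgue_on (ball 0 (R + 1)). (1/lam) * (indicator D (center (W lam) + epsl lam *\<^sub>R y) * W lam (center (W lam) + epsl lam *\<^sub>R y)) * g y"
  let ?I = "LINT y|lebesgue_on (ball 0 (R + 1)). indicator (ball 0 1) y * g y"
  \<comment> \<open>Affine maps preserve null sets, so under the substitution the maximizer may be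
    replaced by its exact patch.\<close>
  have val: "?F lam = (LBINT y. h y * \<eta> lam y)" if q: "Q lam" for lam
  proof (rule LINT_lebesgue_on_eq_lborel)
   have [measurable]: "Aset Om (W lam) (M lam) \<in> sets borel"
    using measurable_Aset[of lam "u lam" Om "M lam"] rep(1)[OF q] unfolding A[OF q] by (auto simp: amax_def intro: adm_bdens)
   have "\<eta> lam \<in> borel_measurable borel" unfolding \<eta>_def[abs_def] by measurable
   then show "(\<lambda>y. h y * \<eta> lam y) \<in> borel_measurable borel" using hm by simp
   have "epsl lam \<noteq> 0" using epsl_pos[OF Q0[OF q]] by simp
   from AE_lborel_affine[OF this rep(4)[OF q], of "X lam"] h
   show "AE y in lborel. indicator (ball 0 (R + 1)) y * ((1/lam) * (indicator D (center (W lam) + epsl lam *\<^sub>R y) * W lam (center (W lam) + epsl lam *\<^sub>R y)) * g y) = h y * \<eta> lam y"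
   proof eventually_elim
    case (elim y)
    have "(1/lam) * (indicator D (X lam + epsl lam *\<^sub>R y) * W lam (X lam + epsl lam *\<^sub>R y)) = \<eta> lam y"
     using elim(1) Q0[OF q] by (cases "X lam + epsl lam *\<^sub>R y \<in> D") (simp_all add: u_def \<eta>_def Aset_def)
    then show ?case using elim(2) by (simp add: X_def)
   qed
  qed simp
  show "(?F \<longlongrightarrow> ?I) at_top"
  proof (rule tendstoI, rule evP)
   fix d :: real and s :: "nat => real"
   assume d: "0 < d" and s: "filterlim s at_top sequentially" and q: "\<And>n. Q (s n)"
   from sub[OF s q] obtain r X0 where g: "G s r X0" by blast
   from tendstoD[OF G[OF g hi] d] show "\<exists>r::nat=>nat. \<forall>\<^sub>F n in sequentially. dist (?F (s (r n))) ?I < d"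
    unfolding lim val[OF q] by blast
  qed
 qed
 show "Xs \<in> D \<and> (\<forall>x\<in>D. Robin Xs - Om/2 * (norm Xs)^2 \<le> Robin x - Om/2 * (norm x)^2)" if lp: "limit_point_at_top (\<lambda>lam. center (W lam)) Xs" for Xs
 proof -
 from lp obtain s where s: "filterlim s at_top sequentially" "(\<lambda>n. X (s n)) \<longlonglongrightarrow> Xs"
  by (auto simp: limit_point_at_top_def X_def)
 have "\<forall>\<^sub>F n in sequentially. Q (s n)" using evQ s(1) by (auto simp: filterlim_iff)
 then obtain N where N: "\<And>n. N \<le> n ==> Q (s n)" by (auto simp: eventually_sequentially)
 \<comment> \<open>Dropping finitely many terms brings the whole sequence into the range of
   \<open>Q\<close>; the extracted subsequence keeps the limit, which identifies \<open>Xs\<close>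
   with the minimum point \<open>X0\<close>.\<close>
 have s': "filterlim (\<lambda>n. s (n + N)) at_top sequentially"
  using s(1) by (rule filterlim_compose) (rule filterlim_add_const_nat_at_top)
 obtain r X0 where "G (\<lambda>n. s (n + N)) r X0" using sub[OF s' N] by auto
 then have r: "X0 \<in> D" "strict_mono r" "(\<lambda>n. X (s (r n + N))) \<longlonglongrightarrow> X0"
   "\<forall>x\<in>D. Robin X0 - Om/2 * (norm X0)^2 \<le> Robin x - Om/2 * (norm x)^2"
  unfolding G_def by simp_all
 have "(\<lambda>n. X (s (r n + N))) \<longlonglongrightarrow> Xs"
  using s(2) by (rule filterlim_compose) (rule filterlim_compose[OF filterlim_add_const_nat_at_top filterlim_subseq[OF r(2)]])
 then have "Xs = X0" using r(3) by (rule LIMSEQ_unique)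
 then show ?thesis using r(1,4) by auto
 qed
 fix K :: "pt set" assume K: "compact K"
 note subK = sub[THEN exE]
 have e1: "\<forall>\<^sub>F lam in at_top. \<forall>y\<in>K. X lam + epsl lam *\<^sub>R y \<in> D \<and> Psi lam differentiable (at y)"
 proof (rule evP)
  fix s :: "nat => real" assume s: "filterlim s at_top sequentially" and q: "\<And>n. Q (s n)"
  from sub[OF s q] obtain r X0 where g: "G s r X0" by blast
  from GK(1)[OF g K] show "\<exists>r::nat=>nat. \<forall>\<^sub>F n in sequentially. \<forall>y\<in>K. X (s (r n)) + epsl (s (r n)) *\<^sub>R y \<in> D \<and> Psi (s (r n)) differentiable (at y)"
   by blast
 qed
 have e2: "uniform_limit K Psi Vstar at_top"
 proof (rule uniform_limitI, rule evP)
  fix d :: real and s :: "nat => real"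
  assume d: "0 < d" and s: "filterlim s at_top sequentially" and q: "\<And>n. Q (s n)"
  from sub[OF s q] obtain r X0 where g: "G s r X0" by blast
  from uniform_limitD[OF GK(2)[OF g K] d] show "\<exists>r::nat=>nat. \<forall>\<^sub>F n in sequentially. \<forall>y\<in>K. dist (Psi (s (r n)) y) (Vstar y) < d" by blast
 qed
 have e3: "uniform_limit K (\<lambda>lam. grad (Psi lam)) (grad Vstar) at_top"
 proof (rule uniform_limitI, rule evP)
  fix d :: real and s :: "nat => real"
  assume d: "0 < d" and s: "filterlim s at_top sequentially" and q: "\<And>n. Q (s n)"
  from sub[OF s q] obtain r X0 where g: "G s r X0" by blast
  from uniform_limitD[OF GK(3)[OF g K] d] show "\<exists>r::nat=>nat. \<forall>\<^sub>F n in sequentially. \<forall>y\<in>K. dist (grad (Psi (s (r n))) y) (grad Vstar y) < d" by blast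
 qed
 have "\<forall>\<^sub>F lam in at_top. (\<lambda>y. X lam + epsl lam *\<^sub>R y) ` K \<subseteq> D \<and> (\<forall>y\<in>K. Psi lam differentiable (at y))"
  using e1 by eventually_elim auto
 with e2 e3 show "?lim K"
  unfolding Psi_def[abs_def] X_def by simp
qed

theorem theorem1p1:
  fixes Om :: real
  assumes "Om > 0"
  shows
   "(\<forall>lam > 1/pi.
       (\<exists>w. maximizer Om lam w)
     \<and> (\<forall>w. maximizer Om lam w \<longrightarrow> weak_eq Om w \<and> (\<exists>\<mu>. patch_form Om lam w \<mu>)))
  \<and> (\<forall>(W :: real \<Rightarrow> pt \<Rightarrow> real) (M :: real \<Rightarrow> real).
       (\<forall>lam > 1/pi. maximizer Om lam (W lam) \<and> patch_form Om lam (W lam) (M lam)) \<longrightarrow>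
       (\<exists>R0 > 1.
          (\<forall>\<^sub>F lam in at_top. diameter (Aset Om (W lam) (M lam)) \<le> R0 * epsl lam)
        \<and> (\<forall>g. integrable (lebesgue_on (ball 0 R0)) g \<longrightarrow>
             ((\<lambda>lam. LINT y|lebesgue_on (ball 0 R0).
                 (1/lam) * (indicator D (center (W lam) + epsl lam *\<^sub>R y)
                            * W lam (center (W lam) + epsl lam *\<^sub>R y)) * g y)
              \<longlongrightarrow> (LINT y|lebesgue_on (ball 0 R0). indicator (ball 0 1) y * g y)) at_top))
     \<and> (\<forall>Xs. limit_point_at_top (\<lambda>lam. center (W lam)) Xs \<longrightarrow>
            Xs \<in> D \<and> (\<forall>x \<in> D. Robin Xs - Om/2 * (norm Xs)^2 \<le> Robin x - Om/2 * (norm x)^2))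
     \<and> (\<forall>K. compact K \<longrightarrow>
          (\<forall>\<^sub>F lam in at_top. (\<lambda>y. center (W lam) + epsl lam *\<^sub>R y) ` K \<subseteq> D
              \<and> (\<forall>y \<in> K. (\<lambda>z. pi * (psi0 Om (W lam) (center (W lam) + epsl lam *\<^sub>R z) - M lam))
                             differentiable (at y)))
        \<and> uniform_limit K
            (\<lambda>lam y. pi * (psi0 Om (W lam) (center (W lam) + epsl lam *\<^sub>R y) - M lam)) Vstar at_top
        \<and> uniform_limit K
            (\<lambda>lam y. grad (\<lambda>z. pi * (psi0 Om (W lam) (center (W lam) + epsl lam *\<^sub>R z) - M lam)) y)
            (grad Vstar) at_top))"
proof -
 have "(\<exists>w. maximizer Om lam w) \<and> (\<forall>w. maximizer Om lam w \<longrightarrow> weak_eq Om w \<and> (\<exists>\<mu>. patch_form Om lam w \<mu>))" if lam: "1/pi < lam" for lam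
 proof (intro conjI allI impI)
  obtain v where v: "amax Om lam v" using amax_exists[OF lam] .
  have "0 < lam" using lam by (rule less_trans[rotated]) simp
  then show "\<exists>w. maximizer Om lam w" using amax_maximizer[OF v] by auto
  fix w assume w: "maximizer Om lam w"
  show "weak_eq Om w" "\<exists>\<mu>. patch_form Om lam w \<mu>" by (rule maximizer_weak_eq[OF w lam])+
 qed
 then show ?thesis
  by (intro conjI allI impI maximizer_asymptotics[OF assms]) (blast | assumption)+
qed

end
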